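(* Let $f:\Omega\times\mathbb{R}\to\mathbb{R}$ satisfy hypotheses $(\mathbf{H}_0)$, $(\mathbf{H}_1)$ and $(\mathbf{H}_2)$ stated in the context. Then there exist three different, nontrivial, weak solutions of the problem $$(-\Delta_g)^s u=f(x,u)\ \text{ in }\Omega,\qquad u=0\ \text{ in }\Omega^c .$$ Moreover, one of them is positive ($u\ge0$, $u\not\equiv0$), one is negative ($u\le0$, $u\not\equiv0$), and the other one has non-constant sign ($u_+\not\equiv0$ and $u_-\not\equiv0$).
   Context: Let $n\ge1$, $s\in(0,1)$, $\Omega\subset\mathbb{R}^n$ a smooth bounded domain, $\Omega^c=\mathbb{R}^n\setminus\Omega$; $u_+=\max\{u,0\}$, $u_-=\max\{-u,0\}$. N-functions: $G:[0,\infty)\to[0,\infty)$ is an N-function if $G(t)=\int_0^t g(\tau)\,d\tau$ with $g$ right-continuous on $[0,\infty)$, positive on $(0,\infty)$, non-decreasing, $g(0)=0$, $\lim_{t\to\infty}g(t)=\infty$. $G$ is extended to $\mathbb{R}$ as an even function and $g=G'$ as an odd function (same convention for every N-function). Standing assumptions on $G$: there are constants $1<p^-\le p^+<\infty$ with $p^--1\le\frac{t g'(t)}{g(t)}\le p^+-1$ for all $t>0$ (which implies $p^-\le \frac{t g(t)}{G(t)}\le p^+$); $g'$ is non-decreasing on $(0,\infty)$; $\int_M^\infty (t/G(t))^{s/(n-s)}dt=\infty$ for some $M>0$ and $\int_0^\delta (t/G(t))^{s/(n-s)}dt<\infty$ for some $\delta>0$. The Orlicz-Sobolev conjugate is $G_{n/s}=G\circ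 H^{-1}$ with $H(t)=\big(\int_0^t(\tau/G(\tau))^{s/(n-s)}d\tau\big)^{(n-s)/n}$. For N-functions $A,B$, write $A\ll B$ if $\lim_{t\to\infty}A(ct)/B(t)=0$ for every $c>0$. Spaces: $d\mu=\frac{dx\,dy}{|x-y|^n}$; $\rho_G(u)=\int_{\mathbb{R}^n}G(|u|)\,dx$, $\rho_{s,G}(u)=\iint_{\mathbb{R}^{2n}}G\big(\frac{|u(x)-u(y)|}{|x-y|^s}\big)d\mu$; $W^{s,G}(\mathbb{R}^n)$ is the set of measurable $u$ with $\rho_G(u)<\infty$, $\rho_{s,G}(u)<\infty$, with norm $\|u\|_{s,G}=\inf\{\lambda>0:\rho_G(u/\lambda)\le1\}+\inf\{\lambda>0:\rho_{s,G}(u/\lambda)\le1\}$. $W^{s,G}_0(\Omega)=\{u\in W^{s,G}(\mathbb{R}^n):u=0\text{ in }\Omega^c\}$. $E$ is the closure of $C_c^\infty(\Omega)$ in $W^{s,G}(\mathbb{R}^n)$. For an N-function $B$, $\rho_{B,\Omega}(u)=\int_\Omega B(|u|)\,dx$ and $L^B(\Omega)$ is the set of measurable $u:\Omega\to\mathbb{R}$ with $\rho_{B,\Omega}(u)<\infty$. All (in)equalities between functions are a.e. Weak solution: $u\in W^{s,G}_0(\Omega)$ such that $\iint_{\mathbb{R}^{2n}}g\big(\frac{u(x)-u(y)}{|x-y|^s}\big)\frac{v(x)-v(y)}{|x-y|^s}\,d\mu=\int_\Omega f(x,u)v\,dx$ for all $v\in E$. Hypotheses on $f$, with $F(x,u)=\int_0^uf(x,\tau)\,d\tau$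 and $B$ an N-function, $b=B'$, such that $p_B^-\le\frac{t b(t)}{B(t)}\le p_B^+$ for all $t>0$ (constants $1<p_B^-\le p_B^+<\infty$), $G\ll B\ll G_{n/s}$ and $p^+<p_B^-$: $(\mathbf{H}_0)$ $f$ is Carathéodory and $|f(x,t)|\le c_0(1+|b(t)|)$ for a.e. $x\in\Omega$, all $t\in\mathbb{R}$, for some $c_0>0$. $(\mathbf{H}_1)$ $f(x,0)=0$ for a.e. $x$, and $f$ is continuously differentiable in $u$. $(\mathbf{H}_2)$ There are constants $c_1,c_2,c_3,c_4>0$ with $c_2>p^+$ and $c_3<\frac1{p^+-1}$ such that for all $u\in L^B(\Omega)$: $c_1\rho_{B,\Omega}(u)\le c_2\int_\Omega F(x,u)\,dx\le\int_\Omega f(x,u)u\,dx\le c_3\int_\Omega f_u(x,u)u^2\,dx\le c_4\rho_{B,\Omega}(u)$. *)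

theory Defs
  imports "HOL-Analysis.Analysis"
begin

section \<open>Smooth functions and smooth bounded domains\<close>

primrec continuously_differentiable :: "nat \<Rightarrow> (real^'n \<Rightarrow> real) \<Rightarrow> bool" where
  "continuously_differentiable 0 f \<longleftrightarrow> continuous_on UNIV f"
| "continuously_differentiable (Suc k) f \<longleftrightarrow>
     (\<forall>x. f differentiable (at x)) \<and>
     (\<forall>i\<in>Basis. continuously_differentiable k (\<lambda>x. frechet_derivative f (at x) i))"

definition smooth :: "(real^'n \<Rightarrow> real) \<Rightarrow> bool" where
  "smooth f \<longleftrightarrow> (\<forall>k. continuously_differentiable k f)"

text \<open>
  Near each boundary point, \<open>\<Omega>\<close> is the part of space above the graph of a smooth function
  over the hyperplane orthogonal to a unit vector \<open>e\<close>; a function on that hyperplane is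
  represented by a function on the whole space that is invariant under translations along \<open>e\<close>.
\<close>
definition smooth_boundary :: "(real^'n) set \<Rightarrow> bool" where
  "smooth_boundary \<Omega> \<longleftrightarrow>
     (\<forall>z \<in> frontier \<Omega>. \<exists>r>0. \<exists>e \<gamma>. norm e = 1 \<and> smooth \<gamma> \<and> (\<forall>x t. \<gamma> (x + t *\<^sub>R e) = \<gamma> x) \<and>
        \<Omega> \<inter> ball z r = {x \<in> ball z r. x \<bullet> e > \<gamma> x})"

definition smooth_bounded_domain :: "(real^'n) set \<Rightarrow> bool" where
  "smooth_bounded_domain \<Omega> \<longleftrightarrow>
     open \<Omega> \<and> connected \<Omega> \<and> \<Omega> \<noteq> {} \<and> bounded \<Omega> \<and> smooth_boundary \<Omega>"

definition test_functions :: "(real^'n) set \<Rightarrow> (real^'n \<Rightarrow> real) set" where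
  "test_functions \<Omega> =
     {\<phi>. smooth \<phi> \<and> compact (closure {x. \<phi> x \<noteq> 0}) \<and> closure {x. \<phi> x \<noteq> 0} \<subseteq> \<Omega>}"

section \<open>N-functions\<close>

text \<open>
  \<open>N_function G g\<close>: \<open>G\<close> is an N-function with density \<open>g\<close>, where \<open>G\<close> and \<open>g\<close> are already
  extended to the whole line, evenly and oddly respectively.
\<close>
definition N_function :: "(real \<Rightarrow> real) \<Rightarrow> (real \<Rightarrow> real) \<Rightarrow> bool" where
  "N_function G g \<longleftrightarrow>
     (\<forall>t\<ge>0. continuous (at_right t) g) \<and> (\<forall>t>0. g t > 0) \<and> mono_on {0..} g \<and> g 0 = 0 \<and>
     filterlim g at_top at_top \<and> (\<forall>t\<ge>0. G t = (LBINT \<tau>=0..t. g \<tau>)) \<and>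
     (\<forall>t. G (- t) = G t) \<and> (\<forall>t. g (- t) = - g t)"

definition essentially_slower :: "(real \<Rightarrow> real) \<Rightarrow> (real \<Rightarrow> real) \<Rightarrow> bool" where
  "essentially_slower A B \<longleftrightarrow> (\<forall>c>0. ((\<lambda>t. A (c * t) / B t) \<longlongrightarrow> 0) at_top)"

definition orlicz_H :: "nat \<Rightarrow> real \<Rightarrow> (real \<Rightarrow> real) \<Rightarrow> real \<Rightarrow> real" where
  "orlicz_H n s G t =
     (LBINT \<tau>=0..t. (\<tau> / G \<tau>) powr (s / (real n - s))) powr ((real n - s) / real n)"

text \<open>The Orlicz-Sobolev conjugate \<open>G\<^sub>n\<^sub>/\<^sub>s = G \<circ> H\<inverse>\<close>, extended evenly.\<close>
definition orlicz_conjugate :: "nat \<Rightarrow> real \<Rightarrow> (real \<Rightarrow> real) \<Rightarrow> real \<Rightarrow> real" where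
  "orlicz_conjugate n s G t = G (inv_into {0..} (orlicz_H n s G) \<bar>t\<bar>)"

section \<open>Fractional Orlicz-Sobolev spaces\<close>

text \<open>
  The measure \<open>dx dy / \<bar>x - y\<bar>\<^sup>n\<close> on \<open>\<real>\<^sup>2\<^sup>n\<close>. Both this density and the quotient below take the
  value 0 on the diagonal, which is a null set.
\<close>
definition mu :: "((real^'n) \<times> (real^'n)) measure" where
  "mu = density lebesgue (\<lambda>(x, y). ennreal (1 / norm (x - y) ^ CARD('n)))"

definition hoelder_quotient ::
    "real \<Rightarrow> (real^'n \<Rightarrow> real) \<Rightarrow> (real^'n) \<times> (real^'n) \<Rightarrow> real" where
  "hoelder_quotient s u = (\<lambda>(x, y). (u x - u y) / norm (x - y) powr s)"

definition modular_on ::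
    "(real \<Rightarrow> real) \<Rightarrow> (real^'n) set \<Rightarrow> (real^'n \<Rightarrow> real) \<Rightarrow> ennreal" where
  "modular_on G \<Omega> u = (\<integral>\<^sup>+x. ennreal (G \<bar>u x\<bar>) \<partial>lebesgue_on \<Omega>)"

definition frac_modular :: "real \<Rightarrow> (real \<Rightarrow> real) \<Rightarrow> (real^'n \<Rightarrow> real) \<Rightarrow> ennreal" where
  "frac_modular s G u = (\<integral>\<^sup>+p. ennreal (G \<bar>hoelder_quotient s u p\<bar>) \<partial>mu)"

text \<open>Elements of the spaces are functions, not classes modulo equality almost everywhere.\<close>
definition W :: "real \<Rightarrow> (real \<Rightarrow> real) \<Rightarrow> (real^'n \<Rightarrow> real) set" where
  "W s G =
     {u \<in> borel_measurable lebesgue. modular_on G UNIV u < \<infinity> \<and> frac_modular s G u < \<infinity>}"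

definition W_norm :: "real \<Rightarrow> (real \<Rightarrow> real) \<Rightarrow> (real^'n \<Rightarrow> real) \<Rightarrow> real" where
  "W_norm s G u =
     Inf {l. l > 0 \<and> modular_on G UNIV (\<lambda>x. u x / l) \<le> 1} +
     Inf {l. l > 0 \<and> frac_modular s G (\<lambda>x. u x / l) \<le> 1}"

definition W0 :: "real \<Rightarrow> (real \<Rightarrow> real) \<Rightarrow> (real^'n) set \<Rightarrow> (real^'n \<Rightarrow> real) set" where
  "W0 s G \<Omega> = {u \<in> W s G. AE x in lebesgue. x \<notin> \<Omega> \<longrightarrow> u x = 0}"

definition E_space :: "real \<Rightarrow> (real \<Rightarrow> real) \<Rightarrow> (real^'n) set \<Rightarrow> (real^'n \<Rightarrow> real) set" where
  "E_space s G \<Omega> =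
     {v \<in> W s G. \<forall>\<epsilon>>0. \<exists>\<phi>\<in>test_functions \<Omega>. W_norm s G (\<lambda>x. v x - \<phi> x) < \<epsilon>}"

definition L_space :: "(real \<Rightarrow> real) \<Rightarrow> (real^'n) set \<Rightarrow> (real^'n \<Rightarrow> real) set" where
  "L_space B \<Omega> = {u \<in> borel_measurable (lebesgue_on \<Omega>). modular_on B \<Omega> u < \<infinity>}"

section \<open>The problem\<close>

text \<open>
  The Bochner integral is total, so the existence of the two integrals is part of the notion.
\<close>
definition weak_solution :: "real \<Rightarrow> (real \<Rightarrow> real) \<Rightarrow> (real \<Rightarrow> real) \<Rightarrow> (real^'n) set \<Rightarrow>
    (real^'n \<Rightarrow> real \<Rightarrow> real) \<Rightarrow> (real^'n \<Rightarrow> real) \<Rightarrow> bool" where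
  "weak_solution s G g \<Omega> f u \<longleftrightarrow> u \<in> W0 s G \<Omega> \<and>
     (\<forall>v \<in> E_space s G \<Omega>.
        integrable mu (\<lambda>p. g (hoelder_quotient s u p) * hoelder_quotient s v p) \<and>
        integrable (lebesgue_on \<Omega>) (\<lambda>x. f x (u x) * v x) \<and>
        (\<integral>p. g (hoelder_quotient s u p) * hoelder_quotient s v p \<partial>mu) =
        (\<integral>x. f x (u x) * v x \<partial>lebesgue_on \<Omega>))"

definition caratheodory :: "(real^'n) set \<Rightarrow> (real^'n \<Rightarrow> real \<Rightarrow> real) \<Rightarrow> bool" where
  "caratheodory \<Omega> f \<longleftrightarrow>
     (\<forall>t. (\<lambda>x. f x t) \<in> borel_measurable (lebesgue_on \<Omega>)) \<and>
     (AE x in lebesgue_on \<Omega>. continuous_on UNIV (f x))"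

definition H0 :: "(real^'n) set \<Rightarrow> (real \<Rightarrow> real) \<Rightarrow> (real^'n \<Rightarrow> real \<Rightarrow> real) \<Rightarrow> bool" where
  "H0 \<Omega> b f \<longleftrightarrow> caratheodory \<Omega> f \<and>
     (\<exists>c0>0. AE x in lebesgue_on \<Omega>. \<forall>t. \<bar>f x t\<bar> \<le> c0 * (1 + \<bar>b t\<bar>))"

definition H1 :: "(real^'n) set \<Rightarrow> (real^'n \<Rightarrow> real \<Rightarrow> real) \<Rightarrow> bool" where
  "H1 \<Omega> f \<longleftrightarrow> (AE x in lebesgue_on \<Omega>. f x 0 = 0) \<and>
     (AE x in lebesgue_on \<Omega>. (\<forall>t. f x differentiable (at t)) \<and> continuous_on UNIV (deriv (f x)))"

text \<open>
  Under \<open>H0\<close> and \<open>H1\<close> all integrals below exist: the first two by the growth bound and the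
  third because, if it did not, its value would be 0 and the chain would force \<open>u = 0\<close> a.e.,
  so the integrand would vanish a.e. and be integrable after all.
\<close>
definition H2 :: "(real^'n) set \<Rightarrow> real \<Rightarrow> (real \<Rightarrow> real) \<Rightarrow> (real^'n \<Rightarrow> real \<Rightarrow> real) \<Rightarrow> bool"
  where
  "H2 \<Omega> pp B f \<longleftrightarrow>
     (\<exists>c1>0. \<exists>c2>0. \<exists>c3>0. \<exists>c4>0. c2 > pp \<and> c3 < 1 / (pp - 1) \<and>
       (\<forall>u \<in> L_space B \<Omega>.
          c1 * enn2real (modular_on B \<Omega> u) \<le> c2 * (\<integral>x. (LBINT \<tau>=0..u x. f x \<tau>) \<partial>lebesgue_on \<Omega>) \<and>
          c2 * (\<integral>x. (LBINT \<tau>=0..u x. f x \<tau>) \<partial>lebesgue_on \<Omega>) \<le> (\<integral>x. f x (u x) * u x \<partial>lebesgue_on \<Omega>) \<and>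
          (\<integral>x. f x (u x) * u x \<partial>lebesgue_on \<Omega>)
            \<le> c3 * (\<integral>x. deriv (f x) (u x) * (u x)\<^sup>2 \<partial>lebesgue_on \<Omega>) \<and>
          c3 * (\<integral>x. deriv (f x) (u x) * (u x)\<^sup>2 \<partial>lebesgue_on \<Omega>)
            \<le> c4 * enn2real (modular_on B \<Omega> u)))"

end

theory Submission
  imports Defs "HOL-Complex_Analysis.Great_Picard" "HOL-Real_Asymp.Real_Asymp"
begin

text \<open>
  Critical points of \<open>J u = A u - \<Phi> u\<close>, with \<open>A u\<close> the fractional modular and \<open>\<Phi> u = \<integral> F(x, u)\<close>, are found
  on Nehari sets: on \<open>{\<langle>J'(u), u\<rangle> = 0}\<close> among the functions \<open>u \<ge> 0\<close> for the positive solution, on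
  \<open>{\<langle>J'(u), u\<^sub>+\<rangle> = \<langle>J'(u), u\<^sub>-\<rangle> = 0}\<close> for the sign-changing one, and by the reflection
  \<open>f(x, t) \<mapsto> - f(x, -t)\<close> for the negative one. \<open>(H\<^sub>2)\<close>, tested with multiples of indicators, says that
  \<open>F(x, \<cdot>)\<close> is convex and \<open>f(x, t) / \<bar>t\<bar>\<^sup>q\<^sup>-\<^sup>1\<close> is increasing in \<open>\<bar>t\<bar>\<close> for some \<open>q > p\<^sup>+\<close>, whereas
  \<open>g(t) / t\<^bsup>p - 1\<^esup>\<close> with \<open>p = p\<^sup>+\<close> decreases. Hence \<open>(a, b) \<mapsto> J(a u\<^sub>+ - b u\<^sub>-)\<close> has exactly one critical point,
  its maximum, and this makes a minimiser on the Nehari set a critical point by a deformation argument.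

  Minimising sequences are bounded in \<open>A\<close>. A level-set estimate (compare \<open>{\<bar>u\<bar> > 2\<^sup>k\<^sup>+\<^sup>1}\<close> with the complement of
  \<open>{\<bar>u\<bar> > 2\<^sup>k}\<close>) gives uniform integrability of \<open>B(u)\<close>, and averages over small balls give almost everywhere
  convergence of a subsequence; then Fatou's lemma handles \<open>A\<close> and Vitali's theorem handles \<open>\<Phi>\<close>. No density of test
  functions is needed, because the equation is obtained for all test functions in \<open>W\<^sub>0\<close>, and \<open>E\<close> embeds
  into that space.
\<close>

section \<open>N-functions\<close>

text \<open>Two obstacles shape the argument. The double integral couples \<open>u\<^sub>+\<close>
  and \<open>u\<^sub>-\<close>, so the energy of \<open>a u\<^sub>+ - b u\<^sub>-\<close> does not
  split. For a pair ordered by \<open>u y \<le> u x\<close>, however, the difference quotients of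
  all truncations with nonnegative coefficients are nonnegative and increase with the coefficients,
  and by symmetry every pointwise estimate may assume this order. The scaling bounds obtained in
  this way control the derivative along a fibre where its own coefficient is the largest or the
  smallest one, which is what uniqueness on the fibre and the Poincare-Miranda faces ask for. The
  Nehari set is not treated as a manifold. \<open>A\<close> and \<open>\<Phi>\<close> are convex,
  and increments of \<open>J\<close> are bounded by derivatives of \<open>A\<close> and
  \<open>\<Phi>\<close> taken at opposite endpoints; with uniqueness on fibres this takes the place
  of Lagrange multipliers. The exponent is \<open>q = 1 + 1 / c\<^sub>3\<close>, and
  \<open>c\<^sub>3 < 1 / (p - 1)\<close> says exactly that \<open>q > p\<close>. For small
  \<open>A u\<close> the modular of \<open>B\<close> is at most a multiple of
  \<open>A u powr (r / p)\<close>, with \<open>r > p\<close> the lower index of \<open>B\<close>;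
  this keeps both parts of a minimising sequence away from zero.\<close>

lemma N_function_mono:
  assumes "N_function B b"
  shows "mono b"
proof (rule monoI)
  fix x y :: real assume xy: "x \<le> y"
  have m: "mono_on {0..} b" and o: "\<And>t. b (- t) = - b t" and z: "b 0 = 0"
    using assms by (auto simp: N_function_def)
  have pos: "b t \<ge> 0" if "t \<ge> 0" for t
    using mono_onD[OF m, of 0 t] that z by simp
  consider "x \<ge> 0" | "y \<le> 0" | "x < 0" "y > 0" using xy by linarith
  then show "b x \<le> b y"
  proof cases
    case 1 then show ?thesis using mono_onD[OF m, of x y] xy by simp
  next
    case 2 then show ?thesis using mono_onD[OF m, of "-y" "-x"] xy o[of x] o[of y] by simp
  next
    case 3 then show ?thesis using pos[of y] pos[of "-x"] o[of x] by simp
  qed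
qed

lemma N_function_integral:
  assumes N: "N_function B b" and st: "0 \<le> s" "s \<le> t"
  shows "b s * (t - s) \<le> B t - B s" "B t - B s \<le> b t * (t - s)"
proof -
  have m: "mono b" by (rule N_function_mono[OF N])
  have [measurable]: "b \<in> borel_measurable borel" by (rule borel_measurable_mono[OF m])
  have si: "set_integrable lborel {x..y} b" for x y
    by (rule set_integrable_bound[OF borel_integrable_atLeastAtMost'[of x y "\<lambda>_. \<bar>b x\<bar> + \<bar>b y\<bar>"]])
      (use monoD[OF m, of x] monoD[OF m, of _ y] in
        \<open>auto simp: set_borel_measurable_def abs_if intro!: AE_I2\<close>, smt+)
  have B: "B x = integral {0..x} b" if "x \<ge> 0" for x
    using N that interval_integral_eq_integral[OF that si]
    by (auto simp: N_function_def interval_integral_eq_integral[OF _ si] zero_ereal_def)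
  have int: "b integrable_on {x..y}" for x y
    using set_borel_integral_eq_integral(1)[OF si] .
  have "B t - B s = integral {s..t} b"
    using Henstock_Kurzweil_Integration.integral_combine[OF st int] st B by auto
  moreover have "integral {s..t} (\<lambda>_. b s) \<le> integral {s..t} b"
    by (rule integral_le) (use int monoD[OF m] in auto)
  moreover have "integral {s..t} b \<le> integral {s..t} (\<lambda>_. b t)"
    by (rule integral_le) (use int monoD[OF m] in auto)
  ultimately show "b s * (t - s) \<le> B t - B s" "B t - B s \<le> b t * (t - s)"
    using st by (auto simp: mult.commute)
qed

lemma N_function_zero: "N_function B b \<Longrightarrow> B 0 = 0"
  by (auto simp: N_function_def zero_ereal_def)

lemma N_function_nonneg: "N_function B b \<Longrightarrow> t \<ge> 0 \<Longrightarrow> b t \<ge> 0"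
  using monoD[OF N_function_mono, of B b 0 t] by (simp add: N_function_def)

text \<open>Monotonicity of \<open>b\<close> makes \<open>b x\<close> the slope of a supporting line
  even where \<open>B\<close> has a corner. Evenness reduces to \<open>x \<ge> 0\<close>; for
  negative \<open>y\<close>, passing to \<open>- y\<close> only raises the left side because
  \<open>b x \<ge> 0\<close>.\<close>

lemma N_function_subgradient:
  assumes N: "N_function B b"
  shows "B x + b x * (y - x) \<le> B y"
proof -
  have even: "\<And>t. B (- t) = B t" and odd: "\<And>t. b (- t) = - b t"
    using N by (auto simp: N_function_def)
  have pos: "B x + b x * (y - x) \<le> B y" if "x \<ge> 0" "y \<ge> 0" for x y
    using N_function_integral[OF N, of x y] N_function_integral[OF N, of y x] that
    by (cases "x \<le> y") (auto simp: algebra_simps)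
  have pos2: "B x + b x * (y - x) \<le> B y" if "x \<ge> 0" for x y
  proof (cases "y \<ge> 0")
    case False
    have "B x + b x * (y - x) \<le> B x + b x * (- y - x)"
      using False N_function_nonneg[OF N that] by (simp add: mult_left_mono)
    also have "\<dots> \<le> B (- y)" using pos[of x "-y"] that False by simp
    finally show ?thesis using even by simp
  qed (use pos that in auto)
  show ?thesis
    using pos2[of x y] pos2[of "-x" "-y"] even[of x] even[of y] odd[of x]
    by (cases "x \<ge> 0") (auto simp: algebra_simps)
qed

lemma N_function_pos:
  assumes N: "N_function B b" and "t \<noteq> 0"
  shows "B t > 0"
proof -
  have "B \<bar>t\<bar> > 0"
    using N_function_integral(1)[OF N, of "\<bar>t\<bar>/2" "\<bar>t\<bar>"] N_function_integral(1)[OF N, of 0 "\<bar>t\<bar>/2"]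
      N_function_zero[OF N] N assms(2)
    by (auto simp: N_function_def) (smt (verit) half_gt_zero_iff mult_pos_pos zero_less_abs_iff)
  moreover have "B \<bar>t\<bar> = B t" using N by (cases "t \<ge> 0") (simp_all add: N_function_def)
  ultimately show ?thesis by simp
qed

lemma N_function_incseq:
  assumes N: "N_function B b" and "0 \<le> s" "s \<le> t"
  shows "B s \<le> B t"
  using N_function_integral(1)[OF N assms(2,3)] N_function_nonneg[OF N assms(2)] assms
  by (smt (verit) mult_nonneg_nonneg)

lemma N_function_continuous:
  assumes N: "N_function B b"
  shows "continuous_on UNIV B"
proof -
  have "\<bar>B x - B y\<bar> \<le> (\<bar>b x\<bar> + \<bar>b y\<bar>) * \<bar>x - y\<bar>" for x y
  proof -
    have "B x - B y \<le> b x * (x - y)" "B y - B x \<le> b y * (y - x)"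
      using N_function_subgradient[OF N, of x y] N_function_subgradient[OF N, of y x]
      by (simp_all add: algebra_simps)
    moreover have "b x * (x - y) \<le> \<bar>b x\<bar> * \<bar>x - y\<bar>" "b y * (y - x) \<le> \<bar>b y\<bar> * \<bar>x - y\<bar>"
      by (metis abs_ge_self abs_mult, metis abs_ge_self abs_minus_commute abs_mult)
    moreover have "0 \<le> \<bar>b x\<bar> * \<bar>x - y\<bar>" "0 \<le> \<bar>b y\<bar> * \<bar>x - y\<bar>" by auto
    ultimately show ?thesis unfolding distrib_right by linarith
  qed
  have "isCont B x" for x
  proof -
    define K where "K = \<bar>b x\<bar> + \<bar>b (x - 1)\<bar> + \<bar>b (x + 1)\<bar>"
    have bd: "norm (B y - B x) \<le> K * \<bar>y - x\<bar>" if "\<bar>y - x\<bar> < 1" for y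
    proof -
      have "\<bar>B x - B y\<bar> \<le> (\<bar>b x\<bar> + \<bar>b y\<bar>) * \<bar>x - y\<bar>" by fact
      also have "\<dots> \<le> K * \<bar>x - y\<bar>"
        using monoD[OF N_function_mono[OF N], of "x - 1" y]
          monoD[OF N_function_mono[OF N], of y "x + 1"] that
        by (intro mult_right_mono) (auto simp: K_def abs_if split: if_splits)
      finally show ?thesis by (simp add: abs_minus_commute)
    qed
    have "((\<lambda>y. B y - B x) \<longlongrightarrow> 0) (at x)"
    proof (rule Lim_null_comparison)
      show "eventually (\<lambda>y. norm (B y - B x) \<le> K * \<bar>y - x\<bar>) (at x)"
        unfolding eventually_at by (rule exI[of _ 1]) (use bd in \<open>auto simp: dist_real_def\<close>)
      show "((\<lambda>y. K * \<bar>y - x\<bar>) \<longlongrightarrow> 0) (at x)"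
        by (auto intro!: tendsto_eq_intros)
    qed
    then show ?thesis by (simp add: isCont_def LIM_zero_iff)
  qed
  then show ?thesis by (simp add: continuous_on_eq_continuous_at)
qed

text \<open>
  Only right-continuity of \<open>b\<close> is available, so \<open>B\<close> need not be differentiable. The growth bounds
  are obtained from the subgradient inequality along the geometric partition \<open>t \<lambda>\<^bsup>i/m\<^esup>\<close>.
\<close>

lemma N_function_scale_upper:
  assumes N: "N_function B b" and P: "\<forall>t>0. t * b t \<le> P * B t" and "l \<ge> 1" "t \<ge> 0" "P > 0"
  shows "B (l * t) \<le> l powr P * B t"
proof (cases "t = 0 \<or> l = 1")
  case True then show ?thesis using N_function_zero[OF N] by auto
next
  case False
  then have t: "t > 0" and l: "l > 1" using assms by auto
  have ineq: "B (l * t) * (1 - P * (1 - l powr (- (1 / real m)))) ^ m \<le> B t"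
    if m: "P * (1 - l powr (- (1 / real m))) < 1" "m > 0" for m
  proof -
    \<comment> \<open>One of \<open>m\<close> geometric steps from \<open>t\<close> to
      \<open>l * t\<close>. The supporting line at the right end of a step costs the factor
      \<open>c\<close>.\<close>
    define k where "k = l powr (1 / real m)"
    have k: "k > 1" using l m by (simp add: k_def)
    have kinv: "l powr (- (1 / real m)) = 1 / k" by (simp add: k_def powr_minus divide_inverse)
    define c where "c = 1 - P * (1 - 1 / k)"
    have c: "c > 0" using m kinv by (simp add: c_def)
    have step: "B (k * x) * c \<le> B x" if "x > 0" for x
    proof -
      have kx: "k * x > 0" using k that by simp
      have "B x \<ge> B (k * x) + b (k * x) * (x - k * x)" by (rule N_function_subgradient[OF N])
      moreover have "b (k * x) * (k * x - x) \<le> P * B (k * x) * (1 - 1 / k)"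
      proof -
        have "b (k * x) * (k * x - x) = (k * x * b (k * x)) * (1 - 1 / k)"
          using k by (simp add: field_simps)
        also have "\<dots> \<le> P * B (k * x) * (1 - 1 / k)"
          using P kx k by (intro mult_right_mono) auto
        finally show ?thesis .
      qed
      ultimately show ?thesis by (simp add: c_def algebra_simps)
    qed
    have "B (k ^ i * t) * c ^ i \<le> B t" for i
    proof (induction i)
      case (Suc i)
      have "B (k ^ Suc i * t) * c ^ Suc i = (B (k * (k ^ i * t)) * c) * c ^ i" by (simp add: ac_simps)
      also have "\<dots> \<le> B (k ^ i * t) * c ^ i"
        using step[of "k ^ i * t"] k t c by (intro mult_right_mono) auto
      finally show ?case using Suc by simp
    qed simp
    moreover have "k ^ m = l" using m l by (simp add: k_def powr_realpow[symmetric] powr_powr)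
    ultimately show ?thesis using kinv c_def by metis
  qed
  have lim1: "(\<lambda>m. P * (1 - l powr (- (1 / real m)))) \<longlonglongrightarrow> 0"
    using l by real_asymp
  \<comment> \<open>To first order \<open>P * (1 - l powr (- (1 / m)))\<close> is
    \<open>P * ln l / m\<close>, so the power tends to \<open>l powr (- P)\<close>.\<close>
  have lim2: "(\<lambda>m. (1 - P * (1 - l powr (- (1 / real m)))) ^ m) \<longlonglongrightarrow> exp (- (P * ln l))"
    using l \<open>P > 0\<close> by (real_asymp simp: algebra_simps)
  have "eventually (\<lambda>m. B (l * t) * (1 - P * (1 - l powr (- (1 / real m)))) ^ m \<le> B t) sequentially"
    using order_tendstoD(2)[OF lim1 zero_less_one] eventually_gt_at_top[of 0]
    by eventually_elim (rule ineq; simp)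
  then have "B (l * t) * exp (- (P * ln l)) \<le> B t"
    by (intro tendsto_upperbound[OF tendsto_mult_left[OF lim2]]) auto
  then show ?thesis using l by (simp add: exp_minus powr_def field_simps)
qed

lemma N_function_scale_lower:
  assumes N: "N_function B b" and P: "\<forall>t>0. P * B t \<le> t * b t" and "l \<ge> 1" "t \<ge> 0" "P > 0"
  shows "l powr P * B t \<le> B (l * t)"
proof (cases "t = 0 \<or> l = 1")
  case True then show ?thesis using N_function_zero[OF N] by auto
next
  case False
  then have t: "t > 0" and l: "l > 1" using assms by auto
  have ineq: "B t * (1 + P * (l powr (1 / real m) - 1)) ^ m \<le> B (l * t)" if m: "m > 0" for m
  proof -
    define k where "k = l powr (1 / real m)"
    have k: "k > 1" using l m by (simp add: k_def)
    \<comment> \<open>Here the supporting line is taken at the left end of a step, which yields a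
      gain by the factor \<open>c\<close>.\<close>
    define c where "c = 1 + P * (k - 1)"
    have c: "c > 0" using k \<open>P > 0\<close> by (simp add: c_def add_pos_pos)
    have step: "B x * c \<le> B (k * x)" if "x > 0" for x
    proof -
      have "B (k * x) \<ge> B x + b x * (k * x - x)" by (rule N_function_subgradient[OF N])
      moreover have "b x * (k * x - x) \<ge> P * B x * (k - 1)"
      proof -
        have "P * B x * (k - 1) \<le> (x * b x) * (k - 1)"
          using P that k by (intro mult_right_mono) auto
        then show ?thesis by (simp add: algebra_simps)
      qed
      ultimately show ?thesis by (simp add: c_def algebra_simps)
    qed
    have "B t * c ^ i \<le> B (k ^ i * t)" for i
    proof (induction i)
      case (Suc i)
      have "B t * c ^ Suc i \<le> B (k ^ i * t) * c" using Suc c by (simp add: mult_right_mono)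
      also have "\<dots> \<le> B (k * (k ^ i * t))" using step[of "k ^ i * t"] k t by simp
      finally show ?case by (simp add: ac_simps)
    qed simp
    moreover have "k ^ m = l" using m l by (simp add: k_def powr_realpow[symmetric] powr_powr)
    ultimately show ?thesis using k_def c_def by metis
  qed
  have lim2: "(\<lambda>m. (1 + P * (l powr (1 / real m) - 1)) ^ m) \<longlonglongrightarrow> exp (P * ln l)"
    using l \<open>P > 0\<close> by (real_asymp simp: algebra_simps)
  have "eventually (\<lambda>m. B t * (1 + P * (l powr (1 / real m) - 1)) ^ m \<le> B (l * t)) sequentially"
    using eventually_gt_at_top[of 0] by eventually_elim (rule ineq)
  then have "B t * exp (P * ln l) \<le> B (l * t)"
    by (intro tendsto_upperbound[OF tendsto_mult_left[OF lim2]]) auto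
  then show ?thesis using l by (simp add: powr_def mult.commute)
qed


text \<open>Giving the supporting line at \<open>c * t\<close> the weight \<open>c\<close> at
  \<open>t\<close> and \<open>1 - c\<close> at 0 cancels the slope, and \<open>B 0 = 0\<close>
  removes the second value.\<close>

lemma N_function_contract:
  assumes N: "N_function B b" and "0 \<le> c" "c \<le> 1"
  shows "B (c * t) \<le> c * B t"
proof -
  have "c * (B (c * t) + b (c * t) * (t - c * t)) \<le> c * B t"
    using N_function_subgradient[OF N] assms by (intro mult_left_mono) auto
  moreover have "(1 - c) * (B (c * t) + b (c * t) * (0 - c * t)) \<le> (1 - c) * B 0"
    by (rule mult_left_mono[OF N_function_subgradient[OF N]]) (use assms in auto)
  ultimately show ?thesis using N_function_zero[OF N] by (simp add: algebra_simps)
qed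

section \<open>Regularity and growth of the density \<open>g\<close>\<close>

lemma N_function_deriv:
  assumes N: "N_function B b" and c: "isCont b x"
  shows "(B has_real_derivative b x) (at x)"
proof -
  \<comment> \<open>The supporting lines at \<open>x\<close> and at \<open>y\<close> squeeze the
    difference quotient between \<open>b x\<close> and \<open>b y\<close>.\<close>
  have bd: "norm ((B y - B x) / (y - x) - b x) \<le> \<bar>b y - b x\<bar>" if "y \<noteq> x" for y
  proof -
    have "b x * (y - x) \<le> B y - B x" "B y - B x \<le> b y * (y - x)"
      using N_function_subgradient[OF N, of x y] N_function_subgradient[OF N, of y x]
      by (auto simp: algebra_simps)
    then have "b x \<le> (B y - B x) / (y - x) \<and> (B y - B x) / (y - x) \<le> b y \<or>
       b y \<le> (B y - B x) / (y - x) \<and> (B y - B x) / (y - x) \<le> b x"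
      using that by (cases "x < y") (auto simp: field_simps)
    then show ?thesis by (auto simp: abs_if)
  qed
  have "((\<lambda>y. (B y - B x) / (y - x) - b x) \<longlongrightarrow> 0) (at x)"
  proof (rule Lim_null_comparison)
    show "eventually (\<lambda>y. norm ((B y - B x) / (y - x) - b x) \<le> \<bar>b y - b x\<bar>) (at x)"
      using bd by (auto simp: eventually_at_filter)
    show "((\<lambda>y. \<bar>b y - b x\<bar>) \<longlongrightarrow> 0) (at x)"
      using c by (auto simp: isCont_def LIM_zero_iff intro!: tendsto_rabs_zero)
  qed
  then show ?thesis by (simp add: has_field_derivative_iff LIM_zero_iff)
qed

text \<open>The upper index bound says that \<open>g x * x powr (- (p - 1))\<close> has nonpositive
  derivative, so it decreases from \<open>t\<close> to \<open>l * t\<close>.\<close>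

lemma N_function_density_scale:
  assumes N: "N_function G g" and d: "\<forall>t>0. g differentiable (at t)"
    and P: "\<forall>t>0. t * deriv g t / g t \<le> p - 1" and "l \<ge> 1" "t \<ge> 0"
  shows "g (l * t) \<le> l powr (p - 1) * g t"
proof (cases "t = 0")
  case True then show ?thesis using N by (simp add: N_function_def)
next
  case False
  then have t: "t > 0" using assms by simp
  have gpos: "g x > 0" if "x > 0" for x using N that by (simp add: N_function_def)
  have "g (l * t) * (l * t) powr (- (p - 1)) \<le> g t * t powr (- (p - 1))"
  proof (rule DERIV_nonpos_imp_nonincreasing[where f = "\<lambda>x. g x * x powr (- (p - 1))"])
    show "t \<le> l * t" using \<open>l \<ge> 1\<close> t by simp
    fix x assume "t \<le> x" "x \<le> l * t"
    then have x: "x > 0" using t by simp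
    have "(g has_real_derivative deriv g x) (at x)"
      using d x by (simp add: DERIV_deriv_iff_real_differentiable)
    then have "((\<lambda>x. g x * x powr (- (p - 1))) has_real_derivative
       deriv g x * x powr (- (p - 1)) + g x * (- (p - 1) * x powr (- (p - 1) - 1))) (at x)"
      using x by (auto intro!: derivative_eq_intros)
    moreover have "deriv g x * x powr (- (p - 1)) + g x * (- (p - 1) * x powr (- (p - 1) - 1))
       = (x * deriv g x - (p - 1) * g x) * x powr (- (p - 1) - 1)"
      using x powr_add[of x "- (p - 1) - 1" 1] by (simp add: algebra_simps)
    moreover have "\<dots> \<le> 0"
      using P x gpos[of x] by (intro mult_nonpos_nonneg) (auto simp: field_simps)
    ultimately show "\<exists>y. ((\<lambda>x. g x * x powr (- (p - 1))) has_real_derivative y) (at x) \<and> y \<le> 0"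
      by auto
  qed
  then have "g (l * t) * l powr (- (p - 1)) * t powr (- (p - 1)) \<le> g t * t powr (- (p - 1))"
    using \<open>l \<ge> 1\<close> t by (simp add: powr_mult ac_simps)
  then have "g (l * t) * l powr (- (p - 1)) \<le> g t" using t by simp
  then have "g (l * t) * l powr (- (p - 1)) * l powr (p - 1) \<le> g t * l powr (p - 1)"
    by (rule mult_right_mono) simp
  then have "g (l * t) * (l powr (- (p - 1)) * l powr (p - 1)) \<le> g t * l powr (p - 1)"
    by (simp only: mult.assoc)
  moreover have "l powr (- (p - 1)) * l powr (p - 1) = 1"
    using \<open>l \<ge> 1\<close> by (simp add: powr_add[symmetric])
  ultimately show ?thesis by (simp only: mult_1_right mult.commute)
qed

lemma N_function_density_continuous:
  assumes N: "N_function G g" and d: "\<forall>t>0. g differentiable (at t)"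
  shows "continuous_on UNIV g"
proof -
  have pos: "isCont g x" if "x > 0" for x
    using d that differentiable_imp_continuous_within by blast
  have odd: "g = (\<lambda>t. - g (- t))" using N by (auto simp: N_function_def)
  have neg: "isCont g x" if "x < 0" for x
  proof -
    have "isCont (\<lambda>t. - g (- t)) x"
      using pos[of "-x"] that by (intro continuous_minus isCont_o2[of _ uminus]) auto
    then show ?thesis using odd by metis
  qed
  have r0: "(g \<longlongrightarrow> 0) (at_right 0)"
    using N by (auto simp: N_function_def continuous_within)
  then have "((\<lambda>t. - g (- t)) \<longlongrightarrow> 0) (at_left 0)"
    using tendsto_minus[OF r0] by (simp add: filterlim_at_left_to_right)
  then have "(g \<longlongrightarrow> 0) (at_left 0)" using odd by metis
  then have "isCont g 0"
    using r0 N by (auto simp: isCont_def filterlim_split_at N_function_def)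
  then show ?thesis using pos neg by (metis continuous_at_imp_continuous_on linorder_less_linear)
qed

text \<open>\<open>p * G x - x * g x\<close> has derivative
  \<open>(p - 1) * g x - x * deriv g x\<close>, nonnegative by the index bound. Its value at a small
  \<open>e\<close> is at least \<open>- (e * g t)\<close>, which vanishes as \<open>e\<close> tends
  to 0.\<close>

lemma N_function_density_bound:
  assumes N: "N_function G g" and d: "\<forall>t>0. g differentiable (at t)"
    and P: "\<forall>t>0. t * deriv g t / g t \<le> p - 1" and "t > 0" "p \<ge> 0"
  shows "t * g t \<le> p * G t"
proof -
  have gpos: "g x > 0" if "x > 0" for x using N that by (simp add: N_function_def)
  have inc: "p * G e - e * g e \<le> p * G t - t * g t" if "0 < e" "e \<le> t" for e
  proof (rule DERIV_nonneg_imp_nondecreasing[where f = "\<lambda>x. p * G x - x * g x"])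
    show "e \<le> t" by fact
    fix x assume "e \<le> x" "x \<le> t"
    then have x: "x > 0" using that by simp
    have g': "(g has_real_derivative deriv g x) (at x)"
      using d x by (simp add: DERIV_deriv_iff_real_differentiable)
    have "((\<lambda>x. p * G x - x * g x) has_real_derivative p * g x - (g x + x * deriv g x)) (at x)"
      using N_function_deriv[OF N] g' DERIV_isCont by (auto intro!: derivative_eq_intros)
    moreover have "p * g x - (g x + x * deriv g x) \<ge> 0"
      using P x gpos[of x] by (auto simp: field_simps)
    ultimately show "\<exists>y. ((\<lambda>x. p * G x - x * g x) has_real_derivative y) (at x) \<and> 0 \<le> y" by blast
  qed
  have "- (e * g t) \<le> p * G t - t * g t" if "0 < e" "e \<le> t" for e
  proof -
    have "e * g e \<le> e * g t" using monoD[OF N_function_mono[OF N]] that by simp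
    moreover have "0 \<le> p * G e" using N_function_pos[OF N, of e] that assms by simp
    ultimately show ?thesis using inc[OF that] by linarith
  qed
  then have "eventually (\<lambda>e. - (e * g t) \<le> p * G t - t * g t) (at_right 0)"
    unfolding eventually_at_right_field using \<open>t > 0\<close> by (intro exI[of _ t]) auto
  moreover have "((\<lambda>e. - (e * g t)) \<longlongrightarrow> 0) (at_right 0)" by (auto intro!: tendsto_eq_intros)
  ultimately have "0 \<le> p * G t - t * g t" by (intro tendsto_upperbound) auto
  then show ?thesis by simp
qed

text \<open>
  The only property of the Orlicz-Sobolev conjugate that is needed is
  \<open>H t \<ge> t (G t)\<^bsup>-s/n\<^esup>\<close>, which holds because \<open>t / G t\<close> decreases.
\<close>

lemma essentially_slower_orlicz_conjugate:
  assumes N: "N_function G g" and s: "0 < s" "s < real n"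
    and inf: "\<exists>M>0. (\<integral>\<^sup>+t\<in>{M..}. ennreal ((t / G t) powr (s / (real n - s))) \<partial>lborel) = \<infinity>"
    and fin: "\<exists>\<delta>>0. (\<integral>\<^sup>+t\<in>{0..\<delta>}. ennreal ((t / G t) powr (s / (real n - s))) \<partial>lborel) < \<infinity>"
    and sl: "essentially_slower B (orlicz_conjugate n s G)"
    and c: "c > 0" "\<epsilon> > 0"
  shows "\<exists>y0. \<forall>t>0. \<forall>y\<ge>y0. y \<le> c * (t * G t powr (- (s / real n))) \<longrightarrow> B y \<le> \<epsilon> * G t"
proof -
  define \<kappa> where "\<kappa> = s / (real n - s)"
  define k where "k \<tau> = (\<tau> / G \<tau>) powr \<kappa>" for \<tau>
  have \<kappa>: "\<kappa> > 0" using s by (simp add: \<kappa>_def)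
  have Gpos: "G t > 0" if "t > 0" for t using N_function_pos[OF N] that by simp
  have [measurable]: "G \<in> borel_measurable borel"
    by (rule borel_measurable_continuous_onI[OF N_function_continuous[OF N]])
  have [measurable]: "k \<in> borel_measurable borel" unfolding k_def by measurable
  have kpos: "k t > 0" if "t > 0" for t using Gpos[OF that] that by (simp add: k_def)
  have k0: "k t \<ge> 0" for t by (simp add: k_def)
  have kanti: "k y \<le> k x" if "0 < x" "x \<le> y" for x y
  proof -
    have "G ((x / y) * y) \<le> (x / y) * G y" by (rule N_function_contract[OF N]) (use that in auto)
    then have "y / G y \<le> x / G x" using that Gpos[of x] Gpos[of y] by (simp add: field_simps)
    then show ?thesis unfolding k_def
      by (intro powr_mono2) (use \<kappa> that Gpos[of y] in auto)
  qed
  obtain \<delta> where \<delta>: "\<delta> > 0" "(\<integral>\<^sup>+t\<in>{0..\<delta>}. ennreal (k t) \<partial>lborel) < \<infinity>"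
    using fin by (auto simp: k_def \<kappa>_def)
  have int\<delta>: "set_integrable lborel {0..\<delta>} k"
    unfolding set_integrable_def
    by (rule integrableI_bounded)
      (use \<delta>(2) k0 in \<open>auto simp: ennreal_mult ennreal_indicator mult.commute\<close>)
  have bnd: "set_integrable lborel {x..y} k" if "0 < x" for x y
    by (rule set_integrable_bound[OF borel_integrable_atLeastAtMost'[of x y "\<lambda>_. k x"]])
      (use that k0 kanti[of x] in \<open>auto simp: set_borel_measurable_def intro!: AE_I2\<close>)
  have int: "set_integrable lborel {x..y} k" if "0 \<le> x" for x y
  proof (rule set_integrable_subset[of _ "{0..\<delta>} \<union> {\<delta>..max y \<delta>}"])
    show "set_integrable lborel ({0..\<delta>} \<union> {\<delta>..max y \<delta>}) k"
      by (rule set_integrable_Un[OF int\<delta> bnd]) (use \<delta> in auto)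
  qed (use that in auto)
  have iint: "k integrable_on {x..y}" if "0 \<le> x" for x y
    using set_borel_integral_eq_integral(1)[OF int[OF that]] .
  define J where "J t = integral {0..t} k" for t
  have H: "orlicz_H n s G t = J t powr ((real n - s) / real n)" if "t \<ge> 0" for t
    using interval_integral_eq_integral[OF that int[of 0 t]]
    unfolding orlicz_H_def J_def k_def[symmetric] \<kappa>_def[symmetric]
    by (simp add: zero_ereal_def)
  have Jdiff: "J y - J x = integral {x..y} k" if "0 \<le> x" "x \<le> y" for x y
    using Henstock_Kurzweil_Integration.integral_combine[OF that iint] that by (simp add: J_def)
  have Jlow: "(y - x) * k y \<le> J y - J x" if "0 \<le> x" "x \<le> y" for x y
  proof -
    \<comment> \<open>At 0 the totalised quotient gives \<open>k 0 = 0\<close>, so monotonicity of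
      \<open>k\<close> fails there; the comparison function is set to 0 on this null set.\<close>
    have "integral {x..y} (\<lambda>t. if t = 0 then 0 else k y) \<le> integral {x..y} k"
    proof (rule integral_le)
      show "(\<lambda>t. if t = 0 then 0 else k y) integrable_on {x..y}"
        by (rule integrable_spike[of "\<lambda>_. k y" _ "{0}"]) auto
      show "(if t = 0 then 0 else k y) \<le> k t" if "t \<in> {x..y}" for t
        using that kanti[of t y] \<open>0 \<le> x\<close> k0 by auto
    qed (use that iint in auto)
    moreover have "integral {x..y} (\<lambda>t. if t = 0 then 0 else k y) = integral {x..y} (\<lambda>_. k y)"
      by (rule integral_spike[of "{0}"]) auto
    ultimately show ?thesis using Jdiff[OF that] that by simp
  qed
  have Jup: "J y - J x \<le> (y - x) * k x" if "0 < x" "x \<le> y" for x y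
  proof -
    have "integral {x..y} k \<le> integral {x..y} (\<lambda>_. k x)"
      by (rule integral_le) (use that iint kanti in auto)
    then show ?thesis using Jdiff[of x y] that by simp
  qed
  have J0: "J t \<ge> 0" if "t \<ge> 0" for t
    using Jlow[of 0 t] that k0[of t] by (auto simp: J_def intro: order_trans[rotated])
  have Jmono: "J x < J y" if "0 \<le> x" "x < y" for x y
    using Jlow[of x y] kpos[of y] that
    by (smt (verit) mult_pos_pos)
  define e where "e = (real n - s) / real n"
  have e: "e > 0" using s by (simp add: e_def)
  \<comment> \<open>With \<open>e = 1 - s / n\<close> one has \<open>\<kappa> * e = s / n\<close>,
    so the powers of \<open>t\<close> in \<open>(t * k t) powr e\<close> combine to \<open>t\<close>
    itself.\<close>
  have Hlow: "t * G t powr (- (s / real n)) \<le> orlicz_H n s G t" if "t > 0" for t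
  proof -
    have "(t * k t) powr e \<le> J t powr e"
      using Jlow[of 0 t] that e k0[of t] by (intro powr_mono2) (auto simp: J_def)
    moreover have "(t * k t) powr e = t * G t powr (- (s / real n))"
    proof -
      have "\<kappa> * e = s / real n" using s by (simp add: \<kappa>_def e_def field_simps)
      then have "(t * k t) powr e = t powr e * (t / G t) powr (s / real n)"
        using that k0[of t] by (simp add: powr_mult k_def powr_powr)
      also have "\<dots> = (t powr e * t powr (s / real n)) * G t powr (- (s / real n))"
        using that Gpos[OF that] by (simp add: powr_divide powr_minus_divide)
      also have "t powr e * t powr (s / real n) = t"
        using that s by (simp add: powr_add[symmetric] e_def add_divide_distrib[symmetric])
      finally show ?thesis .
    qed
    ultimately show ?thesis using H[of t] that by (simp add: e_def)
  qed
  have Jcont: "continuous_on {1..} J"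
  proof (rule lipschitz_on_continuous_on[where L = "k 1"], rule lipschitz_onI)
    fix x y :: real assume "x \<in> {1..}" "y \<in> {1..}"
    then show "dist (J x) (J y) \<le> k 1 * dist x y"
    proof (induction x y rule: linorder_wlog)
      case (le a b)
      have "J b - J a \<le> (b - a) * k 1"
        using Jup[of a b] kanti[of 1 a] le
          mult_left_mono[of "k a" "k 1" "b - a"] by auto
      moreover have "J a \<le> J b" using Jmono[of a b] le by (cases "a = b") auto
      ultimately show ?case using le by (simp add: dist_real_def mult.commute)
    qed (simp add: dist_commute)
  qed (rule k0)
  \<comment> \<open>A bound for \<open>J\<close> would bound every truncated integral of
    \<open>k\<close>, hence the infinite one over \<open>{M..}\<close>.\<close>
  have Junb: "\<exists>t\<ge>1. J t > C" for C
  proof (rule ccontr)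
    assume "\<not> ?thesis"
    then have JC: "J t \<le> C" if "t \<ge> 1" for t using that by force
    obtain M where M: "M > 0" "(\<integral>\<^sup>+t\<in>{M..}. ennreal (k t) \<partial>lborel) = \<infinity>"
      using inf by (auto simp: k_def \<kappa>_def)
    have "(\<integral>\<^sup>+t\<in>{M..}. ennreal (k t) \<partial>lborel) =
        (\<integral>\<^sup>+t. (SUP i. ennreal (k t) * indicator {M..M + real i} t) \<partial>lborel)"
    proof (rule nn_integral_cong)
      fix t
      show "ennreal (k t) * indicator {M..} t = (SUP i. ennreal (k t) * indicator {M..M + real i} t)"
      proof (cases "t \<ge> M")
        case True
        obtain i where i: "t \<le> M + real i" using real_arch_simple[of "t - M"] by (auto simp: algebra_simps)
        show ?thesis
          by (rule antisym[OF SUP_upper2[of i]]) (use True i in \<open>auto intro!: SUP_least split: split_indicator\<close>)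
      qed auto
    qed
    also have "\<dots> = (SUP i. \<integral>\<^sup>+t. ennreal (k t) * indicator {M..M + real i} t \<partial>lborel)"
      by (rule nn_integral_monotone_convergence_SUP)
        (auto simp: incseq_def le_fun_def split: split_indicator)
    also have "\<dots> \<le> ennreal C"
    proof (rule SUP_least)
      fix i :: nat
      have "(\<integral>\<^sup>+t. ennreal (k t) * indicator {M..M + real i} t \<partial>lborel)
         = (\<integral>\<^sup>+t. ennreal (indicator {M..M + real i} t *\<^sub>R k t) \<partial>lborel)"
        using k0 by (auto intro!: nn_integral_cong split: split_indicator)
      also have "\<dots> = ennreal (LINT t:{M..M + real i}|lborel. k t)"
        unfolding set_lebesgue_integral_def
        by (rule nn_integral_eq_integral) (use int[of M] M k0 in \<open>auto simp: set_integrable_def\<close>)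
      also have "(LINT t:{M..M + real i}|lborel. k t) = J (M + real i) - J M"
        using set_borel_integral_eq_integral(2)[OF int[of M "M + real i"]] Jdiff[of M "M + real i"] M
        by simp
      also have "ennreal (J (M + real i) - J M) \<le> ennreal C"
      proof (rule ennreal_leI)
        have "J (M + real i) \<le> J (max 1 (M + real i))"
          using Jmono[of "M + real i" "max 1 (M + real i)"] M
          by (cases "1 \<le> M + real i") auto
        then show "J (M + real i) - J M \<le> C"
          using JC[of "max 1 (M + real i)"] J0[of M] M by auto
      qed
      finally show "(\<integral>\<^sup>+t. ennreal (k t) * indicator {M..M + real i} t \<partial>lborel) \<le> ennreal C" .
    qed
    finally show False using M by (simp add: top_unique)
  qed
  have Hmono: "orlicz_H n s G x < orlicz_H n s G y" if "0 \<le> x" "x < y" for x y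
    using Jmono[OF that] J0[of x] H[of x] H[of y] e that
    by (auto simp: e_def[symmetric] intro!: powr_less_mono2)
  \<comment> \<open>\<open>inv_into\<close> is meaningful only on the range of
    \<open>orlicz_H\<close>. Continuity and unboundedness of \<open>J\<close> put every value above
    \<open>orlicz_H n s G 1\<close> into that range.\<close>
  have Hsurj: "\<exists>t\<ge>1. orlicz_H n s G t = y" if "y \<ge> orlicz_H n s G 1" for y
  proof -
    have y0: "y \<ge> 0" using that by (simp add: orlicz_H_def) (use order_trans powr_ge_zero in blast)
    obtain T where T: "T \<ge> 1" "J T > y powr (1 / e)" using Junb by blast
    have "J 1 \<le> y powr (1 / e)"
    proof -
      have "(J 1 powr e) powr (1 / e) \<le> y powr (1 / e)"
        using that H[of 1] s by (intro powr_mono2) (auto simp: e_def)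
      then show ?thesis using J0[of 1] e by (simp add: powr_powr)
    qed
    then obtain t where "1 \<le> t" "J t = y powr (1 / e)"
      using IVT'[of J 1 "y powr (1 / e)" T] T continuous_on_subset[OF Jcont, of "{1..T}"] by auto
    then show ?thesis using H[of t] y0 e by (intro exI[of _ t]) (auto simp: powr_powr e_def)
  qed
  define Hi where "Hi y = inv_into {0..} (orlicz_H n s G) y" for y
  have Hi: "Hi y \<ge> 0" "orlicz_H n s G (Hi y) = y" if "y \<ge> orlicz_H n s G 1" for y
  proof -
    have im: "y \<in> orlicz_H n s G ` {0..}" using Hsurj[OF that] by force
    show "Hi y \<ge> 0" "orlicz_H n s G (Hi y) = y"
      using inv_into_into[OF im] f_inv_into_f[OF im] by (auto simp: Hi_def)
  qed
  have "((\<lambda>t. B (c * t) / orlicz_conjugate n s G t) \<longlongrightarrow> 0) at_top"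
    using sl c by (simp add: essentially_slower_def)
  then have "eventually (\<lambda>t. B (c * t) / orlicz_conjugate n s G t < \<epsilon>) at_top"
    using order_tendstoD(2) c by blast
  then obtain y1 where y1: "\<And>y. y \<ge> y1 \<Longrightarrow> B (c * y) / orlicz_conjugate n s G y < \<epsilon>"
    by (auto simp: eventually_at_top_linorder)
  \<comment> \<open>Large enough for the quotient to be below \<open>\<epsilon>\<close>, for
    membership in the range of \<open>orlicz_H\<close> and, through the bound 1, for
    \<open>Hi z > 0\<close>.\<close>
  define Y where "Y = max (max y1 (orlicz_H n s G 1)) 1"
  show ?thesis
  proof (intro exI allI impI)
    fix t y :: real assume t: "t > 0" and y: "c * Y \<le> y"
      and le: "y \<le> c * (t * G t powr (- (s / real n)))"
    define z where "z = y / c"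
    have z: "z \<ge> Y" "y = c * z" using y c by (auto simp: z_def field_simps)
    then have z1: "z \<ge> orlicz_H n s G 1" "z \<ge> y1" "z \<ge> 1" by (auto simp: Y_def)
    \<comment> \<open>Monotonicity of \<open>orlicz_H\<close> turns this into
      \<open>Hi z \<le> t\<close>. Hence \<open>B y = B (c * z)\<close> is at most
      \<open>\<epsilon> * G (Hi z)\<close> and so at most \<open>\<epsilon> * G t\<close>.\<close>
    have "z \<le> orlicz_H n s G t" using le z c Hlow[OF t] by simp
    then have le: "Hi z \<le> t"
      using Hi[OF z1(1)] Hmono[of t "Hi z"] t by force
    have Hz: "Hi z > 0"
    proof (rule ccontr)
      assume "\<not> Hi z > 0"
      then have "Hi z = 0" using Hi[OF z1(1)] by simp
      then show False using Hi(2)[OF z1(1)] z1 H[of 0] by (simp add: J_def)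
    qed
    have oc: "orlicz_conjugate n s G z = G (Hi z)" using z1 by (simp add: orlicz_conjugate_def Hi_def)
    have "B y \<le> \<epsilon> * G (Hi z)" using y1[OF z1(2)] oc Gpos[OF Hz] z by (simp add: field_simps)
    also have "\<dots> \<le> \<epsilon> * G t"
      using N_function_incseq[OF N, of "Hi z" t] Hz le c by simp
    finally show "B y \<le> \<epsilon> * G t" .
  qed
qed

section \<open>The modular on functions supported in a bounded set\<close>

text \<open>The Borel counterpart of \<open>mu\<close>. Tonelli's theorem applies to it because
  \<open>lborel\<close> on the product space is the product of its factors, whereas the completion
  is not the product of the completions.\<close>

definition mub :: "((real^'n) \<times> (real^'n)) measure" where
  "mub = density lborel (\<lambda>(x, y). ennreal (1 / norm (x - y) ^ CARD('n)))"

lemma measurable_fst_borel [measurable]: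
  "(fst :: ('a::euclidean_space \<times> 'b::euclidean_space) \<Rightarrow> 'a) \<in> borel \<rightarrow>\<^sub>M borel"
  by (intro borel_measurable_continuous_onI continuous_intros)

lemma measurable_snd_borel [measurable]:
  "(snd :: ('a::euclidean_space \<times> 'b::euclidean_space) \<Rightarrow> 'b) \<in> borel \<rightarrow>\<^sub>M borel"
  by (intro borel_measurable_continuous_onI continuous_intros)

lemma mub_density_measurable [measurable]:
  "(\<lambda>(x :: real^'n, y). ennreal (1 / norm (x - y) ^ CARD('n))) \<in> borel_measurable borel"
  unfolding split_beta by measurable

lemma sets_mub [measurable_cong, simp]: "sets (mub :: ((real^'n) \<times> (real^'n)) measure) = sets borel"
  by (simp add: mub_def)

lemma space_mub [simp]: "space (mub :: ((real^'n) \<times> (real^'n)) measure) = UNIV"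
  by (simp add: mub_def)

lemma hoelder_quotient_measurable [measurable]:
  assumes [measurable]: "u \<in> borel_measurable borel"
  shows "hoelder_quotient s (u :: real^'n \<Rightarrow> real) \<in> borel_measurable borel"
  unfolding hoelder_quotient_def split_beta by measurable

lemma nn_integral_mub:
  fixes h :: "(real^'n) \<times> (real^'n) \<Rightarrow> ennreal"
  assumes [measurable]: "h \<in> borel_measurable borel"
  shows "(\<integral>\<^sup>+p. h p \<partial>mub) =
    (\<integral>\<^sup>+x. \<integral>\<^sup>+y. ennreal (1 / norm (x - y) ^ CARD('n)) * h (x, y) \<partial>lborel \<partial>lborel)"
proof -
  have "(\<integral>\<^sup>+p. h p \<partial>mub) = (\<integral>\<^sup>+p. (case p of (x, y) \<Rightarrow> ennreal (1 / norm (x - y) ^ CARD('n))) * h p \<partial>lborel)"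
    unfolding mub_def by (rule nn_integral_density) simp_all
  also have "\<dots> = (\<integral>\<^sup>+p. (case p of (x, y) \<Rightarrow> ennreal (1 / norm (x - y) ^ CARD('n))) * h p
      \<partial>(lborel \<Otimes>\<^sub>M lborel))"
    by (simp add: lborel_prod)
  also have "\<dots> = (\<integral>\<^sup>+x. \<integral>\<^sup>+y. ennreal (1 / norm (x - y) ^ CARD('n)) * h (x, y) \<partial>lborel \<partial>lborel)"
  proof (subst lborel.nn_integral_fst[symmetric])
    show "(\<lambda>p. (case p of (x, y) \<Rightarrow> ennreal (1 / norm (x - y) ^ CARD('n))) * h p)
      \<in> borel_measurable (lborel \<Otimes>\<^sub>M lborel)"
      unfolding lborel_prod by measurable
  qed simp
  finally show ?thesis .
qed

lemma AE_lborel_fst_snd: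
  assumes "AE x in lborel. P (x :: real^'n)"
  shows "AE p in (lborel :: ((real^'n) \<times> (real^'n)) measure). P (fst p) \<and> P (snd p)"
proof -
  obtain Z where Z: "Z \<in> null_sets lborel" "{x. \<not> P x} \<subseteq> Z"
    using assms by (auto simp: eventually_ae_filter)
  then have [measurable]: "Z \<in> sets borel" by auto
  have "emeasure (lborel \<Otimes>\<^sub>M lborel) (Z \<times> (UNIV :: (real^'n) set)) = 0"
    "emeasure (lborel \<Otimes>\<^sub>M lborel) ((UNIV :: (real^'n) set) \<times> Z) = 0"
    using Z by (subst lborel.emeasure_pair_measure_Times; auto)+
  then have "Z \<times> UNIV \<in> null_sets (lborel :: ((real^'n) \<times> (real^'n)) measure)"
    "UNIV \<times> Z \<in> null_sets (lborel :: ((real^'n) \<times> (real^'n)) measure)"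
    by (auto simp: null_sets_def lborel_prod borel_prod[symmetric])
  then have "Z \<times> UNIV \<union> UNIV \<times> Z \<in> null_sets (lborel :: ((real^'n) \<times> (real^'n)) measure)"
    by (rule null_sets.Un)
  then show ?thesis by (rule AE_I') (use Z in auto)
qed

lemma AE_mub_fst_snd:
  assumes "AE x in lborel. P (x :: real^'n)"
  shows "AE p in mub. P (fst p) \<and> P (snd p)"
  unfolding mub_def using AE_lborel_fst_snd[OF assms] by (subst AE_density) auto

text \<open>\<open>p\<close> is the upper index of \<open>G\<close>, \<open>r\<close> the lower
  index of \<open>B\<close> and \<open>Q\<close> a doubling constant of \<open>B\<close>.
  \<open>B_subcritical\<close> is the form in which slower growth than the Orlicz-Sobolev conjugate
  enters the estimates.\<close>

locale frac_orlicz =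
  fixes \<Omega> :: "(real^'n) set" and s p r Q :: real and G g B :: "real \<Rightarrow> real"
  assumes s: "0 < s" "s < 1"
    and \<Omega>: "open \<Omega>" "bounded \<Omega>"
    and G: "N_function G g"
    and g_cont: "continuous_on UNIV g"
    and p: "1 < p"
    and g_scale: "\<And>l t. l \<ge> 1 \<Longrightarrow> t \<ge> 0 \<Longrightarrow> g (l * t) \<le> l powr (p - 1) * g t"
    and G_scale: "\<And>l t. l \<ge> 1 \<Longrightarrow> t \<ge> 0 \<Longrightarrow> G (l * t) \<le> l powr p * G t"
    and g_bound: "\<And>t. t \<ge> 0 \<Longrightarrow> t * g t \<le> p * G t"
    and B_even: "\<And>t. B (- t) = B t"
    and B_mono: "\<And>a b. 0 \<le> a \<Longrightarrow> a \<le> b \<Longrightarrow> B a \<le> B b"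
    and B_cont: "continuous_on UNIV B"
    and B_0: "B 0 = 0" and B_pos: "\<And>t. t \<noteq> 0 \<Longrightarrow> B t > 0"
    and B_lower: "\<And>l t. l \<ge> 1 \<Longrightarrow> t \<ge> 0 \<Longrightarrow> l powr r * B t \<le> B (l * t)"
    and B_double: "\<And>t. t \<ge> 0 \<Longrightarrow> B (2 * t) \<le> Q * B t" and Q: "Q \<ge> 1"
    and pr: "p < r"
    and B_subcritical: "\<And>c \<epsilon>. c > 0 \<Longrightarrow> \<epsilon> > 0 \<Longrightarrow>
      \<exists>y0. \<forall>t>0. \<forall>y\<ge>y0. y \<le> c * (t * G t powr (- (s / real CARD('n)))) \<longrightarrow> B y \<le> \<epsilon> * G t"
begin

lemma G_borel [measurable]: "G \<in> borel_measurable borel"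
  by (rule borel_measurable_continuous_onI[OF N_function_continuous[OF G]])

lemma g_borel [measurable]: "g \<in> borel_measurable borel"
  by (rule borel_measurable_continuous_onI[OF g_cont])

lemma B_borel [measurable]: "B \<in> borel_measurable borel"
  by (rule borel_measurable_continuous_onI[OF B_cont])

lemma \<Omega>_borel [measurable]: "\<Omega> \<in> sets borel"
  using \<Omega> by auto

lemma G_even: "G (- t) = G t" and g_odd: "g (- t) = - g t" and g_0: "g 0 = 0"
  using G by (auto simp: N_function_def)

lemma G_abs: "G \<bar>t\<bar> = G t" using G_even by (simp add: abs_if)
lemma B_abs: "B \<bar>t\<bar> = B t" using B_even by (simp add: abs_if)

lemmas G_0 = N_function_zero[OF G]
lemmas G_pos = N_function_pos[OF G]
lemmas G_mono = N_function_incseq[OF G]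
lemmas G_contract = N_function_contract[OF G]
lemmas G_subgradient = N_function_subgradient[OF G]
lemmas g_mono = monoD[OF N_function_mono[OF G]]
lemmas g_nonneg = N_function_nonneg[OF G]

lemma G_nonneg: "G t \<ge> 0" using G_pos[of t] G_0 by (cases "t = 0") auto
lemma B_nonneg: "B t \<ge> 0" using B_pos[of t] B_0 by (cases "t = 0") auto

lemma G_mono_abs: "\<bar>a\<bar> \<le> \<bar>b\<bar> \<Longrightarrow> G a \<le> G b"
  using G_mono[of "\<bar>a\<bar>" "\<bar>b\<bar>"] by (simp add: G_abs)

lemma B_mono_abs: "\<bar>a\<bar> \<le> \<bar>b\<bar> \<Longrightarrow> B a \<le> B b"
  using B_mono[of "\<bar>a\<bar>" "\<bar>b\<bar>"] by (simp add: B_abs)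

abbreviation "D \<equiv> hoelder_quotient s"

text \<open>Representatives of the classes in \<open>W0\<close>: Borel, and zero at every point
  outside \<open>\<Omega>\<close>. Finiteness of the zero-order modular is recovered from the bound
  on the modular of \<open>B\<close>.\<close>

definition X :: "(real^'n \<Rightarrow> real) set" where
  "X = {u \<in> borel_measurable borel. (\<forall>x. x \<notin> \<Omega> \<longrightarrow> u x = 0) \<and> integrable mub (\<lambda>q. G (D u q))}"

definition A :: "(real^'n \<Rightarrow> real) \<Rightarrow> real" where
  "A u = (\<integral>q. G (D u q) \<partial>mub)"

lemma X_borel: "u \<in> X \<Longrightarrow> u \<in> borel_measurable borel"
  and X_zero: "u \<in> X \<Longrightarrow> x \<notin> \<Omega> \<Longrightarrow> u x = 0"
  and X_integrable: "u \<in> X \<Longrightarrow> integrable mub (\<lambda>q. G (D u q))"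
  by (auto simp: X_def)

lemma A_nonneg: "A u \<ge> 0"
  unfolding A_def by (intro integral_nonneg_AE AE_I2 G_nonneg)

lemma nn_integral_A: "u \<in> X \<Longrightarrow> (\<integral>\<^sup>+q. ennreal (G (D u q)) \<partial>mub) = ennreal (A u)"
  unfolding A_def by (rule nn_integral_eq_integral) (auto simp: X_integrable G_nonneg)

section \<open>Uniform integrability\<close>

definition ballvol :: real where "ballvol = unit_ball_vol (real CARD('n))"

lemma ballvol_pos: "ballvol > 0" by (simp add: ballvol_def)

text \<open>A ball about \<open>x\<close> of volume \<open>2 * a\<close> keeps volume at least
  \<open>a\<close> outside \<open>T\<close>. The integrand decreases with the distance, so on that
  remainder it is at least its value at the radius \<open>\<rho>\<close>.\<close>

lemma kernel_lower:
  fixes x :: "real^'n"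
  assumes [measurable]: "T \<in> sets borel" and T: "emeasure lborel T = ennreal a" "a > 0" and t: "t \<ge> 0"
  shows "ennreal (ballvol / 2 * G (t * (ballvol / (2 * a)) powr (s / CARD('n)))) \<le>
    (\<integral>\<^sup>+y. ennreal (1 / norm (x - y) ^ CARD('n)) *
      (ennreal (G (t / norm (x - y) powr s)) * indicator (- T) y) \<partial>lborel)"
proof -
  let ?n = "CARD('n)"
  define \<rho> where "\<rho> = (2 * a / ballvol) powr (1 / ?n)"
  have \<rho>: "\<rho> > 0" using T ballvol_pos by (simp add: \<rho>_def)
  have \<rho>n: "\<rho> ^ ?n = 2 * a / ballvol"
    using T ballvol_pos by (simp add: \<rho>_def powr_realpow[symmetric] powr_powr)
  have \<rho>s: "1 / \<rho> powr s = (ballvol / (2 * a)) powr (s / ?n)"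
    using T ballvol_pos by (simp add: \<rho>_def powr_powr powr_divide)
  \<comment> \<open>The point \<open>x\<close> is removed because division by zero makes the
    integrand vanish there.\<close>
  define S where "S = ball x \<rho> - T - {x}"
  have [measurable]: "S \<in> sets borel" by (simp add: S_def)
  have "emeasure lborel (ball x \<rho>) = ennreal (ballvol * \<rho> ^ ?n)"
    using \<rho> by (simp add: emeasure_ball ballvol_def)
  then have "ennreal (2 * a) = emeasure lborel (ball x \<rho>)"
    using \<rho>n ballvol_pos by simp
  also have "\<dots> \<le> emeasure lborel (S \<union> (T \<union> {x}))"
    by (rule emeasure_mono) (auto simp: S_def)
  also have "\<dots> \<le> emeasure lborel S + (emeasure lborel T + emeasure lborel {x})"
    by (intro order_trans[OF emeasure_subadditive] add_left_mono emeasure_subadditive) auto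
  finally have "ennreal a + ennreal a \<le> emeasure lborel S + ennreal a"
    using T by (simp add: ennreal_plus[symmetric] del: ennreal_plus)
  then have S: "ennreal a \<le> emeasure lborel S" by simp
  have "ballvol / 2 * G (t * (ballvol / (2 * a)) powr (s / ?n)) = 1 / \<rho> ^ ?n * G (t / \<rho> powr s) * a"
  proof -
    have "t / \<rho> powr s = t * (ballvol / (2 * a)) powr (s / ?n)"
      by (simp only: \<rho>s[symmetric]) simp
    moreover have "1 / \<rho> ^ ?n * a = ballvol / 2" using \<rho>n T by simp
    then have "1 / \<rho> ^ ?n * G (t / \<rho> powr s) * a = ballvol / 2 * G (t / \<rho> powr s)"
      by (metis mult.assoc mult.commute)
    ultimately show ?thesis by simp
  qed
  then have "ennreal (ballvol / 2 * G (t * (ballvol / (2 * a)) powr (s / ?n)))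
     = ennreal (1 / \<rho> ^ ?n * G (t / \<rho> powr s)) * ennreal a"
    using \<rho> T G_nonneg by (simp add: ennreal_mult[symmetric])
  also have "\<dots> \<le> ennreal (1 / \<rho> ^ ?n * G (t / \<rho> powr s)) * emeasure lborel S"
    by (intro mult_left_mono S) simp
  also have "\<dots> = (\<integral>\<^sup>+y. ennreal (1 / \<rho> ^ ?n * G (t / \<rho> powr s)) * indicator S y \<partial>lborel)"
    by (simp add: nn_integral_cmult)
  also have "\<dots> \<le> (\<integral>\<^sup>+y. ennreal (1 / norm (x - y) ^ ?n) *
      (ennreal (G (t / norm (x - y) powr s)) * indicator (- T) y) \<partial>lborel)"
  proof (rule nn_integral_mono)
    fix y
    show "ennreal (1 / \<rho> ^ ?n * G (t / \<rho> powr s)) * indicator S y \<le> ennreal (1 / norm (x - y) ^ ?n) *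
      (ennreal (G (t / norm (x - y) powr s)) * indicator (- T) y)"
    proof (cases "y \<in> S")
      case True
      then have y: "0 < norm (x - y)" "norm (x - y) < \<rho>" "y \<notin> T" by (auto simp: S_def dist_norm)
      have "1 / \<rho> ^ ?n * G (t / \<rho> powr s) \<le> 1 / norm (x - y) ^ ?n * G (t / norm (x - y) powr s)"
      proof (intro mult_mono G_mono)
        show "1 / \<rho> ^ ?n \<le> 1 / norm (x - y) ^ ?n"
          using y \<rho> by (intro divide_left_mono power_mono mult_pos_pos zero_less_power) auto
        show "t / \<rho> powr s \<le> t / norm (x - y) powr s"
          using y t s \<rho> by (intro divide_left_mono powr_mono2) auto
      qed (use t in \<open>auto simp: G_nonneg\<close>)
      then show ?thesis
        using True y by (auto simp: ennreal_mult[symmetric] G_nonneg intro!: ennreal_leI)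
    qed auto
  qed
  finally show ?thesis .
qed

lemma dyadic_sum_le:
  assumes "\<Delta> \<ge> (0::real)"
  shows "(\<Sum>k<N. if 2 ^ k \<le> \<Delta> then 2 ^ k else 0) \<le> 2 * \<Delta>"
proof (induction N)
  case (Suc N)
  show ?case
  proof (cases "2 ^ N \<le> \<Delta>")
    case True
    have "(\<Sum>k<Suc N. if 2 ^ k \<le> \<Delta> then 2 ^ k else 0) \<le> (\<Sum>k<Suc N. (2::real) ^ k)"
      by (intro sum_mono) auto
    also have "\<dots> = 2 ^ Suc N - 1"
      by (induction N) auto
    finally show ?thesis using True by simp
  qed (use Suc in simp)
qed (use assms in simp)

text \<open>A pair that contributes at level \<open>k\<close> satisfies
  \<open>2 ^ k \<le> \<bar>v - w\<bar>\<close>, and convexity extracts the factor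
  \<open>2 ^ k / \<bar>v - w\<bar>\<close> from \<open>G\<close>. The dyadic numbers up to
  \<open>\<bar>v - w\<bar>\<close> sum to at most twice that number, so counting a pair at every
  level it crosses costs only a factor 2.\<close>

lemma dyadic_levels_le:
  assumes "d \<ge> 0"
  shows "(\<Sum>k<N. if \<bar>v\<bar> > 2 ^ Suc k \<and> \<bar>w\<bar> \<le> 2 ^ k then G (2 ^ k / d) else 0) \<le> 2 * G ((v - w) / d)"
proof -
  define \<Delta> where "\<Delta> = \<bar>v - w\<bar>"
  have le: "(if \<bar>v\<bar> > 2 ^ Suc k \<and> \<bar>w\<bar> \<le> 2 ^ k then G (2 ^ k / d) else 0) \<le>
      (if 2 ^ k \<le> \<Delta> then 2 ^ k else 0) * (G (\<Delta> / d) / \<Delta>)" for k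
  proof (cases "\<bar>v\<bar> > 2 ^ Suc k \<and> \<bar>w\<bar> \<le> 2 ^ k")
    case True
    then have \<Delta>: "2 ^ k \<le> \<Delta>" by (auto simp: \<Delta>_def)
    then have pos: "\<Delta> > 0" by (rule less_le_trans[rotated]) simp
    have "G (2 ^ k / \<Delta> * (\<Delta> / d)) \<le> 2 ^ k / \<Delta> * G (\<Delta> / d)"
      by (rule G_contract) (use \<Delta> pos in auto)
    then show ?thesis using True \<Delta> pos by simp
  qed (auto simp: G_nonneg \<Delta>_def)
  have "(\<Sum>k<N. if \<bar>v\<bar> > 2 ^ Suc k \<and> \<bar>w\<bar> \<le> 2 ^ k then G (2 ^ k / d) else 0) \<le>
      (\<Sum>k<N. (if 2 ^ k \<le> \<Delta> then 2 ^ k else 0) * (G (\<Delta> / d) / \<Delta>))"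
    by (intro sum_mono le)
  also have "\<dots> = (\<Sum>k<N. if 2 ^ k \<le> \<Delta> then 2 ^ k else 0) * (G (\<Delta> / d) / \<Delta>)"
    by (rule sum_distrib_right[symmetric])
  also have "\<dots> \<le> 2 * \<Delta> * (G (\<Delta> / d) / \<Delta>)"
    by (intro mult_right_mono dyadic_sum_le) (auto simp: \<Delta>_def G_nonneg)
  also have "\<dots> \<le> 2 * G (\<Delta> / d)" using G_nonneg by (cases "\<Delta> = 0") auto
  also have "G (\<Delta> / d) = G ((v - w) / d)"
    using assms G_abs[of "(v - w) / d"] by (simp add: \<Delta>_def)
  finally show ?thesis .
qed

lemma level_finite:
  assumes u: "u \<in> X" and "\<tau> \<ge> 0"
  shows "emeasure lborel {x. \<bar>u x\<bar> > \<tau>} = ennreal (measure lborel {x. \<bar>u x\<bar> > \<tau>})"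
    and "measure lborel {x. \<bar>u x\<bar> > \<tau>} \<le> measure lborel \<Omega>"
proof -
  have [measurable]: "u \<in> borel_measurable borel" using u by (rule X_borel)
  have sub: "{x. \<bar>u x\<bar> > \<tau>} \<subseteq> \<Omega>" using X_zero[OF u] assms by force
  have fin: "emeasure lborel \<Omega> < \<infinity>" using emeasure_bounded_finite[OF \<Omega>(2)] .
  then have "emeasure lborel {x. \<bar>u x\<bar> > \<tau>} < \<infinity>"
    using emeasure_mono[OF sub, of lborel] by (auto simp: le_less_trans)
  then show "emeasure lborel {x. \<bar>u x\<bar> > \<tau>} = ennreal (measure lborel {x. \<bar>u x\<bar> > \<tau>})"
    by (intro emeasure_eq_ennreal_measure) auto
  show "measure lborel {x. \<bar>u x\<bar> > \<tau>} \<le> measure lborel \<Omega>"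
    by (rule measure_mono_fmeasurable[OF sub]) (use fin in \<open>auto simp: fmeasurable_def\<close>)
qed

text \<open>For \<open>x\<close> above height \<open>2 ^ Suc k\<close> and \<open>y\<close> below
  height \<open>2 ^ k\<close>, \<open>kernel_lower\<close> bounds the inner integral, with
  \<open>a k\<close> as the volume of the removed set. The level integrals overlap, but
  \<open>dyadic_levels_le\<close> bounds their sum by \<open>2 * A u\<close>.\<close>

lemma level_sum:
  assumes u: "u \<in> X"
  defines "a \<equiv> \<lambda>k::nat. measure lborel {x. \<bar>u x\<bar> > 2 ^ k}"
  shows "(\<Sum>k<N. a (Suc k) * (ballvol / 2 * G (2 ^ k * (ballvol / (2 * a k)) powr (s / CARD('n))))) \<le> 2 * A u"
proof -
  let ?n = "CARD('n)"
  have [measurable]: "u \<in> borel_measurable borel" using u by (rule X_borel)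
  define h where "h k = (\<lambda>(x :: real^'n, y). if \<bar>u x\<bar> > 2 ^ Suc k \<and> \<bar>u y\<bar> \<le> 2 ^ k
     then G (2 ^ k / norm (x - y) powr s) else 0)" for k
  have [measurable]: "h k \<in> borel_measurable borel" for k
    unfolding h_def split_beta by measurable
  have hn: "h k q \<ge> 0" for k q by (auto simp: h_def G_nonneg split: prod.split)
  have a0: "a k \<ge> 0" for k by (simp add: a_def)
  define S where "S k = a (Suc k) * (ballvol / 2 * G (2 ^ k * (ballvol / (2 * a k)) powr (s / ?n)))" for k
  have S0: "S k \<ge> 0" for k using a0 ballvol_pos G_nonneg by (simp add: S_def)
  have one: "ennreal (S k) \<le> (\<integral>\<^sup>+q. ennreal (h k q) \<partial>mub)" for k
  \<comment> \<open>For a null level set the quotient by \<open>a k\<close> is 0, so the summand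
    reduces to \<open>G 0 = 0\<close>.\<close>
  proof (cases "a k = 0")
    case True
    then show ?thesis by (simp add: S_def G_0)
  next
    case False
    define T where "T = {x. \<bar>u x\<bar> > 2 ^ k}"
    define U where "U = {x. \<bar>u x\<bar> > 2 ^ Suc k}"
    have [measurable]: "T \<in> sets borel" "U \<in> sets borel" unfolding T_def U_def by measurable
    have T: "emeasure lborel T = ennreal (a k)" "a k > 0"
      using level_finite(1)[OF u, of "2 ^ k"] False a0[of k]
      unfolding T_def[symmetric] a_def by (auto simp: zero_less_measure_iff)
    have U: "emeasure lborel U = ennreal (a (Suc k))"
      using level_finite(1)[OF u, of "2 ^ Suc k"] unfolding U_def a_def by simp
    define c where "c = ballvol / 2 * G (2 ^ k * (ballvol / (2 * a k)) powr (s / ?n))"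
    have c0: "c \<ge> 0" using ballvol_pos G_nonneg by (simp add: c_def)
    have "ennreal (S k) = ennreal c * emeasure lborel U"
      using a0 c0 unfolding S_def c_def[symmetric] U by (simp add: ennreal_mult[symmetric] mult.commute)
    also have "\<dots> = (\<integral>\<^sup>+x. ennreal c * indicator U x \<partial>lborel)"
      by (simp add: nn_integral_cmult)
    also have "\<dots> \<le> (\<integral>\<^sup>+x. \<integral>\<^sup>+y. ennreal (1 / norm (x - y) ^ ?n) * ennreal (h k (x, y)) \<partial>lborel \<partial>lborel)"
    proof (rule nn_integral_mono)
      fix x
      show "ennreal c * indicator U x \<le>
        (\<integral>\<^sup>+y. ennreal (1 / norm (x - y) ^ ?n) * ennreal (h k (x, y)) \<partial>lborel)"
      proof (cases "x \<in> U")
        case True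
        have "ennreal c \<le> (\<integral>\<^sup>+y. ennreal (1 / norm (x - y) ^ ?n) *
            (ennreal (G (2 ^ k / norm (x - y) powr s)) * indicator (- T) y) \<partial>lborel)"
          unfolding c_def by (rule kernel_lower) (use T in auto)
        also have "\<dots> \<le> (\<integral>\<^sup>+y. ennreal (1 / norm (x - y) ^ ?n) * ennreal (h k (x, y)) \<partial>lborel)"
          using True by (intro nn_integral_mono mult_left_mono)
            (auto simp: h_def T_def U_def split: split_indicator)
        finally show ?thesis using True by simp
      qed simp
    qed
    also have "\<dots> = (\<integral>\<^sup>+q. ennreal (h k q) \<partial>mub)"
      by (subst nn_integral_mub) simp_all
    finally show ?thesis .
  qed
  have "ennreal (\<Sum>k<N. S k) = (\<Sum>k<N. ennreal (S k))"
    by (rule sum_ennreal[symmetric]) (rule S0)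
  also have "\<dots> \<le> (\<Sum>k<N. \<integral>\<^sup>+q. ennreal (h k q) \<partial>mub)" by (intro sum_mono one)
  also have "\<dots> = (\<integral>\<^sup>+q. (\<Sum>k<N. ennreal (h k q)) \<partial>mub)" by (rule nn_integral_sum[symmetric]) simp
  also have "\<dots> \<le> (\<integral>\<^sup>+q. ennreal 2 * ennreal (G (D u q)) \<partial>mub)"
  proof (rule nn_integral_mono)
    fix q :: "(real^'n) \<times> (real^'n)"
    obtain x y where q: "q = (x, y)" by fastforce
    have "(\<Sum>k<N. h k q) \<le> 2 * G (D u q)"
      using dyadic_levels_le[of "norm (x - y) powr s" "u x" "u y" N]
      by (simp add: q h_def hoelder_quotient_def)
    then show "(\<Sum>k<N. ennreal (h k q)) \<le> ennreal 2 * ennreal (G (D u q))"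
      using hn by (simp add: ennreal_mult[symmetric] G_nonneg sum_ennreal ennreal_leI del: ennreal_numeral)
  qed
  also have "\<dots> = ennreal 2 * ennreal (A u)"
    by (subst nn_integral_cmult) (simp_all add: nn_integral_A[OF u])
  also have "\<dots> = ennreal (2 * A u)" by (simp add: ennreal_mult A_nonneg)
  finally show ?thesis using A_nonneg[of u] by (simp add: S_def)
qed

text \<open>
  With \<open>a\<^sub>k = \<bar>{\<bar>u\<bar> > 2\<^sup>k}\<bar>\<close>, \<open>t\<^sub>k\<close> the argument of \<open>G\<close> in \<open>level_sum\<close> and \<open>S\<^sub>k\<close> its summands:
  either \<open>a\<^sub>k G(t\<^sub>k)\<close> is large, and then \<open>a\<^sub>k\<^sub>+\<^sub>1\<close> is a small fraction of \<open>a\<^sub>k\<close>, or it is bounded, and then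
  subcriticality gives \<open>B(2\<^sup>k\<^sup>+\<^sup>1) \<le> \<epsilon> G(t\<^sub>k)\<close>.
\<close>

lemma level_recursion:
  assumes R: "R > 0" and \<eta>: "\<eta> > 0"
  shows "\<exists>k0. \<forall>u\<in>X. A u \<le> R \<longrightarrow> (\<exists>S. (\<forall>k. S k \<ge> 0) \<and> (\<forall>N. (\<Sum>k<N. S k) \<le> 2 * R) \<and>
    (\<forall>k\<ge>k0. B (2 ^ Suc k) * measure lborel {x. \<bar>u x\<bar> > 2 ^ Suc k} \<le>
       B (2 ^ k) * measure lborel {x. \<bar>u x\<bar> > 2 ^ k} / 2 + \<eta> * S k))"
proof -
  define e where "e = s / real CARD('n)"
  have e: "e > 0" using s by (simp add: e_def)
  \<comment> \<open>Chosen for the case \<open>a k * G (t k) > K\<close>: there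
    \<open>S k \<le> 2 * R\<close> gives \<open>a (Suc k) * (2 * Q) \<le> a k\<close>. The factor
    \<open>Q\<close> absorbs the doubling of \<open>B\<close>, and the 2 leaves the half.\<close>
  define K where "K = 8 * R * Q / ballvol"
  have K: "K > 0" using R Q ballvol_pos by (simp add: K_def)
  define c0 where "c0 = (ballvol / 2) powr e"
  have c0: "c0 > 0" using ballvol_pos by (simp add: c0_def)
  \<comment> \<open>In \<open>t k * (K / a k) powr (- e)\<close> the powers of \<open>a k\<close>
    cancel and \<open>2 ^ k * (c0 * K powr (- e))\<close> remains; multiplication by
    \<open>c\<close> makes it \<open>2 ^ Suc k\<close>.\<close>
  define c where "c = 2 / (c0 * K powr (- e))"
  have c: "c > 0" using c0 K by (simp add: c_def)
  have "\<eta> * ballvol / 2 > 0" using \<eta> ballvol_pos by simp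
  from B_subcritical[OF c this] obtain y0 where
    y0: "\<And>t y. t > 0 \<Longrightarrow> y \<ge> y0 \<Longrightarrow> y \<le> c * (t * G t powr (- e)) \<Longrightarrow> B y \<le> \<eta> * ballvol / 2 * G t"
    unfolding e_def by blast
  obtain k0 :: nat where k0: "2 ^ k0 > y0" using real_arch_pow[of 2 y0] by auto
  show ?thesis
  proof (intro exI[of _ k0] ballI impI)
    fix u assume u: "u \<in> X" and Au: "A u \<le> R"
    define a where "a k = measure lborel {x. \<bar>u x\<bar> > 2 ^ k}" for k :: nat
    have [measurable]: "u \<in> borel_measurable borel" using u by (rule X_borel)
    have a0: "a k \<ge> 0" for k by (simp add: a_def)
    have adec: "a (Suc k) \<le> a k" for k
    proof -
      have "emeasure lborel {x. \<bar>u x\<bar> > 2 ^ Suc k} \<le> emeasure lborel {x. \<bar>u x\<bar> > 2 ^ k}"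
      proof (rule emeasure_mono)
        have "(2::real) ^ k \<le> 2 ^ Suc k" by simp
        then show "{x. 2 ^ Suc k < \<bar>u x\<bar>} \<subseteq> {x. 2 ^ k < \<bar>u x\<bar>}" by force
      qed measurable
      then show ?thesis
        using level_finite(1)[OF u, of "2 ^ k"] level_finite(1)[OF u, of "2 ^ Suc k"]
        by (simp add: a_def)
    qed
    define t where "t k = 2 ^ k * (ballvol / (2 * a k)) powr e" for k
    define S where "S k = a (Suc k) * (ballvol / 2 * G (t k))" for k
    have S0: "S k \<ge> 0" for k using a0 ballvol_pos G_nonneg by (simp add: S_def)
    have Ssum: "(\<Sum>k<N. S k) \<le> 2 * R" for N
      using level_sum[OF u, of N] Au by (simp add: S_def t_def a_def e_def)
    have SR: "S k \<le> 2 * R" for k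
      using Ssum[of "Suc k"] sum_nonneg[of "{..<k}" S] S0 by simp
    have "B (2 ^ Suc k) * a (Suc k) \<le> B (2 ^ k) * a k / 2 + \<eta> * S k" if k: "k \<ge> k0" for k
    proof (cases "a k = 0")
      case True
      then show ?thesis using adec[of k] a0[of "Suc k"] S0[of k] \<eta> by simp
    next
      case False
      then have ak: "a k > 0" using a0[of k] by simp
      have tk: "t k > 0" using ak ballvol_pos by (simp add: t_def)
      have Gt: "G (t k) > 0" using tk by (simp add: G_pos)
      have Bk: "B (2 ^ k) * a k \<ge> 0" using B_nonneg ak by simp
      show ?thesis
      proof (cases "a k * G (t k) \<le> K")
        case True
        have "2 ^ Suc k \<le> c * (t k * G (t k) powr (- e))"
        proof -
          have "(K / a k) powr (- e) \<le> G (t k) powr (- e)"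
            using True ak Gt e by (intro powr_mono2') (auto simp: field_simps)
          then have "t k * (K / a k) powr (- e) \<le> t k * G (t k) powr (- e)"
            using tk by simp
          moreover have "t k * (K / a k) powr (- e) = 2 ^ k * (c0 * K powr (- e))"
            using ak K ballvol_pos
            by (simp add: t_def c0_def powr_divide powr_mult powr_minus field_simps)
          ultimately have "c * (2 ^ k * (c0 * K powr (- e))) \<le> c * (t k * G (t k) powr (- e))"
            using c by (intro mult_left_mono) auto
          moreover have "c * (2 ^ k * (c0 * K powr (- e))) = 2 ^ Suc k"
            using c0 K by (simp add: c_def)
          ultimately show ?thesis by simp
        qed
        moreover have "(2::real) ^ k0 \<le> 2 ^ Suc k" using k by (intro power_increasing) auto
        ultimately have "B (2 ^ Suc k) \<le> \<eta> * ballvol / 2 * G (t k)"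
          using y0[OF tk, of "2 ^ Suc k"] k0 by simp
        then have "B (2 ^ Suc k) * a (Suc k) \<le> \<eta> * ballvol / 2 * G (t k) * a (Suc k)"
          by (rule mult_right_mono) (rule a0)
        then show ?thesis using Bk by (simp add: S_def ac_simps)
      next
        case False
        have "a (Suc k) * (ballvol / 2) * K \<le> a (Suc k) * (ballvol / 2) * (a k * G (t k))"
          using False a0 ballvol_pos by (intro mult_left_mono) auto
        also have "\<dots> = a k * S k" by (simp add: S_def)
        also have "\<dots> \<le> a k * (2 * R)" using SR ak by simp
        finally have "a (Suc k) * (2 * Q) * (2 * R) \<le> a k * (2 * R)"
          using ballvol_pos by (simp add: K_def field_simps)
        then have "a (Suc k) * (2 * Q) \<le> a k"
          by (rule mult_right_le_imp_le) (use R in simp)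
        have "B (2 ^ Suc k) * a (Suc k) \<le> Q * B (2 ^ k) * a (Suc k)"
          using B_double[of "2 ^ k"] a0 by (intro mult_right_mono) auto
        also have "\<dots> = B (2 ^ k) * (a (Suc k) * (2 * Q)) / 2" by simp
        also have "\<dots> \<le> B (2 ^ k) * a k / 2"
          by (rule divide_right_mono[OF mult_left_mono[OF \<open>a (Suc k) * (2 * Q) \<le> a k\<close> B_nonneg]]) simp
        finally show ?thesis using S0[of k] \<eta> by (simp add: add_increasing2)
      qed
    qed
    then show "\<exists>S. (\<forall>k. S k \<ge> 0) \<and> (\<forall>N. (\<Sum>k<N. S k) \<le> 2 * R) \<and>
      (\<forall>k\<ge>k0. B (2 ^ Suc k) * measure lborel {x. \<bar>u x\<bar> > 2 ^ Suc k} \<le>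
       B (2 ^ k) * measure lborel {x. \<bar>u x\<bar> > 2 ^ k} / 2 + \<eta> * S k)"
      using S0 Ssum by (auto simp: a_def)
  qed
qed

lemma layer_bound:
  fixes u :: "real^'n \<Rightarrow> real"
  assumes [measurable]: "u \<in> borel_measurable borel"
  shows "(\<integral>\<^sup>+x. ennreal (B (u x)) * indicator {x. \<bar>u x\<bar> > 2 ^ m} x \<partial>lborel) \<le>
    (\<Sum>i. ennreal (B (2 ^ Suc (m + i))) * emeasure lborel {x. \<bar>u x\<bar> > 2 ^ (m + i)})"
proof -
  have "(\<integral>\<^sup>+x. ennreal (B (u x)) * indicator {x. \<bar>u x\<bar> > 2 ^ m} x \<partial>lborel) \<le>
    (\<integral>\<^sup>+x. (\<Sum>i. ennreal (B (2 ^ Suc (m + i))) * indicator {x. \<bar>u x\<bar> > 2 ^ (m + i)} x) \<partial>lborel)"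
  proof (rule nn_integral_mono)
    fix x
    show "ennreal (B (u x)) * indicator {x. \<bar>u x\<bar> > 2 ^ m} x \<le>
      (\<Sum>i. ennreal (B (2 ^ Suc (m + i))) * indicator {x. \<bar>u x\<bar> > 2 ^ (m + i)} x)"
    proof (cases "\<bar>u x\<bar> > 2 ^ m")
      case True
      define j where "j = (LEAST j. \<bar>u x\<bar> \<le> 2 ^ (m + j))"
      obtain j' :: nat where "\<bar>u x\<bar> < 2 ^ j'" using real_arch_pow[of 2 "\<bar>u x\<bar>"] by auto
      then have "\<bar>u x\<bar> \<le> 2 ^ (m + j')"
        by (intro order_trans[OF less_imp_le power_increasing]) auto
      then have j: "\<bar>u x\<bar> \<le> 2 ^ (m + j)" unfolding j_def by (rule LeastI)
      then obtain i where i: "j = Suc i" using True by (cases j) auto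
      have "\<not> \<bar>u x\<bar> \<le> 2 ^ (m + i)" 
        using not_less_Least[of i "\<lambda>j. \<bar>u x\<bar> \<le> 2 ^ (m + j)"] i unfolding j_def by auto
      then have *: "ennreal (B (u x)) \<le> ennreal (B (2 ^ Suc (m + i))) * indicator {x. \<bar>u x\<bar> > 2 ^ (m + i)} x"
        using j i B_mono_abs[of "u x" "2 ^ Suc (m + i)"] by (auto intro!: ennreal_leI)
      also have "\<dots> \<le> (\<Sum>i. ennreal (B (2 ^ Suc (m + i))) * indicator {x. \<bar>u x\<bar> > 2 ^ (m + i)} x)"
        using sum_le_suminf[OF summableI, of "{i}"] by simp
      finally show ?thesis using True by simp
    qed simp
  qed
  also have "\<dots> = (\<Sum>i. ennreal (B (2 ^ Suc (m + i))) * emeasure lborel {x. \<bar>u x\<bar> > 2 ^ (m + i)})"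
    by (subst nn_integral_suminf) (auto simp: nn_integral_cmult)
  finally show ?thesis .
qed

text \<open>The recursion halves the level terms up to errors of total size at most
  \<open>2 * R * \<eta>\<close>. Starting from a crude bound by the volume of
  \<open>\<Omega>\<close>, \<open>j\<close> halvings make a level term small, and from there on the
  whole series of level terms is small, uniformly in \<open>u\<close>.\<close>

lemma uniform_tail:
  assumes R: "R > 0" and \<epsilon>: "\<epsilon> > 0"
  shows "\<exists>T>0. \<forall>u\<in>X. A u \<le> R \<longrightarrow>
    (\<integral>\<^sup>+x. ennreal (B (u x)) * indicator {x. \<bar>u x\<bar> > T} x \<partial>lborel) \<le> ennreal \<epsilon>"
proof -
  define V where "V = measure lborel \<Omega>"
  \<comment> \<open>The budget
    \<open>2 * (\<epsilon> / (4 * Q) + 2 * \<eta> * R) + 4 * \<eta> * R\<close> equals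
    \<open>\<epsilon> / Q\<close>; doubling in the layer bound returns the factor
    \<open>Q\<close>.\<close>
  define \<eta> where "\<eta> = \<epsilon> / (16 * R * Q)"
  have \<eta>: "\<eta> > 0" using \<epsilon> R Q by (simp add: \<eta>_def)
  from level_recursion[OF R \<eta>] obtain k0 where k0: "\<And>u. u \<in> X \<Longrightarrow> A u \<le> R \<Longrightarrow>
    (\<exists>S. (\<forall>k. S k \<ge> 0) \<and> (\<forall>N. (\<Sum>k<N. S k) \<le> 2 * R) \<and>
    (\<forall>k\<ge>k0. B (2 ^ Suc k) * measure lborel {x. \<bar>u x\<bar> > 2 ^ Suc k} \<le>
       B (2 ^ k) * measure lborel {x. \<bar>u x\<bar> > 2 ^ k} / 2 + \<eta> * S k))" by blast
  obtain j :: nat where j: "2 ^ j > 4 * Q * V * B (2 ^ k0) / \<epsilon>"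
    using real_arch_pow[of 2 "4 * Q * V * B (2 ^ k0) / \<epsilon>"] by auto
  define m where "m = k0 + j"
  show ?thesis
  proof (intro exI[of _ "2 ^ m"] conjI ballI impI)
    fix u assume u: "u \<in> X" and Au: "A u \<le> R"
    define a where "a k = measure lborel {x. \<bar>u x\<bar> > 2 ^ k}" for k :: nat
    define \<rho> where "\<rho> k = B (2 ^ k) * a k" for k :: nat
    have [measurable]: "u \<in> borel_measurable borel" using u by (rule X_borel)
    have a0: "a k \<ge> 0" for k by (simp add: a_def)
    have \<rho>0: "\<rho> k \<ge> 0" for k by (simp add: \<rho>_def a0 B_nonneg)
    obtain S where S: "\<And>k. S k \<ge> 0" "\<And>N. (\<Sum>k<N. S k) \<le> 2 * R"
      and rec: "\<And>k. k \<ge> k0 \<Longrightarrow> \<rho> (Suc k) \<le> \<rho> k / 2 + \<eta> * S k"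
      using k0[OF u Au] unfolding \<rho>_def a_def by blast
    have Ssh: "(\<Sum>i<N. S (k + i)) \<le> 2 * R" for k N
    proof -
      have "(\<Sum>i<N. S (k + i)) = (\<Sum>i\<in>{k..<k + N}. S i)"
        by (rule sum.reindex_bij_witness[of _ "\<lambda>i. i - k" "\<lambda>i. k + i"]) auto
      also have "\<dots> \<le> (\<Sum>i<k + N. S i)" by (rule sum_mono2) (auto simp: S)
      finally show ?thesis using S(2)[of "k + N"] by simp
    qed
    have dec: "\<rho> (k0 + i) \<le> \<rho> k0 / 2 ^ i + \<eta> * (\<Sum>l<i. S (k0 + l))" for i
    proof (induction i)
      case (Suc i)
      have "\<rho> (k0 + Suc i) \<le> \<rho> (k0 + i) / 2 + \<eta> * S (k0 + i)" using rec[of "k0 + i"] by simp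
      also have "\<dots> \<le> (\<rho> k0 / 2 ^ i + \<eta> * (\<Sum>l<i. S (k0 + l))) / 2 + \<eta> * S (k0 + i)"
        using Suc by simp
      also have "\<dots> \<le> \<rho> k0 / 2 ^ Suc i + \<eta> * (\<Sum>l<Suc i. S (k0 + l))"
        using \<eta> sum_nonneg[of "{..<i}" "\<lambda>l. S (k0 + l)"] S(1) by (simp add: field_simps)
      finally show ?case .
    qed simp
    have "\<rho> k0 \<le> V * B (2 ^ k0)"
      using level_finite(2)[OF u, of "2 ^ k0"] B_nonneg[of "2 ^ k0"]
      unfolding \<rho>_def a_def V_def mult.commute[of "B (2 ^ k0)"] 
      by (auto intro: mult_right_mono)
    then have "\<rho> k0 / 2 ^ j \<le> V * B (2 ^ k0) / 2 ^ j" by (simp add: divide_right_mono)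
    also have "V * B (2 ^ k0) / 2 ^ j \<le> \<epsilon> / (4 * Q)"
      using j \<epsilon> Q by (simp add: field_simps)
    finally have \<rho>m: "\<rho> m \<le> \<epsilon> / (4 * Q) + 2 * \<eta> * R"
      using dec[of j] mult_left_mono[OF Ssh[of k0 j], of \<eta>] \<eta> unfolding m_def by linarith
    \<comment> \<open>One half of \<open>2 * \<rho> (m + N)\<close> pays for the new summand, the
      other half bounds \<open>2 * \<rho> (m + Suc N)\<close> up to the error
      \<open>2 * \<eta> * S (m + N)\<close>.\<close>
    have pot: "(\<Sum>i<N. \<rho> (m + i)) + 2 * \<rho> (m + N) \<le> 2 * \<rho> m + 2 * \<eta> * (\<Sum>i<N. S (m + i))" for N
    proof (induction N)
      case (Suc N)
      have "\<rho> (m + Suc N) \<le> \<rho> (m + N) / 2 + \<eta> * S (m + N)"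
        using rec[of "m + N"] by (simp add: m_def)
      then show ?case using Suc by (simp add: algebra_simps)
    qed simp
    have tot: "(\<Sum>i<N. \<rho> (m + i)) \<le> \<epsilon> / Q" for N
    proof -
      have "(\<Sum>i<N. \<rho> (m + i)) \<le> 2 * \<rho> m + 2 * \<eta> * (\<Sum>i<N. S (m + i))"
        using pot[of N] \<rho>0[of "m + N"] by simp
      also have "\<dots> \<le> 2 * (\<epsilon> / (4 * Q) + 2 * \<eta> * R) + 2 * \<eta> * (2 * R)"
        using \<rho>m Ssh[of m N] \<eta> by (intro add_mono mult_left_mono) auto
      also have "\<dots> = \<epsilon> / Q" using R Q by (simp add: \<eta>_def field_simps)
      finally show ?thesis .
    qed
    have "(\<integral>\<^sup>+x. ennreal (B (u x)) * indicator {x. \<bar>u x\<bar> > 2 ^ m} x \<partial>lborel) \<le>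
      (\<Sum>i. ennreal (B (2 ^ Suc (m + i))) * emeasure lborel {x. \<bar>u x\<bar> > 2 ^ (m + i)})"
      by (rule layer_bound) simp
    also have "\<dots> \<le> ennreal \<epsilon>"
    proof (rule suminf_le_const[OF summableI])
      fix N
      have "(\<Sum>i<N. ennreal (B (2 ^ Suc (m + i))) * emeasure lborel {x. \<bar>u x\<bar> > 2 ^ (m + i)})
         = (\<Sum>i<N. ennreal (B (2 ^ Suc (m + i)) * a (m + i)))"
        by (intro sum.cong refl)
          (simp add: level_finite(1)[OF u] a_def ennreal_mult B_nonneg)
      also have "\<dots> = ennreal (\<Sum>i<N. B (2 ^ Suc (m + i)) * a (m + i))"
        by (rule sum_ennreal) (simp add: B_nonneg a0)
      also have "\<dots> \<le> ennreal (\<Sum>i<N. Q * \<rho> (m + i))"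
        using B_double a0 by (intro ennreal_leI sum_mono) (simp add: \<rho>_def mult.assoc[symmetric] mult_right_mono)
      also have "\<dots> \<le> ennreal (Q * (\<epsilon> / Q))"
        using tot[of N] Q
          unfolding sum_distrib_left[symmetric] by (intro ennreal_leI mult_left_mono) auto
      also have "Q * (\<epsilon> / Q) = \<epsilon>" using Q by simp
      finally show "(\<Sum>i<N. ennreal (B (2 ^ Suc (m + i))) * emeasure lborel {x. \<bar>u x\<bar> > 2 ^ (m + i)}) \<le> ennreal \<epsilon>" .
    qed
    finally show "(\<integral>\<^sup>+x. ennreal (B (u x)) * indicator {x. \<bar>u x\<bar> > 2 ^ m} x \<partial>lborel) \<le> ennreal \<epsilon>" .
  qed simp
qed

end

section \<open>Closure properties and compactness\<close>

context frac_orlicz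
begin

lemma D_measurable_mub [measurable]: "u \<in> borel_measurable borel \<Longrightarrow> D u \<in> borel_measurable mub"
  using hoelder_quotient_measurable by (simp cong: measurable_cong_sets)

lemma D_lin: "D (\<lambda>x. a * u x + b * v x) q = a * D u q + b * D v q"
  by (simp add: hoelder_quotient_def split_beta diff_divide_distrib add_divide_distrib algebra_simps)

lemma D_scale: "D (\<lambda>x. a * u x) q = a * D u q"
  using D_lin[of a u 0 "\<lambda>_. 0"] by simp

lemma G_scale_max: "G (l * t) \<le> max 1 \<bar>l\<bar> powr p * G t"
proof -
  have "G (l * t) \<le> G (max 1 \<bar>l\<bar> * \<bar>t\<bar>)"
    by (rule G_mono_abs) (auto simp: abs_mult intro: mult_right_mono)
  also have "\<dots> \<le> max 1 \<bar>l\<bar> powr p * G \<bar>t\<bar>" by (rule G_scale) auto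
  finally show ?thesis by (simp add: G_abs)
qed

lemma G_add: "G (a + b) \<le> 2 powr p * (G a + G b)"
proof -
  have "G (a + b) \<le> G (2 * max \<bar>a\<bar> \<bar>b\<bar>)" by (rule G_mono_abs) auto
  also have "\<dots> \<le> 2 powr p * G (max \<bar>a\<bar> \<bar>b\<bar>)" by (rule G_scale) auto
  also have "\<dots> \<le> 2 powr p * (G a + G b)"
    using G_nonneg[of a] G_nonneg[of b] by (intro mult_left_mono) (auto simp: max_def G_abs)
  finally show ?thesis .
qed

lemma B_add: "B (a + b) \<le> Q * (B a + B b)"
proof -
  have "B (a + b) \<le> B (2 * max \<bar>a\<bar> \<bar>b\<bar>)" by (rule B_mono_abs) auto
  also have "\<dots> \<le> Q * B (max \<bar>a\<bar> \<bar>b\<bar>)" by (rule B_double) auto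
  also have "\<dots> \<le> Q * (B a + B b)"
    using B_nonneg[of a] B_nonneg[of b] Q by (intro mult_left_mono) (auto simp: max_def B_abs)
  finally show ?thesis .
qed

lemma X_I:
  assumes "v \<in> borel_measurable borel" "\<And>x. x \<notin> \<Omega> \<Longrightarrow> v x = 0"
    and h: "integrable mub h" and le: "\<And>q. G (D v q) \<le> h q"
  shows "v \<in> X"
proof -
  note [measurable] = assms(1)
  have "integrable mub (\<lambda>q. G (D v q))"
    by (rule Bochner_Integration.integrable_bound[OF h])
      (use le order_trans[OF G_nonneg le] in \<open>auto simp: G_nonneg\<close>)
  then show ?thesis using assms by (simp add: X_def)
qed

lemma X_contract:
  assumes "u \<in> X" "v \<in> borel_measurable borel" "\<And>x. x \<notin> \<Omega> \<Longrightarrow> v x = 0"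
    and "\<And>q. \<bar>D v q\<bar> \<le> \<bar>l * D u q\<bar>"
  shows "v \<in> X" and "A v \<le> max 1 \<bar>l\<bar> powr p * A u"
proof -
  have le: "G (D v q) \<le> max 1 \<bar>l\<bar> powr p * G (D u q)" for q
    using G_mono_abs[OF assms(4)] G_scale_max order_trans by blast
  have int: "integrable mub (\<lambda>q. max 1 \<bar>l\<bar> powr p * G (D u q))" using X_integrable[OF assms(1)] by simp
  show v: "v \<in> X" by (rule X_I[OF assms(2,3) int le])
  have "A v \<le> (\<integral>q. max 1 \<bar>l\<bar> powr p * G (D u q) \<partial>mub)"
    unfolding A_def by (rule integral_mono[OF X_integrable[OF v] int le])
  then show "A v \<le> max 1 \<bar>l\<bar> powr p * A u" by (simp add: A_def)
qed

lemma X_scale: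
  assumes "u \<in> X" shows "(\<lambda>x. l * u x) \<in> X" "A (\<lambda>x. l * u x) \<le> max 1 \<bar>l\<bar> powr p * A u"
proof -
  note [measurable] = X_borel[OF assms]
  show "(\<lambda>x. l * u x) \<in> X" "A (\<lambda>x. l * u x) \<le> max 1 \<bar>l\<bar> powr p * A u"
    using X_contract[OF assms, of "\<lambda>x. l * u x" l] X_zero[OF assms] by (auto simp: D_scale)
qed

lemma integrable_G_sum:
  assumes "u \<in> X" "v \<in> X"
  shows "integrable mub (\<lambda>q. G (a * \<bar>D u q\<bar> + b * \<bar>D v q\<bar>))"
proof -
  note [measurable] = X_borel[OF assms(1)] X_borel[OF assms(2)]
  let ?h = "\<lambda>q. 2 powr p * (max 1 \<bar>a\<bar> powr p * G (D u q) + max 1 \<bar>b\<bar> powr p * G (D v q))"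
  have h: "integrable mub ?h" using X_integrable[OF assms(1)] X_integrable[OF assms(2)] by simp
  have "G (a * \<bar>D u q\<bar> + b * \<bar>D v q\<bar>) \<le> ?h q" for q
    using G_add[of "a * \<bar>D u q\<bar>" "b * \<bar>D v q\<bar>"] G_scale_max[of a "\<bar>D u q\<bar>"] G_scale_max[of b "\<bar>D v q\<bar>"]
    by (intro order_trans[OF G_add] mult_left_mono add_mono) (auto simp: G_abs)
  then have "AE q in mub. norm (G (a * \<bar>D u q\<bar> + b * \<bar>D v q\<bar>)) \<le> norm (?h q)"
    using order_trans[OF G_nonneg] by (auto simp: G_nonneg)
  then show ?thesis by (rule Bochner_Integration.integrable_bound[OF h, rotated]) measurable
qed

lemma X_lin:
  assumes "u \<in> X" "v \<in> X" shows "(\<lambda>x. a * u x + b * v x) \<in> X"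
proof -
  note [measurable] = X_borel[OF assms(1)] X_borel[OF assms(2)]
  show ?thesis
  proof (rule X_I[OF _ _ integrable_G_sum[OF assms, of "\<bar>a\<bar>" "\<bar>b\<bar>"]])
    fix q show "G (D (\<lambda>x. a * u x + b * v x) q) \<le> G (\<bar>a\<bar> * \<bar>D u q\<bar> + \<bar>b\<bar> * \<bar>D v q\<bar>)"
      by (rule G_mono_abs) (auto simp: D_lin abs_mult[symmetric])
  qed (use X_zero[OF assms(1)] X_zero[OF assms(2)] in auto)
qed

lemma A_diff:
  assumes "u \<in> X" "v \<in> X" shows "A (\<lambda>x. u x - v x) \<le> 2 powr p * (A u + A v)"
proof -
  have D: "D (\<lambda>x. u x - v x) q = D u q - D v q" for q
    using D_lin[of 1 u "-1" v] by simp
  have "A (\<lambda>x. u x - v x) \<le> (\<integral>q. 2 powr p * (G (D u q) + G (D v q)) \<partial>mub)"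
    unfolding A_def
  proof (rule integral_mono)
    show "integrable mub (\<lambda>q. G (D (\<lambda>x. u x - v x) q))"
      using X_integrable[OF X_lin[OF assms, of 1 "-1"]] by simp
    fix q show "G (D (\<lambda>x. u x - v x) q) \<le> 2 powr p * (G (D u q) + G (D v q))"
      using G_add[of "D u q" "- D v q"] by (simp add: D G_even)
  qed (use X_integrable assms in auto)
  then show ?thesis using X_integrable assms by (simp add: A_def)
qed

section \<open>The volume of \<Omega> and the modular of \<open>B\<close>\<close>

definition V where "V = measure lborel \<Omega>"

lemma emeasure_\<Omega>: "emeasure lborel \<Omega> = ennreal V"
  unfolding V_def using emeasure_bounded_finite[OF \<Omega>(2)]
  by (intro emeasure_eq_ennreal_measure) auto

lemma V_nonneg: "V \<ge> 0" by (simp add: V_def)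

definition \<rho> :: "(real^'n \<Rightarrow> real) \<Rightarrow> real" where "\<rho> u = (\<integral>x. B (u x) \<partial>lebesgue)"

lemma \<rho>_nonneg: "\<rho> u \<ge> 0"
  unfolding \<rho>_def by (intro integral_nonneg_AE AE_I2 B_nonneg)

lemma X_lebesgue: "u \<in> X \<Longrightarrow> u \<in> borel_measurable lebesgue"
  by (intro measurable_completion) (auto dest: X_borel)

lemma nn_B_bound:
  assumes R: "R > 0"
  shows "\<exists>C>0. \<forall>u\<in>X. A u \<le> R \<longrightarrow> (\<integral>\<^sup>+x. ennreal (B (u x)) \<partial>lebesgue) \<le> ennreal C"
proof -
  obtain T where T: "T > 0" "\<And>u. u \<in> X \<Longrightarrow> A u \<le> R \<Longrightarrow>
    (\<integral>\<^sup>+x. ennreal (B (u x)) * indicator {x. \<bar>u x\<bar> > T} x \<partial>lborel) \<le> ennreal 1"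
    using uniform_tail[OF R, of 1] by auto
  show ?thesis
  proof (intro exI[of _ "B T * V + 1"] conjI ballI impI)
    fix u assume u: "u \<in> X" "A u \<le> R"
    note [measurable] = X_borel[OF u(1)]
    have "(\<integral>\<^sup>+x. ennreal (B (u x)) \<partial>lebesgue) = (\<integral>\<^sup>+x. ennreal (B (u x)) \<partial>lborel)"
      by (rule nn_integral_completion)
    also have "\<dots> \<le> (\<integral>\<^sup>+x. ennreal (B T) * indicator \<Omega> x +
        ennreal (B (u x)) * indicator {x. \<bar>u x\<bar> > T} x \<partial>lborel)"
    proof (rule nn_integral_mono)
      fix x show "ennreal (B (u x)) \<le> ennreal (B T) * indicator \<Omega> x +
        ennreal (B (u x)) * indicator {x. \<bar>u x\<bar> > T} x"
        using X_zero[OF u(1), of x] B_mono_abs[of "u x" T] T(1) B_0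
        by (cases "x \<in> \<Omega>"; cases "\<bar>u x\<bar> > T") (auto intro: ennreal_leI)
    qed
    also have "\<dots> = ennreal (B T) * emeasure lborel \<Omega> +
      (\<integral>\<^sup>+x. ennreal (B (u x)) * indicator {x. \<bar>u x\<bar> > T} x \<partial>lborel)"
      by (subst nn_integral_add) (auto simp: nn_integral_cmult)
    also have "\<dots> \<le> ennreal (B T) * ennreal V + ennreal 1"
      unfolding emeasure_\<Omega> by (intro add_left_mono T u)
    also have "\<dots> = ennreal (B T * V + 1)"
      using B_nonneg V_nonneg by (simp add: ennreal_mult)
    finally show "(\<integral>\<^sup>+x. ennreal (B (u x)) \<partial>lebesgue) \<le> ennreal (B T * V + 1)" .
  qed (use B_nonneg[of T] V_nonneg in \<open>simp add: add_nonneg_pos\<close>)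
qed

lemma integrable_B:
  assumes u: "u \<in> X" shows "integrable lebesgue (\<lambda>x. B (u x))"
proof (rule integrableI_bounded)
  note [measurable] = X_lebesgue[OF u]
  show "(\<lambda>x. B (u x)) \<in> borel_measurable lebesgue" by measurable
  have "A u + 1 > 0" using A_nonneg[of u] by simp
  from nn_B_bound[OF this] u show "(\<integral>\<^sup>+x. ennreal (norm (B (u x))) \<partial>lebesgue) < \<infinity>"
    by (force simp: B_nonneg elim: le_less_trans)
qed

lemma nn_integral_B: "u \<in> X \<Longrightarrow> (\<integral>\<^sup>+x. ennreal (B (u x)) \<partial>lebesgue) = ennreal (\<rho> u)"
  unfolding \<rho>_def by (rule nn_integral_eq_integral) (auto simp: integrable_B B_nonneg)

lemma \<rho>_bound:
  assumes R: "R > 0"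
  shows "\<exists>C>0. \<forall>u\<in>X. A u \<le> R \<longrightarrow> \<rho> u \<le> C"
proof -
  obtain C where C: "C > 0" "\<And>u. u \<in> X \<Longrightarrow> A u \<le> R \<Longrightarrow> (\<integral>\<^sup>+x. ennreal (B (u x)) \<partial>lebesgue) \<le> ennreal C"
    using nn_B_bound[OF R] by blast
  then show ?thesis using nn_integral_B by (intro exI[of _ C]) auto
qed

lemma \<rho>_scale_lower:
  assumes u: "u \<in> X" and l: "l \<ge> 1"
  shows "l powr r * \<rho> u \<le> \<rho> (\<lambda>x. l * u x)"
proof -
  have "l powr r * B t \<le> B (l * t)" for t
    using B_lower[of l "\<bar>t\<bar>"] l B_abs[of "l * t"] by (simp add: abs_mult B_abs)
  then have "(\<integral>x. l powr r * B (u x) \<partial>lebesgue) \<le> \<rho> (\<lambda>x. l * u x)"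
    unfolding \<rho>_def using integrable_B[OF u] integrable_B[OF X_scale(1)[OF u]]
    by (intro integral_mono) auto
  then show ?thesis by (simp add: \<rho>_def)
qed

lemma \<rho>_eq_0:
  assumes u: "u \<in> X" shows "\<rho> u = 0 \<longleftrightarrow> (AE x in lebesgue. u x = 0)"
  unfolding \<rho>_def using integral_nonneg_eq_0_iff_AE[OF integrable_B[OF u]] B_nonneg B_pos B_0
  by (metis (mono_tags, lifting) AE_I2 eventually_mono less_irrefl)

text \<open>Scaling in place of a norm embedding: \<open>u\<close> is multiplied by
  \<open>l = A u powr (- (1 / p))\<close>, for which the growth of \<open>G\<close> still guarantees
  energy at most 1, and the uniform bound for that energy is used. As \<open>r > p\<close>, the
  resulting exponent exceeds 1. If \<open>A u = 0\<close>, every \<open>l\<close> is allowed and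
  \<open>\<rho> u\<close> must vanish.\<close>

lemma \<rho>_small:
  "\<exists>C>0. \<forall>u\<in>X. A u \<le> 1 \<longrightarrow> \<rho> u \<le> C * A u powr (r / p)"
proof -
  obtain C where C: "C > 0" "\<And>u. u \<in> X \<Longrightarrow> A u \<le> 1 \<Longrightarrow> \<rho> u \<le> C"
    using \<rho>_bound[of 1] by auto
  show ?thesis
  proof (intro exI[of _ C] conjI ballI impI)
    fix u assume u: "u \<in> X" "A u \<le> 1"
    have *: "l powr r * \<rho> u \<le> C" if l: "l \<ge> 1" "l powr p * A u \<le> 1" for l
    proof -
      have "max 1 \<bar>l\<bar> = l" using l by simp
      then have "A (\<lambda>x. l * u x) \<le> 1" using X_scale(2)[OF u(1), of l] l(2) by simp
      then have "\<rho> (\<lambda>x. l * u x) \<le> C" by (rule C(2)[OF X_scale(1)[OF u(1)]])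
      then show ?thesis using \<rho>_scale_lower[OF u(1) l(1)] by simp
    qed
    show "\<rho> u \<le> C * A u powr (r / p)"
    proof (cases "A u = 0")
      case True
      have "\<rho> u = 0"
      proof (rule ccontr)
        assume "\<rho> u \<noteq> 0"
        then have pos: "\<rho> u > 0" using \<rho>_nonneg[of u] by simp
        define l where "l = max 1 ((2 * C / \<rho> u) powr (1 / r))"
        have "r > 0" using p pr by simp
        have "2 * C / \<rho> u = ((2 * C / \<rho> u) powr (1 / r)) powr r"
          using \<open>r > 0\<close> C pos by (simp add: powr_powr)
        also have "\<dots> \<le> l powr r"
          using \<open>r > 0\<close> by (intro powr_mono2) (auto simp: l_def)
        finally have "2 * C \<le> l powr r * \<rho> u" using pos by (simp add: field_simps)
        moreover have "l powr r * \<rho> u \<le> C" by (rule *) (auto simp: True l_def)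
        ultimately show False using C by simp
      qed
      then show ?thesis using C by simp
    next
      case False
      then have a: "A u > 0" using A_nonneg[of u] by simp
      define l where "l = A u powr (- (1 / p))"
      have "l \<ge> 1" unfolding l_def using a u p by (simp add: powr_minus_divide powr_le1)
      moreover have "l powr p * A u = 1"
        unfolding l_def powr_powr using a p by (simp add: powr_minus)
      ultimately have "l powr r * \<rho> u \<le> C" by (intro *) auto
      moreover have "l powr r = A u powr (- (r / p))"
        using a p by (simp add: l_def powr_powr)
      ultimately show ?thesis using a by (simp add: powr_minus_divide field_simps)
    qed
  qed (rule C)
qed

text \<open>The bound may vary with \<open>n\<close>: in the minimisation it is an energy level plus
  a convergent integral, and the limit function inherits the limit of these bounds.\<close>

lemma Fatou_A:
  assumes vn: "\<And>n. v n \<in> X" and v: "u \<in> borel_measurable borel" "\<And>x. x \<notin> \<Omega> \<Longrightarrow> u x = 0"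
    and lim: "AE x in lborel. (\<lambda>n. v n x) \<longlonglongrightarrow> u x"
    and c: "\<And>n. A (v n) \<le> c n" "c \<longlonglongrightarrow> c0"
  shows "u \<in> X" "A u \<le> c0"
proof -
  note [measurable] = v(1) X_borel[OF vn]
  have c0: "c0 \<ge> 0" using c(2) order_trans[OF A_nonneg c(1)] by (intro LIMSEQ_le_const) auto
  have "AE q in mub. ennreal (G (D u q)) = liminf (\<lambda>n. ennreal (G (D (v n) q)))"
    using AE_mub_fst_snd[OF lim]
  proof eventually_elim
    case (elim q)
    have "(\<lambda>n. D (v n) q) \<longlonglongrightarrow> D u q"
      unfolding hoelder_quotient_def split_beta divide_inverse
      using elim by (intro tendsto_intros) auto
    then have "(\<lambda>n. ennreal (G (D (v n) q))) \<longlonglongrightarrow> ennreal (G (D u q))"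
      using N_function_continuous[OF G] by (intro tendsto_ennrealI) (rule continuous_on_tendsto_compose, auto)
    then show ?case by (intro lim_imp_Liminf[symmetric]) auto
  qed
  then have "(\<integral>\<^sup>+q. ennreal (G (D u q)) \<partial>mub) = (\<integral>\<^sup>+q. liminf (\<lambda>n. ennreal (G (D (v n) q))) \<partial>mub)"
    by (rule nn_integral_cong_AE)
  also have "\<dots> \<le> liminf (\<lambda>n. \<integral>\<^sup>+q. ennreal (G (D (v n) q)) \<partial>mub)"
    by (rule nn_integral_liminf) measurable
  also have "\<dots> \<le> liminf (\<lambda>n. ennreal (c n))"
    by (intro Liminf_mono always_eventually allI) (simp add: nn_integral_A[OF vn] c ennreal_leI)
  also have "\<dots> = ennreal c0"
    by (intro lim_imp_Liminf tendsto_ennrealI c) auto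
  finally have le: "(\<integral>\<^sup>+q. ennreal (G (D u q)) \<partial>mub) \<le> ennreal c0" .
  have "integrable mub (\<lambda>q. G (D u q))"
    by (rule integrableI_bounded) (use le in \<open>auto simp: G_nonneg le_less_trans\<close>)
  then show "u \<in> X" using v by (simp add: X_def)
  from nn_integral_A[OF this] le show "A u \<le> c0" using c0 by simp
qed

section \<open>Almost everywhere compactness\<close>

lemma integrable_X:
  assumes u: "u \<in> X"
  shows "integrable lborel u" "(\<integral>x. \<bar>u x\<bar> \<partial>lborel) \<le> V + \<rho> u / B 1"
proof -
  note [measurable] = X_borel[OF u]
  have B1: "B 1 > 0" using B_pos by simp
  \<comment> \<open>Beyond 1 the exponent \<open>r > 1\<close> in \<open>B_lower\<close> gives at
    least linear growth from the value \<open>B 1\<close>.\<close>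
  have le: "\<bar>t\<bar> \<le> 1 + B t / B 1" for t
  proof (cases "\<bar>t\<bar> \<ge> 1")
    case True
    have "\<bar>t\<bar> powr 1 * B 1 \<le> \<bar>t\<bar> powr r * B 1"
      using True p pr B1 by (intro mult_right_mono powr_mono) auto
    also have "\<dots> \<le> B (\<bar>t\<bar> * 1)" by (rule B_lower) (use True in auto)
    finally show ?thesis using B1 True by (simp add: B_abs field_simps)
  qed (use B1 B_nonneg in \<open>simp add: add_increasing2\<close>)
  have iB: "integrable lborel (\<lambda>x. B (u x))"
    using integrable_B[OF u] by (subst (asm) integrable_completion) auto
  have i\<Omega>: "integrable lborel (\<lambda>x. indicator \<Omega> x :: real)"
    by (simp add: integrable_indicator_iff emeasure_\<Omega>)
  have int: "integrable lborel (\<lambda>x. indicator \<Omega> x + B (u x) / B 1)"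
    using iB i\<Omega> by auto
  have bd: "norm (u x) \<le> indicator \<Omega> x + B (u x) / B 1" for x
    using X_zero[OF u, of x] le[of "u x"] B_0 by (cases "x \<in> \<Omega>") auto
  show i: "integrable lborel u"
    by (rule Bochner_Integration.integrable_bound[OF int]) (use bd order_trans[OF norm_ge_zero bd] in auto)
  have "(\<integral>x. \<bar>u x\<bar> \<partial>lborel) \<le> (\<integral>x. indicator \<Omega> x + B (u x) / B 1 \<partial>lborel)"
    by (rule integral_mono) (use i int bd in auto)
  also have "\<dots> = V + \<rho> u / B 1"
    using iB i\<Omega> unfolding V_def \<rho>_def by (subst integral_completion) auto
  finally show "(\<integral>x. \<bar>u x\<bar> \<partial>lborel) \<le> V + \<rho> u / B 1" .
qed

text \<open>At distance \<open>d < 2 * h\<close> the difference is \<open>d powr s\<close> times the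
  quotient, and \<open>\<bar>t\<bar> \<le> 1 + G t / G 1\<close> by convexity. The factor
  \<open>(2 * h) ^ n / d ^ n \<ge> 1\<close> inserts the kernel, so that integration produces a part
  of \<open>A\<close>.\<close>

lemma difference_le:
  fixes x y :: "real^'n"
  assumes h: "h > 0" and xy: "x = y \<Longrightarrow> v = w"
  shows "\<bar>v - w\<bar> * indicator (ball x (2 * h)) y \<le>
    (2 * h) powr s * indicator (ball x (2 * h)) y +
    (2 * h) powr s * (2 * h) ^ CARD('n) / G 1 * (1 / norm (x - y) ^ CARD('n) * G ((v - w) / norm (x - y) powr s))"
proof (cases "y \<in> ball x (2 * h) \<and> x \<noteq> y")
  case True
  let ?n = "CARD('n)"
  define d where "d = norm (x - y)"
  have d: "0 < d" "d < 2 * h" using True by (auto simp: d_def dist_norm)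
  have G1: "G 1 > 0" by (rule G_pos) simp
  have le: "\<bar>t\<bar> \<le> 1 + G t / G 1" for t
  proof (cases "\<bar>t\<bar> \<ge> 1")
    case True
    have "G (1 / \<bar>t\<bar> * \<bar>t\<bar>) \<le> 1 / \<bar>t\<bar> * G \<bar>t\<bar>" by (rule G_contract) (use True in auto)
    moreover have "1 / \<bar>t\<bar> * \<bar>t\<bar> = 1" using True by simp
    ultimately show ?thesis using True G1 by (simp add: field_simps G_abs)
  qed (use G1 G_nonneg in \<open>simp add: add_increasing2\<close>)
  have "\<bar>v - w\<bar> = d powr s * \<bar>(v - w) / d powr s\<bar>" using d by simp
  also have "\<dots> \<le> (2 * h) powr s * (1 + G ((v - w) / d powr s) / G 1)"
    using d s le[of "(v - w) / d powr s"] by (intro mult_mono powr_mono2) auto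
  also have "\<dots> = (2 * h) powr s + (2 * h) powr s / G 1 * (1 * G ((v - w) / d powr s))"
    by (simp add: algebra_simps)
  also have "\<dots> \<le> (2 * h) powr s + (2 * h) powr s / G 1 * (((2 * h) ^ ?n * (1 / d ^ ?n)) * G ((v - w) / d powr s))"
  proof -
    have "1 \<le> (2 * h) ^ ?n * (1 / d ^ ?n)"
      using power_mono[of d "2 * h" ?n] d by simp
    then show ?thesis using G1 G_nonneg by (intro add_left_mono mult_left_mono mult_right_mono) auto
  qed
  finally show ?thesis using True by (simp add: d_def)
next
  case False
  then show ?thesis using xy h G_pos[of 1] G_nonneg
    by (auto simp: indicator_def intro!: add_nonneg_nonneg mult_nonneg_nonneg)
qed

text \<open>Each point of \<open>\<Omega>\<close> lies in a covering ball of radius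
  \<open>h\<close>, itself contained in the ball of radius \<open>2 * h\<close> about the point. The
  deviation of \<open>w x\<close> from its mean over the covering ball is controlled by
  \<open>difference_le\<close> and carries the small factor \<open>(2 * h) powr s\<close>; what
  remains are finitely many means.\<close>

lemma average_estimate:
  assumes w: "w \<in> X" and h: "h > 0" and C: "finite C" "\<Omega> \<subseteq> (\<Union>c\<in>C. ball c h)"
  shows "(\<integral>x. \<bar>w x\<bar> \<partial>lborel) \<le> (2 * h) powr s * 2 ^ CARD('n) * (V + A w / (ballvol * G 1)) +
    V / (ballvol * h ^ CARD('n)) * (\<Sum>c\<in>C. \<bar>\<integral>y. indicator (ball c h) y * w y \<partial>lborel\<bar>)"
proof -
  let ?n = "CARD('n)"
  note [measurable] = X_borel[OF w]
  define \<beta> where "\<beta> = ballvol * h ^ ?n"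
  have \<beta>: "\<beta> > 0" using ballvol_pos h by (simp add: \<beta>_def)
  define M where "M = (\<Sum>c\<in>C. \<bar>\<integral>y. indicator (ball c h) y * w y \<partial>lborel\<bar>)"
  have M: "M \<ge> 0" by (simp add: M_def sum_nonneg)
  have G1: "G 1 > 0" by (rule G_pos) simp
  have iw: "integrable lborel w" by (rule integrable_X[OF w])
  define K where "K = (2 * h) powr s * (2 * h) ^ ?n / G 1"
  have K: "K \<ge> 0" using h G1 by (simp add: K_def)
  define \<Theta> where "\<Theta> x = (\<integral>\<^sup>+y. ennreal (1 / norm (x - y) ^ ?n) * ennreal (G (D w (x, y))) \<partial>lborel)" for x
  have pt: "ennreal \<beta> * ennreal \<bar>w x\<bar> \<le>
     indicator \<Omega> x * ennreal ((2 * h) powr s * (ballvol * (2 * h) ^ ?n) + M) + ennreal K * \<Theta> x" for x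
  proof (cases "x \<in> \<Omega>")
    case True
    then obtain c where c: "c \<in> C" "x \<in> ball c h" using C by auto
    have bv: "measure lborel (ball c h) = \<beta>" using h by (simp add: content_ball ballvol_def \<beta>_def)
    have ib: "integrable lborel (\<lambda>y. indicator (ball c h) y :: real)"
      using emeasure_lborel_ball_finite by (subst integrable_indicator_iff) auto
    have iwb: "integrable lborel (\<lambda>y. indicator (ball c h) y * w y)"
      by (rule integrable_real_mult_indicator[OF _ iw, of "ball c h", unfolded mult.commute[of "w _"]]) simp
    have sub: "ball c h \<subseteq> ball x (2 * h)"
    proof
      fix y assume "y \<in> ball c h"
      then show "y \<in> ball x (2 * h)" using c(2) dist_triangle[of x y c]
        by (auto simp: dist_commute)
    qed
    have idiff: "integrable lborel (\<lambda>y. indicator (ball c h) y * (w x - w y))"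
      using ib iwb by (simp add: right_diff_distrib)
    have "\<beta> * w x = (\<integral>y. indicator (ball c h) y * (w x - w y) \<partial>lborel) + (\<integral>y. indicator (ball c h) y * w y \<partial>lborel)"
      using ib iwb bv by (simp add: right_diff_distrib)
    then have "\<beta> * \<bar>w x\<bar> \<le> \<bar>\<integral>y. indicator (ball c h) y * (w x - w y) \<partial>lborel\<bar> + \<bar>\<integral>y. indicator (ball c h) y * w y \<partial>lborel\<bar>"
    proof -
      have "\<beta> * \<bar>w x\<bar> = \<bar>\<beta> * w x\<bar>" using \<beta> by (simp add: abs_mult)
      then show ?thesis unfolding \<open>\<beta> * w x = _\<close> by (simp only: abs_triangle_ineq)
    qed
    also have "\<bar>\<integral>y. indicator (ball c h) y * (w x - w y) \<partial>lborel\<bar> \<le> (\<integral>y. indicator (ball c h) y * \<bar>w x - w y\<bar> \<partial>lborel)"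
      using integral_norm_bound[of lborel "\<lambda>y. indicator (ball c h) y * (w x - w y)"] by (simp add: abs_mult)
    also have "\<bar>\<integral>y. indicator (ball c h) y * w y \<partial>lborel\<bar> \<le> M"
      unfolding M_def using c C by (intro member_le_sum) auto
    finally have "\<beta> * \<bar>w x\<bar> \<le> (\<integral>y. indicator (ball c h) y * \<bar>w x - w y\<bar> \<partial>lborel) + M" by simp
    then have "ennreal (\<beta> * \<bar>w x\<bar>) \<le> ennreal (\<integral>y. indicator (ball c h) y * \<bar>w x - w y\<bar> \<partial>lborel) + ennreal M"
      using M by (simp add: ennreal_plus[symmetric] ennreal_leI Bochner_Integration.integral_nonneg del: ennreal_plus)
    also have "ennreal (\<integral>y. indicator (ball c h) y * \<bar>w x - w y\<bar> \<partial>lborel) =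
        (\<integral>\<^sup>+y. ennreal (indicator (ball c h) y * \<bar>w x - w y\<bar>) \<partial>lborel)"
      by (rule nn_integral_eq_integral[symmetric])
        (use integrable_abs[OF idiff] in \<open>auto simp: abs_mult\<close>)
    also have "\<dots> \<le> (\<integral>\<^sup>+y. ennreal ((2 * h) powr s) * indicator (ball x (2 * h)) y +
        ennreal K * (ennreal (1 / norm (x - y) ^ ?n) * ennreal (G (D w (x, y)))) \<partial>lborel)"
    proof (rule nn_integral_mono)
      fix y
      have "indicator (ball c h) y * \<bar>w x - w y\<bar> \<le> \<bar>w x - w y\<bar> * indicator (ball x (2 * h)) y"
        using sub by (auto simp: indicator_def)
      also have "\<dots> \<le> (2 * h) powr s * indicator (ball x (2 * h)) y +
         K * (1 / norm (x - y) ^ ?n * G (D w (x, y)))"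
        using difference_le[OF h, of x y "w x" "w y"] by (simp add: K_def hoelder_quotient_def)
      finally have "ennreal (indicator (ball c h) y * \<bar>w x - w y\<bar>) \<le>
          ennreal ((2 * h) powr s * indicator (ball x (2 * h)) y + K * (1 / norm (x - y) ^ ?n * G (D w (x, y))))"
        by (rule ennreal_leI)
      also have "\<dots> = ennreal ((2 * h) powr s * indicator (ball x (2 * h)) y) +
          ennreal (K * (1 / norm (x - y) ^ ?n * G (D w (x, y))))"
        using K G_nonneg by (intro ennreal_plus) auto
      also have "ennreal ((2 * h) powr s * indicator (ball x (2 * h)) y) = ennreal ((2 * h) powr s) * indicator (ball x (2 * h)) y"
        by (simp split: split_indicator)
      also have "ennreal (K * (1 / norm (x - y) ^ ?n * G (D w (x, y)))) =
          ennreal K * (ennreal (1 / norm (x - y) ^ ?n) * ennreal (G (D w (x, y))))"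
      proof -
        have "ennreal (a * (b * c)) = ennreal a * (ennreal b * ennreal c)" if "a \<ge> 0" "b \<ge> 0" "c \<ge> 0" for a b c
          using that by (simp add: ennreal_mult)
        then show ?thesis by this (use K G_nonneg in auto)
      qed
      finally show "ennreal (indicator (ball c h) y * \<bar>w x - w y\<bar>) \<le>
        ennreal ((2 * h) powr s) * indicator (ball x (2 * h)) y +
        ennreal K * (ennreal (1 / norm (x - y) ^ ?n) * ennreal (G (D w (x, y))))" .
    qed
    also have "\<dots> = ennreal ((2 * h) powr s) * emeasure lborel (ball x (2 * h)) + ennreal K * \<Theta> x"
    proof (subst nn_integral_add)
      have [measurable]: "(\<lambda>y. D w (x, y)) \<in> borel_measurable borel"
        unfolding hoelder_quotient_def prod.case by measurable
      show "(\<lambda>y. ennreal K * (ennreal (1 / norm (x - y) ^ ?n) * ennreal (G (D w (x, y))))) \<in> borel_measurable lborel"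
        by measurable
      have "(\<integral>\<^sup>+y. ennreal K * (ennreal (1 / norm (x - y) ^ ?n) * ennreal (G (D w (x, y)))) \<partial>lborel) = ennreal K * \<Theta> x"
        unfolding \<Theta>_def by (rule nn_integral_cmult) measurable
      then show "(\<integral>\<^sup>+y. ennreal ((2 * h) powr s) * indicator (ball x (2 * h)) y \<partial>lborel) +
         (\<integral>\<^sup>+y. ennreal K * (ennreal (1 / norm (x - y) ^ ?n) * ennreal (G (D w (x, y)))) \<partial>lborel) =
         ennreal ((2 * h) powr s) * emeasure lborel (ball x (2 * h)) + ennreal K * \<Theta> x"
        by (simp add: nn_integral_cmult_indicator)
      show "(\<lambda>y. ennreal ((2 * h) powr s) * indicator (ball x (2 * h)) y) \<in> borel_measurable lborel"
        by (intro borel_measurable_times_ennreal borel_measurable_const borel_measurable_indicator) simp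
    qed
    also have "emeasure lborel (ball x (2 * h)) = ennreal (ballvol * (2 * h) ^ ?n)"
      using h by (simp add: emeasure_ball ballvol_def)
    finally have "ennreal (\<beta> * \<bar>w x\<bar>) \<le> (ennreal ((2 * h) powr s) * ennreal (ballvol * (2 * h) ^ ?n) + ennreal K * \<Theta> x) + ennreal M"
      by (auto intro: add_right_mono)
    also have "\<dots> = (ennreal ((2 * h) powr s) * ennreal (ballvol * (2 * h) ^ ?n) + ennreal M) + ennreal K * \<Theta> x"
      by (simp only: add.assoc add.commute[of "ennreal K * \<Theta> x"])
    also have "ennreal ((2 * h) powr s) * ennreal (ballvol * (2 * h) ^ ?n) + ennreal M =
        ennreal ((2 * h) powr s * (ballvol * (2 * h) ^ ?n) + M)"
    proof -
      have "ennreal (a * b + c) = ennreal a * ennreal b + ennreal c" if "a \<ge> 0" "b \<ge> 0" "c \<ge> 0" for a b c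
        using that by (simp add: ennreal_mult)
      from this[of "(2 * h) powr s" "ballvol * (2 * h) ^ ?n" M] show ?thesis using M ballvol_pos h by simp
    qed
    finally show ?thesis using True \<beta> by (simp add: ennreal_mult)
  qed (use X_zero[OF w] in simp)
  have "ennreal \<beta> * ennreal (\<integral>x. \<bar>w x\<bar> \<partial>lborel) = (\<integral>\<^sup>+x. ennreal \<beta> * ennreal \<bar>w x\<bar> \<partial>lborel)"
    using integrable_abs[OF iw] by (simp add: nn_integral_cmult nn_integral_eq_integral)
  also have "\<dots> \<le> (\<integral>\<^sup>+x. indicator \<Omega> x * ennreal ((2 * h) powr s * (ballvol * (2 * h) ^ ?n) + M) + ennreal K * \<Theta> x \<partial>lborel)"
    by (intro nn_integral_mono pt)
  also have "\<dots> = ennreal V * ennreal ((2 * h) powr s * (ballvol * (2 * h) ^ ?n) + M) + ennreal K * (\<integral>\<^sup>+x. \<Theta> x \<partial>lborel)"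
    unfolding \<Theta>_def by (subst nn_integral_add) (auto simp: nn_integral_cmult nn_integral_multc emeasure_\<Omega>)
  also have "(\<integral>\<^sup>+x. \<Theta> x \<partial>lborel) = ennreal (A w)"
    unfolding \<Theta>_def nn_integral_A[OF w, symmetric] by (rule nn_integral_mub[symmetric]) measurable
  finally have "ennreal (\<beta> * (\<integral>x. \<bar>w x\<bar> \<partial>lborel)) \<le>
      ennreal (V * ((2 * h) powr s * (ballvol * (2 * h) ^ ?n) + M) + K * A w)"
    using \<beta> V_nonneg M K A_nonneg[of w] ballvol_pos h
    by (simp add: ennreal_mult[symmetric] ennreal_plus[symmetric] del: ennreal_plus)
  then have "\<beta> * (\<integral>x. \<bar>w x\<bar> \<partial>lborel) \<le> V * ((2 * h) powr s * (ballvol * (2 * h) ^ ?n) + M) + K * A w"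
    using V_nonneg M K A_nonneg[of w] ballvol_pos h by (subst (asm) ennreal_le_iff) auto
  then have "(\<integral>x. \<bar>w x\<bar> \<partial>lborel) \<le> (V * ((2 * h) powr s * (ballvol * (2 * h) ^ ?n) + M) + K * A w) / \<beta>"
    using \<beta> by (simp add: field_simps)
  also have "\<dots> = (2 * h) powr s * 2 ^ ?n * (V + A w / (ballvol * G 1)) + V / \<beta> * M"
    using \<beta> h ballvol_pos G1 by (simp add: K_def \<beta>_def field_simps)
  finally show ?thesis by (simp add: M_def \<beta>_def)
qed

text \<open>The means over the countably many balls of all coverings converge along one diagonal
  subsequence. \<open>average_estimate\<close>, applied to differences, makes this subsequence
  Cauchy in mean; a further subsequence converges almost everywhere, and \<open>Fatou_A\<close>
  places its limit in \<open>X\<close>.\<close>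

lemma Rellich:
  fixes u :: "nat \<Rightarrow> real^'n \<Rightarrow> real"
  assumes u: "\<And>n. u n \<in> X" "\<And>n. A (u n) \<le> R"
  shows "\<exists>k w. strict_mono k \<and> w \<in> X \<and> A w \<le> R \<and> (AE x in lborel. (\<lambda>n. u (k n) x) \<longlonglongrightarrow> w x)"
proof -
  let ?n = "CARD('n)"
  define R' where "R' = max R 1"
  have R': "R' > 0" "\<And>n. A (u n) \<le> R'" using u(2) by (auto simp: R'_def le_max_iff_disj)
  obtain C where C: "C > 0" "\<And>v. v \<in> X \<Longrightarrow> A v \<le> R' \<Longrightarrow> \<rho> v \<le> C" using \<rho>_bound[OF R'(1)] by auto
  define h where "h j = 1 / (real j + 1)" for j
  have hpos: "h j > 0" for j by (simp add: h_def)
  have "\<exists>c. finite c \<and> \<Omega> \<subseteq> (\<Union>x\<in>c. ball x (h j))" for j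
  proof -
    have "seq_compact (closure \<Omega>)" using \<Omega> by (simp add: compact_eq_seq_compact_metric[symmetric] compact_closure)
    from seq_compact_imp_totally_bounded[OF this] hpos[of j]
    obtain c where "finite c" "closure \<Omega> \<subseteq> (\<Union>x\<in>c. ball x (h j))" by blast
    then show ?thesis using closure_subset[of \<Omega>] by blast
  qed
  then obtain c where c: "\<And>j. finite (c j)" "\<And>j. \<Omega> \<subseteq> (\<Union>x\<in>c j. ball x (h j))" by metis
  define m where "m n = (\<lambda>(j, y). \<integral>x. indicator (ball y (h j)) x * u n x \<partial>lborel)" for n :: nat
  define S where "S = (SIGMA j:UNIV. c j)"
  have "countable S" unfolding S_def using c by (intro countable_SIGMA) (auto simp: countable_finite)
  moreover have "norm (m n q) \<le> V + C / B 1" for n q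
  proof -
    obtain j y where q: "q = (j, y)" by fastforce
    have "norm (m n q) \<le> (\<integral>x. \<bar>u n x\<bar> \<partial>lborel)"
      unfolding q m_def prod.case
    proof (rule order_trans[OF integral_norm_bound integral_mono])
      have "integrable lborel (\<lambda>x. indicator (ball y (h j)) x * u n x)"
        by (rule integrable_real_mult_indicator[OF _ integrable_X(1)[OF u(1)[of n]], of "ball y (h j)", unfolded mult.commute[of "u n _"]]) simp
      then show "integrable lborel (\<lambda>x. norm (indicator (ball y (h j)) x * u n x))"
        by (rule integrable_norm)
    qed (use integrable_X(1)[OF u(1)] in \<open>auto simp: indicator_def\<close>)
    also have "\<dots> \<le> V + \<rho> (u n) / B 1" by (rule integrable_X[OF u(1)])
    also have "\<dots> \<le> V + C / B 1" using C(2)[OF u(1) R'(2)] B_pos[of 1] by (simp add: divide_right_mono)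
    finally show ?thesis .
  qed
  ultimately obtain k where k: "strict_mono k" "\<And>q. q \<in> S \<Longrightarrow> \<exists>l. (\<lambda>n. m (k n) q) \<longlonglongrightarrow> l"
    using function_convergent_subsequence[of S m "V + C / B 1"] by blast
  define A' where "A' = 2 powr p * (R' + R')"
  define K where "K = 2 ^ ?n * (V + A' / (ballvol * G 1))"
  have "A' > 0" using R' by (simp add: A'_def)
  then have K: "K \<ge> 0" using V_nonneg ballvol_pos G_pos[of 1] by (simp add: K_def)
  have cauchy: "\<exists>N. \<forall>i\<ge>N. \<forall>l\<ge>N. (LINT x|lborel. norm (u (k i) x - u (k l) x)) < e" if e: "e > 0" for e
  proof -
    have "(\<lambda>j. (2 * h j) powr s * K) \<longlonglongrightarrow> 0" unfolding h_def using s by real_asymp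
    then have "eventually (\<lambda>j. (2 * h j) powr s * K < e / 2) sequentially"
      using e by (intro order_tendstoD) auto
    then obtain j where j: "(2 * h j) powr s * K < e / 2" by (auto simp: eventually_sequentially)
    define P where "P = V / (ballvol * h j ^ ?n)"
    have P: "P \<ge> 0" using V_nonneg ballvol_pos hpos[of j] by (simp add: P_def)
    \<comment> \<open>The share of each of the \<open>card (c j)\<close> differences of means; the
      summand 1 keeps the denominator positive.\<close>
    define e' where "e' = e / (2 * (P * card (c j) + 1))"
    have e': "e' > 0" using e P by (simp add: e'_def add_nonneg_pos)
    have "\<exists>N. \<forall>i\<ge>N. \<forall>l\<ge>N. \<bar>m (k i) (j, y) - m (k l) (j, y)\<bar> < e'" if y: "y \<in> c j" for y
    proof -
      obtain L where "(\<lambda>n. m (k n) (j, y)) \<longlonglongrightarrow> L" using k(2)[of "(j, y)"] y by (auto simp: S_def)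
      then have "Cauchy (\<lambda>n. m (k n) (j, y))" by (rule LIMSEQ_imp_Cauchy)
      then show ?thesis using e' by (auto simp: Cauchy_def dist_real_def)
    qed
    then obtain N where N: "\<And>y i l. y \<in> c j \<Longrightarrow> i \<ge> N y \<Longrightarrow> l \<ge> N y \<Longrightarrow> \<bar>m (k i) (j, y) - m (k l) (j, y)\<bar> < e'"
      by metis
    show ?thesis
    proof (intro exI[of _ "Max (insert 0 (N ` c j))"] allI impI)
      fix i l assume il: "i \<ge> Max (insert 0 (N ` c j))" "l \<ge> Max (insert 0 (N ` c j))"
      have ge: "i \<ge> N y" "l \<ge> N y" if "y \<in> c j" for y
        using il that c(1)[of j] by auto
      define w where "w = (\<lambda>x. u (k i) x - u (k l) x)"
      have w: "w \<in> X" using X_lin[OF u(1)[of "k i"] u(1)[of "k l"], of 1 "-1"] by (simp add: w_def)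
      have Aw: "A w \<le> A'"
        unfolding w_def A'_def using A_diff[OF u(1)[of "k i"] u(1)[of "k l"]] R'(2)[of "k i"] R'(2)[of "k l"]
        by (intro order_trans[OF A_diff[OF u(1) u(1)]] mult_left_mono) auto
      have mw: "(\<integral>x. indicator (ball y (h j)) x * w x \<partial>lborel) = m (k i) (j, y) - m (k l) (j, y)" for y
      proof -
        have "integrable lborel (\<lambda>x. indicator (ball y (h j)) x * u n x)" for n
          by (rule integrable_real_mult_indicator[OF _ integrable_X(1)[OF u(1)[of n]], of "ball y (h j)", unfolded mult.commute[of "u n _"]]) simp
        then show ?thesis by (simp add: w_def m_def right_diff_distrib)
      qed
      have "(LINT x|lborel. norm (u (k i) x - u (k l) x)) = (\<integral>x. \<bar>w x\<bar> \<partial>lborel)" by (simp add: w_def)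
      also have "\<dots> \<le> (2 * h j) powr s * 2 ^ ?n * (V + A w / (ballvol * G 1)) + P * (\<Sum>y\<in>c j. \<bar>m (k i) (j, y) - m (k l) (j, y)\<bar>)"
        using average_estimate[OF w hpos c(1) c(2), of j] by (simp add: mw P_def)
      also have "\<dots> \<le> (2 * h j) powr s * K + P * (\<Sum>y\<in>c j. e')"
        using Aw P N ge ballvol_pos G_pos[of 1] unfolding K_def mult.assoc
        by (intro add_mono mult_left_mono sum_mono divide_right_mono) (auto intro!: less_imp_le)
      also have "P * (\<Sum>y\<in>c j. e') = (P * card (c j)) * e'" by simp
      also have "\<dots> \<le> (P * card (c j) + 1) * e'" using e' by (intro mult_right_mono) auto
      also have "\<dots> = e / 2"
      proof -
        have "P * card (c j) + 1 > 0" using P by (simp add: add_nonneg_pos)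
        then show ?thesis unfolding e'_def by (simp add: divide_simps) (simp add: algebra_simps)?
      qed
      finally show "(LINT x|lborel. norm (u (k i) x - u (k l) x)) < e" using j by simp
    qed
  qed
  obtain k' where k': "strict_mono k'" "AE x in lborel. Cauchy (\<lambda>i. u (k (k' i)) x)"
    using cauchy_L1_AE_cauchy_subseq[of lborel "\<lambda>n. u (k n)"] integrable_X(1)[OF u(1)] cauchy by blast
  define w where "w x = lim (\<lambda>i. u (k (k' i)) x)" for x
  have [measurable]: "w \<in> borel_measurable borel"
    unfolding w_def using X_borel[OF u(1)] by (intro borel_measurable_lim_metric) auto
  have w0: "w x = 0" if "x \<notin> \<Omega>" for x using X_zero[OF u(1) that] by (simp add: w_def)
  have lim: "AE x in lborel. (\<lambda>i. u (k (k' i)) x) \<longlonglongrightarrow> w x"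
    using k'(2) by eventually_elim (simp add: w_def Cauchy_convergent_iff convergent_LIMSEQ_iff[symmetric])
  have "w \<in> X" "A w \<le> R"
    using Fatou_A[of "\<lambda>i. u (k (k' i))" w "\<lambda>_. R" R] u w0 lim by auto
  then show ?thesis
    using k k' lim by (intro exI[of _ "k \<circ> k'"] exI[of _ w]) (auto intro: strict_mono_o)
qed


section \<open>Convergence of integrals along sequences bounded in \<open>A\<close>\<close>

lemma integrable_lebesgue_bounded:
  assumes [measurable]: "h \<in> borel_measurable lebesgue" and "\<And>x. x \<notin> \<Omega> \<Longrightarrow> h x = (0::real)" "\<And>x. \<bar>h x\<bar> \<le> c"
  shows "integrable lebesgue h"
proof (rule Bochner_Integration.integrable_bound)
  show "integrable lebesgue (\<lambda>x. c * indicator \<Omega> x :: real)"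
    by (auto simp: integrable_indicator_iff emeasure_\<Omega>)
  show "AE x in lebesgue. norm (h x) \<le> norm (c * indicator \<Omega> x :: real)"
    using assms by (intro AE_I2) (auto simp: indicator_def intro: order_trans[OF _ abs_ge_self])
qed simp

lemma Caratheodory_compose:
  assumes "(\<lambda>(x, t). \<Psi> x t) \<in> borel_measurable (lebesgue \<Otimes>\<^sub>M borel)"
    and [measurable]: "u \<in> borel_measurable lebesgue"
  shows "(\<lambda>x. \<Psi> x (u x) :: real) \<in> borel_measurable lebesgue"
  using measurable_compose[OF _ assms(1), of "\<lambda>x. (x, u x)" lebesgue] by simp

text \<open>Values are truncated at height \<open>T\<close>. \<open>uniform_tail\<close> bounds the
  truncation error uniformly along the sequence, and the truncated integrands are dominated by a
  multiple of the indicator of \<open>\<Omega>\<close>. The integrand is left general because both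
  \<open>F\<close> and \<open>B\<close> are needed.\<close>

lemma integral_convergence:
  fixes u :: "nat \<Rightarrow> real^'n \<Rightarrow> real"
  assumes u: "\<And>n. u n \<in> X" "\<And>n. A (u n) \<le> R" and w: "w \<in> X"
    and lim: "AE x in lborel. (\<lambda>n. u n x) \<longlonglongrightarrow> w x"
    and \<Psi>: "(\<lambda>(x, t). \<Psi> x t) \<in> borel_measurable (lebesgue \<Otimes>\<^sub>M borel)"
      "\<And>x. continuous_on UNIV (\<Psi> x)" "\<And>x t. \<bar>\<Psi> x t\<bar> \<le> C * B t"
  shows "(\<lambda>n. \<integral>x. \<Psi> x (u n x) \<partial>lebesgue) \<longlonglongrightarrow> (\<integral>x. \<Psi> x (w x) \<partial>lebesgue)"
proof (rule LIMSEQ_I)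
  fix e :: real assume e: "e > 0"
  define R' where "R' = max (max R (A w)) 1"
  have R': "R' > 0" "\<And>n. A (u n) \<le> R'" "A w \<le> R'" using u(2) by (auto simp: R'_def le_max_iff_disj)
  have C: "C \<ge> 0" using order_trans[OF abs_ge_zero \<Psi>(3)[of _ 1]] B_pos[of 1] by (simp add: zero_le_mult_iff)
  \<comment> \<open>Two truncation errors of size \<open>2 * C * \<delta>\<close> and one error
    \<open>e / 3\<close> from dominated convergence have to fit into \<open>e\<close>.\<close>
  define \<delta> where "\<delta> = e / (6 * C + 6)"
  have \<delta>: "\<delta> > 0" using e C by (simp add: \<delta>_def add_nonneg_pos)
  obtain T where T: "T > 0" "\<And>v. v \<in> X \<Longrightarrow> A v \<le> R' \<Longrightarrow>
    (\<integral>\<^sup>+x. ennreal (B (v x)) * indicator {x. \<bar>v x\<bar> > T} x \<partial>lborel) \<le> ennreal \<delta>"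
    using uniform_tail[OF R'(1) \<delta>] by auto
  define \<tau> where "\<tau> t = max (- T) (min T t)" for t
  have \<tau>: "\<bar>\<tau> t\<bar> \<le> T" "\<bar>\<tau> t\<bar> \<le> \<bar>t\<bar>" "\<bar>t\<bar> \<le> T \<Longrightarrow> \<tau> t = t" for t using T(1) by (auto simp: \<tau>_def)
  have \<tau>c: "continuous_on UNIV \<tau>" unfolding \<tau>_def by (intro continuous_intros)
  have \<Psi>0: "\<Psi> x 0 = 0" for x using \<Psi>(3)[of x 0] B_0 by simp
  have meas: "(\<lambda>x. \<Psi> x (v x)) \<in> borel_measurable lebesgue" "(\<lambda>x. \<Psi> x (\<tau> (v x))) \<in> borel_measurable lebesgue"
    if "v \<in> X" for v
  proof -
    note [measurable] = X_lebesgue[OF that]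
    show "(\<lambda>x. \<Psi> x (v x)) \<in> borel_measurable lebesgue" by (rule Caratheodory_compose[OF \<Psi>(1)]) measurable
    show "(\<lambda>x. \<Psi> x (\<tau> (v x))) \<in> borel_measurable lebesgue"
      by (rule Caratheodory_compose[OF \<Psi>(1)]) (simp add: \<tau>_def)
  qed
  have int: "integrable lebesgue (\<lambda>x. \<Psi> x (v x))" if "v \<in> X" for v
    by (rule Bochner_Integration.integrable_bound[OF _ meas(1)[OF that], of "\<lambda>x. C * B (v x)"])
      (use integrable_B[OF that] \<Psi>(3) order_trans[OF \<Psi>(3) abs_ge_self] in auto)
  have bdd: "\<bar>\<Psi> x (\<tau> t)\<bar> \<le> C * B T" for x t
    using \<Psi>(3)[of x "\<tau> t"] B_mono_abs[of "\<tau> t" T] \<tau>(1)[of t] T(1) C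
    by (auto intro: order_trans mult_left_mono)
  have int\<tau>: "integrable lebesgue (\<lambda>x. \<Psi> x (\<tau> (v x)))" if "v \<in> X" for v
    by (rule integrable_lebesgue_bounded[OF meas(2)[OF that] _ bdd])
      (use X_zero[OF that] \<Psi>0 T(1) in \<open>auto simp: \<tau>_def\<close>)
  have tail: "\<bar>(\<integral>x. \<Psi> x (v x) \<partial>lebesgue) - (\<integral>x. \<Psi> x (\<tau> (v x)) \<partial>lebesgue)\<bar> \<le> 2 * C * \<delta>"
    if v: "v \<in> X" "A v \<le> R'" for v
  proof -
    note [measurable] = X_borel[OF v(1)]
    have "ennreal \<bar>(\<integral>x. \<Psi> x (v x) \<partial>lebesgue) - (\<integral>x. \<Psi> x (\<tau> (v x)) \<partial>lebesgue)\<bar> =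
      ennreal \<bar>\<integral>x. \<Psi> x (v x) - \<Psi> x (\<tau> (v x)) \<partial>lebesgue\<bar>"
      using int[OF v(1)] int\<tau>[OF v(1)] by simp
    also have "\<dots> \<le> (\<integral>\<^sup>+x. ennreal (norm (\<Psi> x (v x) - \<Psi> x (\<tau> (v x)))) \<partial>lebesgue)"
      using integral_norm_bound_ennreal[OF Bochner_Integration.integrable_diff[OF int[OF v(1)] int\<tau>[OF v(1)]]] by simp
    also have "\<dots> \<le> (\<integral>\<^sup>+x. ennreal (2 * C) * (ennreal (B (v x)) * indicator {x. \<bar>v x\<bar> > T} x) \<partial>lebesgue)"
    proof (rule nn_integral_mono)
      fix x
      have "\<bar>\<Psi> x (v x) - \<Psi> x (\<tau> (v x))\<bar> \<le> C * B (v x) + C * B (\<tau> (v x))"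
        using \<Psi>(3)[of x "v x"] \<Psi>(3)[of x "\<tau> (v x)"] by linarith
      also have "\<dots> \<le> 2 * C * B (v x)"
        using mult_left_mono[OF B_mono_abs[OF \<tau>(2)[of "v x"]] C] by simp
      finally show "ennreal (norm (\<Psi> x (v x) - \<Psi> x (\<tau> (v x)))) \<le>
        ennreal (2 * C) * (ennreal (B (v x)) * indicator {x. \<bar>v x\<bar> > T} x)"
        using \<tau>(3)[of "v x"] C B_nonneg[of "v x"]
        by (cases "\<bar>v x\<bar> > T") (auto simp: ennreal_mult[symmetric] simp del: ennreal_numeral intro!: ennreal_leI)
    qed
    also have "\<dots> = ennreal (2 * C) * (\<integral>\<^sup>+x. ennreal (B (v x)) * indicator {x. \<bar>v x\<bar> > T} x \<partial>lborel)"
      unfolding nn_integral_completion by (rule nn_integral_cmult) measurable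
    also have "\<dots> \<le> ennreal (2 * C) * ennreal \<delta>" by (intro mult_left_mono T v) simp
    also have "\<dots> = ennreal (2 * C * \<delta>)" using C \<delta> by (intro ennreal_mult[symmetric]) auto
    finally show ?thesis using C \<delta> by (subst (asm) ennreal_le_iff) auto
  qed
  have AEl: "AE x in lebesgue. (\<lambda>n. u n x) \<longlonglongrightarrow> w x" using lim by (rule AE_completion)
  have "(\<lambda>n. \<integral>x. \<Psi> x (\<tau> (u n x)) \<partial>lebesgue) \<longlonglongrightarrow> (\<integral>x. \<Psi> x (\<tau> (w x)) \<partial>lebesgue)"
  proof (rule integral_dominated_convergence[where w = "\<lambda>x. C * B T * indicator \<Omega> x"])
    show "integrable lebesgue (\<lambda>x. C * B T * indicator \<Omega> x :: real)"
      by (auto simp: integrable_indicator_iff emeasure_\<Omega>)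
    show "AE x in lebesgue. (\<lambda>n. \<Psi> x (\<tau> (u n x))) \<longlonglongrightarrow> \<Psi> x (\<tau> (w x))"
      using AEl
    proof eventually_elim
      case (elim x)
      have "(\<lambda>n. \<tau> (u n x)) \<longlonglongrightarrow> \<tau> (w x)" using continuous_on_tendsto_compose[OF \<tau>c elim] by simp
      then show ?case using continuous_on_tendsto_compose[OF \<Psi>(2)] by simp
    qed
    show "AE x in lebesgue. norm (\<Psi> x (\<tau> (u n x))) \<le> C * B T * indicator \<Omega> x" for n
      using bdd X_zero[OF u(1)[of n]] \<Psi>0 T(1) by (intro AE_I2) (auto simp: indicator_def \<tau>_def)
  qed (use meas u w in auto)
  from LIMSEQ_D[OF this, of "e / 3"] e obtain N where N: "\<And>n. n \<ge> N \<Longrightarrow> \<bar>(\<integral>x. \<Psi> x (\<tau> (u n x)) \<partial>lebesgue) - (\<integral>x. \<Psi> x (\<tau> (w x)) \<partial>lebesgue)\<bar> < e / 3"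
    by auto
  show "\<exists>N. \<forall>n\<ge>N. norm ((\<integral>x. \<Psi> x (u n x) \<partial>lebesgue) - (\<integral>x. \<Psi> x (w x) \<partial>lebesgue)) < e"
  proof (intro exI[of _ N] allI impI)
    fix n assume n: "n \<ge> N"
    have "2 * C * \<delta> \<le> e / 3" using C e by (simp add: \<delta>_def field_simps)
    then show "norm ((\<integral>x. \<Psi> x (u n x) \<partial>lebesgue) - (\<integral>x. \<Psi> x (w x) \<partial>lebesgue)) < e"
      using tail[OF u(1) R'(2), of n] tail[OF w R'(3)] N[OF n]
      unfolding real_norm_def by linarith
  qed
qed

end

section \<open>Lipschitz functions\<close>

lemma dyadic_above:
  assumes "d \<ge> (1::real)"
  obtains i :: nat where "2 ^ i \<le> d" "d < 2 ^ Suc i"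
proof -
  obtain j :: nat where j: "d < 2 ^ j" using real_arch_pow[of 2 d] by auto
  define i where "i = (LEAST i. d < 2 ^ Suc i)"
  have "d < 2 ^ Suc j" using j by (rule less_le_trans) simp
  then have 1: "d < 2 ^ Suc i" unfolding i_def by (rule LeastI)
  have "2 ^ i \<le> d"
  proof (cases i)
    case (Suc k)
    then show ?thesis using not_less_Least[of k "\<lambda>i. d < 2 ^ Suc i"] by (auto simp: i_def)
  qed (use assms in simp)
  then show ?thesis using 1 that by blast
qed

lemma dyadic_below:
  assumes "0 < d" "d < (1::real)"
  obtains i :: nat where "(1 / 2) ^ Suc i \<le> d" "d < (1 / 2) ^ i"
proof -
  obtain j :: nat where j: "(1 / 2) ^ j < d" using real_arch_pow_inv[of d "1 / 2"] assms by auto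
  define i where "i = (LEAST i. (1 / 2) ^ Suc i \<le> d)"
  have "(1 / 2) ^ Suc j \<le> d" using j by (intro order_trans[OF _ less_imp_le[OF j]]) simp
  then have 1: "(1 / 2) ^ Suc i \<le> d" unfolding i_def by (rule LeastI)
  have "d < (1 / 2) ^ i"
  proof (cases i)
    case (Suc k)
    then show ?thesis using not_less_Least[of k "\<lambda>i. (1 / 2) ^ Suc i \<le> d"] by (auto simp: i_def)
  qed (use assms in simp)
  then show ?thesis using 1 that by blast
qed

context frac_orlicz
begin

text \<open>The kernel is summed over dyadic shells around \<open>x\<close>, inside and outside the unit ball.\<close>

lemma kernel_upper:
  assumes LM: "L \<ge> 0" "M \<ge> 0"
  shows "\<exists>K\<ge>0. \<forall>x::real^'n. (\<integral>\<^sup>+y. ennreal (1 / norm (x - y) ^ CARD('n)) *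
    ennreal (G (min (L * norm (x - y)) M / norm (x - y) powr s)) \<partial>lborel) \<le> ennreal K"
proof -
  let ?n = "CARD('n)"
  \<comment> \<open>Near \<open>x\<close> the quotient is at most \<open>L * d powr (1 - s)\<close>,
    far away at most \<open>M * d powr (- s)\<close>; from one dyadic shell to the next these bounds
    shrink by \<open>\<theta>1\<close> and \<open>\<theta>2\<close>. The kernel bound and the volume
    of the enclosing ball compensate each other, so both sums are geometric.\<close>
  define \<theta>1 where "\<theta>1 = (1 / 2 :: real) powr (1 - s)"
  define \<theta>2 where "\<theta>2 = (1 / 2 :: real) powr s"
  define \<alpha> where "\<alpha> i = (2 ^ Suc i) ^ ?n * (\<theta>1 ^ i * G L)" for i
  define \<gamma> where "\<gamma> i = (1 / 2 ^ i) ^ ?n * (\<theta>2 ^ i * G M)" for i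
  have \<theta>: "0 < \<theta>1" "\<theta>1 < 1" "0 < \<theta>2" "\<theta>2 < 1"
    using s powr_less_mono2[of "1 - s" "1/2" 1] powr_less_mono2[of s "1/2" 1]
    by (simp_all add: \<theta>1_def \<theta>2_def)
  have \<alpha>: "\<alpha> i \<ge> 0" for i using \<theta> by (simp add: \<alpha>_def G_nonneg)
  have \<gamma>: "\<gamma> i \<ge> 0" for i using \<theta> by (simp add: \<gamma>_def G_nonneg)
  define T where "T i = ballvol * 2 ^ ?n * (\<theta>1 ^ i * G L + \<theta>2 ^ i * G M)" for i
  have sT: "summable T" unfolding T_def
    using \<theta> by (intro summable_mult summable_add summable_mult2 summable_geometric) auto
  have T0: "T i \<ge> 0" for i using ballvol_pos \<theta> G_nonneg by (simp add: T_def)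
  have le: "(\<integral>\<^sup>+y. ennreal (1 / norm (x - y) ^ ?n) *
    ennreal (G (min (L * norm (x - y)) M / norm (x - y) powr s)) \<partial>lborel) \<le> ennreal (suminf T)" for x :: "real^'n"
  proof -
    define \<tau> where "\<tau> i y = ennreal (\<alpha> i) * indicator (ball x ((1 / 2) ^ i)) y +
       ennreal (\<gamma> i) * indicator (ball x (2 ^ Suc i)) y" for i y
    have [measurable]: "\<tau> i \<in> borel_measurable borel" for i
      unfolding \<tau>_def by (intro borel_measurable_add borel_measurable_times_ennreal
        borel_measurable_const borel_measurable_indicator) simp_all
    have pt: "ennreal (1 / norm (x - y) ^ ?n) * ennreal (G (min (L * norm (x - y)) M / norm (x - y) powr s)) \<le>
       (\<Sum>i. \<tau> i y)" for y
    proof -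
      define d where "d = norm (x - y)"
      have mn: "min (L * d) M / d powr s \<ge> 0" using LM by (simp add: d_def)
      have sumle: "\<tau> i y \<le> (\<Sum>i. \<tau> i y)" for i
        using sum_le_suminf[OF summableI, of "{i}" "\<lambda>i. \<tau> i y"] by simp
      have "ennreal (1 / d ^ ?n) * ennreal (G (min (L * d) M / d powr s)) \<le> (\<Sum>i. \<tau> i y)"
      proof -
        consider "d = 0" | "0 < d" "d < 1" | "d \<ge> 1" unfolding d_def by force
        then show ?thesis
        proof cases
          case 1 then show ?thesis by (simp add: G_0)
        next
          case 2
          then obtain i where i: "(1 / 2) ^ Suc i \<le> d" "d < (1 / 2) ^ i" by (rule dyadic_below)
          have "1 / d ^ ?n \<le> 1 / ((1 / 2) ^ Suc i) ^ ?n"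
            using i(1) 2 by (intro divide_left_mono power_mono mult_pos_pos zero_less_power) auto
          also have "\<dots> = (2 ^ Suc i) ^ ?n" by (simp add: power_one_over)
          finally have k: "1 / d ^ ?n \<le> (2 ^ Suc i) ^ ?n" .
          have m1: "min (L * d) M / d powr s \<le> L * (d / d powr s)"
            by (simp add: divide_right_mono)
          have "d / d powr s = d powr (1 - s)" using 2 by (simp add: powr_diff)
          also have "d powr (1 - s) \<le> ((1 / 2) ^ i) powr (1 - s)"
            using 2 i s by (intro powr_mono2) auto
          also have "((1 / 2) ^ i) powr (1 - s) = \<theta>1 ^ i"
            by (simp add: \<theta>1_def powr_realpow[symmetric] powr_powr mult.commute)
          finally have "L * (d / d powr s) \<le> L * \<theta>1 ^ i" using LM by (intro mult_left_mono)
          with m1 have "min (L * d) M / d powr s \<le> \<theta>1 ^ i * L" by (simp add: mult.commute)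
          then have "G (min (L * d) M / d powr s) \<le> G (\<theta>1 ^ i * L)" by (rule G_mono[OF mn])
          also have "\<dots> \<le> \<theta>1 ^ i * G L" using \<theta> by (intro G_contract) (auto intro: power_le_one)
          finally have "1 / d ^ ?n * G (min (L * d) M / d powr s) \<le> \<alpha> i"
            unfolding \<alpha>_def using k G_nonneg by (intro mult_mono) auto
          then have "ennreal (1 / d ^ ?n) * ennreal (G (min (L * d) M / d powr s)) \<le> ennreal (\<alpha> i)"
            using 2 G_nonneg by (simp add: ennreal_mult[symmetric] ennreal_leI)
          also have "\<dots> \<le> \<tau> i y" using i(2) by (simp add: \<tau>_def d_def dist_norm)
          finally show ?thesis using sumle by (rule order_trans)
        next
          case 3
          then obtain i where i: "2 ^ i \<le> d" "d < 2 ^ Suc i" by (rule dyadic_above)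
          have d0: "d > 0" using 3 by simp
          have "1 / d ^ ?n \<le> 1 / (2 ^ i) ^ ?n"
            using i(1) d0 by (intro divide_left_mono power_mono mult_pos_pos zero_less_power) auto
          then have k: "1 / d ^ ?n \<le> (1 / 2 ^ i) ^ ?n" by (simp add: power_one_over)
          have "min (L * d) M / d powr s \<le> M / d powr s"
            by (simp add: divide_right_mono)
          also have "\<dots> \<le> M / (2 ^ i) powr s"
            using d0 i s LM by (intro divide_left_mono powr_mono2 mult_pos_pos) auto
          also have "\<dots> = \<theta>2 ^ i * M"
            by (simp add: \<theta>2_def powr_realpow[symmetric] powr_powr powr_divide mult.commute)
          finally have "G (min (L * d) M / d powr s) \<le> G (\<theta>2 ^ i * M)" by (rule G_mono[OF mn])
          also have "\<dots> \<le> \<theta>2 ^ i * G M" using \<theta> by (intro G_contract) (auto intro: power_le_one)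
          finally have "1 / d ^ ?n * G (min (L * d) M / d powr s) \<le> \<gamma> i"
            unfolding \<gamma>_def using k G_nonneg by (intro mult_mono) auto
          then have "ennreal (1 / d ^ ?n) * ennreal (G (min (L * d) M / d powr s)) \<le> ennreal (\<gamma> i)"
            using 3 G_nonneg by (simp add: ennreal_mult[symmetric] ennreal_leI)
          also have "\<dots> \<le> \<tau> i y" using i(2) by (simp add: \<tau>_def d_def dist_norm)
          finally show ?thesis using sumle by (rule order_trans)
        qed
      qed
      then show ?thesis by (simp add: d_def)
    qed
    have "(\<integral>\<^sup>+y. ennreal (1 / norm (x - y) ^ ?n) *
      ennreal (G (min (L * norm (x - y)) M / norm (x - y) powr s)) \<partial>lborel) \<le> (\<integral>\<^sup>+y. (\<Sum>i. \<tau> i y) \<partial>lborel)"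
      by (intro nn_integral_mono pt)
    also have "\<dots> = (\<Sum>i. \<integral>\<^sup>+y. \<tau> i y \<partial>lborel)" by (rule nn_integral_suminf) simp
    also have "\<dots> = (\<Sum>i. ennreal (T i))"
    proof (intro suminf_cong)
      fix i
      have m: "(\<lambda>y. ennreal c * indicator (ball x a) y) \<in> borel_measurable lborel" for c a
        by (intro borel_measurable_times_ennreal borel_measurable_const borel_measurable_indicator) simp
      have "(\<integral>\<^sup>+y. \<tau> i y \<partial>lborel) = ennreal (\<alpha> i) * emeasure lborel (ball x ((1 / 2) ^ i)) +
         ennreal (\<gamma> i) * emeasure lborel (ball x (2 ^ Suc i))"
        unfolding \<tau>_def by (subst nn_integral_add[OF m m]) (simp add: nn_integral_cmult_indicator)
      also have "\<dots> = ennreal (\<alpha> i) * ennreal (ballvol * ((1 / 2) ^ i) ^ ?n) + ennreal (\<gamma> i) * ennreal (ballvol * (2 ^ Suc i) ^ ?n)"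
        by (simp add: emeasure_ball ballvol_def)
      also have "\<dots> = ennreal (\<alpha> i * (ballvol * ((1 / 2) ^ i) ^ ?n) + \<gamma> i * (ballvol * (2 ^ Suc i) ^ ?n))"
        using \<alpha>[of i] \<gamma>[of i] ballvol_pos by (simp add: ennreal_mult[symmetric] ennreal_plus[symmetric] del: ennreal_plus)
      also have "\<alpha> i * (ballvol * ((1 / 2) ^ i) ^ ?n) + \<gamma> i * (ballvol * (2 ^ Suc i) ^ ?n) = T i"
      proof -
        have e: "((2::real) ^ Suc i) ^ ?n * ((1 / 2) ^ i) ^ ?n = 2 ^ ?n"
          "(1 / 2 ^ i) ^ ?n * ((2::real) ^ Suc i) ^ ?n = 2 ^ ?n"
          unfolding power_mult_distrib[symmetric] by (simp_all add: power_one_over)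
        have "\<alpha> i * (ballvol * ((1 / 2) ^ i) ^ ?n) = ballvol * (((2::real) ^ Suc i) ^ ?n * ((1 / 2) ^ i) ^ ?n) * (\<theta>1 ^ i * G L)"
          unfolding \<alpha>_def by (simp only: ac_simps)
        moreover have "\<gamma> i * (ballvol * (2 ^ Suc i) ^ ?n) = ballvol * ((1 / 2 ^ i) ^ ?n * ((2::real) ^ Suc i) ^ ?n) * (\<theta>2 ^ i * G M)"
          unfolding \<gamma>_def by (simp only: ac_simps)
        ultimately show ?thesis unfolding e T_def by (simp only: distrib_left)
      qed
      finally show "(\<integral>\<^sup>+y. \<tau> i y \<partial>lborel) = ennreal (T i)" .
    qed
    also have "\<dots> = ennreal (suminf T)" using T0 sT by (rule suminf_ennreal2)
    finally show ?thesis .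
  qed
  then show ?thesis using suminf_nonneg[OF sT T0] by blast
qed

text \<open>Pairs with both points outside \<open>\<Omega>\<close> contribute nothing. For the
  others \<open>kernel_upper\<close> bounds the inner integral by a constant, and symmetry of the
  kernel allows the outer integration always to run over the bounded set
  \<open>\<Omega>\<close>.\<close>

lemma X_Lipschitz:
  assumes [measurable]: "\<phi> \<in> borel_measurable borel" and z: "\<And>x. x \<notin> \<Omega> \<Longrightarrow> \<phi> x = 0"
    and L: "\<And>x y. \<bar>\<phi> x - \<phi> y\<bar> \<le> L * norm (x - y)" "L \<ge> 0" and M: "\<And>x. \<bar>\<phi> x\<bar> \<le> M"
  shows "\<phi> \<in> X"
proof -
  let ?n = "CARD('n)"
  define \<kappa> where "\<kappa> = (\<lambda>(x :: real^'n, y). ennreal (1 / norm (x - y) ^ ?n) *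
    ennreal (G (min (L * norm (x - y)) (2 * M) / norm (x - y) powr s)))"
  have M0: "M \<ge> 0" using order_trans[OF abs_ge_zero M] .
  obtain K where K: "K \<ge> 0" "\<And>x. (\<integral>\<^sup>+y. \<kappa> (x, y) \<partial>lborel) \<le> ennreal K"
    using kernel_upper[OF L(2), of "2 * M"] M0 unfolding \<kappa>_def by auto
  have \<kappa>m: "\<kappa> \<in> borel_measurable borel" unfolding \<kappa>_def split_beta by measurable
  then have [measurable]: "\<kappa> \<in> borel_measurable (lborel \<Otimes>\<^sub>M lborel)" by (simp add: lborel_prod)
  have sym: "\<kappa> (x, y) = \<kappa> (y, x)" for x y by (simp add: \<kappa>_def norm_minus_commute)
  have "(\<integral>\<^sup>+q. ennreal (G (D \<phi> q)) \<partial>mub) =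
    (\<integral>\<^sup>+x. \<integral>\<^sup>+y. ennreal (1 / norm (x - y) ^ ?n) * ennreal (G (D \<phi> (x, y))) \<partial>lborel \<partial>lborel)"
    by (rule nn_integral_mub) measurable
  also have "\<dots> \<le> (\<integral>\<^sup>+x. \<integral>\<^sup>+y. indicator \<Omega> x * \<kappa> (x, y) + indicator \<Omega> y * \<kappa> (x, y) \<partial>lborel \<partial>lborel)"
  proof (intro nn_integral_mono)
    fix x y :: "real^'n"
    have "\<bar>\<phi> x - \<phi> y\<bar> \<le> 2 * M" using M[of x] M[of y] by linarith
    then have "\<bar>D \<phi> (x, y)\<bar> \<le> min (L * norm (x - y)) (2 * M) / norm (x - y) powr s"
      using L(1)[of x y] by (simp add: hoelder_quotient_def abs_divide divide_right_mono)
    then have "G (D \<phi> (x, y)) \<le> G (min (L * norm (x - y)) (2 * M) / norm (x - y) powr s)"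
      by (intro G_mono_abs order_trans[OF _ abs_ge_self])
    then have le: "ennreal (1 / norm (x - y) ^ ?n) * ennreal (G (D \<phi> (x, y))) \<le> \<kappa> (x, y)"
      unfolding \<kappa>_def by (auto intro!: mult_left_mono ennreal_leI)
    show "ennreal (1 / norm (x - y) ^ ?n) * ennreal (G (D \<phi> (x, y))) \<le>
      indicator \<Omega> x * \<kappa> (x, y) + indicator \<Omega> y * \<kappa> (x, y)"
    proof (cases "x \<in> \<Omega> \<or> y \<in> \<Omega>")
      case True
      then show ?thesis using le by (auto simp: indicator_def intro: order_trans add_increasing2)
    qed (use z in \<open>auto simp: hoelder_quotient_def G_0\<close>)
  qed
  also have "\<dots> = (\<integral>\<^sup>+x. indicator \<Omega> x * (\<integral>\<^sup>+y. \<kappa> (x, y) \<partial>lborel) + (\<integral>\<^sup>+y. indicator \<Omega> y * \<kappa> (x, y) \<partial>lborel) \<partial>lborel)"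
    by (subst nn_integral_add) (auto simp: nn_integral_cmult)
  also have "\<dots> = (\<integral>\<^sup>+x. indicator \<Omega> x * (\<integral>\<^sup>+y. \<kappa> (x, y) \<partial>lborel) \<partial>lborel) +
      (\<integral>\<^sup>+x. \<integral>\<^sup>+y. indicator \<Omega> y * \<kappa> (x, y) \<partial>lborel \<partial>lborel)"
    by (rule nn_integral_add) measurable
  also have "(\<integral>\<^sup>+x. \<integral>\<^sup>+y. indicator \<Omega> y * \<kappa> (x, y) \<partial>lborel \<partial>lborel) =
      (\<integral>\<^sup>+y. \<integral>\<^sup>+x. indicator \<Omega> y * \<kappa> (x, y) \<partial>lborel \<partial>lborel)"
    by (rule lborel_pair.Fubini'[symmetric]) measurable
  also have "\<dots> = (\<integral>\<^sup>+y. indicator \<Omega> y * (\<integral>\<^sup>+x. \<kappa> (x, y) \<partial>lborel) \<partial>lborel)"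
    by (intro nn_integral_cong) (auto simp: nn_integral_cmult)
  also have "\<dots> = (\<integral>\<^sup>+x. indicator \<Omega> x * (\<integral>\<^sup>+y. \<kappa> (x, y) \<partial>lborel) \<partial>lborel)"
    by (subst sym) (rule refl)
  also have "(\<integral>\<^sup>+x. indicator \<Omega> x * (\<integral>\<^sup>+y. \<kappa> (x, y) \<partial>lborel) \<partial>lborel) \<le> (\<integral>\<^sup>+x. ennreal K * indicator \<Omega> x \<partial>lborel)"
    by (intro nn_integral_mono) (use K in \<open>auto simp: indicator_def\<close>)
  also have "(\<integral>\<^sup>+x. ennreal K * indicator \<Omega> x \<partial>lborel) = ennreal K * ennreal V"
    by (simp add: nn_integral_cmult emeasure_\<Omega>)
  finally have le: "(\<integral>\<^sup>+q. ennreal (G (D \<phi> q)) \<partial>mub) \<le> ennreal K * ennreal V + ennreal K * ennreal V"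
    by (auto intro: order_trans add_mono)
  have "integrable mub (\<lambda>q. G (D \<phi> q))"
  proof (rule integrableI_bounded)
    show "(\<integral>\<^sup>+q. ennreal (norm (G (D \<phi> q))) \<partial>mub) < \<infinity>"
      using le by (simp add: G_nonneg) (auto simp: ennreal_mult_less_top intro: le_less_trans)
  qed measurable
  then show ?thesis using z by (simp add: X_def)
qed

end

section \<open>The energy functional\<close>

text \<open>As \<open>min t 0\<close> keeps its sign, \<open>T a b u\<close> is
  \<open>a u\<^sub>+ - b u\<^sub>-\<close>; in particular \<open>T 0 1 u\<close> is
  \<open>- u\<^sub>-\<close>.\<close>

definition tw :: "real \<Rightarrow> real \<Rightarrow> real \<Rightarrow> real" where
  "tw a b t = a * max t 0 + b * min t 0"

definition T :: "real \<Rightarrow> real \<Rightarrow> ('a \<Rightarrow> real) \<Rightarrow> 'a \<Rightarrow> real" where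
  "T a b u = (\<lambda>x. tw a b (u x))"

lemma tw_pos: "t \<ge> 0 \<Longrightarrow> tw a b t = a * t" and tw_neg: "t \<le> 0 \<Longrightarrow> tw a b t = b * t"
  by (auto simp: tw_def max_def min_def)

lemma tw_add: "tw a b t + tw c d t = tw (a + c) (b + d) t"
  by (simp add: tw_def algebra_simps)

lemma tw_tw: "a \<ge> 0 \<Longrightarrow> b \<ge> 0 \<Longrightarrow> tw c d (tw a b t) = tw (c * a) (d * b) t"
  by (cases "t \<ge> 0") (auto simp: tw_pos tw_neg mult_nonneg_nonpos)

lemma T_T: "a \<ge> 0 \<Longrightarrow> b \<ge> 0 \<Longrightarrow> T c d (T a b u) = T (c * a) (d * b) u"
  by (simp add: T_def tw_tw)

lemma T_1 [simp]: "T 1 1 u = u"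
  by (auto simp: T_def tw_def max_def min_def fun_eq_iff)

lemma T_nonneg: "(\<And>x. u x \<ge> 0) \<Longrightarrow> T a b u = (\<lambda>x. a * u x)"
  by (simp add: T_def tw_pos)

lemma tw_mono: "0 \<le> a \<Longrightarrow> a \<le> c \<Longrightarrow> 0 \<le> b \<Longrightarrow> b \<le> d \<Longrightarrow> x \<le> y \<Longrightarrow> tw a b y - tw a b x \<le> tw c d y - tw c d x"
proof -
  assume *: "0 \<le> a" "a \<le> c" "0 \<le> b" "b \<le> d" "x \<le> y"
  have "a * (max y 0 - max x 0) \<le> c * (max y 0 - max x 0)" "b * (min y 0 - min x 0) \<le> d * (min y 0 - min x 0)"
    using * by (intro mult_right_mono; simp)+
  then show ?thesis by (simp add: tw_def algebra_simps)
qed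

lemma tw_lipschitz:
  assumes "\<bar>a\<bar> \<le> c" "\<bar>b\<bar> \<le> c" shows "\<bar>tw a b x - tw a b y\<bar> \<le> c * \<bar>x - y\<bar>"
proof -
  have "\<bar>tw a b x - tw a b y\<bar> \<le> \<bar>a\<bar> * \<bar>max x 0 - max y 0\<bar> + \<bar>b\<bar> * \<bar>min x 0 - min y 0\<bar>"
    using abs_triangle_ineq[of "a * (max x 0 - max y 0)" "b * (min x 0 - min y 0)"]
    by (simp add: tw_def algebra_simps flip: abs_mult)
  also have "\<dots> \<le> c * \<bar>max x 0 - max y 0\<bar> + c * \<bar>min x 0 - min y 0\<bar>"
    using assms by (intro add_mono mult_right_mono) auto
  also have "\<dots> = c * \<bar>x - y\<bar>"
    unfolding distrib_left[symmetric] by (rule arg_cong[where f = "(*) c"]) (auto simp: max_def min_def)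
  finally show ?thesis .
qed

lemma tw_0 [simp]: "tw a b 0 = 0" by (simp add: tw_def)

lemma T_borel [measurable]: "u \<in> borel_measurable M \<Longrightarrow> T a b u \<in> borel_measurable M"
proof -
  assume [measurable]: "u \<in> borel_measurable M"
  have "T a b u = (\<lambda>x. a * max (u x) 0 - b * max (- u x) 0)"
    by (auto simp: T_def tw_def max_def min_def fun_eq_iff)
  then show ?thesis by simp
qed

text \<open>This is the nonlinearity after its modification on a null set and outside
  \<open>\<Omega>\<close>. \<open>f_lower\<close> can hold only almost everywhere in
  \<open>\<Omega>\<close>, since the modified function is zero elsewhere. Stating
  \<open>f_scale\<close> for \<open>f x t * t\<close> covers positive and negative \<open>t\<close>
  at once.\<close>

locale nehari = frac_orlicz \<Omega> s p r Q G g B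
  for \<Omega> :: "(real^'n) set" and s p r Q G g B +
  fixes f :: "real^'n \<Rightarrow> real \<Rightarrow> real" and q c1 c4 :: real
  assumes f_meas: "(\<lambda>(x, t). f x t) \<in> borel_measurable (lebesgue \<Otimes>\<^sub>M borel)"
    and f_cont: "\<And>x. continuous_on UNIV (f x)"
    and f_mono: "\<And>x. mono (f x)"
    and f_0: "\<And>x. f x 0 = 0"
    and f_upper: "\<And>x t. f x t * t \<le> c4 * B t"
    and f_lower: "AE x in lebesgue. x \<in> \<Omega> \<longrightarrow> (\<forall>t. c1 * B t \<le> f x t * t)"
    and f_scale: "\<And>x l t. l \<ge> 1 \<Longrightarrow> l powr q * (f x t * t) \<le> f x (l * t) * (l * t)"
    and c14: "c1 > 0" "c4 > 0" and pq: "p < q"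
begin

lemma f_scale_le:
  assumes "0 < l" "l \<le> 1" shows "f x (l * t) * (l * t) \<le> l powr q * (f x t * t)"
proof -
  have "(1 / l) powr q * (f x (l * t) * (l * t)) \<le> f x t * t"
    using f_scale[of "1 / l" x "l * t"] assms by simp
  then show ?thesis using assms by (simp add: powr_divide field_simps)
qed

section \<open>The primitive of the nonlinearity\<close>

definition F :: "real^'n \<Rightarrow> real \<Rightarrow> real" where "F x t = (LBINT \<tau>=0..t. f x \<tau>)"

lemma F_deriv: "(F x has_real_derivative f x t) (at t)"
proof -
  have "((\<lambda>u. LBINT y=0..u. f x y) has_vector_derivative f x t) (at t within {min 0 t - 1..max 0 t + 1})"
    using continuous_on_subset[OF f_cont]
      interval_integral_FTC2[of "min 0 t - 1" 0 "max 0 t + 1" "f x" t] by (simp add: zero_ereal_def)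
  then have "((\<lambda>u. LBINT y=0..u. f x y) has_vector_derivative f x t) (at t)"
    by (subst (asm) at_within_Icc_at) auto
  then show ?thesis
    unfolding F_def has_real_derivative_iff_has_vector_derivative .
qed

lemma F_0: "F x 0 = 0" by (simp add: F_def zero_ereal_def)

lemma F_cont: "continuous_on UNIV (F x)"
  using F_deriv DERIV_isCont by (blast intro: continuous_at_imp_continuous_on)

lemma F_convex: "F x a + f x a * (b - a) \<le> F x b"
proof -
  consider "a = b" | "a < b" | "b < a" by linarith
  then show ?thesis
  proof cases
    case 2
    then obtain z where z: "a < z" "z < b" "F x b - F x a = (b - a) * f x z"
      using MVT2[of a b "F x" "f x"] F_deriv by blast
    have "(b - a) * f x a \<le> (b - a) * f x z" using 2 z monoD[OF f_mono] by (intro mult_left_mono) auto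
    then show ?thesis using z by (simp add: algebra_simps)
  next
    case 3
    then obtain z where z: "b < z" "z < a" "F x a - F x b = (a - b) * f x z"
      using MVT2[of b a "F x" "f x"] F_deriv by blast
    have "(a - b) * f x z \<le> (a - b) * f x a" using 3 z monoD[OF f_mono] by (intro mult_left_mono) auto
    then show ?thesis using z by (simp add: algebra_simps)
  qed simp
qed

lemma F_nonneg: "F x t \<ge> 0"
  using F_convex[of x 0 t] by (simp add: F_0 f_0)

lemma F_le_f: "F x t \<le> f x t * t"
  using F_convex[of x t 0] by (simp add: F_0)

lemma F_upper: "F x t \<le> c4 * B t"
  using F_le_f f_upper order_trans by blast

lemma F_abs: "\<bar>F x t\<bar> \<le> c4 * B t"
  using F_upper F_nonneg by simp

text \<open>The supporting line of \<open>F x\<close> at \<open>t / 2\<close> gives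
  \<open>f x (t / 2) * (t / 2) \<le> F x t\<close>, and doubling returns from
  \<open>B (t / 2)\<close> to \<open>B t\<close>.\<close>

lemma F_lower:
  assumes "\<forall>t. c1 * B t \<le> f x t * t" shows "c1 / Q * B t \<le> F x t"
proof -
  have "c1 * B t \<le> c1 * (Q * B (t / 2))"
    using B_double[of "\<bar>t\<bar> / 2"] c14 B_abs[of t] B_abs[of "t / 2"] by (intro mult_left_mono) auto
  also have "\<dots> = Q * (c1 * B (t / 2))" by simp
  also have "\<dots> \<le> Q * (f x (t / 2) * (t / 2))"
    using spec[OF assms, of "t / 2"] Q by (intro mult_left_mono) auto
  also have "\<dots> \<le> Q * F x t"
    using F_convex[of x "t / 2" t] F_nonneg[of x "t / 2"] Q by (intro mult_left_mono) auto
  finally show ?thesis using Q by (simp add: field_simps)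
qed

text \<open>The Ambrosetti-Rabinowitz inequality. Along the segment from 0 to \<open>t\<close>,
  \<open>f_scale_le\<close> makes \<open>\<theta> powr q * c - q * F x (\<theta> * t)\<close>
  nondecreasing in \<open>\<theta>\<close>, and this difference tends to 0 at 0.\<close>

lemma F_AR: "q * F x t \<le> f x t * t"
proof -
  define c where "c = f x t * t"
  have q: "q > 1" using p pq by simp
  define h where "h \<theta> = \<theta> powr q * c - q * F x (\<theta> * t)" for \<theta>
  have inc: "h e \<le> h 1" if "0 < e" "e \<le> 1" for e
  proof (rule DERIV_nonneg_imp_nondecreasing[OF that(2)])
    fix \<theta> :: real assume \<theta>: "e \<le> \<theta>" "\<theta> \<le> 1"
    then have pos: "\<theta> > 0" using that by simp
    have "((\<lambda>\<theta>. F x (\<theta> * t)) has_real_derivative f x (\<theta> * t) * t) (at \<theta>)"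
      by (rule DERIV_chain2[OF F_deriv]) (auto intro!: derivative_eq_intros)
    then have "(h has_real_derivative q * \<theta> powr (q - 1) * c - q * (f x (\<theta> * t) * t)) (at \<theta>)"
      unfolding h_def using pos by (auto intro!: derivative_eq_intros)
    moreover have "f x (\<theta> * t) * t \<le> \<theta> powr (q - 1) * c"
    proof -
      have "\<theta> * (f x (\<theta> * t) * t) \<le> \<theta> powr q * c"
        using f_scale_le[OF pos \<theta>(2), of x t] by (simp add: c_def ac_simps)
      also have "\<dots> = \<theta> * (\<theta> powr (q - 1) * c)" using pos by (simp add: powr_diff)
      finally show ?thesis using pos by simp
    qed
    then have "q * (f x (\<theta> * t) * t) \<le> q * (\<theta> powr (q - 1) * c)" using q by (intro mult_left_mono) auto
    ultimately show "\<exists>y. (h has_real_derivative y) (at \<theta>) \<and> 0 \<le> y" by (force simp: mult.assoc)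
  qed
  have "((\<lambda>\<theta>. F x (\<theta> * t)) \<longlongrightarrow> F x (0 * t)) (at_right 0)"
    by (rule continuous_on_tendsto_compose[OF F_cont]) (auto intro!: tendsto_eq_intros)
  moreover have "((\<lambda>\<theta>. \<theta> powr q * c) \<longlongrightarrow> 0) (at_right 0)"
    using q by real_asymp
  ultimately have "((\<lambda>\<theta>. \<theta> powr q * c - q * F x (\<theta> * t)) \<longlongrightarrow> 0 - q * F x (0 * t)) (at_right 0)"
    by (intro tendsto_diff tendsto_mult_left)
  then have "(h \<longlongrightarrow> 0) (at_right 0)" unfolding h_def by (simp add: F_0)
  moreover have "eventually (\<lambda>e. h e \<le> h 1) (at_right 0)"
    unfolding eventually_at_right_field using inc by (intro exI[of _ 1]) auto
  ultimately have "0 \<le> h 1" by (intro tendsto_upperbound) auto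
  then show ?thesis by (simp add: h_def c_def)
qed

lemma F_meas: "(\<lambda>(x, t). F x t) \<in> borel_measurable (lebesgue \<Otimes>\<^sub>M borel)"
proof -
  \<comment> \<open>Signed indicators turn the oriented integral into one over a fixed domain, where
    measurability of parameter integrals applies. The indicators overlap only for
    \<open>t = 0\<close> and \<open>\<tau> = 0\<close>, and there \<open>f_0\<close> makes the
    integrand vanish.\<close>
  have Feq: "F x t = (\<integral>\<tau>. ((if 0 \<le> \<tau> \<and> \<tau> \<le> t then 1 else 0) - (if t \<le> \<tau> \<and> \<tau> \<le> 0 then 1 else 0)) * f x \<tau> \<partial>lborel)"
    for x t
  proof (cases "t \<ge> 0")
    case True
    have "F x t = (LINT \<tau>:{0..t}|lborel. f x \<tau>)"
      unfolding F_def using True interval_integral_Icc[of 0 t "f x"] by (simp add: zero_ereal_def)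
    also have "\<dots> = (\<integral>\<tau>. ((if 0 \<le> \<tau> \<and> \<tau> \<le> t then 1 else 0) - (if t \<le> \<tau> \<and> \<tau> \<le> 0 then 1 else 0)) * f x \<tau> \<partial>lborel)"
      unfolding set_lebesgue_integral_def using True f_0
      by (intro Bochner_Integration.integral_cong refl) (auto simp: indicator_def)
    finally show ?thesis .
  next
    case False
    have "F x t = - (LINT \<tau>:{t..0}|lborel. f x \<tau>)"
      unfolding F_def using False interval_integral_Icc[of t 0 "f x"]
        interval_integral_endpoints_reverse[of 0 "ereal t" "f x"] by (simp add: zero_ereal_def)
    also have "\<dots> = (\<integral>\<tau>. ((if 0 \<le> \<tau> \<and> \<tau> \<le> t then 1 else 0) - (if t \<le> \<tau> \<and> \<tau> \<le> 0 then 1 else 0)) * f x \<tau> \<partial>lborel)"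
      unfolding set_lebesgue_integral_def using False f_0
      by (subst Bochner_Integration.integral_minus[symmetric])
        (intro Bochner_Integration.integral_cong refl, auto simp: indicator_def)
    finally show ?thesis .
  qed
  have [measurable]: "(\<lambda>z. f (fst (fst z)) (snd z)) \<in> borel_measurable ((lebesgue \<Otimes>\<^sub>M borel) \<Otimes>\<^sub>M lborel)"
    using measurable_compose[OF _ f_meas, of "\<lambda>z. (fst (fst z), snd z)" "(lebesgue \<Otimes>\<^sub>M borel) \<Otimes>\<^sub>M lborel"]
    by (simp add: split_beta)
  show ?thesis
    unfolding split_beta Feq
    by (rule lborel.borel_measurable_lebesgue_integral) (simp add: split_beta)
qed

section \<open>The functionals and their formal derivatives\<close>

definition \<Phi> :: "(real^'n \<Rightarrow> real) \<Rightarrow> real" where "\<Phi> u = (\<integral>x. F x (u x) \<partial>lebesgue)"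
definition J :: "(real^'n \<Rightarrow> real) \<Rightarrow> real" where "J u = A u - \<Phi> u"
text \<open>\<open>gA u v\<close> and \<open>fv u v\<close> are the formal derivatives of
  \<open>A\<close> and \<open>\<Phi>\<close> at \<open>u\<close> in direction \<open>v\<close>; the
  weak equation reads \<open>gA u v = fv u v\<close>. By convexity they act as subgradients.\<close>

definition gA :: "(real^'n \<Rightarrow> real) \<Rightarrow> (real^'n \<Rightarrow> real) \<Rightarrow> real" where
  "gA u v = (\<integral>z. g (D u z) * D v z \<partial>mub)"
definition fv :: "(real^'n \<Rightarrow> real) \<Rightarrow> (real^'n \<Rightarrow> real) \<Rightarrow> real" where
  "fv u v = (\<integral>x. f x (u x) * v x \<partial>lebesgue)"

lemma g_abs: "\<bar>g t\<bar> = g \<bar>t\<bar>"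
  using g_odd[of t] g_nonneg[of "\<bar>t\<bar>"] by (cases "t \<ge> 0") auto

text \<open>One majorant \<open>m\<close> for both factors replaces Young's inequality with the
  conjugate N-function, because \<open>m * g m \<le> p * G m\<close>.\<close>

lemma g_product_le:
  assumes "\<bar>a\<bar> \<le> m" "\<bar>b\<bar> \<le> m" shows "\<bar>g a * b\<bar> \<le> p * G m"
proof -
  have "\<bar>g a * b\<bar> = g \<bar>a\<bar> * \<bar>b\<bar>" by (simp add: abs_mult g_abs)
  also have "\<dots> \<le> g m * m" using assms g_mono[of "\<bar>a\<bar>" m] g_nonneg[of "\<bar>a\<bar>"]
      g_nonneg[of m] by (intro mult_mono) auto
  also have "\<dots> \<le> p * G m" using g_bound[of m] assms by (simp add: mult.commute)
  finally show ?thesis .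
qed

text \<open>Monotonicity and \<open>f x 0 = 0\<close> give
  \<open>\<bar>f x a\<bar> \<le> f x m - f x (- m)\<close>, and multiplication by \<open>m\<close>
  leaves two instances of \<open>f_upper\<close>.\<close>

lemma f_product_le:
  assumes "\<bar>a\<bar> \<le> m" "\<bar>b\<bar> \<le> m" shows "\<bar>f x a * b\<bar> \<le> 2 * c4 * B m"
proof -
  have m: "m \<ge> 0" using assms by simp
  have "f x a \<le> f x m" "f x (- m) \<le> f x a" "f x 0 \<le> f x m" "f x (- m) \<le> f x 0"
    using assms m by (auto intro!: monoD[OF f_mono])
  then have "\<bar>f x a\<bar> \<le> f x m - f x (- m)" using f_0[of x] by linarith
  then have "\<bar>f x a\<bar> * \<bar>b\<bar> \<le> (f x m - f x (- m)) * m" using assms m by (intro mult_mono) auto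
  also have "\<dots> = f x m * m + f x (- m) * (- m)" by (simp add: algebra_simps)
  also have "\<dots> \<le> 2 * c4 * B m" using f_upper[of x m] f_upper[of x "- m"] B_even by simp
  finally show ?thesis by (simp add: abs_mult)
qed

lemma f_compose: "u \<in> borel_measurable lebesgue \<Longrightarrow> (\<lambda>x. f x (u x)) \<in> borel_measurable lebesgue"
  by (rule Caratheodory_compose[OF f_meas])

lemma F_compose: "u \<in> borel_measurable lebesgue \<Longrightarrow> (\<lambda>x. F x (u x)) \<in> borel_measurable lebesgue"
  by (rule Caratheodory_compose[OF F_meas])

lemma integrable_gA:
  assumes "u \<in> X" "v \<in> X" shows "integrable mub (\<lambda>z. g (D u z) * D v z)"
proof -
  note [measurable] = X_borel[OF assms(1)] X_borel[OF assms(2)]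
  show ?thesis
  proof (rule Bochner_Integration.integrable_bound[of mub "\<lambda>z. p * G (1 * \<bar>D u z\<bar> + 1 * \<bar>D v z\<bar>)"])
    show "integrable mub (\<lambda>z. p * G (1 * \<bar>D u z\<bar> + 1 * \<bar>D v z\<bar>))"
      using integrable_G_sum[OF assms, of 1 1] by simp
    show "AE z in mub. norm (g (D u z) * D v z) \<le> norm (p * G (1 * \<bar>D u z\<bar> + 1 * \<bar>D v z\<bar>))"
    proof (rule AE_I2)
      fix z
      show "norm (g (D u z) * D v z) \<le> norm (p * G (1 * \<bar>D u z\<bar> + 1 * \<bar>D v z\<bar>))"
        using g_product_le[of "D u z" "\<bar>D u z\<bar> + \<bar>D v z\<bar>" "D v z"] by simp
    qed
  qed measurable
qed

lemma integrable_B_sum: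
  assumes "u \<in> X" "v \<in> X" shows "integrable lebesgue (\<lambda>x. B (2 * (\<bar>u x\<bar> + \<bar>v x\<bar>)))"
proof -
  note [measurable] = X_lebesgue[OF assms(1)] X_lebesgue[OF assms(2)]
  show ?thesis
  proof (rule Bochner_Integration.integrable_bound[of lebesgue "\<lambda>x. Q * (Q * (B (u x) + B (v x)))"])
    show "integrable lebesgue (\<lambda>x. Q * (Q * (B (u x) + B (v x))))"
      using integrable_B assms by simp
    show "AE x in lebesgue. norm (B (2 * (\<bar>u x\<bar> + \<bar>v x\<bar>))) \<le> norm (Q * (Q * (B (u x) + B (v x))))"
    proof (rule AE_I2)
      fix x
      have "B (2 * (\<bar>u x\<bar> + \<bar>v x\<bar>)) \<le> Q * B (\<bar>u x\<bar> + \<bar>v x\<bar>)" by (rule B_double) simp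
      also have "\<dots> \<le> Q * (Q * (B (u x) + B (v x)))"
        using B_add[of "\<bar>u x\<bar>" "\<bar>v x\<bar>"] Q by (intro mult_left_mono) (auto simp: B_abs)
      finally show "norm (B (2 * (\<bar>u x\<bar> + \<bar>v x\<bar>))) \<le> norm (Q * (Q * (B (u x) + B (v x))))"
        by (simp add: B_nonneg)
    qed
  qed measurable
qed

lemma integrable_fv:
  assumes "u \<in> X" "v \<in> X" shows "integrable lebesgue (\<lambda>x. f x (u x) * v x)"
proof -
  note [measurable] = X_lebesgue[OF assms(1)] X_lebesgue[OF assms(2)] f_compose[OF X_lebesgue[OF assms(1)]]
  show ?thesis
  proof (rule Bochner_Integration.integrable_bound[of lebesgue "\<lambda>x. 2 * c4 * B (2 * (\<bar>u x\<bar> + \<bar>v x\<bar>))"])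
    show "integrable lebesgue (\<lambda>x. 2 * c4 * B (2 * (\<bar>u x\<bar> + \<bar>v x\<bar>)))"
      using integrable_B_sum[OF assms] by simp
    show "AE x in lebesgue. norm (f x (u x) * v x) \<le> norm (2 * c4 * B (2 * (\<bar>u x\<bar> + \<bar>v x\<bar>)))"
    proof (rule AE_I2)
      fix x
      have "\<bar>f x (u x) * v x\<bar> \<le> 2 * c4 * B (2 * (\<bar>u x\<bar> + \<bar>v x\<bar>))" by (rule f_product_le) auto
      then show "norm (f x (u x) * v x) \<le> norm (2 * c4 * B (2 * (\<bar>u x\<bar> + \<bar>v x\<bar>)))" by simp
    qed
  qed measurable
qed

lemma integrable_F:
  assumes "u \<in> X" shows "integrable lebesgue (\<lambda>x. F x (u x))"
  by (rule Bochner_Integration.integrable_bound[of lebesgue "\<lambda>x. c4 * B (u x)"])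
    (use integrable_B[OF assms] F_compose[OF X_lebesgue[OF assms]] F_abs order_trans[OF F_abs abs_ge_self] in auto)

lemma gA_le:
  assumes "u \<in> X" "v \<in> X" "u' \<in> X" "v' \<in> X" "\<And>z. g (D u z) * D v z \<le> c * (g (D u' z) * D v' z)"
  shows "gA u v \<le> c * gA u' v'"
proof -
  have "gA u v \<le> (\<integral>z. c * (g (D u' z) * D v' z) \<partial>mub)"
    unfolding gA_def using integrable_gA assms by (intro integral_mono) auto
  then show ?thesis by (simp add: gA_def)
qed

lemma fv_le:
  assumes "u \<in> X" "v \<in> X" "u' \<in> X" "v' \<in> X" "\<And>x. f x (u x) * v x \<le> c * (f x (u' x) * v' x)"
  shows "fv u v \<le> c * fv u' v'"
proof -
  have "fv u v \<le> (\<integral>x. c * (f x (u' x) * v' x) \<partial>lebesgue)"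
    unfolding fv_def using integrable_fv assms by (intro integral_mono) auto
  then show ?thesis by (simp add: fv_def)
qed

lemma gA_lin: "u \<in> X \<Longrightarrow> v \<in> X \<Longrightarrow> w \<in> X \<Longrightarrow> gA u (\<lambda>x. a * v x + b * w x) = a * gA u v + b * gA u w"
  using integrable_gA[of u v] integrable_gA[of u w]
  by (simp add: gA_def D_lin distrib_left mult.left_commute)

lemma fv_lin: "u \<in> X \<Longrightarrow> v \<in> X \<Longrightarrow> w \<in> X \<Longrightarrow> fv u (\<lambda>x. a * v x + b * w x) = a * fv u v + b * fv u w"
  using integrable_fv[of u v] integrable_fv[of u w]
  by (simp add: fv_def distrib_left mult.left_commute)

lemma A_subgradient:
  assumes "u \<in> X" "h \<in> X" shows "A u + gA u h \<le> A (\<lambda>x. u x + h x)"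
proof -
  have X: "(\<lambda>x. u x + h x) \<in> X" using X_lin[OF assms, of 1 1] by simp
  have "A u + gA u h = (\<integral>z. G (D u z) + g (D u z) * D h z \<partial>mub)"
    using X_integrable[OF assms(1)] integrable_gA[OF assms] by (simp add: A_def gA_def)
  also have "\<dots> \<le> A (\<lambda>x. u x + h x)"
    unfolding A_def
  proof (rule integral_mono)
    fix z
    show "G (D u z) + g (D u z) * D h z \<le> G (D (\<lambda>x. u x + h x) z)"
      using G_subgradient[of "D u z" "D (\<lambda>x. u x + h x) z"] D_lin[of 1 u 1 h z] by simp
  qed (use X_integrable[OF assms(1)] integrable_gA[OF assms] X_integrable[OF X] in auto)
  finally show ?thesis .
qed

lemma \<Phi>_subgradient:
  assumes "u \<in> X" "h \<in> X" shows "\<Phi> u + fv u h \<le> \<Phi> (\<lambda>x. u x + h x)"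
proof -
  have X: "(\<lambda>x. u x + h x) \<in> X" using X_lin[OF assms, of 1 1] by simp
  have "\<Phi> u + fv u h = (\<integral>x. F x (u x) + f x (u x) * h x \<partial>lebesgue)"
    using integrable_F[OF assms(1)] integrable_fv[OF assms] by (simp add: \<Phi>_def fv_def)
  also have "\<dots> \<le> \<Phi> (\<lambda>x. u x + h x)"
    unfolding \<Phi>_def
  proof (rule integral_mono)
    fix x
    show "F x (u x) + f x (u x) * h x \<le> F x (u x + h x)" using F_convex[of x "u x" "u x + h x"] by simp
  qed (use integrable_F[OF assms(1)] integrable_fv[OF assms] integrable_F[OF X] in auto)
  finally show ?thesis .
qed

lemma T_D:
  assumes "\<bar>a\<bar> \<le> c" "\<bar>b\<bar> \<le> c" shows "\<bar>D (T a b u) z\<bar> \<le> c * \<bar>D u z\<bar>"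
proof -
  obtain x y where z: "z = (x, y)" by fastforce
  have "\<bar>tw a b (u x) - tw a b (u y)\<bar> / norm (x - y) powr s \<le> c * \<bar>u x - u y\<bar> / norm (x - y) powr s"
    by (intro divide_right_mono tw_lipschitz assms) simp
  then show ?thesis by (simp add: z hoelder_quotient_def T_def abs_divide)
qed

lemma T_X:
  assumes "u \<in> X" shows "T a b u \<in> X" "A (T a b u) \<le> max 1 (max \<bar>a\<bar> \<bar>b\<bar>) powr p * A u"
proof -
  note [measurable] = X_borel[OF assms]
  have "\<bar>D (T a b u) z\<bar> \<le> \<bar>max \<bar>a\<bar> \<bar>b\<bar> * D u z\<bar>" for z
    using T_D[of a "max \<bar>a\<bar> \<bar>b\<bar>" b u z] by (simp add: abs_mult)
  moreover have "T a b u x = 0" if "x \<notin> \<Omega>" for x using X_zero[OF assms that] by (simp add: T_def)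
  ultimately show "T a b u \<in> X" "A (T a b u) \<le> max 1 (max \<bar>a\<bar> \<bar>b\<bar>) powr p * A u"
    using X_contract[OF assms, of "T a b u" "max \<bar>a\<bar> \<bar>b\<bar>"] T_borel[OF X_borel[OF assms]] by auto
qed

lemma A_part_le: "u \<in> X \<Longrightarrow> \<bar>a\<bar> \<le> 1 \<Longrightarrow> \<bar>b\<bar> \<le> 1 \<Longrightarrow> A (T a b u) \<le> A u"
  using T_X(2)[of u a b] by (simp add: max_def split: if_splits)

text \<open>Parameter families dominated by two fixed members \<open>w\<close> and \<open>v\<close>
  of \<open>X\<close>: all integrals along such a family share one integrable majorant, so the
  functionals depend continuously on the parameter. The factor 2 leaves room for the coefficients in
  \<open>{0..2}\<close> of the deformation.\<close>

definition fam :: "'a::metric_space set \<Rightarrow> (real^'n \<Rightarrow> real) \<Rightarrow> (real^'n \<Rightarrow> real) \<Rightarrow> ('a \<Rightarrow> real^'n \<Rightarrow> real) \<Rightarrow> bool" where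
  "fam S w v z \<longleftrightarrow> w \<in> X \<and> v \<in> X \<and> (\<forall>\<theta>\<in>S. z \<theta> \<in> X) \<and> (\<forall>x. continuous_on S (\<lambda>\<theta>. z \<theta> x)) \<and>
     (\<forall>\<theta>\<in>S. \<forall>y. \<bar>D (z \<theta>) y\<bar> \<le> 2 * (\<bar>D w y\<bar> + \<bar>D v y\<bar>)) \<and>
     (\<forall>\<theta>\<in>S. \<forall>x. \<bar>z \<theta> x\<bar> \<le> 2 * (\<bar>w x\<bar> + \<bar>v x\<bar>))"

lemma fam_D: "fam S w v z \<Longrightarrow> \<theta> \<in> S \<Longrightarrow> \<bar>D (z \<theta>) y\<bar> \<le> 2 * \<bar>D w y\<bar> + 2 * \<bar>D v y\<bar>"
  unfolding fam_def by (metis distrib_left)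

lemma fam_abs: "fam S w v z \<Longrightarrow> \<theta> \<in> S \<Longrightarrow> \<bar>z \<theta> x\<bar> \<le> 2 * (\<bar>w x\<bar> + \<bar>v x\<bar>)"
  unfolding fam_def by metis

lemma fam_seq:
  assumes "fam S w v z" "\<And>n. \<theta> n \<in> S" "\<theta>' \<in> S" "\<theta> \<longlonglongrightarrow> \<theta>'"
  shows "(\<lambda>n. z (\<theta> n) x) \<longlonglongrightarrow> z \<theta>' x" "(\<lambda>n. D (z (\<theta> n)) y) \<longlonglongrightarrow> D (z \<theta>') y"
proof -
  show *: "(\<lambda>n. z (\<theta> n) x) \<longlonglongrightarrow> z \<theta>' x" for x
    using assms continuous_on_tendsto_compose[of S "\<lambda>\<theta>. z \<theta> x" \<theta> \<theta>' sequentially] by (auto simp: fam_def)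
  show "(\<lambda>n. D (z (\<theta> n)) y) \<longlonglongrightarrow> D (z \<theta>') y"
    unfolding hoelder_quotient_def split_beta divide_inverse by (intro tendsto_intros *)
qed

lemma fam_T: "fam S w v z \<Longrightarrow> \<bar>a\<bar> \<le> 1 \<Longrightarrow> \<bar>b\<bar> \<le> 1 \<Longrightarrow> fam S w v (\<lambda>\<theta>. T a b (z \<theta>))"
  unfolding fam_def
proof (safe intro!: T_X(1))
  fix \<theta> x y
  assume *: "\<bar>a\<bar> \<le> 1" "\<bar>b\<bar> \<le> 1" "\<theta> \<in> S"
    "\<forall>\<theta>\<in>S. \<forall>y. \<bar>D (z \<theta>) y\<bar> \<le> 2 * (\<bar>D w y\<bar> + \<bar>D v y\<bar>)" "\<forall>\<theta>\<in>S. \<forall>x. \<bar>z \<theta> x\<bar> \<le> 2 * (\<bar>w x\<bar> + \<bar>v x\<bar>)"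
  show "\<bar>D (T a b (z \<theta>)) y\<bar> \<le> 2 * (\<bar>D w y\<bar> + \<bar>D v y\<bar>)"
    using T_D[OF *(1,2), of "z \<theta>" y] bspec[OF *(4,3), THEN spec[of _ y]] by linarith
  show "\<bar>T a b (z \<theta>) x\<bar> \<le> 2 * (\<bar>w x\<bar> + \<bar>v x\<bar>)"
    using tw_lipschitz[OF *(1,2), of "z \<theta> x" 0] bspec[OF *(5,3), THEN spec[of _ x]]
    by (simp add: T_def)
qed (auto simp: T_def tw_def intro!: continuous_intros)

lemma fam_gA:
  assumes z: "fam S w v z" and y: "fam S w v y"
  shows "continuous_on S (\<lambda>\<theta>. gA (z \<theta>) (y \<theta>))"
  unfolding continuous_on_sequentially o_def
proof (intro allI ballI impI, elim conjE)
  fix \<theta> \<theta>' assume \<theta>: "\<theta>' \<in> S" "\<forall>n. \<theta> n \<in> S" "\<theta> \<longlonglongrightarrow> \<theta>'"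
  have X: "w \<in> X" "v \<in> X" "z (\<theta> n) \<in> X" "y (\<theta> n) \<in> X" "z \<theta>' \<in> X" "y \<theta>' \<in> X" for n
    using z y \<theta> by (auto simp: fam_def)
  note [measurable] = X[THEN X_borel]
  show "(\<lambda>n. gA (z (\<theta> n)) (y (\<theta> n))) \<longlonglongrightarrow> gA (z \<theta>') (y \<theta>')"
    unfolding gA_def
  proof (rule integral_dominated_convergence[where w = "\<lambda>q. p * G (2 * \<bar>D w q\<bar> + 2 * \<bar>D v q\<bar>)"])
    show "integrable mub (\<lambda>q. p * G (2 * \<bar>D w q\<bar> + 2 * \<bar>D v q\<bar>))"
      using integrable_G_sum[OF X(1,2)] by simp
    show "AE q in mub. (\<lambda>n. g (D (z (\<theta> n)) q) * D (y (\<theta> n)) q) \<longlonglongrightarrow> g (D (z \<theta>') q) * D (y \<theta>') q"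
    proof (rule AE_I2)
      fix q
      show "(\<lambda>n. g (D (z (\<theta> n)) q) * D (y (\<theta> n)) q) \<longlonglongrightarrow> g (D (z \<theta>') q) * D (y \<theta>') q"
        using fam_seq(2)[OF z _ \<theta>(1,3)] fam_seq(2)[OF y _ \<theta>(1,3)] \<theta>(2)
        by (intro tendsto_mult continuous_on_tendsto_compose[OF g_cont]) auto
    qed
    show "AE q in mub. norm (g (D (z (\<theta> n)) q) * D (y (\<theta> n)) q) \<le> p * G (2 * \<bar>D w q\<bar> + 2 * \<bar>D v q\<bar>)" for n
    proof (rule AE_I2)
      fix q
      show "norm (g (D (z (\<theta> n)) q) * D (y (\<theta> n)) q) \<le> p * G (2 * \<bar>D w q\<bar> + 2 * \<bar>D v q\<bar>)"
        unfolding real_norm_def using fam_D[OF z, of "\<theta> n" q] fam_D[OF y, of "\<theta> n" q] \<theta>(2)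
        by (intro g_product_le) auto
    qed
  qed measurable
qed

lemma fam_A:
  assumes z: "fam S w v z" shows "continuous_on S (\<lambda>\<theta>. A (z \<theta>))"
  unfolding continuous_on_sequentially o_def
proof (intro allI ballI impI, elim conjE)
  fix \<theta> \<theta>' assume \<theta>: "\<theta>' \<in> S" "\<forall>n. \<theta> n \<in> S" "\<theta> \<longlonglongrightarrow> \<theta>'"
  have X: "w \<in> X" "v \<in> X" "z (\<theta> n) \<in> X" "z \<theta>' \<in> X" for n
    using z \<theta> by (auto simp: fam_def)
  note [measurable] = X[THEN X_borel]
  show "(\<lambda>n. A (z (\<theta> n))) \<longlonglongrightarrow> A (z \<theta>')"
    unfolding A_def
  proof (rule integral_dominated_convergence[where w = "\<lambda>q. G (2 * \<bar>D w q\<bar> + 2 * \<bar>D v q\<bar>)"])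
    show "integrable mub (\<lambda>q. G (2 * \<bar>D w q\<bar> + 2 * \<bar>D v q\<bar>))"
      by (rule integrable_G_sum[OF X(1,2)])
    show "AE q in mub. (\<lambda>n. G (D (z (\<theta> n)) q)) \<longlonglongrightarrow> G (D (z \<theta>') q)"
    proof (rule AE_I2)
      fix q
      show "(\<lambda>n. G (D (z (\<theta> n)) q)) \<longlonglongrightarrow> G (D (z \<theta>') q)"
        using fam_seq(2)[OF z _ \<theta>(1,3)] \<theta>(2)
        by (intro continuous_on_tendsto_compose[OF N_function_continuous[OF G]]) auto
    qed
    show "AE q in mub. norm (G (D (z (\<theta> n)) q)) \<le> G (2 * \<bar>D w q\<bar> + 2 * \<bar>D v q\<bar>)" for n
    proof (rule AE_I2)
      fix q
      have "\<bar>D (z (\<theta> n)) q\<bar> \<le> 2 * \<bar>D w q\<bar> + 2 * \<bar>D v q\<bar>" using fam_D[OF z, of "\<theta> n" q] \<theta>(2) by auto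
      then have "G (D (z (\<theta> n)) q) \<le> G (2 * \<bar>D w q\<bar> + 2 * \<bar>D v q\<bar>)" by (intro G_mono_abs) simp
      then show "norm (G (D (z (\<theta> n)) q)) \<le> G (2 * \<bar>D w q\<bar> + 2 * \<bar>D v q\<bar>)" by (simp add: G_nonneg)
    qed
  qed measurable
qed

lemma fam_fv:
  assumes z: "fam S w v z" and y: "fam S w v y"
  shows "continuous_on S (\<lambda>\<theta>. fv (z \<theta>) (y \<theta>))"
  unfolding continuous_on_sequentially o_def
proof (intro allI ballI impI, elim conjE)
  fix \<theta> \<theta>' assume \<theta>: "\<theta>' \<in> S" "\<forall>n. \<theta> n \<in> S" "\<theta> \<longlonglongrightarrow> \<theta>'"
  have X: "w \<in> X" "v \<in> X" "z (\<theta> n) \<in> X" "y (\<theta> n) \<in> X" "z \<theta>' \<in> X" "y \<theta>' \<in> X" for n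
    using z y \<theta> by (auto simp: fam_def)
  note [measurable] = X[THEN X_lebesgue] X[THEN X_lebesgue, THEN f_compose]
  show "(\<lambda>n. fv (z (\<theta> n)) (y (\<theta> n))) \<longlonglongrightarrow> fv (z \<theta>') (y \<theta>')"
    unfolding fv_def
  proof (rule integral_dominated_convergence[where w = "\<lambda>x. 2 * c4 * B (2 * (\<bar>w x\<bar> + \<bar>v x\<bar>))"])
    show "integrable lebesgue (\<lambda>x. 2 * c4 * B (2 * (\<bar>w x\<bar> + \<bar>v x\<bar>)))"
      using integrable_B_sum[OF X(1,2)] by simp
    show "AE x in lebesgue. (\<lambda>n. f x (z (\<theta> n) x) * y (\<theta> n) x) \<longlonglongrightarrow> f x (z \<theta>' x) * y \<theta>' x"
    proof (rule AE_I2)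
      fix x
      show "(\<lambda>n. f x (z (\<theta> n) x) * y (\<theta> n) x) \<longlonglongrightarrow> f x (z \<theta>' x) * y \<theta>' x"
        using fam_seq(1)[OF z _ \<theta>(1,3)] fam_seq(1)[OF y _ \<theta>(1,3)] \<theta>(2)
        by (intro tendsto_mult continuous_on_tendsto_compose[OF f_cont]) auto
    qed
    show "AE x in lebesgue. norm (f x (z (\<theta> n) x) * y (\<theta> n) x) \<le> 2 * c4 * B (2 * (\<bar>w x\<bar> + \<bar>v x\<bar>))" for n
      using fam_abs[OF z, of "\<theta> n"] fam_abs[OF y, of "\<theta> n"] \<theta>(2)
      unfolding real_norm_def by (intro AE_I2 f_product_le) auto
  qed measurable
qed

lemma fam_integral:
  assumes z: "fam S w v z"
    and \<Psi>: "(\<lambda>(x, t). \<Psi> x t) \<in> borel_measurable (lebesgue \<Otimes>\<^sub>M borel)"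
      "\<And>x. continuous_on UNIV (\<Psi> x)" "\<And>x t. \<bar>\<Psi> x t\<bar> \<le> C * B t"
  shows "continuous_on S (\<lambda>\<theta>. \<integral>x. \<Psi> x (z \<theta> x) \<partial>lebesgue)"
  unfolding continuous_on_sequentially o_def
proof (intro allI ballI impI, elim conjE)
  fix \<theta> \<theta>' assume \<theta>: "\<theta>' \<in> S" "\<forall>n. \<theta> n \<in> S" "\<theta> \<longlonglongrightarrow> \<theta>'"
  have C: "C \<ge> 0" using order_trans[OF abs_ge_zero \<Psi>(3)[of _ 1]] B_pos[of 1] by (simp add: zero_le_mult_iff)
  have X: "w \<in> X" "v \<in> X" "z (\<theta> n) \<in> X" "z \<theta>' \<in> X" for n
    using z \<theta> by (auto simp: fam_def)
  note [measurable] = X[THEN X_lebesgue, THEN Caratheodory_compose[OF \<Psi>(1)]]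
  show "(\<lambda>n. \<integral>x. \<Psi> x (z (\<theta> n) x) \<partial>lebesgue) \<longlonglongrightarrow> (\<integral>x. \<Psi> x (z \<theta>' x) \<partial>lebesgue)"
  proof (rule integral_dominated_convergence[where w = "\<lambda>x. C * B (2 * (\<bar>w x\<bar> + \<bar>v x\<bar>))"])
    show "integrable lebesgue (\<lambda>x. C * B (2 * (\<bar>w x\<bar> + \<bar>v x\<bar>)))"
      using integrable_B_sum[OF X(1,2)] by simp
    show "AE x in lebesgue. (\<lambda>n. \<Psi> x (z (\<theta> n) x)) \<longlonglongrightarrow> \<Psi> x (z \<theta>' x)"
    proof (rule AE_I2)
      fix x
      show "(\<lambda>n. \<Psi> x (z (\<theta> n) x)) \<longlonglongrightarrow> \<Psi> x (z \<theta>' x)"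
        using fam_seq(1)[OF z _ \<theta>(1,3)] \<theta>(2) by (intro continuous_on_tendsto_compose[OF \<Psi>(2)]) auto
    qed
    show "AE x in lebesgue. norm (\<Psi> x (z (\<theta> n) x)) \<le> C * B (2 * (\<bar>w x\<bar> + \<bar>v x\<bar>))" for n
    proof (rule AE_I2)
      fix x
      have "\<bar>z (\<theta> n) x\<bar> \<le> 2 * (\<bar>w x\<bar> + \<bar>v x\<bar>)" using fam_abs[OF z] \<theta>(2) by auto
      then have "C * B (z (\<theta> n) x) \<le> C * B (2 * (\<bar>w x\<bar> + \<bar>v x\<bar>))"
        using C by (intro mult_left_mono B_mono_abs) auto
      then show "norm (\<Psi> x (z (\<theta> n) x)) \<le> C * B (2 * (\<bar>w x\<bar> + \<bar>v x\<bar>))"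
        using \<Psi>(3)[of x "z (\<theta> n) x"] by simp
    qed
  qed measurable
qed

lemma B_Caratheodory: "(\<lambda>(x :: real^'n, t). B t) \<in> borel_measurable (lebesgue \<Otimes>\<^sub>M borel)"
  unfolding split_beta by measurable

lemma fam_J: "fam S w v z \<Longrightarrow> continuous_on S (\<lambda>\<theta>. J (z \<theta>))"
  unfolding J_def \<Phi>_def by (intro continuous_on_diff fam_A fam_integral[OF _ F_meas F_cont F_abs])

lemma fam_\<rho>: "fam S w v z \<Longrightarrow> continuous_on S (\<lambda>\<theta>. \<rho> (z \<theta>))"
  unfolding \<rho>_def by (rule fam_integral[OF _ B_Caratheodory B_cont, of _ _ _ _ 1]) (auto simp: B_nonneg)

end

section \<open>The Nehari sets\<close>

text \<open>Compactness of \<open>S\<close> makes the strict inequality uniform: violations at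
  parameters tending to 0 would accumulate at some \<open>(l, 0)\<close> with
  \<open>h (l, 0) \<ge> 0\<close>. It keeps the sign conditions on a whole face for all small
  deformations.\<close>

lemma tube_negative:
  fixes h :: "'a::metric_space \<times> real \<Rightarrow> real"
  assumes S: "compact S" and h: "continuous_on (S \<times> {0..d}) h" "d > 0" and neg: "\<And>x. x \<in> S \<Longrightarrow> h (x, 0) < 0"
  shows "\<exists>e>0. e \<le> d \<and> (\<forall>\<epsilon>\<in>{0..e}. \<forall>x\<in>S. h (x, \<epsilon>) < 0)"
proof (rule ccontr)
  assume "\<not> ?thesis"
  then have ex: "\<exists>\<epsilon> x. \<epsilon> \<in> {0..e} \<and> x \<in> S \<and> \<not> h (x, \<epsilon>) < 0" if "0 < e" "e \<le> d" for e
    using that by blast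
  have "\<exists>\<epsilon> x. \<epsilon> \<in> {0..d / (real n + 1)} \<and> x \<in> S \<and> h (x, \<epsilon>) \<ge> 0" for n
  proof -
    have "0 < d / (real n + 1)" "d / (real n + 1) \<le> d" using h(2) by (auto simp: field_simps)
    then show ?thesis using ex[of "d / (real n + 1)"] by (auto simp: not_less)
  qed
  then obtain \<epsilon> x where x: "\<And>n. \<epsilon> n \<in> {0..d / (real n + 1)}" "\<And>n. x n \<in> S" "\<And>n. h (x n, \<epsilon> n) \<ge> 0"
    by metis
  obtain l k where k: "l \<in> S" "strict_mono k" "(x \<circ> k) \<longlonglongrightarrow> l"
    using S[unfolded compact_eq_seq_compact_metric seq_compact_def] x(2) by blast
  have "(\<lambda>n. d / (real n + 1)) \<longlonglongrightarrow> 0" by real_asymp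
  then have "\<epsilon> \<longlonglongrightarrow> 0" 
    by (rule tendsto_sandwich[OF _ _ tendsto_const, rotated 2]) (use x(1) in auto)
  then have e: "(\<epsilon> \<circ> k) \<longlonglongrightarrow> 0" using k(2) by (rule LIMSEQ_subseq_LIMSEQ)
  have "d / (real n + 1) \<le> d" for n using h(2) by (simp add: field_simps)
  then have \<epsilon>d: "\<epsilon> n \<in> {0..d}" for n using x(1)[of n] by (force intro: order_trans)
  have "(\<lambda>n. h (x (k n), \<epsilon> (k n))) \<longlonglongrightarrow> h (l, 0)"
    by (rule continuous_on_tendsto_compose[OF h(1)])
      (use k e x(2) \<epsilon>d h(2) in \<open>auto simp: o_def intro!: tendsto_Pair\<close>)
  then have "0 \<le> h (l, 0)" using x(3) by (intro LIMSEQ_le_const) auto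
  then show False using neg[OF k(1)] by simp
qed

text \<open>Brouwer's theorem for the map \<open>z + P z\<close> clamped to the square. At a fixed
  point the clamping cannot be active, since on each face the corresponding component points
  inward.\<close>

lemma Poincare_Miranda:
  fixes P1 P2 :: "real \<times> real \<Rightarrow> real"
  assumes ab: "a < b" and cont: "continuous_on ({a..b} \<times> {a..b}) P1" "continuous_on ({a..b} \<times> {a..b}) P2"
    and P1: "\<And>y. y \<in> {a..b} \<Longrightarrow> P1 (b, y) < 0" "\<And>y. y \<in> {a..b} \<Longrightarrow> P1 (a, y) > 0"
    and P2: "\<And>x. x \<in> {a..b} \<Longrightarrow> P2 (x, b) < 0" "\<And>x. x \<in> {a..b} \<Longrightarrow> P2 (x, a) > 0"
  shows "\<exists>x\<in>{a..b}. \<exists>y\<in>{a..b}. P1 (x, y) = 0 \<and> P2 (x, y) = 0"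
proof -
  define cl where "cl t = max a (min b t)" for t :: real
  define \<phi> where "\<phi> z = (cl (fst z + P1 z), cl (snd z + P2 z))" for z
  have "continuous_on ({a..b} \<times> {a..b}) \<phi>"
    unfolding \<phi>_def cl_def using cont by (intro continuous_intros)
  moreover have "\<phi> \<in> {a..b} \<times> {a..b} \<rightarrow> {a..b} \<times> {a..b}"
    using ab by (auto simp: \<phi>_def cl_def)
  moreover have "compact ({a..b} \<times> {a..b})" "convex ({a..b} \<times> {a..b})" "{a..b} \<times> {a..b} \<noteq> {}"
    using ab by (auto intro: compact_Times convex_Times)
  ultimately obtain z where z: "z \<in> {a..b} \<times> {a..b}" "\<phi> z = z" 
    using brouwer[of "{a..b} \<times> {a..b}" \<phi>] by blast
  obtain x y where xy: "z = (x, y)" by fastforce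
  have zero: "t + r = t" if "cl (t + r) = t" "t = b \<Longrightarrow> r < 0" "t = a \<Longrightarrow> r > 0" for t r
    using that ab by (auto simp: cl_def max_def min_def split: if_splits)
  have "P1 (x, y) = 0" using zero[of x "P1 (x, y)"] z xy P1 by (auto simp: \<phi>_def)
  moreover have "P2 (x, y) = 0" using zero[of y "P2 (x, y)"] z xy P2 by (auto simp: \<phi>_def)
  ultimately show ?thesis using z(1) unfolding xy by blast
qed

context nehari
begin

section \<open>Difference quotients of truncations\<close>

lemma D_swap: "D w (y, x) = - D w (x, y)"
  by (simp add: hoelder_quotient_def norm_minus_commute minus_divide_left)

lemma D_T_mono:
  assumes "0 \<le> a" "a \<le> c" "0 \<le> b" "b \<le> d" "u y \<le> u x"
  shows "0 \<le> D (T a b u) (x, y)" "D (T a b u) (x, y) \<le> D (T c d u) (x, y)"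
proof -
  have "0 \<le> tw a b (u x) - tw a b (u y)" using tw_mono[of 0 a 0 b "u y" "u x"] assms by (simp add: tw_def)
  then show "0 \<le> D (T a b u) (x, y)" by (simp add: hoelder_quotient_def T_def)
  show "D (T a b u) (x, y) \<le> D (T c d u) (x, y)"
    using tw_mono[OF assms(1-5)] by (simp add: hoelder_quotient_def T_def divide_right_mono)
qed

text \<open>Swapping \<open>x\<close> and \<open>y\<close> flips all quotients, and the integrands
  are invariant because \<open>G\<close> is even and \<open>g\<close> is odd. Under
  \<open>u y \<le> u x\<close> the quotients of truncations with nonnegative coefficients are
  nonnegative, so monotonicity of \<open>g\<close> applies without absolute values.\<close>

lemma pair_wlog:
  fixes u :: "real^'n \<Rightarrow> real"
  assumes "\<And>x y. u y \<le> u x \<Longrightarrow> P (x, y)" "\<And>x y. P (y, x) \<Longrightarrow> P (x, y)"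
  shows "P (z :: (real^'n) \<times> (real^'n))"
  using assms by (cases z) (metis linear)

lemma T_c: "T (c * a) (c * b) u = (\<lambda>x. c * T a b u x)"
  by (simp add: T_def tw_def distrib_left mult.assoc)

lemma T_cc: "T c c u = (\<lambda>x. c * u x)"
  using T_c[of c 1 1 u] by simp

lemma \<rho>_T: "u \<in> X \<Longrightarrow> a > 0 \<Longrightarrow> \<rho> u > 0 \<Longrightarrow> \<rho> (\<lambda>x. a * u x) > 0"
  using \<rho>_eq_0[of u] \<rho>_eq_0[OF X_scale(1), of u a] \<rho>_nonneg[of "\<lambda>x. a * u x"]
  by (auto simp: less_le)

text \<open>Each of two numbers of equal sign is, in modulus, a fraction of the modulus of the sum,
  and the two fractions add up to 1; \<open>G_contract\<close> is applied to both.\<close>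

lemma G_super: "a * c \<ge> 0 \<Longrightarrow> G a + G c \<le> G (a + c)"
proof -
  assume "a * c \<ge> 0"
  then have abs: "\<bar>a + c\<bar> = \<bar>a\<bar> + \<bar>c\<bar>" by (auto simp: zero_le_mult_iff)
  define m where "m = \<bar>a\<bar> + \<bar>c\<bar>"
  show ?thesis
  proof (cases "m = 0")
    case False
    then have m: "m > 0" by (simp add: m_def)
    have "G (\<bar>a\<bar> / m * m) \<le> \<bar>a\<bar> / m * G m" "G (\<bar>c\<bar> / m * m) \<le> \<bar>c\<bar> / m * G m"
      using m by (intro G_contract; simp add: m_def)+
    moreover have "\<bar>a\<bar> / m * G m + \<bar>c\<bar> / m * G m = G m"
      using m unfolding distrib_right[symmetric] add_divide_distrib[symmetric] m_def[symmetric] by simp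
    ultimately have "G \<bar>a\<bar> + G \<bar>c\<bar> \<le> G m" using m by simp
    then show ?thesis using abs G_abs[of "a + c"] by (simp add: G_abs m_def)
  next
    case True
    then have "a = 0" "c = 0" by (auto simp: m_def)
    then show ?thesis using G_0 by simp
  qed
qed

text \<open>The quotients of the two parts have the same sign at every pair, so \<open>A\<close> is
  superadditive on them; \<open>\<Phi>\<close> is additive because the parts live on disjoint sets.
  Hence adding a missing part of positive energy raises \<open>J\<close>, which keeps the maximum on
  a fibre away from the coordinate axes.\<close>

lemma J_super:
  assumes u: "u \<in> X" and ab: "a \<ge> 0" "b \<ge> 0"
  shows "J (T a 0 u) + J (T 0 b u) \<le> J (T a b u)" "\<Phi> (T a b u) = \<Phi> (T a 0 u) + \<Phi> (T 0 b u)"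
proof -
  have X: "T c d u \<in> X" for c d by (rule T_X[OF u])
  have add: "D (T a b u) z = D (T a 0 u) z + D (T 0 b u) z" for z
  proof -
    have "T a b u = (\<lambda>x. 1 * T a 0 u x + 1 * T 0 b u x)" by (simp add: T_def tw_def)
    then show ?thesis by (simp only: D_lin)
  qed
  have "G (D (T a 0 u) z) + G (D (T 0 b u) z) \<le> G (D (T a b u) z)" for z
    unfolding add
  proof (rule G_super, rule pair_wlog[of u])
    fix x y assume "u y \<le> u x"
    then show "0 \<le> D (T a 0 u) (x, y) * D (T 0 b u) (x, y)"
      using D_T_mono(1)[of a a 0 0 u y x] D_T_mono(1)[of 0 0 b b u y x] ab by simp
  next
    fix x y assume "0 \<le> D (T a 0 u) (y, x) * D (T 0 b u) (y, x)"
    then show "0 \<le> D (T a 0 u) (x, y) * D (T 0 b u) (x, y)" by (simp add: D_swap[of _ y x])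
  qed
  then have "(\<integral>z. G (D (T a 0 u) z) + G (D (T 0 b u) z) \<partial>mub) \<le> A (T a b u)"
    unfolding A_def using X_integrable[OF X] by (intro integral_mono) auto
  then have "A (T a 0 u) + A (T 0 b u) \<le> A (T a b u)"
    using X_integrable[OF X] by (simp add: A_def)
  moreover have "F x (T a b u x) = F x (T a 0 u x) + F x (T 0 b u x)" for x
    by (cases "u x \<ge> 0") (auto simp: T_def tw_pos tw_neg F_0)
  then show \<Phi>: "\<Phi> (T a b u) = \<Phi> (T a 0 u) + \<Phi> (T 0 b u)"
    using integrable_F[OF X] by (simp add: \<Phi>_def)
  ultimately show "J (T a 0 u) + J (T 0 b u) \<le> J (T a b u)" by (simp add: J_def)
qed

section \<open>Comparison with the modular of \<open>B\<close> and behaviour near zero\<close>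

lemma \<Phi>_upper: "u \<in> X \<Longrightarrow> \<Phi> u \<le> c4 * \<rho> u"
proof -
  assume u: "u \<in> X"
  have "\<Phi> u \<le> (\<integral>x. c4 * B (u x) \<partial>lebesgue)"
    unfolding \<Phi>_def using integrable_F[OF u] integrable_B[OF u] F_upper by (intro integral_mono) auto
  then show ?thesis by (simp add: \<rho>_def)
qed

lemma \<Phi>_lower: "u \<in> X \<Longrightarrow> c1 / Q * \<rho> u \<le> \<Phi> u"
proof -
  assume u: "u \<in> X"
  have "(\<integral>x. c1 / Q * B (u x) \<partial>lebesgue) \<le> \<Phi> u"
    unfolding \<Phi>_def
  proof (rule integral_mono_AE)
    show "AE x in lebesgue. c1 / Q * B (u x) \<le> F x (u x)"
      using f_lower
    proof eventually_elim
      case (elim x)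
      then show ?case using F_lower[of x "u x"] X_zero[OF u, of x] B_0 F_0 by (cases "x \<in> \<Omega>") auto
    qed
  qed (use integrable_F[OF u] integrable_B[OF u] in auto)
  then show ?thesis by (simp add: \<rho>_def)
qed

lemma fv_upper: "u \<in> X \<Longrightarrow> fv u u \<le> c4 * \<rho> u"
proof -
  assume u: "u \<in> X"
  have "fv u u \<le> (\<integral>x. c4 * B (u x) \<partial>lebesgue)"
    unfolding fv_def using integrable_fv[OF u u] integrable_B[OF u] f_upper by (intro integral_mono) auto
  then show ?thesis by (simp add: \<rho>_def)
qed

lemma fv_lower: "u \<in> X \<Longrightarrow> c1 * \<rho> u \<le> fv u u"
proof -
  assume u: "u \<in> X"
  have "(\<integral>x. c1 * B (u x) \<partial>lebesgue) \<le> fv u u"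
    unfolding fv_def
  proof (rule integral_mono_AE)
    show "AE x in lebesgue. c1 * B (u x) \<le> f x (u x) * u x"
      using f_lower
    proof eventually_elim
      case (elim x)
      then show ?case using X_zero[OF u, of x] B_0 by (cases "x \<in> \<Omega>") auto
    qed
  qed (use integrable_fv[OF u u] integrable_B[OF u] in auto)
  then show ?thesis by (simp add: \<rho>_def)
qed

lemma fv_part:
  assumes "a = 0 \<or> a = 1" "b = 0 \<or> b = 1"
  shows "fv u (T a b u) = fv (T a b u) (T a b u)"
proof -
  have eq: "f x (u x) * T a b u x = f x (T a b u x) * T a b u x" for x
    using assms by (cases "u x \<ge> 0") (auto simp: T_def tw_pos tw_neg)
  show ?thesis unfolding fv_def eq ..
qed

text \<open>On ordered pairs the quotient of the truncation lies between 0 and that of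
  \<open>u\<close>. Lowering the argument of \<open>g\<close> accordingly and using
  \<open>G t \<le> g t * t\<close> gives the bound; the interaction between the two parts thus has a
  favourable sign.\<close>

lemma gA_part:
  assumes u: "u \<in> X" and ab: "0 \<le> a" "a \<le> 1" "0 \<le> b" "b \<le> 1"
  shows "A (T a b u) \<le> gA u (T a b u)"
  unfolding A_def gA_def
proof (rule integral_mono)
  fix z
  show "G (D (T a b u) z) \<le> g (D u z) * D (T a b u) z"
  proof (rule pair_wlog[of u])
    fix x y assume "u y \<le> u x"
    then have *: "0 \<le> D (T a b u) (x, y)" "D (T a b u) (x, y) \<le> D u (x, y)"
      using D_T_mono[of a 1 b 1 u y x] ab by auto
    have "G (D (T a b u) (x, y)) \<le> g (D (T a b u) (x, y)) * D (T a b u) (x, y)"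
      using G_subgradient[of "D (T a b u) (x, y)" 0] G_0 by simp
    also have "\<dots> \<le> g (D u (x, y)) * D (T a b u) (x, y)"
      using * g_mono by (intro mult_right_mono) auto
    finally show "G (D (T a b u) (x, y)) \<le> g (D u (x, y)) * D (T a b u) (x, y)" .
  next
    fix x y assume "G (D (T a b u) (y, x)) \<le> g (D u (y, x)) * D (T a b u) (y, x)"
    then show "G (D (T a b u) (x, y)) \<le> g (D u (x, y)) * D (T a b u) (x, y)"
      by (simp add: D_swap[of _ y x] G_even g_odd)
  qed
qed (use X_integrable[OF T_X(1)[OF u]] integrable_gA[OF u T_X(1)[OF u]] in auto)

text \<open>The bound \<open>C * A w powr (r / p)\<close> on \<open>\<rho> w\<close> is superlinear
  in \<open>A w\<close>, so it loses against \<open>A w\<close> below a threshold.\<close>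

lemma A_small: "\<exists>\<eta>>0. \<forall>w\<in>X. 0 < \<rho> w \<longrightarrow> A w \<le> \<eta> \<longrightarrow> c4 * \<rho> w < A w"
proof -
  obtain C where C: "C > 0" "\<And>u. u \<in> X \<Longrightarrow> A u \<le> 1 \<Longrightarrow> \<rho> u \<le> C * A u powr (r / p)"
    using \<rho>_small by blast
  define e where "e = r / p - 1"
  have e: "e > 0" using p pr by (simp add: e_def)
  \<comment> \<open>Makes \<open>c4 * C * \<eta> powr e\<close> at most one half.\<close>
  define \<eta> where "\<eta> = min 1 ((1 / (2 * c4 * C)) powr (1 / e))"
  have \<eta>: "\<eta> > 0" using C c14 by (simp add: \<eta>_def)
  show ?thesis
  proof (intro exI[of _ \<eta>] conjI ballI impI)
    fix w assume w: "w \<in> X" "0 < \<rho> w" "A w \<le> \<eta>"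
    have le: "\<rho> w \<le> C * A w powr (r / p)" by (rule C) (use w in \<open>auto simp: \<eta>_def\<close>)
    then have "A w \<noteq> 0" using w by auto
    then have Aw: "A w > 0" using A_nonneg[of w] by simp
    have "c4 * \<rho> w \<le> c4 * (C * A w powr (1 + e))" using le c14 by (intro mult_left_mono) (auto simp: e_def)
    also have "\<dots> = c4 * C * A w powr e * A w" using Aw by (simp add: powr_add)
    also have "\<dots> < 1 * A w"
    proof (rule mult_strict_right_mono[OF _ Aw])
      have "A w powr e \<le> ((1 / (2 * c4 * C)) powr (1 / e)) powr e"
        using Aw w e by (intro powr_mono2) (auto simp: \<eta>_def)
      also have "\<dots> = 1 / (2 * c4 * C)" using e C c14 by (simp add: powr_powr)
      finally have "c4 * C * A w powr e \<le> c4 * C * (1 / (2 * c4 * C))" using C c14 by (intro mult_left_mono) auto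
      then show "c4 * C * A w powr e < 1" using C c14 by simp
    qed
    finally show "c4 * \<rho> w < A w" by simp
  qed (rule \<eta>)
qed

lemma J_small_pos:
  assumes u: "u \<in> X" "\<rho> u > 0" and R: "R > 0"
  shows "\<exists>a. 0 < a \<and> a \<le> R \<and> J (\<lambda>x. a * u x) > 0"
proof -
  obtain \<eta> where \<eta>: "\<eta> > 0" "\<And>w. w \<in> X \<Longrightarrow> 0 < \<rho> w \<Longrightarrow> A w \<le> \<eta> \<Longrightarrow> c4 * \<rho> w < A w"
    using A_small by blast
  define a where "a = min (min 1 R) (\<eta> / (A u + 1))"
  have Au: "A u + 1 > 0" using A_nonneg[of u] by simp
  have "a \<le> \<eta> / (A u + 1)" by (simp add: a_def)
  then have "a * (A u + 1) \<le> \<eta>" using Au by (simp add: pos_le_divide_eq)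
  then have a: "0 < a" "a \<le> 1" "a \<le> R" "a * (A u + 1) \<le> \<eta>"
    using \<eta>(1) R Au by (auto simp: a_def)
  have X: "(\<lambda>x. a * u x) \<in> X" by (rule X_scale[OF u(1)])
  have "A (\<lambda>x. a * u x) \<le> (\<integral>z. a * G (D u z) \<partial>mub)"
    unfolding A_def using X_integrable[OF X] X_integrable[OF u(1)] a
    by (intro integral_mono) (auto simp: D_scale intro: G_contract)
  also have "\<dots> = a * A u" by (simp add: A_def)
  also have "\<dots> \<le> \<eta>" using a by (simp add: distrib_left)
  finally have "c4 * \<rho> (\<lambda>x. a * u x) < A (\<lambda>x. a * u x)"
    using \<eta>(2)[OF X] \<rho>_T[OF u(1) a(1) u(2)] by simp
  then show ?thesis using \<Phi>_upper[OF X] a by (intro exI[of _ a]) (auto simp: J_def)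
qed

text \<open>One flag covers both problems. In the nodal case both parts are nonzero; otherwise
  \<open>u\<close> is nonnegative and its fibre is a ray, on which the coefficient \<open>b\<close>
  has no effect.\<close>

definition Y :: "bool \<Rightarrow> (real^'n \<Rightarrow> real) set" where
  "Y nodal = {u \<in> X. \<rho> (T 1 0 u) > 0 \<and> (if nodal then \<rho> (T 0 1 u) > 0 else (\<forall>x. u x \<ge> 0))}"

text \<open>The Nehari set, encoded by maximality on the own fibre instead of vanishing derivatives.
  \<open>Nm_critical\<close> and \<open>Nm_unique\<close> show that on \<open>Y\<close> the two
  descriptions agree. Maximality is what passes through the limit of a minimising sequence.\<close>

definition Nm :: "bool \<Rightarrow> (real^'n \<Rightarrow> real) set" where
  "Nm nodal = {u \<in> Y nodal. \<forall>a\<ge>0. \<forall>b\<ge>0. J (T a b u) \<le> J u}"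

text \<open>The formal derivative of \<open>J\<close> at \<open>u\<close> in direction
  \<open>T 1 0 u\<close>. \<open>Pneg\<close> uses \<open>T 0 1 u\<close>, that is
  \<open>- u\<^sub>-\<close>, so that both have the same sign pattern along a fibre.\<close>

definition Ppos :: "(real^'n \<Rightarrow> real) \<Rightarrow> real" where "Ppos u = gA u (T 1 0 u) - fv u (T 1 0 u)"
definition Pneg :: "(real^'n \<Rightarrow> real) \<Rightarrow> real" where "Pneg u = gA u (T 0 1 u) - fv u (T 0 1 u)"

lemma Y_X: "u \<in> Y n \<Longrightarrow> u \<in> X" by (simp add: Y_def)

lemma Y_T:
  assumes u: "u \<in> Y n" and ab: "a > 0" "b > 0" shows "T a b u \<in> Y n"
proof -
  have X: "T c d u \<in> X" for c d by (rule T_X[OF Y_X[OF u]])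
  have "\<rho> (T 1 0 (T a b u)) > 0"
    using \<rho>_T[OF X, of a 1 0] u ab T_c[of a 1 0 u] by (simp add: T_T Y_def)
  moreover have "\<rho> (T 0 1 (T a b u)) > 0" if n
    using \<rho>_T[OF X, of b 0 1] u ab T_c[of b 0 1 u] that by (simp add: T_T Y_def)
  moreover have "T a b u x \<ge> 0" if "\<not> n" for x
    using u that ab T_nonneg[of u a b] by (simp add: Y_def)
  ultimately show ?thesis using X by (simp add: Y_def)
qed

section \<open>Energy along fibres and projection to the Nehari set\<close>

lemma \<rho>_T_lower:
  assumes u: "u \<in> X" and "a \<ge> 1"
  shows "a powr r * \<rho> (T 1 0 u) \<le> \<rho> (T a 0 u)" "a powr r * \<rho> (T 0 1 u) \<le> \<rho> (T 0 a u)"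
  using \<rho>_scale_lower[OF T_X(1)[OF u] assms(2), of 1 0] \<rho>_scale_lower[OF T_X(1)[OF u] assms(2), of 0 1]
    T_c[of a 1 0 u] T_c[of a 0 1 u] by simp_all

text \<open>If \<open>a\<close> is the larger coefficient, \<open>A\<close> grows at most like
  \<open>a powr p\<close>, while \<open>\<Phi>\<close> of the positive part alone grows at least
  like \<open>a powr r\<close> with \<open>r > p\<close>. The larger coefficient decides, so the
  nodal case treats both orders.\<close>

lemma J_large_neg:
  assumes u: "u \<in> Y n"
  shows "\<exists>R\<ge>1. (\<forall>a b. a \<ge> R \<longrightarrow> 0 \<le> b \<longrightarrow> b \<le> a \<longrightarrow> J (T a b u) < 0) \<and>
     (n \<longrightarrow> (\<forall>a b. b \<ge> R \<longrightarrow> 0 \<le> a \<longrightarrow> a \<le> b \<longrightarrow> J (T a b u) < 0))"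
proof -
  have uX: "u \<in> X" by (rule Y_X[OF u])
  define k where "k = c1 / Q"
  have k: "k > 0" using c14 Q by (simp add: k_def)
  have lim: "\<exists>R\<ge>1. \<forall>l\<ge>R. l powr p * A u - k * (l powr r * m) < 0" if m: "m > 0" for m
  proof -
    \<comment> \<open>From this threshold on, \<open>k * m * l powr (r - p)\<close> is at least
      \<open>A u + 1\<close>.\<close>
    define R where "R = max 1 (((A u + 1) / (k * m)) powr (1 / (r - p)))"
    have km: "k * m > 0" using k m by simp
    have "l powr p * A u - k * (l powr r * m) < 0" if l: "l \<ge> R" for l
    proof -
      have l1: "l \<ge> 1" using l by (simp add: R_def)
      have "(A u + 1) / (k * m) = (((A u + 1) / (k * m)) powr (1 / (r - p))) powr (r - p)"
        using pr km A_nonneg[of u] by (simp add: powr_powr)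
      also have "\<dots> \<le> l powr (r - p)" using pr l by (intro powr_mono2) (auto simp: R_def)
      finally have "A u + 1 \<le> k * m * l powr (r - p)" using km by (simp add: field_simps)
      then have "l powr p * (A u - k * m * l powr (r - p)) < 0"
        using l1 by (intro mult_pos_neg) auto
      moreover have "l powr p * l powr (r - p) = l powr r" by (simp add: powr_add[symmetric])
      ultimately show ?thesis by (simp add: right_diff_distrib mult.left_commute mult.commute)
    qed
    then show ?thesis by (intro exI[of _ R]) (auto simp: R_def)
  qed
  have J1: "J (T a b u) \<le> a powr p * A u - k * (a powr r * \<rho> (T 1 0 u))" if "a \<ge> 1" "0 \<le> b" "b \<le> a" for a b
  proof -
    have "A (T a b u) \<le> a powr p * A u" using T_X(2)[OF uX, of a b] that by (simp add: max_def)
    moreover have "k * (a powr r * \<rho> (T 1 0 u)) \<le> k * \<rho> (T a 0 u)"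
      using \<rho>_T_lower(1)[OF uX that(1)] k by (intro mult_left_mono) auto
    moreover have "k * \<rho> (T a 0 u) \<le> \<Phi> (T a 0 u)" unfolding k_def by (rule \<Phi>_lower[OF T_X(1)[OF uX]])
    moreover have "0 \<le> k * \<rho> (T 0 b u)" using k \<rho>_nonneg by simp
    moreover have "k * \<rho> (T 0 b u) \<le> \<Phi> (T 0 b u)" unfolding k_def by (rule \<Phi>_lower[OF T_X(1)[OF uX]])
    ultimately show ?thesis using J_super(2)[OF uX, of a b] that unfolding J_def by linarith
  qed
  have J2: "J (T a b u) \<le> b powr p * A u - k * (b powr r * \<rho> (T 0 1 u))" if "b \<ge> 1" "0 \<le> a" "a \<le> b" for a b
  proof -
    have "A (T a b u) \<le> b powr p * A u" using T_X(2)[OF uX, of a b] that by (simp add: max_def split: if_splits)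
    moreover have "k * (b powr r * \<rho> (T 0 1 u)) \<le> k * \<rho> (T 0 b u)"
      using \<rho>_T_lower(2)[OF uX that(1)] k by (intro mult_left_mono) auto
    moreover have "k * \<rho> (T a 0 u) \<le> \<Phi> (T a 0 u)" unfolding k_def by (rule \<Phi>_lower[OF T_X(1)[OF uX]])
    moreover have "0 \<le> k * \<rho> (T a 0 u)" using k \<rho>_nonneg by simp
    moreover have "k * \<rho> (T 0 b u) \<le> \<Phi> (T 0 b u)" unfolding k_def by (rule \<Phi>_lower[OF T_X(1)[OF uX]])
    ultimately show ?thesis using J_super(2)[OF uX, of a b] that unfolding J_def by linarith
  qed
  have m1: "\<rho> (T 1 0 u) > 0" using u by (simp add: Y_def)
  obtain R1 where R1: "R1 \<ge> 1" "\<And>l. l \<ge> R1 \<Longrightarrow> l powr p * A u - k * (l powr r * \<rho> (T 1 0 u)) < 0"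
    using lim[OF m1] by blast
  have R1J: "J (T a b u) < 0" if "a \<ge> R1" "0 \<le> b" "b \<le> a" for a b
    using J1[of a b] R1 that by (smt (verit))
  show ?thesis
  proof (cases n)
    case True
    then have "\<rho> (T 0 1 u) > 0" using u by (simp add: Y_def)
    from lim[OF this] obtain R2 where R2: "R2 \<ge> 1" "\<And>l. l \<ge> R2 \<Longrightarrow> l powr p * A u - k * (l powr r * \<rho> (T 0 1 u)) < 0"
      by blast
    have "J (T a b u) < 0" if "b \<ge> R2" "0 \<le> a" "a \<le> b" for a b
      using J2[of b a] R2 that by (smt (verit))
    then show ?thesis using R1J R1(1) by (intro exI[of _ "max R1 R2"]) auto
  next
    case False
    then show ?thesis using R1J R1(1) by blast
  qed
qed

text \<open>A maximum over the square of side \<open>R\<close> exists by continuity and is global,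
  because the relevant energies beyond the square are negative while that of 0 is 0. A vanishing
  coefficient that matters is excluded by \<open>J_small_pos\<close> and
  \<open>J_super\<close>.\<close>

lemma Nehari_projection:
  assumes u: "u \<in> Y n"
  shows "\<exists>a>0. \<exists>b>0. T a b u \<in> Nm n"
proof -
  have uX: "u \<in> X" by (rule Y_X[OF u])
  obtain R where R: "R \<ge> 1" "\<And>a b. a \<ge> R \<Longrightarrow> 0 \<le> b \<Longrightarrow> b \<le> a \<Longrightarrow> J (T a b u) < 0"
    "\<And>a b. n \<Longrightarrow> b \<ge> R \<Longrightarrow> 0 \<le> a \<Longrightarrow> a \<le> b \<Longrightarrow> J (T a b u) < 0"
    using J_large_neg[OF u] by blast
  define S where "S = {0..R} \<times> {0..R}"
  define uR where "uR = (\<lambda>x. R * u x)"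
  have "fam S uR uR (\<lambda>\<theta>. T (fst \<theta>) (snd \<theta>) u)"
    unfolding fam_def
  proof (intro conjI ballI allI)
    show "uR \<in> X" "uR \<in> X" unfolding uR_def by (rule X_scale[OF uX])+
    show "T (fst \<theta>) (snd \<theta>) u \<in> X" for \<theta> by (rule T_X[OF uX])
    show "continuous_on S (\<lambda>\<theta>. T (fst \<theta>) (snd \<theta>) u x)" for x
      unfolding T_def tw_def by (intro continuous_intros)
    fix \<theta> assume \<theta>: "\<theta> \<in> S"
    show "\<bar>D (T (fst \<theta>) (snd \<theta>) u) y\<bar> \<le> 2 * (\<bar>D uR y\<bar> + \<bar>D uR y\<bar>)" for y
      using T_D[of "fst \<theta>" R "snd \<theta>" u y] \<theta> R(1) by (auto simp: S_def uR_def D_scale abs_mult)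
    show "\<bar>T (fst \<theta>) (snd \<theta>) u x\<bar> \<le> 2 * (\<bar>uR x\<bar> + \<bar>uR x\<bar>)" for x
      using tw_lipschitz[of "fst \<theta>" R "snd \<theta>" "u x" 0] \<theta> R(1) by (auto simp: S_def uR_def T_def abs_mult)
  qed
  then have cont: "continuous_on S (\<lambda>\<theta>. J (T (fst \<theta>) (snd \<theta>) u))" by (rule fam_J)
  have "compact S" "S \<noteq> {}" using R(1) by (auto simp: S_def intro: compact_Times)
  from continuous_attains_sup[OF this cont] obtain a b where ab: "0 \<le> a" "a \<le> R" "0 \<le> b" "b \<le> R"
    and max: "\<And>a' b'. 0 \<le> a' \<Longrightarrow> a' \<le> R \<Longrightarrow> 0 \<le> b' \<Longrightarrow> b' \<le> R \<Longrightarrow> J (T a' b' u) \<le> J (T a b u)"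
    by (fastforce simp: S_def)
  have "J (T 0 0 u) = 0"
    by (simp add: J_def A_def \<Phi>_def T_def tw_def hoelder_quotient_def split_beta G_0 F_0)
  then have pos: "J (T a b u) \<ge> 0" using max[of 0 0] R(1) by simp
  have ind: "T a' b' u = T a' b'' u" if "\<not> n" for a' b' b''
    using u that by (simp add: Y_def T_nonneg)
  have global: "J (T a' b' u) \<le> J (T a b u)" if "a' \<ge> 0" "b' \<ge> 0" for a' b'
  proof (cases n)
    case True
    show ?thesis
    proof (cases "a' \<le> R \<and> b' \<le> R")
      case False
      then show ?thesis using R(2)[of a' b'] R(3)[OF True, of b' a'] that pos by (cases "b' \<le> a'") auto
    qed (use max that in auto)
  next
    case False
    show ?thesis
    proof (cases "a' \<le> R")
      case True
      then show ?thesis using max[of a' 0] ind[OF False, of a' b' 0] that R(1) by simp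
    next
      case aR: False
      then show ?thesis using R(2)[of a' 0] ind[OF False, of a' b' 0] that pos by simp
    qed
  qed
  have X1: "T 1 0 u \<in> X" "T 0 1 u \<in> X" by (rule T_X[OF uX])+
  have R0: "R > 0" using R(1) by simp
  have a: "a > 0"
  proof (rule ccontr)
    assume "\<not> a > 0"
    then have a0: "a = 0" using ab by simp
    obtain e where e: "0 < e" "e \<le> R" "J (\<lambda>x. e * T 1 0 u x) > 0"
      using J_small_pos[OF X1(1) _ R0] u by (auto simp: Y_def)
    have "J (T e 0 u) > 0" using e T_c[of e 1 0 u] by simp
    then have "J (T 0 b u) < J (T e b u)" using J_super(1)[OF uX, of e b] e ab by simp
    then show False using max[of e b] e ab a0 by simp
  qed
  show ?thesis
  proof (cases n)
    case True
    have b: "b > 0"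
    proof (rule ccontr)
      assume "\<not> b > 0"
      then have b0: "b = 0" using ab by simp
      obtain e where e: "0 < e" "e \<le> R" "J (\<lambda>x. e * T 0 1 u x) > 0"
        using J_small_pos[OF X1(2) _ R0] u True by (auto simp: Y_def)
      have "J (T 0 e u) > 0" using e T_c[of e 0 1 u] by simp
      then have "J (T a 0 u) < J (T a e u)" using J_super(1)[OF uX, of a e] e ab by simp
      then show False using max[of a e] e ab b0 by simp
    qed
    have "T a b u \<in> Nm n"
      unfolding Nm_def using Y_T[OF u a b] global ab by (auto simp: T_T)
    then show ?thesis using a b by blast
  next
    case False
    \<comment> \<open>The maximiser may have \<open>b = 0\<close>; as \<open>b\<close> has no effect
      here, 1 serves as a positive value.\<close>
    have "T a 1 u \<in> Nm n"
      unfolding Nm_def using Y_T[OF u a zero_less_one] global ind[OF False, of a 1 b] ab by (auto simp: T_T)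
    then show ?thesis using a by (intro exI[of _ a] conjI exI[of _ 1]) auto
  qed
qed

text \<open>\<open>J\<close> is a difference of convex functionals. Supporting lines at both
  endpoints bound the increment on either side, with the derivatives of \<open>A\<close> and of
  \<open>\<Phi>\<close> taken at opposite ends.\<close>

lemma J_increment:
  assumes "u \<in> X" "h \<in> X"
  shows "J u + (gA u h - fv (\<lambda>x. u x + h x) h) \<le> J (\<lambda>x. u x + h x)"
    and "J (\<lambda>x. u x + h x) \<le> J u + (gA (\<lambda>x. u x + h x) h - fv u h)"
proof -
  let ?w = "\<lambda>x. u x + h x"
  have w: "?w \<in> X" using X_lin[OF assms, of 1 1] by simp
  have mh: "(\<lambda>x. - h x) \<in> X" using X_scale(1)[OF assms(2), of "-1"] by simp
  have neg: "gA ?w (\<lambda>x. - h x) = - gA ?w h" "fv ?w (\<lambda>x. - h x) = - fv ?w h"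
    using gA_lin[OF w assms(2) assms(2), of "-1" 0] fv_lin[OF w assms(2) assms(2), of "-1" 0] by auto
  have "A ?w - gA ?w h \<le> A u" using A_subgradient[OF w mh] neg by simp
  moreover have "\<Phi> ?w - fv ?w h \<le> \<Phi> u" using \<Phi>_subgradient[OF w mh] neg by simp
  moreover have "A u + gA u h \<le> A ?w" "\<Phi> u + fv u h \<le> \<Phi> ?w"
    using A_subgradient[OF assms] \<Phi>_subgradient[OF assms] by auto
  ultimately show "J u + (gA u h - fv ?w h) \<le> J ?w" "J ?w \<le> J u + (gA ?w h - fv u h)"
    by (auto simp: J_def)
qed

text \<open>In the lower bound of \<open>J_increment\<close> the term \<open>gA u h\<close> stays at
  \<open>u\<close>, and only \<open>fv\<close> moves with \<open>t\<close>. Dividing by positive and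
  by negative \<open>t\<close> and letting \<open>t\<close> tend to 0 uses continuity of
  \<open>fv\<close> alone.\<close>

lemma critical_direction:
  assumes u: "u \<in> X" and h: "h \<in> X"
    and max: "\<And>t. \<bar>t\<bar> \<le> 1 \<Longrightarrow> J (\<lambda>x. u x + t * h x) \<le> J u"
  shows "gA u h = fv u h"
proof -
  define z where "z t = (\<lambda>x. u x + t * h x)" for t
  have "fam {-1..1} u h z"
    unfolding fam_def z_def
  proof (intro conjI ballI allI u h)
    fix t :: real assume t: "t \<in> {-1..1}"
    show "(\<lambda>x. u x + t * h x) \<in> X" using X_lin[OF u h, of 1 t] by simp
    have "\<bar>t\<bar> \<le> 1" using t by auto
    then have th: "\<bar>t * c\<bar> \<le> \<bar>c\<bar>" for c by (simp add: abs_mult mult_left_le_one_le)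
    show "\<bar>D (\<lambda>x. u x + t * h x) y\<bar> \<le> 2 * (\<bar>D u y\<bar> + \<bar>D h y\<bar>)" for y
      using D_lin[of 1 u t h y] th[of "D h y"] by simp
    show "\<bar>u x + t * h x\<bar> \<le> 2 * (\<bar>u x\<bar> + \<bar>h x\<bar>)" for x using th[of "h x"] by simp
  qed (intro continuous_intros)
  moreover have "fam {-1..1} u h (\<lambda>_. h)" using u h by (simp add: fam_def)
  ultimately have cont: "continuous_on {-1..1} (\<lambda>t. fv (z t) h)" by (rule fam_fv)
  have z0: "z 0 = u" by (simp add: z_def)
  have le: "t * (gA u h - fv (z t) h) \<le> 0" if "\<bar>t\<bar> \<le> 1" for t
  proof -
    have th: "(\<lambda>x. t * h x) \<in> X" by (rule X_scale[OF h])
    have zX: "z t \<in> X" using X_lin[OF u h, of 1 t] by (simp add: z_def)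
    have "gA u (\<lambda>x. t * h x) = t * gA u h" "fv (z t) (\<lambda>x. t * h x) = t * fv (z t) h"
      using gA_lin[OF u h h, of t 0] fv_lin[OF zX h h, of t 0] by auto
    then show ?thesis using J_increment(1)[OF u th] max[OF that] by (simp add: z_def right_diff_distrib)
  qed
  have seq: "(\<lambda>n. gA u h - fv (z (c / (real n + 1))) h) \<longlonglongrightarrow> gA u h - fv u h" if "\<bar>c\<bar> = 1" for c
  proof -
    have "(\<lambda>n. fv (z (c / (real n + 1))) h) \<longlonglongrightarrow> fv (z 0) h"
    proof (rule continuous_on_tendsto_compose[OF cont])
      show "(\<lambda>n. c / (real n + 1)) \<longlonglongrightarrow> 0" by real_asymp
      show "\<forall>\<^sub>F n in sequentially. c / (real n + 1) \<in> {- 1..1}"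
        using that by (intro always_eventually allI) (auto simp: field_simps abs_if split: if_splits)
    qed simp
    then show ?thesis using z0 by (auto intro!: tendsto_intros)
  qed
  have "gA u h - fv (z (1 / (real n + 1))) h \<le> 0" for n
    using le[of "1 / (real n + 1)"] by (simp add: mult_le_0_iff divide_le_0_iff field_simps)
  then have "gA u h - fv u h \<le> 0" by (intro LIMSEQ_le_const2[OF seq[of 1]]) auto
  moreover have "gA u h - fv (z (- 1 / (real n + 1))) h \<ge> 0" for n
    using le[of "- 1 / (real n + 1)"] by (simp add: field_simps)
  then have "gA u h - fv u h \<ge> 0" by (intro LIMSEQ_le_const[OF seq[of "-1"]]) auto
  ultimately show ?thesis by simp
qed

lemma Nm_critical:
  assumes u: "u \<in> Nm n" shows "Ppos u = 0" "Pneg u = 0"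
proof -
  have uX: "u \<in> X" using u by (simp add: Nm_def Y_def)
  have "J (\<lambda>x. u x + t * T 1 0 u x) \<le> J u" if "\<bar>t\<bar> \<le> 1" for t
  proof -
    \<comment> \<open>For \<open>\<bar>t\<bar> \<le> 1\<close> the perturbed function stays on the
      fibre with nonnegative coefficients.\<close>
    have "(\<lambda>x. u x + t * T 1 0 u x) = T (1 + t) 1 u"
      using tw_add[of 1 1 _ t 0] T_c[of t 1 0 u] T_1[of u] by (simp add: T_def fun_eq_iff) (metis add.commute)
    then show ?thesis using u that by (auto simp: Nm_def)
  qed
  then show "Ppos u = 0" unfolding Ppos_def using critical_direction[OF uX T_X(1)[OF uX]] by simp
  have "J (\<lambda>x. u x + t * T 0 1 u x) \<le> J u" if "\<bar>t\<bar> \<le> 1" for t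
  proof -
    have "(\<lambda>x. u x + t * T 0 1 u x) = T 1 (1 + t) u"
      using tw_add[of 1 1 _ 0 t] T_c[of t 0 1 u] T_1[of u] by (simp add: T_def fun_eq_iff) (metis add.commute)
    then show ?thesis using u that by (auto simp: Nm_def)
  qed
  then show "Pneg u = 0" unfolding Pneg_def using critical_direction[OF uX T_X(1)[OF uX]] by simp
qed

text \<open>If \<open>c\<close> dominates both coefficients, every ordered pair satisfies
  \<open>D (T a b u) \<le> c * D u\<close>, and \<open>g_scale\<close> extracts
  \<open>c powr (p - 1)\<close>; the last power comes from the tested function. Through the nonlocal
  coupling the other coefficient enters as well, hence the condition on both.\<close>

lemma gA_T_upper:
  assumes u: "u \<in> X" and c: "c \<ge> 1" and ab: "0 \<le> a" "a \<le> c" "0 \<le> b" "b \<le> c" and de: "0 \<le> d" "0 \<le> e"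
  shows "gA (T a b u) (T (c * d) (c * e) u) \<le> c powr p * gA u (T d e u)"
proof (rule gA_le)
  fix z
  show "g (D (T a b u) z) * D (T (c * d) (c * e) u) z \<le> c powr p * (g (D u z) * D (T d e u) z)"
  proof (rule pair_wlog[of u])
    fix x y assume xy: "u y \<le> u x"
    have 1: "0 \<le> D (T a b u) (x, y)" "D (T a b u) (x, y) \<le> c * D u (x, y)"
      using D_T_mono[OF ab xy] by (auto simp: T_cc D_scale)
    have 2: "0 \<le> D (T d e u) (x, y)" using D_T_mono(1)[of d d e e u y x] de xy by simp
    have 3: "0 \<le> D u (x, y)" using D_T_mono(1)[of 1 1 1 1 u y x] xy by simp
    have "g (D (T a b u) (x, y)) \<le> g (c * D u (x, y))" by (rule g_mono[OF 1(2)])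
    also have "\<dots> \<le> c powr (p - 1) * g (D u (x, y))" by (rule g_scale[OF c 3])
    finally have "g (D (T a b u) (x, y)) * (c * D (T d e u) (x, y)) \<le> c powr (p - 1) * g (D u (x, y)) * (c * D (T d e u) (x, y))"
      using 2 c by (intro mult_right_mono) auto
    also have "\<dots> = c powr p * (g (D u (x, y)) * D (T d e u) (x, y))"
      using c by (simp add: powr_diff)
    finally show "g (D (T a b u) (x, y)) * D (T (c * d) (c * e) u) (x, y) \<le> c powr p * (g (D u (x, y)) * D (T d e u) (x, y))"
      by (simp add: T_c D_scale)
  next
    fix x y assume "g (D (T a b u) (y, x)) * D (T (c * d) (c * e) u) (y, x) \<le> c powr p * (g (D u (y, x)) * D (T d e u) (y, x))"
    then show "g (D (T a b u) (x, y)) * D (T (c * d) (c * e) u) (x, y) \<le> c powr p * (g (D u (x, y)) * D (T d e u) (x, y))"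
      by (simp add: D_swap[of _ y x] g_odd)
  qed
qed (use u in \<open>auto intro: T_X\<close>)

text \<open>Mirror image of the upper bound: \<open>c\<close> is below both coefficients, and
  \<open>g_scale\<close> is used with the factor \<open>1 / c\<close>.\<close>

lemma gA_T_lower:
  assumes u: "u \<in> X" and c: "0 < c" "c \<le> 1" and ab: "c \<le> a" "c \<le> b" and de: "0 \<le> d" "0 \<le> e"
  shows "c powr p * gA u (T d e u) \<le> gA (T a b u) (T (c * d) (c * e) u)"
proof -
  have "gA u (T d e u) \<le> (1 / c powr p) * gA (T a b u) (T (c * d) (c * e) u)"
  proof (rule gA_le)
    fix z
    show "g (D u z) * D (T d e u) z \<le> 1 / c powr p * (g (D (T a b u) z) * D (T (c * d) (c * e) u) z)"
    proof (rule pair_wlog[of u])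
      fix x y assume xy: "u y \<le> u x"
      have 1: "c * D u (x, y) \<le> D (T a b u) (x, y)"
        using D_T_mono(2)[of c a c b u y x] ab c xy by (auto simp: T_cc D_scale)
      have 2: "0 \<le> D (T d e u) (x, y)" using D_T_mono(1)[of d d e e u y x] de xy by simp
      have 3: "0 \<le> D u (x, y)" using D_T_mono(1)[of 1 1 1 1 u y x] xy by simp
      have "g (1 / c * (c * D u (x, y))) \<le> (1 / c) powr (p - 1) * g (c * D u (x, y))"
        by (rule g_scale) (use c 3 in auto)
      also have "\<dots> \<le> (1 / c) powr (p - 1) * g (D (T a b u) (x, y))"
        by (intro mult_left_mono g_mono 1) auto
      finally have "g (D u (x, y)) * D (T d e u) (x, y) \<le> (1 / c) powr (p - 1) * g (D (T a b u) (x, y)) * D (T d e u) (x, y)"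
        using 2 c by (intro mult_right_mono) auto
      also have "\<dots> = 1 / c powr p * (g (D (T a b u) (x, y)) * (c * D (T d e u) (x, y)))"
        using c by (simp add: powr_diff powr_divide)
      finally show "g (D u (x, y)) * D (T d e u) (x, y) \<le> 1 / c powr p * (g (D (T a b u) (x, y)) * D (T (c * d) (c * e) u) (x, y))"
        by (simp add: T_c D_scale)
    next
      fix x y assume "g (D u (y, x)) * D (T d e u) (y, x) \<le> 1 / c powr p * (g (D (T a b u) (y, x)) * D (T (c * d) (c * e) u) (y, x))"
      then show "g (D u (x, y)) * D (T d e u) (x, y) \<le> 1 / c powr p * (g (D (T a b u) (x, y)) * D (T (c * d) (c * e) u) (x, y))"
        by (simp add: D_swap[of _ y x] g_odd)
    qed
  qed (use u in \<open>auto intro: T_X\<close>)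
  then show ?thesis using c by (simp add: field_simps)
qed

text \<open>\<open>fv\<close> is local: where the tested part is nonzero, the function in the first
  argument is \<open>c * u\<close>, so the other coefficient \<open>b\<close> drops out.\<close>

lemma fv_T:
  assumes u: "u \<in> X" and c: "c > 0"
  shows "1 \<le> c \<Longrightarrow> c powr q * fv u (T 1 0 u) \<le> fv (T c b u) (T c 0 u)"
    and "1 \<le> c \<Longrightarrow> c powr q * fv u (T 0 1 u) \<le> fv (T b c u) (T 0 c u)"
    and "c \<le> 1 \<Longrightarrow> fv (T c b u) (T c 0 u) \<le> c powr q * fv u (T 1 0 u)"
    and "c \<le> 1 \<Longrightarrow> fv (T b c u) (T 0 c u) \<le> c powr q * fv u (T 0 1 u)"
proof -
  have X: "T a d u \<in> X" for a d by (rule T_X[OF u])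
  have inv: "fv u h \<le> 1 / c powr q * fv u' h' \<Longrightarrow> c powr q * fv u h \<le> fv u' h'" for h u' h'
    using c by (simp add: field_simps)
  have up: "f x t * t \<le> 1 / c powr q * (f x (c * t) * (c * t))" if "1 \<le> c" for x t
    using f_scale[OF that, of x t] c by (simp add: field_simps)
  show "c powr q * fv u (T 1 0 u) \<le> fv (T c b u) (T c 0 u)" if "1 \<le> c"
    using up[OF that] by (intro inv fv_le X u) (auto simp: T_def tw_def max_def min_def)
  show "c powr q * fv u (T 0 1 u) \<le> fv (T b c u) (T 0 c u)" if "1 \<le> c"
    using up[OF that] by (intro inv fv_le X u) (auto simp: T_def tw_def max_def min_def)
  show "fv (T c b u) (T c 0 u) \<le> c powr q * fv u (T 1 0 u)" if "c \<le> 1"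
    using f_scale_le[OF c that] by (intro fv_le X u) (auto simp: T_def tw_def max_def min_def)
  show "fv (T b c u) (T 0 c u) \<le> c powr q * fv u (T 0 1 u)" if "c \<le> 1"
    using f_scale_le[OF c that] by (intro fv_le X u) (auto simp: T_def tw_def max_def min_def)
qed

text \<open>Both terms of \<open>Ppos u\<close> equal the same \<open>k > 0\<close>. On the fibre
  the first is compared with \<open>a powr p * k\<close> and the second with
  \<open>a powr q * k\<close>, and \<open>p < q\<close> decides the sign, provided \<open>a\<close>
  is the larger coefficient when \<open>a > 1\<close> and the smaller one when
  \<open>a < 1\<close>.\<close>

lemma Ppos_T:
  assumes u: "u \<in> X" "Ppos u = 0" "\<rho> (T 1 0 u) > 0"
  shows "1 < a \<Longrightarrow> 0 \<le> b \<Longrightarrow> b \<le> a \<Longrightarrow> Ppos (T a b u) < 0"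
    and "0 < a \<Longrightarrow> a < 1 \<Longrightarrow> a \<le> b \<Longrightarrow> Ppos (T a b u) > 0"
proof -
  define k where "k = fv u (T 1 0 u)"
  have gk: "gA u (T 1 0 u) = k" using u(2) by (simp add: k_def Ppos_def)
  have "c1 * \<rho> (T 1 0 u) \<le> k" using fv_lower[OF T_X(1)[OF u(1)], of 1 0] fv_part[of 1 0 u] by (simp add: k_def)
  then have k: "k > 0" using u(3) c14 by (auto intro: less_le_trans mult_pos_pos)
  show "Ppos (T a b u) < 0" if *: "1 < a" "0 \<le> b" "b \<le> a"
  proof -
    have "Ppos (T a b u) \<le> a powr p * k - a powr q * k"
      using gA_T_upper[OF u(1), of a a b 1 0] fv_T(1)[OF u(1), of a b] * gk
      by (simp add: Ppos_def T_T k_def)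
    moreover have "a powr p * k < a powr q * k" using k pq * by (intro mult_strict_right_mono powr_less_mono) auto
    ultimately show ?thesis by simp
  qed
  show "Ppos (T a b u) > 0" if *: "0 < a" "a < 1" "a \<le> b"
  proof -
    have "Ppos (T a b u) \<ge> a powr p * k - a powr q * k"
      using gA_T_lower[OF u(1), of a a b 1 0] fv_T(3)[OF u(1), of a b] * gk
      by (simp add: Ppos_def T_T k_def)
    moreover have "a powr q * k < a powr p * k" using k pq * by (intro mult_strict_right_mono powr_less_mono') auto
    ultimately show ?thesis by simp
  qed
qed

lemma Pneg_T:
  assumes u: "u \<in> X" "Pneg u = 0" "\<rho> (T 0 1 u) > 0"
  shows "1 < b \<Longrightarrow> 0 \<le> a \<Longrightarrow> a \<le> b \<Longrightarrow> Pneg (T a b u) < 0"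
    and "0 < b \<Longrightarrow> b < 1 \<Longrightarrow> b \<le> a \<Longrightarrow> Pneg (T a b u) > 0"
proof -
  define k where "k = fv u (T 0 1 u)"
  have gk: "gA u (T 0 1 u) = k" using u(2) by (simp add: k_def Pneg_def)
  have "c1 * \<rho> (T 0 1 u) \<le> k" using fv_lower[OF T_X(1)[OF u(1)], of 0 1] fv_part[of 0 1 u] by (simp add: k_def)
  then have k: "k > 0" using u(3) c14 by (auto intro: less_le_trans mult_pos_pos)
  show "Pneg (T a b u) < 0" if *: "1 < b" "0 \<le> a" "a \<le> b"
  proof -
    have "Pneg (T a b u) \<le> b powr p * k - b powr q * k"
      using gA_T_upper[OF u(1), of b a b 0 1] fv_T(2)[OF u(1), of b a] * gk
      by (simp add: Pneg_def T_T k_def)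
    moreover have "b powr p * k < b powr q * k" using k pq * by (intro mult_strict_right_mono powr_less_mono) auto
    ultimately show ?thesis by simp
  qed
  show "Pneg (T a b u) > 0" if *: "0 < b" "b < 1" "b \<le> a"
  proof -
    have "Pneg (T a b u) \<ge> b powr p * k - b powr q * k"
      using gA_T_lower[OF u(1), of b a b 0 1] fv_T(4)[OF u(1), of b a] * gk
      by (simp add: Pneg_def T_T k_def)
    moreover have "b powr q * k < b powr p * k" using k pq * by (intro mult_strict_right_mono powr_less_mono') auto
    ultimately show ?thesis by simp
  qed
qed

text \<open>The projection of \<open>u\<close> to the Nehari set has vanishing derivatives too. By
  \<open>Ppos_T\<close> and \<open>Pneg_T\<close> its larger coefficient cannot exceed 1 and its
  smaller one cannot be below 1, so the projection is \<open>u\<close> itself.\<close>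

lemma Nm_unique:
  assumes u: "u \<in> Y n" "Ppos u = 0" "n \<Longrightarrow> Pneg u = 0" shows "u \<in> Nm n"
proof -
  have uX: "u \<in> X" by (rule Y_X[OF u(1)])
  have pos: "\<rho> (T 1 0 u) > 0" "n \<Longrightarrow> \<rho> (T 0 1 u) > 0" using u(1) by (auto simp: Y_def)
  obtain a b where ab: "a > 0" "b > 0" "T a b u \<in> Nm n" using Nehari_projection[OF u(1)] by blast
  have P: "Ppos (T a b u) = 0" "Pneg (T a b u) = 0" using Nm_critical[OF ab(3)] by auto
  have "T a b u = u"
  proof (cases n)
    case True
    have "a \<le> 1 \<or> a < b" using Ppos_T(1)[OF uX u(2) pos(1), of a b] P ab by force
    moreover have "a \<ge> 1 \<or> b < a" using Ppos_T(2)[OF uX u(2) pos(1), of a b] P ab by force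
    moreover have "b \<le> 1 \<or> b < a" using Pneg_T(1)[OF uX u(3)[OF True] pos(2)[OF True], of b a] P ab by force
    moreover have "b \<ge> 1 \<or> a < b" using Pneg_T(2)[OF uX u(3)[OF True] pos(2)[OF True], of b a] P ab by force
    ultimately have "a = 1 \<and> b = 1" by linarith
    then show ?thesis by simp
  next
    case False
    then have eq: "T a b u = T a a u" using u(1) by (simp add: Y_def T_nonneg)
    have "a \<le> 1" using Ppos_T(1)[OF uX u(2) pos(1), of a a] P(1) eq ab by force
    moreover have "a \<ge> 1" using Ppos_T(2)[OF uX u(2) pos(1), of a a] P(1) eq ab by force
    ultimately show ?thesis using eq by (simp add: T_cc)
  qed
  then show ?thesis using ab by simp
qed

end

section \<open>Minimisers on the Nehari sets are weak solutions\<close>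

context nehari
begin

lemma gA_split: "u \<in> X \<Longrightarrow> h \<in> X \<Longrightarrow> gA h u = gA h (T 1 0 u) + gA h (T 0 1 u)"
  and fv_split: "u \<in> X \<Longrightarrow> h \<in> X \<Longrightarrow> fv h u = fv h (T 1 0 u) + fv h (T 0 1 u)"
proof -
  have eq: "u = (\<lambda>x. 1 * T 1 0 u x + 1 * T 0 1 u x)" by (auto simp: T_def tw_def max_def min_def fun_eq_iff)
  show "gA h u = gA h (T 1 0 u) + gA h (T 0 1 u)" if "u \<in> X" "h \<in> X"
    by (subst eq, subst gA_lin) (use that T_X in auto)
  show "fv h u = fv h (T 1 0 u) + fv h (T 0 1 u)" if "u \<in> X" "h \<in> X"
    by (subst eq, subst fv_lin) (use that T_X in auto)
qed

text \<open>Coercivity: on the Nehari set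
  \<open>q * \<Phi> u \<le> fv u u = gA u u \<le> p * A u\<close>, and \<open>p < q\<close>.\<close>

lemma Nm_energy:
  assumes u: "u \<in> Nm n" shows "(1 - p / q) * A u \<le> J u"
proof -
  have uX: "u \<in> X" using u by (simp add: Nm_def Y_def)
  have "gA u u \<le> (\<integral>z. p * G (D u z) \<partial>mub)"
    unfolding gA_def
  proof (rule integral_mono)
    fix z
    have "D u z * g (D u z) \<le> p * G (D u z)"
      using g_bound[of "D u z"] g_bound[of "- D u z"] by (cases "D u z \<ge> 0") (auto simp: g_odd G_even)
    then show "g (D u z) * D u z \<le> p * G (D u z)" by (simp add: mult.commute)
  qed (use integrable_gA[OF uX uX] X_integrable[OF uX] in auto)
  then have 1: "gA u u \<le> p * A u" by (simp add: A_def)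
  have "(\<integral>x. q * F x (u x) \<partial>lebesgue) \<le> fv u u"
    unfolding fv_def using integrable_F[OF uX] integrable_fv[OF uX uX] F_AR by (intro integral_mono) auto
  then have 2: "q * \<Phi> u \<le> fv u u" by (simp add: \<Phi>_def)
  have "gA u u = fv u u"
    using Nm_critical[OF u] gA_split[OF uX uX] fv_split[OF uX uX] by (simp add: Ppos_def Pneg_def)
  then have "q * \<Phi> u \<le> p * A u" using 1 2 by simp
  then have "\<Phi> u \<le> p / q * A u" using p pq by (simp add: field_simps)
  then show ?thesis by (simp add: J_def algebra_simps)
qed

text \<open>For each part, \<open>gA_part\<close> and the Nehari identity give
  \<open>A \<le> c4 * \<rho>\<close>, which \<open>A_small\<close> rules out below the energy
  \<open>\<eta>\<close>. Hence the part has energy above \<open>\<eta>\<close> and, by the same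
  inequality, \<open>\<rho>\<close> at least \<open>\<eta> / c4\<close>.\<close>

lemma Nm_lower:
  "\<exists>\<kappa>>0. \<forall>n. \<forall>u\<in>Nm n. \<kappa> \<le> \<rho> (T 1 0 u) \<and> (n \<longrightarrow> \<kappa> \<le> \<rho> (T 0 1 u))"
proof -
  obtain \<eta> where \<eta>: "\<eta> > 0" "\<And>w. w \<in> X \<Longrightarrow> 0 < \<rho> w \<Longrightarrow> A w \<le> \<eta> \<Longrightarrow> c4 * \<rho> w < A w"
    using A_small by blast
  have part: "\<eta> / c4 \<le> \<rho> (T a b u)"
    if u: "u \<in> X" and ab: "a = 0 \<or> a = 1" "b = 0 \<or> b = 1" and P: "gA u (T a b u) = fv u (T a b u)"
      and pos: "\<rho> (T a b u) > 0" for a b u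
  proof -
    have X: "T a b u \<in> X" by (rule T_X[OF u])
    have "A (T a b u) \<le> gA u (T a b u)" by (rule gA_part[OF u]) (use ab in auto)
    also have "\<dots> = fv (T a b u) (T a b u)" using P fv_part[OF ab] by simp
    also have "\<dots> \<le> c4 * \<rho> (T a b u)" by (rule fv_upper[OF X])
    finally have le: "A (T a b u) \<le> c4 * \<rho> (T a b u)" .
    then have "\<eta> < A (T a b u)" using \<eta>(2)[OF X pos] by force
    then show ?thesis using le c14 by (simp add: field_simps)
  qed
  show ?thesis
  proof (intro exI[of _ "\<eta> / c4"] conjI allI ballI impI)
    fix n u assume u: "u \<in> Nm n"
    then have uX: "u \<in> X" by (simp add: Nm_def Y_def)
    show "\<eta> / c4 \<le> \<rho> (T 1 0 u)"
      using part[OF uX, of 1 0] Nm_critical[OF u] u by (simp add: Ppos_def Nm_def Y_def)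
    show "\<eta> / c4 \<le> \<rho> (T 0 1 u)" if n
      using part[OF uX, of 0 1] Nm_critical[OF u] u that by (simp add: Pneg_def Nm_def Y_def)
  qed (use \<eta> c14 in auto)
qed

text \<open>The limit of a minimising sequence is not shown to lie in \<open>Nm n\<close> directly.
  Fibre maximality of the sequence and Fatou's lemma give \<open>J (T a b w) \<le> c\<close> for all
  nonnegative \<open>a\<close> and \<open>b\<close>, and the lower bound on the parts puts
  \<open>w\<close> into \<open>Y n\<close>; projecting \<open>w\<close> then gives the
  minimiser.\<close>

lemma minimizer:
  assumes Y: "Y n \<noteq> {}"
  shows "\<exists>w\<in>Nm n. \<forall>z\<in>Nm n. J w \<le> J z"
proof -
  define c where "c = Inf (J ` Nm n)"
  have \<theta>: "1 - p / q > 0" using p pq by simp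
  have J0: "J u \<ge> 0" if "u \<in> Nm n" for u
  proof -
    have "0 \<le> (1 - p / q) * A u" using \<theta> A_nonneg by (intro mult_nonneg_nonneg) auto
    then show ?thesis using Nm_energy[OF that] by simp
  qed
  have bdd: "bdd_below (J ` Nm n)" using J0 by (auto intro: bdd_belowI[of _ 0])
  have ne: "J ` Nm n \<noteq> {}" using Nehari_projection Y by blast
  have c_le: "c \<le> J z" if "z \<in> Nm n" for z unfolding c_def using that by (intro cInf_lower bdd) auto
  have "\<exists>u\<in>Nm n. J u < c + 1 / (real k + 1)" for k
    using cInf_lessD[OF ne, of "c + 1 / (real k + 1)"] by (auto simp: c_def)
  then obtain u where u: "\<And>k. u k \<in> Nm n" "\<And>k. J (u k) < c + 1 / (real k + 1)" by metis
  have uX: "u k \<in> X" for k using u(1)[of k] by (simp add: Nm_def Y_def)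
  define R where "R = (c + 1) / (1 - p / q)"
  have AR: "A (u k) \<le> R" for k
  proof -
    have "1 / (real k + 1) \<le> 1" by simp
    then have "(1 - p / q) * A (u k) \<le> c + 1" using Nm_energy[OF u(1)[of k]] u(2)[of k] by linarith
    then show ?thesis using \<theta> by (simp add: R_def pos_le_divide_eq mult.commute)
  qed
  obtain k w0 where k: "strict_mono k" and w0: "w0 \<in> X" "AE x in lborel. (\<lambda>j. u (k j) x) \<longlonglongrightarrow> w0 x"
    using Rellich[of u R] uX AR by blast
  define v where "v j = u (k j)" for j
  \<comment> \<open>The limit \<open>w0\<close> is known to be nonnegative only almost everywhere,
    whereas \<open>Y\<close> asks for it at every point.\<close>
  define w where "w = (if n then w0 else T 1 0 w0)"
  have wX: "w \<in> X" using w0 T_X by (simp add: w_def)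
  have tw_cont: "continuous_on UNIV (tw a b)" for a b
    unfolding tw_def by (intro continuous_intros)
  have v: "v j \<in> Nm n" "v j \<in> X" "A (v j) \<le> R" for j using u uX AR by (auto simp: v_def)
  have Jv: "J (v j) \<le> c + 1 / (real j + 1)" for j
  proof -
    have "1 / (real (k j) + 1) \<le> 1 / (real j + 1)"
      using seq_suble[OF k, of j] by (simp add: field_simps)
    then show ?thesis using u(2)[of "k j"] by (simp add: v_def)
  qed
  have vw: "AE x in lborel. (\<lambda>j. v j x) \<longlonglongrightarrow> w x"
    using w0(2)
  proof eventually_elim
    case (elim x)
    show ?case
    proof (cases n)
      case False
      then have "T 1 0 (v j) = v j" for j using v(1)[of j] by (simp add: Nm_def Y_def T_nonneg)
      then have "v j x = tw 1 0 (u (k j) x)" for j by (simp add: T_def v_def fun_eq_iff)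
      then show ?thesis
        using continuous_on_tendsto_compose[OF tw_cont elim] False by (simp add: w_def T_def)
    qed (use elim in \<open>simp add: v_def w_def\<close>)
  qed
  have Tvw: "AE x in lborel. (\<lambda>j. T a b (v j) x) \<longlonglongrightarrow> T a b w x" for a b
    using vw
  proof eventually_elim
    case (elim x)
    show ?case unfolding T_def using continuous_on_tendsto_compose[OF tw_cont elim] by simp
  qed
  have TA: "A (T a b (v j)) \<le> max 1 (max \<bar>a\<bar> \<bar>b\<bar>) powr p * R" for a b j
    by (rule order_trans[OF T_X(2)[OF v(2)] mult_left_mono[OF v(3)]]) simp
  have conv: "(\<lambda>j. \<integral>x. \<Psi> x (T a b (v j) x) \<partial>lebesgue) \<longlonglongrightarrow> (\<integral>x. \<Psi> x (T a b w x) \<partial>lebesgue)"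
    if "(\<lambda>(x, t). \<Psi> x t) \<in> borel_measurable (lebesgue \<Otimes>\<^sub>M borel)"
      "\<And>x. continuous_on UNIV (\<Psi> x)" "\<And>x t. \<bar>\<Psi> x t\<bar> \<le> C * B t" for a b \<Psi> C
    by (rule integral_convergence[OF T_X(1)[OF v(2)] TA T_X(1)[OF wX] Tvw that])
  obtain \<kappa> where \<kappa>: "\<kappa> > 0" "\<And>u. u \<in> Nm n \<Longrightarrow> \<kappa> \<le> \<rho> (T 1 0 u)" "\<And>u. u \<in> Nm n \<Longrightarrow> n \<Longrightarrow> \<kappa> \<le> \<rho> (T 0 1 u)"
    using Nm_lower by blast
  have \<rho>conv: "(\<lambda>j. \<rho> (T a b (v j))) \<longlonglongrightarrow> \<rho> (T a b w)" for a b
    unfolding \<rho>_def by (rule conv[OF B_Caratheodory B_cont, of 1]) (simp add: B_nonneg)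
  have "\<kappa> \<le> \<rho> (T 1 0 w)" by (rule LIMSEQ_le_const[OF \<rho>conv]) (use \<kappa>(2) v(1) in auto)
  moreover have "\<kappa> \<le> \<rho> (T 0 1 w)" if n by (rule LIMSEQ_le_const[OF \<rho>conv]) (use \<kappa>(3)[OF _ that] v(1) in auto)
  moreover have "w x \<ge> 0" if "\<not> n" for x using that by (simp add: w_def T_def tw_def)
  ultimately have wY: "w \<in> Y n" using wX \<kappa>(1) by (auto simp: Y_def)
  have JT: "J (T a b w) \<le> c" if ab: "a \<ge> 0" "b \<ge> 0" for a b
  proof -
    have "A (T a b w) \<le> c + \<Phi> (T a b w)"
    proof (rule Fatou_A(2)[where v = "\<lambda>j. T a b (v j)" and c = "\<lambda>j. (c + 1 / (real j + 1)) + \<Phi> (T a b (v j))"])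
      show "T a b (v j) \<in> X" for j by (rule T_X[OF v(2)])
      show "T a b w \<in> borel_measurable borel" by (rule X_borel[OF T_X(1)[OF wX]])
      show "T a b w x = 0" if "x \<notin> \<Omega>" for x by (rule X_zero[OF T_X(1)[OF wX] that])
      show "AE x in lborel. (\<lambda>j. T a b (v j) x) \<longlonglongrightarrow> T a b w x" by (rule Tvw)
      show "A (T a b (v j)) \<le> (c + 1 / (real j + 1)) + \<Phi> (T a b (v j))" for j
      proof -
        have "J (T a b (v j)) \<le> J (v j)" using v(1)[of j] ab by (simp add: Nm_def)
        then show ?thesis using Jv[of j] unfolding J_def by linarith
      qed
      have "(\<lambda>j. \<Phi> (T a b (v j))) \<longlonglongrightarrow> \<Phi> (T a b w)"
        unfolding \<Phi>_def by (rule conv[OF F_meas F_cont F_abs])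
      moreover have "(\<lambda>j. c + 1 / (real j + 1)) \<longlonglongrightarrow> c" by real_asymp
      ultimately show "(\<lambda>j. (c + 1 / (real j + 1)) + \<Phi> (T a b (v j))) \<longlonglongrightarrow> c + \<Phi> (T a b w)"
        by (rule tendsto_add[rotated])
    qed
    then show ?thesis by (simp add: J_def)
  qed
  obtain a b where ab: "a > 0" "b > 0" "T a b w \<in> Nm n" using Nehari_projection[OF wY] by blast
  then show ?thesis using JT[of a b] c_le by (intro bexI[OF _ ab(3)]) (auto intro: order_trans)
qed

text \<open>
  If \<open>J'(w)v < 0\<close>, the energy of the two-parameter family \<open>a w\<^sub>+ - b w\<^sub>- + \<epsilon> v\<close> lies below
  \<open>J w\<close> near \<open>a = b = 1\<close>, whereas a Poincare-Miranda argument finds a member of the family on the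
  Nehari set. For the non-nodal set the family is replaced by its positive part, which does not
  increase the bound on the energy.
\<close>

lemma minimizer_not_descending:
  assumes w: "w \<in> Nm n" and min: "\<And>z. z \<in> Nm n \<Longrightarrow> J w \<le> J z" and v: "v \<in> X"
  shows "\<not> gA w v < fv w v"
proof
  assume desc: "gA w v < fv w v"
  have wY: "w \<in> Y n" and wX: "w \<in> X" using w by (auto simp: Nm_def Y_def)
  define K :: "((real \<times> real) \<times> real) set" where "K = ({0..2} \<times> {0..2}) \<times> {0..1}"
  define \<zeta> where "\<zeta> = (\<lambda>((a, b), \<epsilon>) x. T a b w x + \<epsilon> * v x)"
  define z where "z \<theta> = (if n then \<zeta> \<theta> else T 1 0 (\<zeta> \<theta>))" for \<theta>
  have \<zeta>X: "\<zeta> \<theta> \<in> X" for \<theta>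
    using X_lin[OF T_X(1)[OF wX] v, of 1 _ _ "snd \<theta>"] by (auto simp: \<zeta>_def split_beta)
  have fam\<zeta>: "fam K w v \<zeta>"
    unfolding fam_def
  proof (intro conjI ballI allI wX v \<zeta>X)
    show "continuous_on K (\<lambda>\<theta>. \<zeta> \<theta> x)" for x
      unfolding \<zeta>_def split_beta T_def tw_def by (intro continuous_intros)
    fix \<theta> assume "\<theta> \<in> K"
    then obtain a b \<epsilon> where \<theta>: "\<theta> = ((a, b), \<epsilon>)" "\<bar>a\<bar> \<le> 2" "\<bar>b\<bar> \<le> 2" "\<bar>\<epsilon>\<bar> \<le> 1" by (auto simp: K_def)
    have \<epsilon>: "\<bar>\<epsilon> * t\<bar> \<le> \<bar>t\<bar>" for t using \<theta>(4) by (simp add: abs_mult mult_left_le_one_le)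
    show "\<bar>D (\<zeta> \<theta>) y\<bar> \<le> 2 * (\<bar>D w y\<bar> + \<bar>D v y\<bar>)" for y
      using T_D[OF \<theta>(2,3), of w y] \<epsilon>[of "D v y"] D_lin[of 1 "T a b w" \<epsilon> v y] by (simp add: \<theta>(1) \<zeta>_def)
    show "\<bar>\<zeta> \<theta> x\<bar> \<le> 2 * (\<bar>w x\<bar> + \<bar>v x\<bar>)" for x
      using tw_lipschitz[OF \<theta>(2,3), of "w x" 0] \<epsilon>[of "v x"] by (simp add: \<theta>(1) \<zeta>_def T_def)
  qed
  have famz: "fam K w v z"
    unfolding z_def using fam\<zeta> fam_T[OF fam\<zeta>, of 1 0] by (cases n) auto
  have famv: "fam K w v (\<lambda>_. v)" using wX v by (simp add: fam_def)
  have famT: "fam K w v (\<lambda>\<theta>. T (fst (fst \<theta>)) (snd (fst \<theta>)) w)"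
    unfolding fam_def
  proof (intro conjI ballI allI wX v T_X(1))
    show "continuous_on K (\<lambda>\<theta>. T (fst (fst \<theta>)) (snd (fst \<theta>)) w x)" for x
      unfolding T_def tw_def by (intro continuous_intros)
    fix \<theta> assume "\<theta> \<in> K"
    then have \<theta>: "\<bar>fst (fst \<theta>)\<bar> \<le> 2" "\<bar>snd (fst \<theta>)\<bar> \<le> 2" by (auto simp: K_def)
    show "\<bar>D (T (fst (fst \<theta>)) (snd (fst \<theta>)) w) y\<bar> \<le> 2 * (\<bar>D w y\<bar> + \<bar>D v y\<bar>)" for y
      using T_D[OF \<theta>, of w y] by simp
    show "\<bar>T (fst (fst \<theta>)) (snd (fst \<theta>)) w x\<bar> \<le> 2 * (\<bar>w x\<bar> + \<bar>v x\<bar>)" for x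
      using tw_lipschitz[OF \<theta>, of "w x" 0] by (simp add: T_def)
  qed
  \<comment> \<open>The mixed endpoints of \<open>J_increment(2)\<close>: \<open>gA\<close> at the
    end of the step, \<open>fv\<close> at its start.\<close>
  define Jd where "Jd \<theta> = gA (\<zeta> \<theta>) v - fv (T (fst (fst \<theta>)) (snd (fst \<theta>)) w) v" for \<theta>
  have Jd_cont: "continuous_on K Jd"
    unfolding Jd_def by (intro continuous_on_diff fam_gA[OF fam\<zeta> famv] fam_fv[OF famT famv])
  define P1 where "P1 \<theta> = Ppos (z \<theta>)" for \<theta>
  \<comment> \<open>Without a sign change the second equation is the dummy condition
    \<open>b = 1\<close>, with the same signs on the faces.\<close>
  define P2 where "P2 \<theta> = (if n then Pneg (z \<theta>) else 1 - snd (fst \<theta>))" for \<theta>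
  have P1_cont: "continuous_on K P1"
    unfolding P1_def Ppos_def using famz fam_T[OF famz, of 1 0]
    by (intro continuous_on_diff fam_gA fam_fv) auto
  have P2_cont: "continuous_on K P2"
  proof (cases n)
    case True
    then show ?thesis
      unfolding P2_def Pneg_def using famz fam_T[OF famz, of 0 1] by (auto intro!: continuous_on_diff fam_gA fam_fv)
  qed (auto simp: P2_def intro!: continuous_intros)
  \<comment> \<open>Negative values of \<open>q1\<close> and \<open>q2\<close> express membership in
    \<open>Y\<close>, in the form required by \<open>tube_negative\<close>.\<close>
  define q1 where "q1 \<theta> = - \<rho> (T 1 0 (z \<theta>))" for \<theta>
  define q2 where "q2 \<theta> = (if n then - \<rho> (T 0 1 (z \<theta>)) else -1)" for \<theta>
  have q_cont: "continuous_on K q1" "continuous_on K q2"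
    unfolding q1_def q2_def using fam_T[OF famz, of 1 0] fam_T[OF famz, of 0 1]
    by (cases n; auto intro!: continuous_on_minus fam_\<rho>)+
  have z0: "z ((a, b), 0) = T a b w" if "a \<ge> 0" "b \<ge> 0" for a b
    using wY that by (auto simp: z_def \<zeta>_def Y_def T_T T_nonneg)
  have "Jd ((1, 1), 0) < 0" using desc by (simp add: Jd_def \<zeta>_def)
  moreover have "((1, 1), 0) \<in> K" by (simp add: K_def)
  ultimately obtain d where d: "d > 0" "\<And>\<theta>. \<theta> \<in> K \<Longrightarrow> dist \<theta> ((1, 1), 0) < d \<Longrightarrow> dist (Jd \<theta>) (Jd ((1, 1), 0)) < - Jd ((1, 1), 0)"
    using Jd_cont unfolding continuous_on_iff by (metis neg_0_less_iff_less)
  \<comment> \<open>Three coordinate deviations of at most \<open>d / 4\<close> stay below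
    \<open>d\<close>, and the bound \<open>1 / 2\<close> keeps the coefficients positive.\<close>
  define \<delta> where "\<delta> = min (d / 4) (1 / 2)"
  have \<delta>: "0 < \<delta>" "\<delta> \<le> 1 / 2" "4 * \<delta> \<le> d" using d(1) by (auto simp: \<delta>_def)
  define I where "I = {1 - \<delta>..1 + \<delta>}"
  have Isub: "(I \<times> I) \<times> {0..\<delta>} \<subseteq> K" using \<delta> by (auto simp: I_def K_def)
  have Jneg: "Jd ((a, b), \<epsilon>) < 0" if "a \<in> I" "b \<in> I" "\<epsilon> \<in> {0..\<delta>}" for a b \<epsilon>
  proof -
    have "dist ((a, b), \<epsilon>) ((1, 1), 0 :: real) \<le> dist (a, b) (1, 1) + dist \<epsilon> 0"
      unfolding dist_prod_def fst_conv snd_conv by (intro sqrt_sum_squares_le_sum) auto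
    also have "dist (a, b) (1, 1 :: real) \<le> dist a 1 + dist b 1"
      unfolding dist_prod_def fst_conv snd_conv by (intro sqrt_sum_squares_le_sum) auto
    also have "dist a 1 + dist b 1 + dist \<epsilon> 0 < d" using that \<delta> by (auto simp: I_def dist_real_def)
    finally have "dist ((a, b), \<epsilon>) ((1, 1), 0 :: real) < d" by simp
    then show ?thesis using d(2)[of "((a, b), \<epsilon>)"] Isub that by (fastforce simp: dist_real_def)
  qed
  have cI: "compact I" "compact (I \<times> I)" by (auto simp: I_def intro: compact_Times)
  \<comment> \<open>\<open>\<gamma>\<close> parametrises one side of the square; each of the four
    sides gets its own range of deformation parameters.\<close>
  have face: "\<exists>e>0. e \<le> \<delta> \<and> (\<forall>\<epsilon>\<in>{0..e}. \<forall>t\<in>I. h (\<gamma> t, \<epsilon>) < 0)"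
    if "continuous_on K h" "continuous_on I \<gamma>" "\<gamma> ` I \<subseteq> I \<times> I" "\<And>t. t \<in> I \<Longrightarrow> h (\<gamma> t, 0) < 0" for h :: "_ \<Rightarrow> real" and \<gamma>
  proof -
    have "continuous_on (I \<times> {0..\<delta>}) (\<lambda>x. h (\<gamma> (fst x), snd x))"
    proof (rule continuous_on_compose2[OF that(1)])
      show "continuous_on (I \<times> {0..\<delta>}) (\<lambda>x. (\<gamma> (fst x), snd x))"
      proof (rule continuous_on_Pair)
        have "fst ` (I \<times> {0..\<delta>}) \<subseteq> I" by force
        then show "continuous_on (I \<times> {0..\<delta>}) (\<lambda>x. \<gamma> (fst x))"
          by (rule continuous_on_compose2[OF that(2) continuous_on_fst[OF continuous_on_id]])
      qed (rule continuous_on_snd[OF continuous_on_id])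
      show "(\<lambda>x. (\<gamma> (fst x), snd x)) ` (I \<times> {0..\<delta>}) \<subseteq> K"
      proof (rule image_subsetI)
        fix x assume "x \<in> I \<times> {0..\<delta>}"
        then have x: "fst x \<in> I" "snd x \<in> {0..\<delta>}" by (simp_all add: mem_Times_iff)
        then have "\<gamma> (fst x) \<in> I \<times> I" using that(3) by blast
        then have "(\<gamma> (fst x), snd x) \<in> (I \<times> I) \<times> {0..\<delta>}" using x(2) by (rule SigmaI)
        then show "(\<gamma> (fst x), snd x) \<in> K" by (rule subsetD[OF Isub])
      qed
    qed
    from tube_negative[of I \<delta> "\<lambda>x. h (\<gamma> (fst x), snd x)", OF cI(1) this \<delta>(1)] that(4) show ?thesis by auto
  qed
  have pos: "\<rho> (T 1 0 w) > 0" "n \<Longrightarrow> \<rho> (T 0 1 w) > 0" using wY by (auto simp: Y_def)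
  have Pw: "Ppos w = 0" "Pneg w = 0" using Nm_critical[OF w] by auto
  have bI: "1 - \<delta> \<in> I" "1 + \<delta> \<in> I" using \<delta> by (auto simp: I_def)
  have I0: "t > 0" "1 - \<delta> \<le> t" "t \<le> 1 + \<delta>" if "t \<in> I" for t using that \<delta> by (auto simp: I_def)
  have "\<exists>e>0. e \<le> \<delta> \<and> (\<forall>\<epsilon>\<in>{0..e}. \<forall>t\<in>I. P1 ((1 + \<delta>, t), \<epsilon>) < 0)"
  proof (rule face[OF P1_cont, of "\<lambda>t. (1 + \<delta>, t)"])
    show "continuous_on I (\<lambda>t. (1 + \<delta>, t))" by (intro continuous_intros)
    show "(\<lambda>t. (1 + \<delta>, t)) ` I \<subseteq> I \<times> I" using bI by auto
    fix t assume t: "t \<in> I"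
    have eq: "z ((1 + \<delta>, t), 0) = T (1 + \<delta>) t w" using z0 I0[OF t] \<delta> by simp
    show "P1 ((1 + \<delta>, t), 0) < 0"
      unfolding P1_def eq using Ppos_T(1)[OF wX Pw(1) pos(1)] I0[OF t] \<delta> by simp
  qed
  then obtain e1 where e1: "e1 > 0" "e1 \<le> \<delta>" "\<And>\<epsilon> t. \<epsilon> \<in> {0..e1} \<Longrightarrow> t \<in> I \<Longrightarrow> P1 ((1 + \<delta>, t), \<epsilon>) < 0" by blast
  have "\<exists>e>0. e \<le> \<delta> \<and> (\<forall>\<epsilon>\<in>{0..e}. \<forall>t\<in>I. - P1 ((1 - \<delta>, t), \<epsilon>) < 0)"
  proof (rule face[OF continuous_on_minus[OF P1_cont], of "\<lambda>t. (1 - \<delta>, t)"])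
    show "continuous_on I (\<lambda>t. (1 - \<delta>, t))" by (intro continuous_intros)
    show "(\<lambda>t. (1 - \<delta>, t)) ` I \<subseteq> I \<times> I" using bI by auto
    fix t assume t: "t \<in> I"
    have eq: "z ((1 - \<delta>, t), 0) = T (1 - \<delta>) t w" using z0 I0[OF t] \<delta> by simp
    show "- P1 ((1 - \<delta>, t), 0) < 0"
      unfolding P1_def eq using Ppos_T(2)[OF wX Pw(1) pos(1)] I0[OF t] \<delta> by simp
  qed
  then obtain e2 where e2: "e2 > 0" "e2 \<le> \<delta>" "\<And>\<epsilon> t. \<epsilon> \<in> {0..e2} \<Longrightarrow> t \<in> I \<Longrightarrow> - P1 ((1 - \<delta>, t), \<epsilon>) < 0" by blast
  have "\<exists>e>0. e \<le> \<delta> \<and> (\<forall>\<epsilon>\<in>{0..e}. \<forall>t\<in>I. P2 ((t, 1 + \<delta>), \<epsilon>) < 0)"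
  proof (rule face[OF P2_cont, of "\<lambda>t. (t, 1 + \<delta>)"])
    show "continuous_on I (\<lambda>t. (t, 1 + \<delta>))" by (intro continuous_intros)
    show "(\<lambda>t. (t, 1 + \<delta>)) ` I \<subseteq> I \<times> I" using bI by auto
    fix t assume t: "t \<in> I"
    have eq: "z ((t, 1 + \<delta>), 0) = T t (1 + \<delta>) w" using z0 I0[OF t] \<delta> by simp
    show "P2 ((t, 1 + \<delta>), 0) < 0"
    proof (cases n)
      case True
      then show ?thesis unfolding P2_def eq using Pneg_T(1)[OF wX Pw(2) pos(2)] I0[OF t] \<delta> by simp
    qed (use \<delta> in \<open>simp add: P2_def\<close>)
  qed
  then obtain e3 where e3: "e3 > 0" "e3 \<le> \<delta>" "\<And>\<epsilon> t. \<epsilon> \<in> {0..e3} \<Longrightarrow> t \<in> I \<Longrightarrow> P2 ((t, 1 + \<delta>), \<epsilon>) < 0" by blast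
  have "\<exists>e>0. e \<le> \<delta> \<and> (\<forall>\<epsilon>\<in>{0..e}. \<forall>t\<in>I. - P2 ((t, 1 - \<delta>), \<epsilon>) < 0)"
  proof (rule face[OF continuous_on_minus[OF P2_cont], of "\<lambda>t. (t, 1 - \<delta>)"])
    show "continuous_on I (\<lambda>t. (t, 1 - \<delta>))" by (intro continuous_intros)
    show "(\<lambda>t. (t, 1 - \<delta>)) ` I \<subseteq> I \<times> I" using bI by auto
    fix t assume t: "t \<in> I"
    have eq: "z ((t, 1 - \<delta>), 0) = T t (1 - \<delta>) w" using z0 I0[OF t] \<delta> by simp
    show "- P2 ((t, 1 - \<delta>), 0) < 0"
    proof (cases n)
      case True
      then show ?thesis unfolding P2_def eq using Pneg_T(2)[OF wX Pw(2) pos(2)] I0[OF t] \<delta> by simp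
    qed (use \<delta> in \<open>simp add: P2_def\<close>)
  qed
  then obtain e4 where e4: "e4 > 0" "e4 \<le> \<delta>" "\<And>\<epsilon> t. \<epsilon> \<in> {0..e4} \<Longrightarrow> t \<in> I \<Longrightarrow> - P2 ((t, 1 - \<delta>), \<epsilon>) < 0" by blast
  have "\<exists>e>0. e \<le> \<delta> \<and> (\<forall>\<epsilon>\<in>{0..e}. \<forall>x\<in>I \<times> I. q1 (x, \<epsilon>) < 0)"
  proof (rule tube_negative[OF cI(2) continuous_on_subset[OF q_cont(1) Isub] \<delta>(1)])
    fix x assume "x \<in> I \<times> I"
    then show "q1 (x, 0) < 0" using z0 I0 Y_T[OF wY] by (cases x) (auto simp: q1_def Y_def less_imp_le)
  qed
  then obtain e5 where e5: "e5 > 0" "e5 \<le> \<delta>" "\<And>\<epsilon> x. \<epsilon> \<in> {0..e5} \<Longrightarrow> x \<in> I \<times> I \<Longrightarrow> q1 (x, \<epsilon>) < 0" by blast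
  have "\<exists>e>0. e \<le> \<delta> \<and> (\<forall>\<epsilon>\<in>{0..e}. \<forall>x\<in>I \<times> I. q2 (x, \<epsilon>) < 0)"
  proof (rule tube_negative[OF cI(2) continuous_on_subset[OF q_cont(2) Isub] \<delta>(1)])
    fix x assume "x \<in> I \<times> I"
    then show "q2 (x, 0) < 0" using z0 I0 Y_T[OF wY] by (cases x) (auto simp: q2_def Y_def less_imp_le)
  qed
  then obtain e6 where e6: "e6 > 0" "e6 \<le> \<delta>" "\<And>\<epsilon> x. \<epsilon> \<in> {0..e6} \<Longrightarrow> x \<in> I \<times> I \<Longrightarrow> q2 (x, \<epsilon>) < 0" by blast
  define \<epsilon> where "\<epsilon> = min (min (min e1 e2) (min e3 e4)) (min e5 e6)"
  have \<epsilon>: "\<epsilon> > 0" "\<epsilon> \<le> \<delta>" "\<epsilon> \<in> {0..e1}" "\<epsilon> \<in> {0..e2}" "\<epsilon> \<in> {0..e3}" "\<epsilon> \<in> {0..e4}" "\<epsilon> \<in> {0..e5}" "\<epsilon> \<in> {0..e6}"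
    using e1(1,2) e2(1) e3(1) e4(1) e5(1) e6(1) by (auto simp: \<epsilon>_def)
  have sec: "continuous_on (I \<times> I) (\<lambda>x. h (x, \<epsilon>))" if "continuous_on K h" for h
    by (rule continuous_on_compose2[OF that]) (use Isub \<epsilon> in \<open>auto intro!: continuous_intros\<close>)
  have "\<exists>a\<in>I. \<exists>b\<in>I. P1 ((a, b), \<epsilon>) = 0 \<and> P2 ((a, b), \<epsilon>) = 0"
    by (rule Poincare_Miranda[of "1 - \<delta>" "1 + \<delta>" "\<lambda>x. P1 (x, \<epsilon>)" "\<lambda>x. P2 (x, \<epsilon>)", folded I_def])
      (use \<delta> sec[OF P1_cont] sec[OF P2_cont] e1(3)[OF \<epsilon>(3)] e2(3)[OF \<epsilon>(4)] e3(3)[OF \<epsilon>(5)] e4(3)[OF \<epsilon>(6)] in auto)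
  then obtain a b where ab: "a \<in> I" "b \<in> I" and P0: "P1 ((a, b), \<epsilon>) = 0" "P2 ((a, b), \<epsilon>) = 0" by blast
  define y where "y = z ((a, b), \<epsilon>)"
  have yX: "y \<in> X" using \<zeta>X T_X by (simp add: y_def z_def)
  have yY: "y \<in> Y n"
    using yX e5(3)[OF \<epsilon>(7), of "(a, b)"] e6(3)[OF \<epsilon>(8), of "(a, b)"] ab
    by (auto simp: Y_def q1_def q2_def y_def z_def T_def[of 1 0] tw_def)
  have "y \<in> Nm n"
    using P0 by (intro Nm_unique[OF yY]) (auto simp: P1_def P2_def y_def)
  then have "J w \<le> J y" by (rule min)
  moreover have "J y < J (T a b w)"
  proof -
    have ab0: "a \<ge> 0" "b \<ge> 0" using I0 ab by (auto intro: less_imp_le)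
    define u where "u = T a b w"
    have uX: "u \<in> X" by (simp add: u_def T_X[OF wX])
    have hX: "(\<lambda>x. \<epsilon> * v x) \<in> X" by (rule X_scale[OF v])
    define \<zeta>' where "\<zeta>' = \<zeta> ((a, b), \<epsilon>)"
    have \<zeta>': "\<zeta>' = (\<lambda>x. u x + \<epsilon> * v x)" by (simp add: \<zeta>'_def \<zeta>_def u_def)
    have \<zeta>'X: "\<zeta>' \<in> X" using \<zeta>X by (simp add: \<zeta>'_def)
    have lin: "gA \<zeta>' (\<lambda>x. \<epsilon> * v x) = \<epsilon> * gA \<zeta>' v" "fv u (\<lambda>x. \<epsilon> * v x) = \<epsilon> * fv u v"
      using gA_lin[OF \<zeta>'X v v, of \<epsilon> 0] fv_lin[OF uX v v, of \<epsilon> 0] by auto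
    have eJ: "\<epsilon> * (gA \<zeta>' v - fv u v) < 0"
      using Jneg[OF ab, of \<epsilon>] \<epsilon> by (intro mult_pos_neg) (auto simp: Jd_def \<zeta>'_def u_def)
    show ?thesis
    proof (cases n)
      case True
      then have "y = \<zeta>'" by (simp add: y_def z_def \<zeta>'_def)
      then show ?thesis using J_increment(2)[OF uX hX] eJ lin \<zeta>' by (simp add: u_def right_diff_distrib)
    next
      case False
      then have y: "y = T 1 0 \<zeta>'" by (simp add: y_def z_def \<zeta>'_def)
      have u0: "u x \<ge> 0" for x using wY False ab0 by (simp add: u_def Y_def T_nonneg)
      have mX: "(\<lambda>x. - (\<epsilon> * v x)) \<in> X" using X_scale(1)[OF hX, of "-1"] by simp
      \<comment> \<open>Taking the positive part lowers \<open>A\<close>. For \<open>\<Phi>\<close>,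
        the supporting line at \<open>u\<close> is used: its slope \<open>f x (u x)\<close> is
        nonnegative and \<open>y - u \<ge> \<epsilon> * v\<close>, so the bound for the untruncated
        step survives.\<close>
      have "A y \<le> A \<zeta>'" using A_part_le[OF \<zeta>'X, of 1 0] y by simp
      moreover have "A \<zeta>' - gA \<zeta>' (\<lambda>x. \<epsilon> * v x) \<le> A u"
      proof -
        have "gA \<zeta>' (\<lambda>x. - (\<epsilon> * v x)) = - gA \<zeta>' (\<lambda>x. \<epsilon> * v x)"
          using gA_lin[OF \<zeta>'X hX hX, of "-1" 0] by simp
        then show ?thesis using A_subgradient[OF \<zeta>'X mX] by (simp add: \<zeta>')
      qed
      moreover have "\<Phi> u + fv u (\<lambda>x. \<epsilon> * v x) \<le> \<Phi> y"
      proof -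
        have dX: "(\<lambda>x. y x - u x) \<in> X" using X_lin[OF yX uX, of 1 "-1"] by simp
        have "fv u (\<lambda>x. \<epsilon> * v x) \<le> 1 * fv u (\<lambda>x. y x - u x)"
        proof (rule fv_le[OF uX hX uX dX])
          fix x
          have "f x (u x) \<ge> 0" using monoD[OF f_mono, of 0 "u x" x] u0 f_0 by simp
          moreover have "\<epsilon> * v x \<le> y x - u x" unfolding y \<zeta>' by (simp add: T_def tw_def)
          ultimately show "f x (u x) * (\<epsilon> * v x) \<le> 1 * (f x (u x) * (y x - u x))"
            by (simp add: mult_left_mono)
        qed
        then show ?thesis using \<Phi>_subgradient[OF uX dX] by simp
      qed
      ultimately show ?thesis using eJ lin by (simp add: J_def u_def right_diff_distrib)
    qed
  qed
  moreover have "J (T a b w) \<le> J w" using w I0 ab by (auto simp: Nm_def less_imp_le)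
  ultimately show False by simp
qed

section \<open>Nonempty Nehari sets and existence of critical points\<close>

lemma \<rho>_pos_ball:
  assumes u: "u \<in> X" and r: "e > 0" and nz: "\<And>x. x \<in> ball c e \<Longrightarrow> u x \<noteq> 0"
  shows "\<rho> u > 0"
proof (rule ccontr)
  assume "\<not> \<rho> u > 0"
  then have "AE x in lebesgue. u x = 0" using \<rho>_eq_0[OF u] \<rho>_nonneg[of u] by simp
  then have "AE x in lebesgue. x \<notin> ball c e" by eventually_elim (use nz in blast)
  then have "emeasure lebesgue (ball c e) = 0"
    using AE_iff_measurable[of "ball c e" lebesgue "\<lambda>x. x \<notin> ball c e"]
    by (simp add: ball_def)
  then show False using r ballvol_pos by (simp add: emeasure_ball ballvol_def)
qed

lemma bump:
  fixes c :: "real^'n" and e :: real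
  defines "\<phi> \<equiv> \<lambda>x. max 0 (e - norm (x - c))"
  assumes e: "e > 0" "ball c e \<subseteq> \<Omega>"
  shows "\<phi> \<in> X" "\<And>x. \<phi> x \<ge> 0" "\<And>x. \<phi> x > 0 \<longleftrightarrow> x \<in> ball c e"
proof -
  have z: "\<phi> x > 0 \<longleftrightarrow> x \<in> ball c e" for x by (auto simp: \<phi>_def dist_norm norm_minus_commute)
  then show "\<And>x. \<phi> x > 0 \<longleftrightarrow> x \<in> ball c e" by blast
  show nn: "\<And>x. \<phi> x \<ge> 0" by (simp add: \<phi>_def)
  show "\<phi> \<in> X"
  proof (rule X_Lipschitz[where L = 1 and M = e])
    show "\<phi> \<in> borel_measurable borel" unfolding \<phi>_def by measurable
    show "\<phi> x = 0" if "x \<notin> \<Omega>" for x using z[of x] nn[of x] e that by force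
    show "\<bar>\<phi> x - \<phi> y\<bar> \<le> 1 * norm (x - y)" for x y
      using norm_triangle_ineq3[of "x - c" "y - c"] by (auto simp: \<phi>_def max_def)
    show "\<bar>\<phi> x\<bar> \<le> e" for x using e by (auto simp: \<phi>_def)
  qed simp
qed

lemma Y_nonempty:
  assumes "\<Omega> \<noteq> {}" shows "Y n \<noteq> {}"
proof -
  obtain c e where ce: "e > 0" "ball c e \<subseteq> \<Omega>" using \<Omega>(1) assms by (meson equals0I open_contains_ball)
  obtain i :: "real^'n" where i: "i \<in> Basis" by (meson nonempty_Basis ex_in_conv)
  \<comment> \<open>Centres at distance \<open>e / 2\<close> and radii \<open>e / 8\<close> give
    disjoint balls inside \<open>ball c e\<close>, which carry the two signs.\<close>
  define c' where "c' = c + (e / 2) *\<^sub>R i"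
  have cc': "dist c c' = e / 2" using i ce by (simp add: c'_def dist_norm)
  have sub: "ball c (e / 8) \<subseteq> \<Omega>" "ball c' (e / 8) \<subseteq> \<Omega>"
  proof -
    show "ball c (e / 8) \<subseteq> \<Omega>" using ce by (intro order_trans[OF _ ce(2)] subset_ball) simp
    have "ball c' (e / 8) \<subseteq> ball c e"
    proof
      fix x assume "x \<in> ball c' (e / 8)"
      then show "x \<in> ball c e" using dist_triangle[of c x c'] cc' ce by auto
    qed
    then show "ball c' (e / 8) \<subseteq> \<Omega>" using ce by blast
  qed
  have disj: "x \<notin> ball c' (e / 8)" if "x \<in> ball c (e / 8)" for x
    using that dist_triangle[of c c' x] cc' ce by (auto simp: dist_commute)
  define \<phi> where "\<phi> c x = max 0 (e / 8 - norm (x - c))" for c x :: "real^'n"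
  have e8: "e / 8 > 0" using ce by simp
  note b1 = bump[OF e8 sub(1), folded \<phi>_def] and b2 = bump[OF e8 sub(2), folded \<phi>_def]
  define u where "u = (\<lambda>x. if n then \<phi> c x - \<phi> c' x else \<phi> c x)"
  have uX: "u \<in> X" using X_lin[OF b1(1) b2(1), of 1 "-1"] b1(1) by (cases n) (auto simp: u_def)
  have "\<rho> (T 1 0 u) > 0"
  proof (rule \<rho>_pos_ball[OF T_X(1)[OF uX] e8])
    fix x assume x: "x \<in> ball c (e / 8)"
    then have "\<phi> c x > 0" "\<phi> c' x = 0" using b1(3) b2(3)[of x] b2(2)[of x] disj by (auto simp: less_le)
    then show "T 1 0 u x \<noteq> 0" by (simp add: u_def T_def tw_def)
  qed
  moreover have "\<rho> (T 0 1 u) > 0" if n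
  proof (rule \<rho>_pos_ball[OF T_X(1)[OF uX] e8])
    fix x assume x: "x \<in> ball c' (e / 8)"
    then have "\<phi> c' x > 0" "\<phi> c x = 0" using b2(3) b1(3)[of x] b1(2)[of x] disj by (auto simp: less_le)
    then show "T 0 1 u x \<noteq> 0" using that by (simp add: u_def T_def tw_def)
  qed
  ultimately have "u \<in> Y n" using uX b1(2) by (auto simp: Y_def u_def)
  then show ?thesis by blast
qed

lemma Nehari_solution:
  assumes "\<Omega> \<noteq> {}"
  shows "\<exists>w\<in>Y n. \<forall>v\<in>X. gA w v = fv w v"
proof -
  obtain w where w: "w \<in> Nm n" "\<And>z. z \<in> Nm n \<Longrightarrow> J w \<le> J z"
    using minimizer[OF Y_nonempty[OF assms]] by blast
  have wX: "w \<in> X" using w(1) by (simp add: Nm_def Y_def)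
  have "gA w v = fv w v" if v: "v \<in> X" for v
  proof -
    have mv: "(\<lambda>x. - v x) \<in> X" using X_scale(1)[OF v, of "-1"] by simp
    have "gA w (\<lambda>x. - v x) = - gA w v" "fv w (\<lambda>x. - v x) = - fv w v"
      using gA_lin[OF wX v v, of "-1" 0] fv_lin[OF wX v v, of "-1" 0] by auto
    then show ?thesis
      using minimizer_not_descending[OF w v] minimizer_not_descending[OF w mv] by simp
  qed
  then show ?thesis using w(1) by (auto simp: Nm_def)
qed

end

section \<open>Pointwise consequences of the hypotheses on the nonlinearity\<close>

lemma AE_nonneg_of_integrals:
  fixes \<phi> :: "'a \<Rightarrow> real"
  assumes int: "integrable M \<phi>" and nn: "\<And>E. E \<in> sets M \<Longrightarrow> 0 \<le> (\<integral>x. indicator E x * \<phi> x \<partial>M)"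
  shows "AE x in M. 0 \<le> \<phi> x"
proof -
  have [measurable]: "\<phi> \<in> borel_measurable M" using int by auto
  define E where "E = {x \<in> space M. \<phi> x < 0}"
  have E: "E \<in> sets M" unfolding E_def by measurable
  define h where "h x = - (indicator E x * \<phi> x)" for x
  have h: "integrable M h"
    unfolding h_def using integrable_mult_indicator[OF E int] by simp
  have h0: "0 \<le> h x" for x by (auto simp: h_def E_def indicator_def)
  have "(\<integral>x. h x \<partial>M) = 0"
    using nn[OF E] Bochner_Integration.integral_nonneg[of M h] h0 unfolding h_def by auto
  then have "AE x in M. h x = 0" using integral_nonneg_eq_0_iff_AE[OF h] h0 by simp
  then show ?thesis using AE_space by eventually_elim (auto simp: h_def E_def indicator_def split: if_splits)
qed

text \<open>For positive arguments the inequality says that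
  \<open>\<phi> x * x powr (- (1 / c))\<close> is nondecreasing, so \<open>\<phi>\<close> grows at
  least with exponent \<open>1 / c\<close>; the factor \<open>t\<close> adds 1. Negative arguments
  follow from \<open>- \<phi> (- t)\<close>. With \<open>c = c3\<close> this is the origin of
  \<open>q\<close>.\<close>

lemma power_growth:
  fixes \<phi> \<phi>' :: "real \<Rightarrow> real"
  assumes d: "\<And>t. (\<phi> has_real_derivative \<phi>' t) (at t)" and c: "c > 0"
    and le: "\<And>t. \<phi> t * t \<le> c * (\<phi>' t * t\<^sup>2)" and l: "l \<ge> 1"
  shows "l powr (1 + 1 / c) * (\<phi> t * t) \<le> \<phi> (l * t) * (l * t)"
proof -
  have pos: "l powr (1 + 1 / c) * (\<phi> t * t) \<le> \<phi> (l * t) * (l * t)"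
    if d: "\<And>t. (\<phi> has_real_derivative \<phi>' t) (at t)" and le: "\<And>t. \<phi> t * t \<le> c * (\<phi>' t * t\<^sup>2)"
      and t: "t > 0" for \<phi> \<phi>' :: "real \<Rightarrow> real" and t
  proof -
    have "\<phi> t * t powr (- (1 / c)) \<le> \<phi> (l * t) * (l * t) powr (- (1 / c))"
    proof (rule DERIV_nonneg_imp_nondecreasing[where f = "\<lambda>x. \<phi> x * x powr (- (1 / c))"])
      show "t \<le> l * t" using l t by simp
      fix x assume "t \<le> x" "x \<le> l * t"
      then have x: "x > 0" using t by simp
      have "((\<lambda>x. \<phi> x * x powr (- (1 / c))) has_real_derivative
         \<phi>' x * x powr (- (1 / c)) + \<phi> x * (- (1 / c) * x powr (- (1 / c) - 1))) (at x)"
        using x d by (auto intro!: derivative_eq_intros)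
      moreover have "x powr (- (1 / c)) = x * x powr (- (1 / c) - 1)"
        using x powr_add[of x 1 "- (1 / c) - 1"] by simp
      moreover have "0 \<le> x powr (- (1 / c) - 1) * (\<phi>' x * x - \<phi> x / c)"
      proof (rule mult_nonneg_nonneg)
        have "\<phi> x * x \<le> (c * (\<phi>' x * x)) * x" using le[of x] by (simp add: power2_eq_square ac_simps)
        then have "\<phi> x \<le> c * (\<phi>' x * x)" using x by simp
        then show "0 \<le> \<phi>' x * x - \<phi> x / c" using c by (simp add: field_simps)
      qed simp
      ultimately show "\<exists>y. ((\<lambda>x. \<phi> x * x powr (- (1 / c))) has_real_derivative y) (at x) \<and> 0 \<le> y"
        by (auto simp: algebra_simps)
    qed
    then have "\<phi> t * t powr (- (1 / c)) \<le> (\<phi> (l * t) * l powr (- (1 / c))) * t powr (- (1 / c))"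
      using l t by (simp add: powr_mult ac_simps)
    then have "\<phi> t \<le> \<phi> (l * t) * l powr (- (1 / c))" using t by simp
    then have "\<phi> t * (l powr (1 / c) * (l * t)) \<le> \<phi> (l * t) * l powr (- (1 / c)) * (l powr (1 / c) * (l * t))"
      using l t by (intro mult_right_mono) auto
    also have "\<phi> (l * t) * l powr (- (1 / c)) * (l powr (1 / c) * (l * t)) =
        (l powr (- (1 / c)) * l powr (1 / c)) * (\<phi> (l * t) * (l * t))" by (simp only: ac_simps)
    also have "l powr (- (1 / c)) * l powr (1 / c) = 1" using l by (simp add: powr_add[symmetric])
    finally show ?thesis using l by (simp add: powr_add ac_simps)
  qed
  consider "t = 0" | "t > 0" | "t < 0" by linarith
  then show ?thesis
  proof cases
    case 3
    have d': "((\<lambda>t. - \<phi> (- t)) has_real_derivative \<phi>' (- t)) (at t)" for t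
      using DERIV_minus[OF DERIV_chain2[OF d[of "- t"] DERIV_minus[OF DERIV_ident]]] by simp
    have le': "- \<phi> (- t) * t \<le> c * (\<phi>' (- t) * t\<^sup>2)" for t using le[of "- t"] by simp
    show ?thesis using pos[OF d' le', of "- t"] 3 by simp
  qed (use pos[OF d le] in auto)
qed

text \<open>The functions \<open>t * indicator E x\<close> lie in \<open>L_space B \<Omega>\<close>
  and vary \<open>E\<close> freely at fixed height \<open>t\<close>, so the integral chain becomes
  an almost everywhere inequality for each \<open>t\<close>. The exceptional set is made independent
  of \<open>t\<close> by restricting to rational heights and using continuity.\<close>

lemma H2_pointwise:
  fixes \<Omega> :: "(real^'n) set"
  assumes \<Omega>: "open \<Omega>" "bounded \<Omega>" "\<Omega> \<noteq> {}" and B: "N_function B b"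
    and H: "H0 \<Omega> b f" "H1 \<Omega> f" "H2 \<Omega> pp B f"
  obtains c1 c3 c4 where "c1 > 0" "c3 > 0" "c4 > 0" "c3 < 1 / (pp - 1)"
    "AE x in lebesgue_on \<Omega>. \<forall>t. c1 * B t \<le> f x t * t \<and> f x t * t \<le> c4 * B t \<and>
       f x t * t \<le> c3 * (deriv (f x) t * t\<^sup>2)"
proof -
  define M where "M = lebesgue_on \<Omega>"
  have \<Omega>s: "\<Omega> \<in> sets lebesgue" using \<Omega>(1) by auto
  have fin: "emeasure M (space M) < \<infinity>"
    using emeasure_bounded_finite[OF \<Omega>(2)] \<Omega>s
    by (simp add: M_def emeasure_restrict_space space_restrict_space \<Omega>(1))
  interpret M: finite_measure M by standard (use fin in auto)
  have mpos: "measure M (space M) > 0"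
  proof -
    obtain c e where ce: "e > 0" "ball c e \<subseteq> \<Omega>" using \<Omega> by (meson equals0I open_contains_ball)
    have "0 < measure lborel (ball c e)" using ce by (rule_tac content_ball_pos)
    also have "\<dots> \<le> measure lborel \<Omega>"
      using ce \<Omega>(1) emeasure_bounded_finite[OF \<Omega>(2)] by (intro measure_mono_fmeasurable) (auto simp: fmeasurable_def)
    also have "\<dots> = measure M (space M)"
      using \<Omega>s \<Omega>(1) by (simp add: M_def measure_restrict_space space_restrict_space)
    finally show ?thesis .
  qed
  from H(3) obtain c1 c2 c3 c4 where c: "c1 > 0" "c2 > 0" "c3 > 0" "c4 > 0" "c3 < 1 / (pp - 1)"
    and H2: "\<And>u. u \<in> L_space B \<Omega> \<Longrightarrow>
          c1 * enn2real (modular_on B \<Omega> u) \<le> c2 * (\<integral>x. (LBINT \<tau>=0..u x. f x \<tau>) \<partial>M) \<and>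
          c2 * (\<integral>x. (LBINT \<tau>=0..u x. f x \<tau>) \<partial>M) \<le> (\<integral>x. f x (u x) * u x \<partial>M) \<and>
          (\<integral>x. f x (u x) * u x \<partial>M) \<le> c3 * (\<integral>x. deriv (f x) (u x) * (u x)\<^sup>2 \<partial>M) \<and>
          c3 * (\<integral>x. deriv (f x) (u x) * (u x)\<^sup>2 \<partial>M) \<le> c4 * enn2real (modular_on B \<Omega> u)"
    unfolding H2_def M_def by blast
  have Bnn: "B t \<ge> 0" for t using N_function_pos[OF B, of t] N_function_zero[OF B] by (cases "t = 0") auto
  have Babs: "B \<bar>t\<bar> = B t" for t using B by (cases "t \<ge> 0") (auto simp: N_function_def)
  have chain: "c1 * (B t * measure M E) \<le> (\<integral>x. indicator E x * (f x t * t) \<partial>M)"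
    "(\<integral>x. indicator E x * (f x t * t) \<partial>M) \<le> c3 * (\<integral>x. indicator E x * (deriv (f x) t * t\<^sup>2) \<partial>M)"
    "c3 * (\<integral>x. indicator E x * (deriv (f x) t * t\<^sup>2) \<partial>M) \<le> c4 * (B t * measure M E)"
    if E: "E \<in> sets M" for E t
  proof -
    define u where "u x = t * indicator E x" for x
    have [measurable]: "u \<in> borel_measurable M" unfolding u_def using E by measurable
    have "modular_on B \<Omega> u = (\<integral>\<^sup>+x. ennreal (B t) * indicator E x \<partial>M)"
      unfolding modular_on_def M_def[symmetric]
      by (intro nn_integral_cong) (auto simp: u_def indicator_def Babs N_function_zero[OF B])
    also have "\<dots> = ennreal (B t) * emeasure M E" using E by (simp add: nn_integral_cmult_indicator)
    also have "\<dots> = ennreal (B t * measure M E)" using Bnn by (simp add: M.emeasure_eq_measure ennreal_mult)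
    finally have m: "modular_on B \<Omega> u = ennreal (B t * measure M E)" .
    then have "u \<in> L_space B \<Omega>" by (simp add: L_space_def M_def[symmetric])
    from H2[OF this] have
      "c1 * (B t * measure M E) \<le> (\<integral>x. f x (u x) * u x \<partial>M)"
      "(\<integral>x. f x (u x) * u x \<partial>M) \<le> c3 * (\<integral>x. deriv (f x) (u x) * (u x)\<^sup>2 \<partial>M)"
      "c3 * (\<integral>x. deriv (f x) (u x) * (u x)\<^sup>2 \<partial>M) \<le> c4 * (B t * measure M E)"
      using Bnn[of t] by (auto simp: m)
    moreover have "f x (u x) * u x = indicator E x * (f x t * t)"
      "deriv (f x) (u x) * (u x)\<^sup>2 = indicator E x * (deriv (f x) t * t\<^sup>2)" for x
      by (auto simp: u_def indicator_def)
    ultimately show "c1 * (B t * measure M E) \<le> (\<integral>x. indicator E x * (f x t * t) \<partial>M)"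
      "(\<integral>x. indicator E x * (f x t * t) \<partial>M) \<le> c3 * (\<integral>x. indicator E x * (deriv (f x) t * t\<^sup>2) \<partial>M)"
      "c3 * (\<integral>x. indicator E x * (deriv (f x) t * t\<^sup>2) \<partial>M) \<le> c4 * (B t * measure M E)"
      by auto
  qed
  obtain c0 where c0: "c0 > 0" "AE x in M. \<forall>t. \<bar>f x t\<bar> \<le> c0 * (1 + \<bar>b t\<bar>)"
    and fm: "\<And>t. (\<lambda>x. f x t) \<in> borel_measurable M"
    using H(1) unfolding H0_def caratheodory_def M_def by blast
  have fint: "integrable M (\<lambda>x. f x t * t)" for t
  proof (rule M.integrable_const_bound[where B = "c0 * (1 + \<bar>b t\<bar>) * \<bar>t\<bar>"])
    show "AE x in M. norm (f x t * t) \<le> c0 * (1 + \<bar>b t\<bar>) * \<bar>t\<bar>"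
      using c0(2) by eventually_elim (simp add: abs_mult mult_right_mono)
  qed (use fm in measurable)
  have ind: "(\<integral>x. indicator E x * (\<phi> x - \<psi> x) \<partial>M) = (\<integral>x. indicator E x * \<phi> x \<partial>M) - (\<integral>x. indicator E x * \<psi> x \<partial>M)"
    if "E \<in> sets M" "integrable M \<phi>" "integrable M \<psi>" for E and \<phi> \<psi> :: "_ \<Rightarrow> real"
    using integrable_mult_indicator[OF that(1,2)] integrable_mult_indicator[OF that(1,3)]
    by (simp add: right_diff_distrib)
  have indc: "(\<integral>x. indicator E x * k \<partial>M) = k * measure M E" if "E \<in> sets M" for E and k :: real
    using that sets.sets_into_space[OF that] by (simp add: Int_absorb1)
  have 1: "AE x in M. 0 \<le> f x t * t - c1 * B t" for t
  proof (rule AE_nonneg_of_integrals)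
    fix E assume E: "E \<in> sets M"
    show "0 \<le> (\<integral>x. indicator E x * (f x t * t - c1 * B t) \<partial>M)"
      using chain(1)[OF E, of t] unfolding ind[OF E fint M.integrable_const] indc[OF E] by (simp add: mult.assoc)
  qed (use fint in auto)
  have 2: "AE x in M. 0 \<le> c4 * B t - f x t * t" for t
  proof (rule AE_nonneg_of_integrals)
    fix E assume E: "E \<in> sets M"
    show "0 \<le> (\<integral>x. indicator E x * (c4 * B t - f x t * t) \<partial>M)"
      using chain(2,3)[OF E, of t] unfolding ind[OF E M.integrable_const fint] indc[OF E] by (simp add: mult.assoc)
  qed (use fint in auto)
  have 3: "AE x in M. 0 \<le> c3 * (deriv (f x) t * t\<^sup>2) - f x t * t" for t
  proof (cases "t = 0")
    case False
    \<comment> \<open>If this failed, the integral over the whole space would be 0 by convention,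
      whereas the chain with \<open>E = space M\<close> bounds it below by a positive
      number.\<close>
    have dint: "integrable M (\<lambda>x. deriv (f x) t * t\<^sup>2)"
    proof (rule ccontr)
      assume "\<not> ?thesis"
      then have "(\<integral>x. deriv (f x) t * t\<^sup>2 \<partial>M) = 0" by (rule not_integrable_integral_eq)
      moreover have "(\<integral>x. indicator (space M) x * (deriv (f x) t * t\<^sup>2) \<partial>M) = (\<integral>x. deriv (f x) t * t\<^sup>2 \<partial>M)"
        by (rule Bochner_Integration.integral_cong) auto
      moreover have "0 < c1 * (B t * measure M (space M))"
        using c mpos N_function_pos[OF B False] by simp
      ultimately show False using chain(1,2)[of "space M" t] by auto
    qed
    show ?thesis
    proof (rule AE_nonneg_of_integrals)
      show "integrable M (\<lambda>x. c3 * (deriv (f x) t * t\<^sup>2) - f x t * t)"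
        by (intro Bochner_Integration.integrable_diff fint integrable_mult_right dint)
      fix E assume E: "E \<in> sets M"
      have "(\<integral>x. indicator E x * (c3 * (deriv (f x) t * t\<^sup>2)) \<partial>M) = c3 * (\<integral>x. indicator E x * (deriv (f x) t * t\<^sup>2) \<partial>M)"
        by (subst mult.left_commute) simp
      then show "0 \<le> (\<integral>x. indicator E x * (c3 * (deriv (f x) t * t\<^sup>2) - f x t * t) \<partial>M)"
        using chain(2)[OF E, of t] ind[OF E integrable_mult_right[OF dint] fint] by simp
    qed
  qed simp
  have rat: "AE x in M. \<forall>r::rat. 0 \<le> f x (of_rat r) * of_rat r - c1 * B (of_rat r) \<and>
     0 \<le> c4 * B (of_rat r) - f x (of_rat r) * of_rat r \<and>
     0 \<le> c3 * (deriv (f x) (of_rat r) * (of_rat r)\<^sup>2) - f x (of_rat r) * of_rat r"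
    unfolding AE_all_countable using 1 2 3 by (intro allI AE_conjI)
  have sm: "AE x in M. (\<forall>t. f x differentiable (at t)) \<and> continuous_on UNIV (deriv (f x))"
    using H(2) unfolding H1_def M_def by blast
  have dense: "0 \<le> h t" if h: "continuous_on UNIV h" "\<And>r::rat. 0 \<le> h (of_rat r)" for h :: "real \<Rightarrow> real" and t
    by (rule continuous_ge_on_closure[of \<rat>]) (use h in \<open>auto simp: Rats_closure_real elim: Rats_cases\<close>)
  have "AE x in M. \<forall>t. c1 * B t \<le> f x t * t \<and> f x t * t \<le> c4 * B t \<and> f x t * t \<le> c3 * (deriv (f x) t * t\<^sup>2)"
    using rat sm
  proof eventually_elim
    case (elim x)
    have fc: "continuous_on UNIV (f x)"
      using elim by (meson continuous_at_imp_continuous_on differentiable_imp_continuous_within)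
    note Bc = N_function_continuous[OF B]
    show ?case
    proof
      fix t
      have "0 \<le> f x t * t - c1 * B t"
        by (rule dense) (use elim fc Bc in \<open>auto intro!: continuous_intros\<close>)
      moreover have "0 \<le> c4 * B t - f x t * t"
        by (rule dense) (use elim fc Bc in \<open>auto intro!: continuous_intros\<close>)
      moreover have "0 \<le> c3 * (deriv (f x) t * t\<^sup>2) - f x t * t"
        by (rule dense) (use elim fc in \<open>auto intro!: continuous_intros\<close>)
      ultimately show "c1 * B t \<le> f x t * t \<and> f x t * t \<le> c4 * B t \<and> f x t * t \<le> c3 * (deriv (f x) t * t\<^sup>2)"
        by simp
    qed
  qed
  then show ?thesis using c that unfolding M_def by blast
qed

text \<open>The second argument is rounded down to multiples of \<open>1 / (n + 1)\<close>, which
  leaves countably many measurable sections; continuity gives the limit.\<close>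

lemma Caratheodory_measurable:
  fixes f :: "'a \<Rightarrow> real \<Rightarrow> real"
  assumes m: "\<And>t. (\<lambda>x. f x t) \<in> borel_measurable M" and c: "\<And>x. continuous_on UNIV (f x)"
  shows "(\<lambda>(x, t). f x t) \<in> borel_measurable (M \<Otimes>\<^sub>M borel)"
proof (rule borel_measurable_LIMSEQ_real)
  fix n :: nat
  define d where "d = real n + 1"
  have "(\<lambda>z. f (fst z) (of_int i / d)) \<in> borel_measurable (M \<Otimes>\<^sub>M borel)" for i
    by (rule measurable_compose[OF measurable_fst m])
  moreover have "(\<lambda>z. \<lfloor>d * snd z\<rfloor>) \<in> measurable (M \<Otimes>\<^sub>M borel) (count_space UNIV)"
    by (rule measurable_compose[OF _ measurable_real_floor]) measurable
  ultimately show "(\<lambda>z. f (fst z) (of_int \<lfloor>d * snd z\<rfloor> / d)) \<in> borel_measurable (M \<Otimes>\<^sub>M borel)"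
    by (rule measurable_compose_countable)
next
  fix z :: "'a \<times> real"
  obtain x t where z: "z = (x, t)" by fastforce
  have "(\<lambda>n. of_int \<lfloor>(real n + 1) * t\<rfloor> / (real n + 1)) \<longlonglongrightarrow> t"
  proof (rule tendsto_sandwich)
    show "(\<lambda>n. t - 1 / (real n + 1)) \<longlonglongrightarrow> t" by real_asymp
    show "\<forall>\<^sub>F n in sequentially. t - 1 / (real n + 1) \<le> of_int \<lfloor>(real n + 1) * t\<rfloor> / (real n + 1)"
    proof (intro always_eventually allI)
      fix n
      have "(real n + 1) * t - 1 \<le> of_int \<lfloor>(real n + 1) * t\<rfloor>" by linarith
      then have "((real n + 1) * t - 1) / (real n + 1) \<le> of_int \<lfloor>(real n + 1) * t\<rfloor> / (real n + 1)"
        by (intro divide_right_mono) auto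
      moreover have "((real n + 1) * t - 1) / (real n + 1) = t - 1 / (real n + 1)"
        by (simp add: diff_divide_distrib)
      ultimately show "t - 1 / (real n + 1) \<le> of_int \<lfloor>(real n + 1) * t\<rfloor> / (real n + 1)" by simp
    qed
    show "\<forall>\<^sub>F n in sequentially. of_int \<lfloor>(real n + 1) * t\<rfloor> / (real n + 1) \<le> t"
    proof (intro always_eventually allI)
      fix n
      have "of_int \<lfloor>(real n + 1) * t\<rfloor> \<le> (real n + 1) * t" by linarith
      then show "of_int \<lfloor>(real n + 1) * t\<rfloor> / (real n + 1) \<le> t" by (simp add: field_simps)
    qed
  qed simp
  then show "(\<lambda>n. f (fst z) (of_int \<lfloor>(real n + 1) * snd z\<rfloor> / (real n + 1))) \<longlonglongrightarrow> (case z of (x, t) \<Rightarrow> f x t)"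
    unfolding z using continuous_on_tendsto_compose[OF c] by simp
qed

text \<open>The nonlinearity is modified on a null set so that its properties hold for every \<open>x\<close>.\<close>

lemma nehari_nonlinearity:
  fixes \<Omega> :: "(real^'n) set"
  assumes loc: "frac_orlicz \<Omega> s pp r Q G g B" and ne: "\<Omega> \<noteq> {}" and B: "N_function B b"
    and H: "H0 \<Omega> b f" "H1 \<Omega> f" "H2 \<Omega> pp B f"
  obtains h q c1 c4 where "nehari \<Omega> s pp r Q G g B h q c1 c4" "AE x in lebesgue. x \<in> \<Omega> \<longrightarrow> h x = f x"
proof -
  interpret frac_orlicz \<Omega> s pp r Q G g B by (rule loc)
  from H2_pointwise[OF \<Omega> ne B H] obtain c1 c3 c4 where
    c: "c1 > 0" "c3 > 0" "c4 > 0" "c3 < 1 / (pp - 1)"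
    and pt: "AE x in lebesgue_on \<Omega>. \<forall>t. c1 * B t \<le> f x t * t \<and> f x t * t \<le> c4 * B t \<and>
       f x t * t \<le> c3 * (deriv (f x) t * t\<^sup>2)" .
  define good where "good x \<longleftrightarrow> x \<in> \<Omega> \<and> f x 0 = 0 \<and> (\<forall>t. f x differentiable (at t)) \<and>
     continuous_on UNIV (deriv (f x)) \<and> (\<forall>t. c1 * B t \<le> f x t * t \<and> f x t * t \<le> c4 * B t \<and>
       f x t * t \<le> c3 * (deriv (f x) t * t\<^sup>2))" for x
  define h where "h x t = (if good x then f x t else 0)" for x t
  have [simp]: "\<Omega> \<in> sets lebesgue" using \<Omega>_borel by auto
  have AE\<Omega>: "(AE x in lebesgue_on \<Omega>. P x) \<longleftrightarrow> (AE x in lebesgue. x \<in> \<Omega> \<longrightarrow> P x)" for P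
    by (rule AE_restrict_space_iff) simp
  have AEgood: "AE x in lebesgue. x \<in> \<Omega> \<longrightarrow> good x"
    using pt H(2) unfolding H1_def AE\<Omega> by (auto simp: good_def)
  have fm: "(\<lambda>x. f x t) \<in> borel_measurable (lebesgue_on \<Omega>)" for t
    using H(1) by (simp add: H0_def caratheodory_def)
  have hm: "(\<lambda>x. h x t) \<in> borel_measurable lebesgue" for t
  proof (rule borel_measurable_AE)
    show "(\<lambda>x. indicator \<Omega> x *\<^sub>R f x t) \<in> borel_measurable lebesgue"
      using fm[of t] by (subst (asm) borel_measurable_restrict_space_iff) auto
    show "AE x in lebesgue. indicator \<Omega> x *\<^sub>R f x t = h x t"
      using AEgood by eventually_elim (auto simp: h_def good_def indicator_def)
  qed
  have der: "(f x has_real_derivative deriv (f x) t) (at t)" if "good x" for x t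
    using that by (simp add: good_def DERIV_deriv_iff_real_differentiable)
  have hc: "continuous_on UNIV (h x)" for x
  proof (cases "good x")
    case True
    then have "continuous_on UNIV (f x)"
      using der DERIV_isCont by (blast intro: continuous_at_imp_continuous_on)
    then show ?thesis using True by (simp add: h_def cong: continuous_on_cong)
  qed (simp add: h_def)
  have hmono: "mono (h x)" for x
  proof (cases "good x")
    case True
    \<comment> \<open>Since \<open>B t > 0\<close>, the chain from \<open>c1 * B t\<close> to the
      derivative term forces the sign; at \<open>t = 0\<close> it follows by continuity of the
      derivative.\<close>
    have d0: "deriv (f x) t \<ge> 0" if "t \<noteq> 0" for t
    proof -
      have "0 < c1 * B t" using c B_pos[OF that] by simp
      then have "0 \<le> c3 * (deriv (f x) t * t\<^sup>2)" using True unfolding good_def by (meson less_imp_le order_trans)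
      then show ?thesis using c that by (simp add: zero_le_mult_iff)
    qed
    have "deriv (f x) t \<ge> 0" for t
    proof (cases "t = 0")
      case t: True
      have "(\<lambda>n. deriv (f x) (1 / (real n + 1))) \<longlonglongrightarrow> deriv (f x) 0"
        by (rule continuous_on_tendsto_compose[of UNIV]) (use True in \<open>auto simp: good_def, real_asymp\<close>)
      then show ?thesis unfolding t by (rule LIMSEQ_le_const) (auto intro!: d0)
    qed (rule d0)
    then have "f x a \<le> f x b" if "a \<le> b" for a b
      using der[OF True] by (intro DERIV_nonneg_imp_nondecreasing[OF that]) blast
    then show ?thesis using True by (auto simp: mono_def h_def)
  qed (simp add: h_def mono_def)
  have "nehari \<Omega> s pp r Q G g B h (1 + 1 / c3) c1 c4"
  proof (intro nehari.intro loc nehari_axioms.intro)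
    show "(\<lambda>(x, t). h x t) \<in> borel_measurable (lebesgue \<Otimes>\<^sub>M borel)" by (rule Caratheodory_measurable[OF hm hc])
    show "AE x in lebesgue. x \<in> \<Omega> \<longrightarrow> (\<forall>t. c1 * B t \<le> h x t * t)"
      using AEgood by eventually_elim (auto simp: h_def good_def)
    show "l powr (1 + 1 / c3) * (h x t * t) \<le> h x (l * t) * (l * t)" if "l \<ge> 1" for x l t
      using power_growth[OF der c(2) _ that, of x t] by (auto simp: h_def good_def)
    show "pp < 1 + 1 / c3" using c p by (simp add: field_simps)
    show "h x t * t \<le> c4 * B t" for x t using c B_nonneg[of t] by (auto simp: h_def good_def)
  qed (use hc hmono c in \<open>auto simp: h_def good_def\<close>)
  moreover have "AE x in lebesgue. x \<in> \<Omega> \<longrightarrow> h x = f x"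
    using AEgood by eventually_elim (auto simp: h_def)
  ultimately show ?thesis using that by blast
qed

lemma (in nehari) reflect: "nehari \<Omega> s p r Q G g B (\<lambda>x t. - f x (- t)) q c1 c4"
proof (intro nehari.intro frac_orlicz_axioms nehari_axioms.intro)
  have "(\<lambda>z. - f (fst z) (- snd z)) \<in> borel_measurable (lebesgue \<Otimes>\<^sub>M borel)"
    using measurable_compose[OF _ f_meas, of "\<lambda>z. (fst z, - snd z)" "lebesgue \<Otimes>\<^sub>M borel"] by simp
  then show "(\<lambda>(x, t). - f x (- t)) \<in> borel_measurable (lebesgue \<Otimes>\<^sub>M borel)" by (simp add: split_beta)
  show "continuous_on UNIV (\<lambda>t. - f x (- t))" for x
    by (intro continuous_on_minus continuous_on_compose2[OF f_cont]) (auto intro!: continuous_intros)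
  show "mono (\<lambda>t. - f x (- t))" for x using f_mono[of x] by (auto simp: mono_def)
  show "- f x (- t) * t \<le> c4 * B t" for x t using f_upper[of x "- t"] B_even[of t] by simp
  show "AE x in lebesgue. x \<in> \<Omega> \<longrightarrow> (\<forall>t. c1 * B t \<le> - f x (- t) * t)"
    using f_lower
  proof eventually_elim
    case (elim x)
    then show ?case using B_even by (metis minus_mult_commute minus_minus)
  qed
  show "l powr q * (- f x (- t) * t) \<le> - f x (- (l * t)) * (l * t)" if "l \<ge> 1" for x l t
    using f_scale[OF that, of x "- t"] by simp
qed (use c14 pq f_0 in auto)

section \<open>Test functions and weak solutions\<close>

lemma AE_mu:
  assumes "AE z in lborel. P z" shows "AE z in mu. P (z :: (real^'n) \<times> (real^'n))"
proof -
  have [measurable]: "(\<lambda>(x :: real^'n, y). ennreal (1 / norm (x - y) ^ CARD('n))) \<in> borel_measurable lebesgue"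
    by (rule measurable_completion) simp
  show ?thesis unfolding mu_def using AE_completion[OF assms] by (subst AE_density) auto
qed

lemma sets_mu: "sets (mu :: ((real^'n) \<times> (real^'n)) measure) = sets lebesgue"
  by (simp add: mu_def)

lemma mu_measurable:
  fixes h h' :: "(real^'n) \<times> (real^'n) \<Rightarrow> real"
  assumes "h \<in> borel_measurable borel" "AE z in lborel. h z = h' z" shows "h' \<in> borel_measurable mu"
proof -
  have "h \<in> borel_measurable lebesgue" using assms by (intro measurable_completion) simp
  then have "h' \<in> borel_measurable lebesgue" using AE_completion[OF assms(2)] by (rule borel_measurable_AE)
  then show ?thesis by (simp add: sets_mu cong: measurable_cong_sets)
qed

lemma nn_integral_mu:
  fixes h :: "(real^'n) \<times> (real^'n) \<Rightarrow> ennreal"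
  assumes [measurable]: "h \<in> borel_measurable borel"
  shows "(\<integral>\<^sup>+z. h z \<partial>mu) = (\<integral>\<^sup>+z. h z \<partial>mub)"
proof -
  let ?k = "\<lambda>(x :: real^'n, y). ennreal (1 / norm (x - y) ^ CARD('n))"
  have m: "?k \<in> borel_measurable lebesgue" "h \<in> borel_measurable lebesgue"
    by (rule measurable_completion; simp)+
  have "(\<integral>\<^sup>+z. h z \<partial>mu) = (\<integral>\<^sup>+z. ?k z * h z \<partial>lebesgue)"
    unfolding mu_def by (rule nn_integral_density[OF m])
  also have "\<dots> = (\<integral>\<^sup>+z. ?k z * h z \<partial>lborel)" by (rule nn_integral_completion)
  also have "\<dots> = (\<integral>\<^sup>+z. h z \<partial>mub)"
    unfolding mub_def by (rule nn_integral_density[symmetric]) auto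
  finally show ?thesis .
qed

lemma integral_mu:
  fixes h :: "(real^'n) \<times> (real^'n) \<Rightarrow> real"
  assumes [measurable]: "h \<in> borel_measurable borel"
  shows "integral\<^sup>L mu h = integral\<^sup>L mub h" "integrable mu h \<longleftrightarrow> integrable mub h"
proof -
  define k :: "(real^'n) \<times> (real^'n) \<Rightarrow> real" where "k z = 1 / norm (fst z - snd z) ^ CARD('n)" for z
  have [measurable]: "k \<in> borel_measurable borel" unfolding k_def by measurable
  have m: "k \<in> borel_measurable lebesgue" "h \<in> borel_measurable lebesgue"
    by (rule measurable_completion; simp)+
  have k: "mu = density lebesgue (\<lambda>z. ennreal (k z))" "mub = density lborel (\<lambda>z. ennreal (k z))"
    unfolding mu_def mub_def k_def by (simp_all add: case_prod_beta')
  have nn: "AE z in M. 0 \<le> k z" for M by (simp add: k_def)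
  have "integral\<^sup>L mu h = (\<integral>z. k z * h z \<partial>lebesgue)"
    unfolding k by (rule integral_real_density[OF m(1) nn m(2)])
  also have "\<dots> = (\<integral>z. k z * h z \<partial>lborel)" by (rule integral_completion) simp
  also have "\<dots> = integral\<^sup>L mub h" unfolding k by (rule integral_real_density[OF _ nn, symmetric]) simp_all
  finally show "integral\<^sup>L mu h = integral\<^sup>L mub h" .
  have "integrable mu h \<longleftrightarrow> integrable lebesgue (\<lambda>z. k z * h z)"
    unfolding k by (rule integrable_real_density[OF m(1) nn m(2)])
  also have "\<dots> \<longleftrightarrow> integrable lborel (\<lambda>z. k z * h z)" by (rule integrable_completion) simp
  also have "\<dots> \<longleftrightarrow> integrable mub h" unfolding k by (rule integrable_real_density[OF _ nn, symmetric]) simp_all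
  finally show "integrable mu h \<longleftrightarrow> integrable mub h" .
qed

lemma hoelder_quotient_AE:
  assumes "AE x in lebesgue. v x = v' x"
  shows "AE z in lborel. hoelder_quotient s v z = hoelder_quotient s v' z"
proof -
  have "AE x in lborel. v x = v' x" using assms by (simp add: AE_completion_iff)
  from AE_lborel_fst_snd[OF this] show ?thesis
    by eventually_elim (simp add: hoelder_quotient_def split_beta)
qed

text \<open>The derivative vanishes off the compact support, where it does not the continuous
  partial derivatives are bounded. The sum of these bounds over the basis dominates the operator
  norm, and the mean value inequality applies.\<close>

lemma test_function_Lipschitz:
  fixes \<phi> :: "real^'n \<Rightarrow> real"
  assumes \<phi>: "\<phi> \<in> test_functions \<Omega>"
  shows "continuous_on UNIV \<phi>" "\<And>x. x \<notin> \<Omega> \<Longrightarrow> \<phi> x = 0"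
    "\<exists>L\<ge>0. \<forall>x y. \<bar>\<phi> x - \<phi> y\<bar> \<le> L * norm (x - y)" "\<exists>M. \<forall>x. \<bar>\<phi> x\<bar> \<le> M"
proof -
  define S where "S = closure {x. \<phi> x \<noteq> 0}"
  have S: "compact S" "S \<subseteq> \<Omega>" and sm: "smooth \<phi>" using \<phi> by (auto simp: test_functions_def S_def)
  have out: "\<phi> x = 0" if "x \<notin> S" for x using that closure_subset[of "{x. \<phi> x \<noteq> 0}"] by (auto simp: S_def)
  then show "\<phi> x = 0" if "x \<notin> \<Omega>" for x using that S by blast
  have "continuously_differentiable (Suc 0) \<phi>" using sm unfolding smooth_def by blast
  then have diff: "\<And>x. \<phi> differentiable (at x)"
    and cont: "\<And>i. i \<in> Basis \<Longrightarrow> continuous_on UNIV (\<lambda>x. frechet_derivative \<phi> (at x) i)"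
    by auto
  show c\<phi>: "continuous_on UNIV \<phi>"
    using diff by (meson continuous_at_imp_continuous_on differentiable_imp_continuous_within)
  have bdd: "\<exists>M. \<forall>x\<in>S. \<bar>h x\<bar> \<le> M" if "continuous_on UNIV h" for h :: "real^'n \<Rightarrow> real"
    using compact_imp_bounded[OF compact_continuous_image[OF continuous_on_subset[OF that] S(1)]]
    by (auto simp: bounded_iff)
  obtain M where M: "\<And>x. x \<in> S \<Longrightarrow> \<bar>\<phi> x\<bar> \<le> M" using bdd[OF c\<phi>] by blast
  have "\<bar>\<phi> x\<bar> \<le> \<bar>M\<bar>" for x using M[of x] out[of x] by (cases "x \<in> S") auto
  then show "\<exists>M. \<forall>x. \<bar>\<phi> x\<bar> \<le> M" by blast
  obtain m where m: "\<And>i x. i \<in> Basis \<Longrightarrow> x \<in> S \<Longrightarrow> \<bar>frechet_derivative \<phi> (at x) i\<bar> \<le> m i"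
    using bdd[OF cont] by metis
  define L where "L = (\<Sum>i\<in>(Basis :: (real^'n) set). \<bar>m i\<bar>)"
  have L: "L \<ge> 0" by (simp add: L_def sum_nonneg)
  have der: "(\<phi> has_derivative frechet_derivative \<phi> (at x)) (at x)" for x
    using diff frechet_derivative_works by blast
  have zero: "frechet_derivative \<phi> (at x) h = 0" if "x \<notin> S" for x h
  proof -
    have "((\<lambda>_. 0) has_derivative (\<lambda>_. 0)) (at x)" by simp
    then have "(\<phi> has_derivative (\<lambda>_. 0)) (at x)"
    proof (rule has_derivative_transform_within_open)
      show "open (- S)" using S(1) by (simp add: compact_imp_closed open_Compl)
    qed (use that out in auto)
    then show ?thesis using has_derivative_unique[OF der] by (metis (mono_tags))
  qed
  have "onorm (frechet_derivative \<phi> (at x)) \<le> L" for x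
  proof (rule onorm_le)
    fix h
    have lin: "linear (frechet_derivative \<phi> (at x))" using der has_derivative_linear by blast
    have "frechet_derivative \<phi> (at x) h = frechet_derivative \<phi> (at x) (\<Sum>i\<in>Basis. (h \<bullet> i) *\<^sub>R i)"
      by (simp add: euclidean_representation)
    also have "\<dots> = (\<Sum>i\<in>Basis. (h \<bullet> i) * frechet_derivative \<phi> (at x) i)"
      by (simp add: linear_sum[OF lin] linear_scale[OF lin])
    finally have "\<bar>frechet_derivative \<phi> (at x) h\<bar> \<le> (\<Sum>i\<in>Basis. \<bar>(h \<bullet> i) * frechet_derivative \<phi> (at x) i\<bar>)"
      by (simp add: sum_abs)
    also have "\<dots> \<le> (\<Sum>i\<in>Basis. norm h * \<bar>m i\<bar>)"
    proof (rule sum_mono)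
      fix i :: "real^'n" assume i: "i \<in> Basis"
      have "\<bar>frechet_derivative \<phi> (at x) i\<bar> \<le> \<bar>m i\<bar>"
        using m[OF i, of x] zero[of x i] by (cases "x \<in> S") auto
      then show "\<bar>(h \<bullet> i) * frechet_derivative \<phi> (at x) i\<bar> \<le> norm h * \<bar>m i\<bar>"
        unfolding abs_mult using Basis_le_norm[OF i, of h] by (intro mult_mono) auto
    qed
    also have "\<dots> = L * norm h" by (simp add: L_def sum_distrib_left mult.commute)
    finally show "norm (frechet_derivative \<phi> (at x) h) \<le> L * norm h" by simp
  qed
  then have "\<bar>\<phi> x - \<phi> y\<bar> \<le> L * norm (x - y)" for x y
    using differentiable_bound[of UNIV \<phi> "\<lambda>x. frechet_derivative \<phi> (at x)" L x y] der by auto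
  then show "\<exists>L\<ge>0. \<forall>x y. \<bar>\<phi> x - \<phi> y\<bar> \<le> L * norm (x - y)" using L by blast
qed

context frac_orlicz
begin

section \<open>Test functions, \<open>E\<close> and \<open>W0\<close> in terms of
  \<open>X\<close>\<close>

lemma X_test: "\<phi> \<in> test_functions \<Omega> \<Longrightarrow> \<phi> \<in> X"
proof -
  assume \<phi>: "\<phi> \<in> test_functions \<Omega>"
  note t = test_function_Lipschitz[OF \<phi>]
  obtain L M where "L \<ge> 0" "\<And>x y. \<bar>\<phi> x - \<phi> y\<bar> \<le> L * norm (x - y)" "\<And>x. \<bar>\<phi> x\<bar> \<le> M" using t(3,4) by blast
  then show ?thesis by (intro X_Lipschitz[where L = L and M = M] borel_measurable_continuous_onI t)
qed

text \<open>By convexity, dividing by \<open>l \<ge> 1\<close> multiplies the modular by at most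
  \<open>1 / l\<close>. It makes the sets whose infima define the Luxemburg norms nonempty.\<close>

lemma scaled_modular:
  assumes [measurable]: "y \<in> borel_measurable N" and fin: "(\<integral>\<^sup>+z. ennreal (G (y z)) \<partial>N) < \<infinity>"
  shows "\<exists>l>0. (\<integral>\<^sup>+z. ennreal (G (y z / l)) \<partial>N) \<le> 1"
proof -
  obtain K where K: "K \<ge> 0" "(\<integral>\<^sup>+z. ennreal (G (y z)) \<partial>N) = ennreal K"
    using fin by (metis enn2real_nonneg ennreal_enn2real infinity_ennreal_def)
  define l where "l = max 1 K"
  have l: "l \<ge> 1" "K / l \<le> 1" using K by (auto simp: l_def field_simps)
  have "(\<integral>\<^sup>+z. ennreal (G (y z / l)) \<partial>N) \<le> (\<integral>\<^sup>+z. ennreal (1 / l) * ennreal (G (y z)) \<partial>N)"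
  proof (rule nn_integral_mono)
    fix z
    have "G (1 / l * y z) \<le> 1 / l * G (y z)" using l by (intro G_contract) auto
    then show "ennreal (G (y z / l)) \<le> ennreal (1 / l) * ennreal (G (y z))"
      using l G_nonneg by (simp add: ennreal_mult[symmetric] ennreal_leI)
  qed
  also have "\<dots> = ennreal (1 / l) * ennreal K" by (subst nn_integral_cmult) (simp_all add: K)
  also have "\<dots> \<le> ennreal 1" using l K by (simp add: ennreal_mult[symmetric] ennreal_leI del: ennreal_1)
  finally show ?thesis using l by (intro exI[of _ l]) auto
qed

lemma frac_modular_AE:
  assumes [measurable]: "w \<in> borel_measurable borel" and "AE x in lebesgue. v x = w x"
  shows "frac_modular s G v = (\<integral>\<^sup>+z. ennreal (G (D w z)) \<partial>mub)"
proof -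
  have "frac_modular s G v = (\<integral>\<^sup>+z. ennreal (G (D w z)) \<partial>mu)"
    unfolding frac_modular_def G_abs
    using AE_mu[OF hoelder_quotient_AE[OF assms(2), of s]] by (intro nn_integral_cong_AE) auto
  then show ?thesis by (simp add: nn_integral_mu)
qed

lemma modular_UNIV: "modular_on G UNIV v = (\<integral>\<^sup>+x. ennreal (G (v x)) \<partial>lebesgue)"
  unfolding modular_on_def G_abs by (simp add: lebesgue_on_UNIV_eq)

text \<open>\<open>W_norm\<close> is a sum of two infima, and the first is below
  \<open>\<epsilon>\<close> once the second is known to be nonnegative. As \<open>Inf\<close> of the
  empty set is unspecified, both sets have to be shown nonempty.\<close>

lemma Luxemburg_scale:
  assumes v: "v \<in> W s G" and \<phi>: "\<phi> \<in> test_functions \<Omega>"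
    and norm: "W_norm s G (\<lambda>x. v x - \<phi> x) < \<epsilon>"
  shows "\<exists>l>0. l < \<epsilon> \<and> modular_on G UNIV (\<lambda>x. (v x - \<phi> x) / l) \<le> 1"
proof -
  have \<phi>X: "\<phi> \<in> X" by (rule X_test[OF \<phi>])
  note [measurable] = X_borel[OF \<phi>X]
  have vm: "v \<in> borel_measurable lebesgue" and vG: "modular_on G UNIV v < \<infinity>" and vF: "frac_modular s G v < \<infinity>"
    using v by (auto simp: W_def)
  obtain w where w [measurable]: "w \<in> borel_measurable borel" and vw: "AE x in lborel. v x = w x"
    using completion_ex_borel_measurable_real[OF vm] by auto
  have vw': "AE x in lebesgue. v x = w x" by (rule AE_completion[OF vw])
  define S1 where "S1 = {l. l > 0 \<and> modular_on G UNIV (\<lambda>x. (v x - \<phi> x) / l) \<le> 1}"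
  define S2 where "S2 = {l. l > 0 \<and> frac_modular s G (\<lambda>x. (v x - \<phi> x) / l) \<le> 1}"
  have "S2 \<noteq> {}"
  proof -
    have D: "D (\<lambda>x. w x - \<phi> x) z = D w z - D \<phi> z" for z using D_lin[of 1 w "-1" \<phi> z] by simp
    have "(\<integral>\<^sup>+z. ennreal (G (D (\<lambda>x. w x - \<phi> x) z)) \<partial>mub) \<le>
        (\<integral>\<^sup>+z. ennreal (2 powr p) * (ennreal (G (D w z)) + ennreal (G (D \<phi> z))) \<partial>mub)"
    proof (rule nn_integral_mono)
      fix z
      have "G (D (\<lambda>x. w x - \<phi> x) z) \<le> 2 powr p * (G (D w z) + G (D \<phi> z))"
        using G_add[of "D w z" "- D \<phi> z"] by (simp add: D G_even)
      then show "ennreal (G (D (\<lambda>x. w x - \<phi> x) z)) \<le> ennreal (2 powr p) * (ennreal (G (D w z)) + ennreal (G (D \<phi> z)))"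
        using G_nonneg by (simp add: ennreal_mult[symmetric] ennreal_plus[symmetric] ennreal_leI del: ennreal_plus)
    qed
    also have "\<dots> = ennreal (2 powr p) * (frac_modular s G v + ennreal (A \<phi>))"
      by (simp add: nn_integral_cmult nn_integral_add frac_modular_AE[OF w vw'] nn_integral_A[OF \<phi>X])
    also have "\<dots> < \<infinity>" using vF by (simp add: ennreal_mult_less_top)
    finally obtain l where l: "l > 0" "(\<integral>\<^sup>+z. ennreal (G (D (\<lambda>x. w x - \<phi> x) z / l)) \<partial>mub) \<le> 1"
      using scaled_modular[of "D (\<lambda>x. w x - \<phi> x)" mub] by auto
    have "frac_modular s G (\<lambda>x. (v x - \<phi> x) / l) = (\<integral>\<^sup>+z. ennreal (G (D (\<lambda>x. (w x - \<phi> x) / l) z)) \<partial>mub)"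
      by (rule frac_modular_AE) (use vw' in \<open>auto elim: eventually_mono\<close>)
    also have "\<dots> = (\<integral>\<^sup>+z. ennreal (G (D (\<lambda>x. w x - \<phi> x) z / l)) \<partial>mub)"
      using D_scale[of "1 / l" "\<lambda>x. w x - \<phi> x"] by simp
    finally show ?thesis using l by (auto simp: S2_def)
  qed
  then have "Inf S2 \<ge> 0" by (rule cInf_greatest) (auto simp: S2_def)
  then have "Inf S1 < \<epsilon>" using norm by (simp add: W_norm_def S1_def S2_def)
  moreover have "S1 \<noteq> {}"
  proof -
    note vm [measurable]
    have [measurable]: "\<phi> \<in> borel_measurable lebesgue" by (rule X_lebesgue[OF \<phi>X])
    have [measurable]: "\<Omega> \<in> sets lebesgue" using \<Omega>_borel by auto
    obtain M where M: "\<And>x. \<bar>\<phi> x\<bar> \<le> M" using test_function_Lipschitz(4)[OF \<phi>] by blast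
    have "(\<integral>\<^sup>+x. ennreal (G (v x - \<phi> x)) \<partial>lebesgue) \<le>
        (\<integral>\<^sup>+x. ennreal (2 powr p) * (ennreal (G (v x)) + ennreal (G M) * indicator \<Omega> x) \<partial>lebesgue)"
    proof (rule nn_integral_mono)
      fix x
      have "G (\<phi> x) \<le> G M * indicator \<Omega> x"
        using G_mono_abs[of "\<phi> x" M] order_trans[OF M abs_ge_self] X_zero[OF \<phi>X, of x] G_0 by (cases "x \<in> \<Omega>") auto
      then have le: "2 powr p * (G (v x) + G (\<phi> x)) \<le> 2 powr p * (G (v x) + G M * indicator \<Omega> x)"
        by (intro mult_left_mono) auto
      have "G (v x - \<phi> x) \<le> 2 powr p * (G (v x) + G M * indicator \<Omega> x)"
        by (rule order_trans[OF _ le]) (use G_add[of "v x" "- \<phi> x"] in \<open>simp add: G_even\<close>)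
      then have "ennreal (G (v x - \<phi> x)) \<le> ennreal (2 powr p * (G (v x) + G M * indicator \<Omega> x))" by (rule ennreal_leI)
      also have "\<dots> = ennreal (2 powr p) * (ennreal (G (v x)) + ennreal (G M) * indicator \<Omega> x)"
        using G_nonneg by (cases "x \<in> \<Omega>") (simp_all add: ennreal_mult)
      finally show "ennreal (G (v x - \<phi> x)) \<le> ennreal (2 powr p) * (ennreal (G (v x)) + ennreal (G M) * indicator \<Omega> x)" .
    qed
    also have "\<dots> = ennreal (2 powr p) * (modular_on G UNIV v + ennreal (G M) * ennreal V)"
      by (simp add: nn_integral_cmult nn_integral_add modular_UNIV emeasure_\<Omega>)
    also have "\<dots> < \<infinity>" using vG by (simp add: ennreal_mult_less_top)
    finally obtain l where "l > 0" "(\<integral>\<^sup>+x. ennreal (G ((v x - \<phi> x) / l)) \<partial>lebesgue) \<le> 1"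
      using scaled_modular[of "\<lambda>x. v x - \<phi> x" lebesgue] by auto
    then show ?thesis by (auto simp: S1_def modular_UNIV)
  qed
  ultimately obtain l where "l \<in> S1" "l < \<epsilon>" using cInf_lessD by blast
  then show ?thesis by (auto simp: S1_def)
qed

text \<open>Off \<open>\<Omega>\<close> the approximating test functions vanish, so there
  \<open>G (v x)\<close> is at most \<open>l * G ((v x - \<phi> x) / l)\<close>, whose integral is
  at most \<open>l\<close>. As \<open>l\<close> can be arbitrarily small, \<open>v\<close> vanishes
  almost everywhere outside \<open>\<Omega>\<close>, and a Borel version set to zero there lies in
  \<open>X\<close>.\<close>

lemma E_space_X:
  assumes v: "v \<in> E_space s G \<Omega>"
  shows "\<exists>v'\<in>X. AE x in lebesgue. v x = v' x"
proof -
  have vW: "v \<in> W s G" using v by (simp add: E_space_def)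
  then have vm [measurable]: "v \<in> borel_measurable lebesgue" and vF: "frac_modular s G v < \<infinity>"
    by (auto simp: W_def)
  obtain w where [measurable]: "w \<in> borel_measurable borel" and vw: "AE x in lborel. v x = w x"
    using completion_ex_borel_measurable_real[OF vm] by auto
  define Z where "Z = (\<integral>\<^sup>+x. ennreal (G (v x)) * indicator (- \<Omega>) x \<partial>lebesgue)"
  have Z\<epsilon>: "Z \<le> ennreal \<epsilon>" if "\<epsilon> > 0" for \<epsilon>
  proof -
    \<comment> \<open>The bound by 1 makes \<open>l\<close> an admissible factor in
      \<open>G_contract\<close>.\<close>
    have "min \<epsilon> 1 > 0" using that by simp
    then obtain \<phi> where \<phi>: "\<phi> \<in> test_functions \<Omega>" "W_norm s G (\<lambda>x. v x - \<phi> x) < min \<epsilon> 1"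
      using v unfolding E_space_def by blast
    from Luxemburg_scale[OF vW this] obtain l where
      l: "l > 0" "l < min \<epsilon> 1" "modular_on G UNIV (\<lambda>x. (v x - \<phi> x) / l) \<le> 1" by blast
    have [measurable]: "\<phi> \<in> borel_measurable lebesgue" by (rule X_lebesgue[OF X_test[OF \<phi>(1)]])
    have "Z \<le> (\<integral>\<^sup>+x. ennreal l * ennreal (G ((v x - \<phi> x) / l)) \<partial>lebesgue)"
      unfolding Z_def
    proof (rule nn_integral_mono)
      fix x
      show "ennreal (G (v x)) * indicator (- \<Omega>) x \<le> ennreal l * ennreal (G ((v x - \<phi> x) / l))"
      proof (cases "x \<in> \<Omega>")
        case False
        then have "\<phi> x = 0" by (rule test_function_Lipschitz(2)[OF \<phi>(1)])
        moreover have "G (l * (v x / l)) \<le> l * G (v x / l)" using l by (intro G_contract) auto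
        ultimately show ?thesis using False l G_nonneg by (simp add: ennreal_mult[symmetric] ennreal_leI)
      qed simp
    qed
    also have "\<dots> = ennreal l * modular_on G UNIV (\<lambda>x. (v x - \<phi> x) / l)"
      unfolding modular_UNIV by (rule nn_integral_cmult) measurable
    also have "\<dots> \<le> ennreal l * 1" by (intro mult_left_mono l) simp
    also have "\<dots> \<le> ennreal \<epsilon>" using l by (simp add: ennreal_leI)
    finally show ?thesis .
  qed
  have "Z \<le> 0"
  proof (rule ennreal_le_epsilon)
    fix e :: real assume "0 < e"
    from Z\<epsilon>[OF this] show "Z \<le> 0 + ennreal e" by simp
  qed
  then have Z0: "(\<integral>\<^sup>+x. ennreal (G (v x)) * indicator (- \<Omega>) x \<partial>lebesgue) = 0" by (simp add: Z_def)
  have [measurable]: "- \<Omega> \<in> sets lebesgue" using \<Omega>_borel by auto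
  have "(\<lambda>x. ennreal (G (v x)) * indicator (- \<Omega>) x) \<in> borel_measurable lebesgue" by measurable
  from nn_integral_0_iff_AE[OF this] Z0
  have "AE x in lebesgue. ennreal (G (v x)) * indicator (- \<Omega>) x = 0" by simp
  then have zero: "AE x in lebesgue. x \<notin> \<Omega> \<longrightarrow> v x = 0"
  proof eventually_elim
    case (elim x)
    show ?case
    proof
      assume "x \<notin> \<Omega>"
      then have "G (v x) \<le> 0" using elim by (simp add: ennreal_eq_0_iff)
      then show "v x = 0" using G_pos[of "v x"] by force
    qed
  qed
  define v' where "v' x = (if x \<in> \<Omega> then w x else 0)" for x
  have [measurable]: "v' \<in> borel_measurable borel" unfolding v'_def by measurable
  have eq: "AE x in lebesgue. v x = v' x"
    using zero AE_completion[OF vw] by eventually_elim (auto simp: v'_def)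
  have "integrable mub (\<lambda>z. G (D v' z))"
    by (rule integrableI_bounded) (use vF frac_modular_AE[OF _ eq] G_nonneg in auto)
  then have "v' \<in> X" by (simp add: X_def v'_def)
  then show ?thesis using eq by blast
qed

lemma X_W0:
  assumes u: "u \<in> X" and K: "\<And>t. G t \<le> B t + K" "K \<ge> 0"
  shows "u \<in> W0 s G \<Omega>"
proof -
  note [measurable] = X_borel[OF u] X_lebesgue[OF u]
  have [measurable]: "\<Omega> \<in> sets lebesgue" using \<Omega>_borel by auto
  have "modular_on G UNIV u \<le> (\<integral>\<^sup>+x. ennreal (B (u x)) + ennreal K * indicator \<Omega> x \<partial>lebesgue)"
    unfolding modular_UNIV
  proof (rule nn_integral_mono)
    fix x
    show "ennreal (G (u x)) \<le> ennreal (B (u x)) + ennreal K * indicator \<Omega> x"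
    proof (cases "x \<in> \<Omega>")
      case True
      then show ?thesis using K B_nonneg by (simp add: ennreal_plus[symmetric] ennreal_leI del: ennreal_plus)
    qed (use X_zero[OF u] G_0 in simp)
  qed
  also have "\<dots> = ennreal (\<rho> u) + ennreal K * ennreal V"
    by (subst nn_integral_add) (auto simp: nn_integral_cmult nn_integral_B[OF u] emeasure_\<Omega>)
  also have "\<dots> < \<infinity>" by (simp add: ennreal_mult_less_top)
  finally have "modular_on G UNIV u < \<infinity>" .
  moreover have "frac_modular s G u < \<infinity>"
    using frac_modular_AE[of u u] nn_integral_A[OF u] by simp
  ultimately show ?thesis using X_zero[OF u] by (auto simp: W0_def W_def)
qed

end

context nehari
begin

text \<open>A test function from \<open>E\<close> is replaced by its representative in
  \<open>X\<close>, where the equation is known. Both integrands change only on null sets, which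
  transfers integrability and the values of the integrals.\<close>

lemma weak_solutionI:
  assumes u: "u \<in> X" and eq: "\<And>v. v \<in> X \<Longrightarrow> gA u v = fv u v"
    and K: "\<And>t. G t \<le> B t + K" "K \<ge> 0"
    and h: "AE x in lebesgue. x \<in> \<Omega> \<longrightarrow> f x = h x"
  shows "weak_solution s G g \<Omega> h u"
  unfolding weak_solution_def
proof (intro conjI ballI X_W0[OF u K])
  fix v assume "v \<in> E_space s G \<Omega>"
  then obtain v' where v': "v' \<in> X" "AE x in lebesgue. v x = v' x" using E_space_X by blast
  note [measurable] = X_borel[OF u] X_borel[OF v'(1)]
  have AE1: "AE z in lborel. g (D u z) * D v' z = g (D u z) * D v z"
    using hoelder_quotient_AE[OF v'(2), of s] by eventually_elim simp
  have m1: "(\<lambda>z. g (D u z) * D v' z) \<in> borel_measurable borel" by measurable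
  have i1: "integrable mu (\<lambda>z. g (D u z) * D v' z)" using integrable_gA[OF u v'(1)] by (simp add: integral_mu(2)[OF m1])
  have m2: "(\<lambda>z. g (D u z) * D v z) \<in> borel_measurable mu" by (rule mu_measurable[OF m1 AE1])
  show "integrable mu (\<lambda>z. g (D u z) * D v z)"
    by (rule integrable_cong_AE_imp[OF i1 m2 AE_mu[OF AE1]])
  have "(\<integral>z. g (D u z) * D v z \<partial>mu) = (\<integral>z. g (D u z) * D v' z \<partial>mu)"
    by (rule integral_cong_AE[OF m2 borel_measurable_integrable[OF i1]])
      (use AE_mu[OF AE1] in \<open>auto elim: eventually_mono\<close>)
  also have "\<dots> = gA u v'" by (simp add: gA_def integral_mu(1)[OF m1])
  finally have L: "(\<integral>z. g (D u z) * D v z \<partial>mu) = gA u v'" .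
  have \<Omega>l: "\<Omega> \<inter> space lebesgue \<in> sets lebesgue" using \<Omega>_borel by auto
  have AE2: "AE x in lebesgue. f x (u x) * v' x = indicator \<Omega> x *\<^sub>R (h x (u x) * v x)"
    using h v'(2) by eventually_elim (use X_zero[OF v'(1)] in \<open>auto simp: indicator_def\<close>)
  have i2: "integrable lebesgue (\<lambda>x. f x (u x) * v' x)" by (rule integrable_fv[OF u v'(1)])
  have m3: "(\<lambda>x. indicator \<Omega> x *\<^sub>R (h x (u x) * v x)) \<in> borel_measurable lebesgue"
    by (rule borel_measurable_AE[OF borel_measurable_integrable[OF i2] AE2])
  show "integrable (lebesgue_on \<Omega>) (\<lambda>x. h x (u x) * v x)"
    unfolding integrable_restrict_space[OF \<Omega>l] by (rule integrable_cong_AE_imp[OF i2 m3 AE2])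
  have "(\<integral>x. h x (u x) * v x \<partial>lebesgue_on \<Omega>) = fv u v'"
    unfolding integral_restrict_space[OF \<Omega>l] fv_def
    by (rule integral_cong_AE[OF m3 borel_measurable_integrable[OF i2]])
      (use AE2 in \<open>auto elim: eventually_mono\<close>)
  then show "(\<integral>z. g (D u z) * D v z \<partial>mu) = (\<integral>x. h x (u x) * v x \<partial>lebesgue_on \<Omega>)"
    using L eq[OF v'(1)] by simp
qed

lemma Y_not_AE:
  assumes "u \<in> Y n"
  shows "\<not> (AE x in lebesgue. max (u x) 0 = 0)" "n \<Longrightarrow> \<not> (AE x in lebesgue. max (- u x) 0 = 0)"
proof -
  have X: "T a b u \<in> X" for a b by (rule T_X[OF Y_X[OF assms]])
  show "\<not> (AE x in lebesgue. max (u x) 0 = 0)"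
    using assms \<rho>_eq_0[OF X[of 1 0]] by (auto simp: Y_def T_def tw_def)
  have "max (- u x) 0 = 0 \<longleftrightarrow> T 0 1 u x = 0" for x by (auto simp: T_def tw_def)
  then show "\<not> (AE x in lebesgue. max (- u x) 0 = 0)" if n
    using assms \<rho>_eq_0[OF X[of 0 1]] that by (auto simp: Y_def)
qed

text \<open>Minus a nonnegative solution for the reflected nonlinearity solves the original equation
  because \<open>g\<close> is odd.\<close>

lemma negative_solution:
  assumes "\<Omega> \<noteq> {}"
  shows "\<exists>u\<in>X. (\<forall>x. u x \<le> 0) \<and> \<not> (AE x in lebesgue. u x = 0) \<and> (\<forall>v\<in>X. gA u v = fv u v)"
proof -
  interpret R: nehari \<Omega> s p r Q G g B "\<lambda>x t. - f x (- t)" q c1 c4 by (rule reflect)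
  obtain w where w: "w \<in> R.Y False" "\<And>v. v \<in> X \<Longrightarrow> R.gA w v = R.fv w v"
    using R.Nehari_solution[OF assms, of False] by blast
  have wX: "w \<in> X" and w0: "\<And>x. w x \<ge> 0" using w(1) by (auto simp: R.Y_def)
  have D: "D (\<lambda>x. - w x) z = - D w z" for z using D_scale[of "-1" w z] by simp
  show ?thesis
  proof (intro bexI[of _ "\<lambda>x. - w x"] conjI ballI allI)
    show "(\<lambda>x. - w x) \<in> X" using X_scale(1)[OF wX, of "-1"] by simp
    show "\<not> (AE x in lebesgue. - w x = 0)"
    proof
      assume "AE x in lebesgue. - w x = 0"
      then have "AE x in lebesgue. max (w x) 0 = 0" by eventually_elim auto
      then show False using R.Y_not_AE(1)[OF w(1)] by simp
    qed
    fix v assume v: "v \<in> X"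
    have "gA (\<lambda>x. - w x) v = - R.gA w v" by (simp add: gA_def R.gA_def D g_odd)
    also have "\<dots> = fv (\<lambda>x. - w x) v" unfolding w(2)[OF v] by (simp add: fv_def R.fv_def)
    finally show "gA (\<lambda>x. - w x) v = fv (\<lambda>x. - w x) v" .
  qed (use w0 in auto)
qed

end

text \<open>The dictionary of parameters: \<open>p\<close> is \<open>pp\<close>, \<open>r\<close> is
  \<open>pBm\<close>, and the doubling constant \<open>2 powr pBp\<close> is the growth bound for
  \<open>B\<close> at the factor 2.\<close>

lemma frac_orlicz_intro:
  fixes \<Omega> :: "(real^'n) set"
  assumes s: "0 < s" "s < 1" and \<Omega>: "smooth_bounded_domain \<Omega>" and G: "N_function G g"
    and p: "1 < pm" "pm \<le> pp" and d: "\<forall>t>0. g differentiable (at t)"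
    and gp: "\<forall>t>0. pm - 1 \<le> t * deriv g t / g t \<and> t * deriv g t / g t \<le> pp - 1"
    and inf: "\<exists>M>0. (\<integral>\<^sup>+t\<in>{M..}. ennreal ((t / G t) powr (s / (real CARD('n) - s))) \<partial>lborel) = \<infinity>"
    and fin: "\<exists>\<delta>>0. (\<integral>\<^sup>+t\<in>{0..\<delta>}. ennreal ((t / G t) powr (s / (real CARD('n) - s))) \<partial>lborel) < \<infinity>"
    and B: "N_function B b" and pB: "1 < pBm" "pBm \<le> pBp"
    and Bp: "\<forall>t>0. pBm \<le> t * b t / B t \<and> t * b t / B t \<le> pBp"
    and sl: "essentially_slower B (orlicz_conjugate CARD('n) s G)" and pp: "pp < pBm"
  shows "frac_orlicz \<Omega> s pp pBm (2 powr pBp) G g B"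
proof
  have Bpos: "B t > 0" if "t \<noteq> 0" for t by (rule N_function_pos[OF B that])
  have gpp: "\<forall>t>0. t * deriv g t / g t \<le> pp - 1" using gp by blast
  have tg: "\<forall>t>0. t * g t \<le> pp * G t"
    using N_function_density_bound[OF G d gpp] p by auto
  have Bu: "\<forall>t>0. t * b t \<le> pBp * B t" and Bl: "\<forall>t>0. pBm * B t \<le> t * b t"
    using Bp Bpos by (auto simp: field_simps)
  show "open \<Omega>" "bounded \<Omega>" using \<Omega> by (auto simp: smooth_bounded_domain_def)
  show "continuous_on UNIV g" by (rule N_function_density_continuous[OF G d])
  show "g (l * t) \<le> l powr (pp - 1) * g t" if "l \<ge> 1" "t \<ge> 0" for l t
    by (rule N_function_density_scale[OF G d gpp that])
  show "G (l * t) \<le> l powr pp * G t" if "l \<ge> 1" "t \<ge> 0" for l t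
    by (rule N_function_scale_upper[OF G tg that]) (use p in auto)
  show "t * g t \<le> pp * G t" if "t \<ge> 0" for t
    using tg that N_function_zero[OF G] by (cases "t = 0") auto
  show "B (- t) = B t" for t using B by (simp add: N_function_def)
  show "B x \<le> B y" if "0 \<le> x" "x \<le> y" for x y by (rule N_function_incseq[OF B that])
  show "continuous_on UNIV B" by (rule N_function_continuous[OF B])
  show "B 0 = 0" by (rule N_function_zero[OF B])
  show "B t > 0" if "t \<noteq> 0" for t by (rule Bpos[OF that])
  show "l powr pBm * B t \<le> B (l * t)" if "l \<ge> 1" "t \<ge> 0" for l t
    by (rule N_function_scale_lower[OF B Bl that]) (use pB in auto)
  show "B (2 * t) \<le> 2 powr pBp * B t" if "t \<ge> 0" for t
    by (rule N_function_scale_upper[OF B Bu _ that]) (use pB in auto)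
  show "2 powr pBp \<ge> 1" using pB by (simp add: ge_one_powr_ge_zero)
  have "s < real CARD('n)"
  proof -
    have "(1::real) \<le> real CARD('n)" by (simp add: Suc_le_eq)
    then show ?thesis using s by linarith
  qed
  then show "\<exists>y0. \<forall>t>0. \<forall>y\<ge>y0. y \<le> c * (t * G t powr (- (s / real CARD('n)))) \<longrightarrow> B y \<le> \<epsilon> * G t"
    if "c > 0" "\<epsilon> > 0" for c \<epsilon>
    by (rule essentially_slower_orlicz_conjugate[OF G s(1) _ inf fin sl that])
qed (use s G p pp in auto)

lemma essentially_slower_bound:
  assumes G: "N_function G g" and B: "N_function B b" and sl: "essentially_slower G B"
  obtains K where "K \<ge> 0" "\<And>t. G t \<le> B t + K"
proof -
  have "((\<lambda>t. G (1 * t) / B t) \<longlongrightarrow> 0) at_top" using sl unfolding essentially_slower_def by (metis zero_less_one)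
  then have "eventually (\<lambda>t. G (1 * t) / B t < 1) at_top" by (rule order_tendstoD) simp
  then obtain t0 where t0: "\<And>t. t \<ge> t0 \<Longrightarrow> G t / B t < 1" by (auto simp: eventually_at_top_linorder)
  define T where "T = max t0 1"
  have B0: "B t \<ge> 0" for t using N_function_pos[OF B, of t] N_function_zero[OF B] by (cases "t = 0") auto
  have "T > 0" by (simp add: T_def)
  then have K: "G T \<ge> 0" using N_function_pos[OF G, of T] by simp
  have "G \<bar>t\<bar> \<le> B \<bar>t\<bar> + G T" for t
  proof (cases "\<bar>t\<bar> \<ge> T")
    case True
    then have "G \<bar>t\<bar> / B \<bar>t\<bar> < 1" "B \<bar>t\<bar> > 0"
      using t0[of "\<bar>t\<bar>"] N_function_pos[OF B, of "\<bar>t\<bar>"] \<open>T > 0\<close> by (auto simp: T_def)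
    then show ?thesis using K by (simp add: field_simps)
  next
    case False
    then have "G \<bar>t\<bar> \<le> G T" by (intro N_function_incseq[OF G]) auto
    then show ?thesis using B0[of "\<bar>t\<bar>"] by simp
  qed
  moreover have "G \<bar>t\<bar> = G t" "B \<bar>t\<bar> = B t" for t
    using G B by (cases "t \<ge> 0"; simp add: N_function_def)+
  ultimately show ?thesis using that[OF K] by simp
qed

theorem theorem37:
  fixes \<Omega> :: "(real^'n) set" and s pm pp pBm pBp :: real
    and G g B b :: "real \<Rightarrow> real" and f :: "real^'n \<Rightarrow> real \<Rightarrow> real"
  assumes "0 < s" "s < 1"
    and "smooth_bounded_domain \<Omega>"
    and "N_function G g"
    and "1 < pm" "pm \<le> pp"
    and "\<forall>t>0. g differentiable (at t)"
    and "\<forall>t>0. pm - 1 \<le> t * deriv g t / g t \<and> t * deriv g t / g t \<le> pp - 1"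
    and "mono_on {0<..} (deriv g)"
    and "\<exists>M>0. (\<integral>\<^sup>+t\<in>{M..}. ennreal ((t / G t) powr (s / (real CARD('n) - s))) \<partial>lborel) = \<infinity>"
    and "\<exists>\<delta>>0. (\<integral>\<^sup>+t\<in>{0..\<delta>}. ennreal ((t / G t) powr (s / (real CARD('n) - s))) \<partial>lborel) < \<infinity>"
    and "N_function B b"
    and "1 < pBm" "pBm \<le> pBp"
    and "\<forall>t>0. pBm \<le> t * b t / B t \<and> t * b t / B t \<le> pBp"
    and "essentially_slower G B" "essentially_slower B (orlicz_conjugate CARD('n) s G)"
    and "pp < pBm"
    and "H0 \<Omega> b f" "H1 \<Omega> f" "H2 \<Omega> pp B f"
  shows "\<exists>u1 u2 u3 :: real^'n \<Rightarrow> real.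
    weak_solution s G g \<Omega> f u1 \<and> weak_solution s G g \<Omega> f u2 \<and> weak_solution s G g \<Omega> f u3 \<and>
    \<not> (AE x in lebesgue. u1 x = u2 x) \<and>
    \<not> (AE x in lebesgue. u1 x = u3 x) \<and>
    \<not> (AE x in lebesgue. u2 x = u3 x) \<and>
    (AE x in lebesgue. u1 x \<ge> 0) \<and> \<not> (AE x in lebesgue. u1 x = 0) \<and>
    (AE x in lebesgue. u2 x \<le> 0) \<and> \<not> (AE x in lebesgue. u2 x = 0) \<and>
    \<not> (AE x in lebesgue. u3 x = 0) \<and>
    \<not> (AE x in lebesgue. max (u3 x) 0 = 0) \<and> \<not> (AE x in lebesgue. max (- u3 x) 0 = 0)"
proof -
  have frac: "frac_orlicz \<Omega> s pp pBm (2 powr pBp) G g B"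
    by (rule frac_orlicz_intro) (use assms in blast)+
  have ne: "\<Omega> \<noteq> {}" using assms(3) by (simp add: smooth_bounded_domain_def)
  obtain K where K: "K \<ge> 0" "\<And>t. G t \<le> B t + K"
    using essentially_slower_bound[OF assms(4) assms(12) assms(16)] by blast
  obtain h q c1 c4 where nehari: "nehari \<Omega> s pp pBm (2 powr pBp) G g B h q c1 c4"
    and h: "AE x in lebesgue. x \<in> \<Omega> \<longrightarrow> h x = f x"
    using nehari_nonlinearity[OF frac ne assms(12) assms(19-21)] by blast
  interpret nehari \<Omega> s pp pBm "2 powr pBp" G g B h q c1 c4 by (rule nehari)
  note weak = weak_solutionI[OF _ _ K(2,1) h]
  obtain u1 where u1: "u1 \<in> Y False" "\<And>v. v \<in> X \<Longrightarrow> gA u1 v = fv u1 v"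
    using Nehari_solution[OF ne] by blast
  obtain u2 where u2: "u2 \<in> X" "\<And>x. u2 x \<le> 0" "\<not> (AE x in lebesgue. u2 x = 0)"
    "\<And>v. v \<in> X \<Longrightarrow> gA u2 v = fv u2 v"
    using negative_solution[OF ne] by blast
  obtain u3 where u3: "u3 \<in> Y True" "\<And>v. v \<in> X \<Longrightarrow> gA u3 v = fv u3 v"
    using Nehari_solution[OF ne] by blast
  have u1_nonneg: "u1 x \<ge> 0" for x using u1(1) by (simp add: Y_def)
  note n1 = Y_not_AE(1)[OF u1(1)] and n3 = Y_not_AE(1)[OF u3(1)] Y_not_AE(2)[OF u3(1) TrueI]
  show ?thesis
  proof (intro exI conjI)
    show "weak_solution s G g \<Omega> f u1" by (rule weak[OF Y_X[OF u1(1)] u1(2)])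
    show "weak_solution s G g \<Omega> f u2" by (rule weak[OF u2(1,4)])
    show "weak_solution s G g \<Omega> f u3" by (rule weak[OF Y_X[OF u3(1)] u3(2)])
    show "\<not> (AE x in lebesgue. u1 x = u2 x)"
    proof
      assume "AE x in lebesgue. u1 x = u2 x"
      then have "AE x in lebesgue. u2 x = 0" by eventually_elim (metis antisym u1_nonneg u2(2))
      then show False using u2(3) by simp
    qed
    show "\<not> (AE x in lebesgue. u1 x = u3 x)"
    proof
      assume "AE x in lebesgue. u1 x = u3 x"
      then have "AE x in lebesgue. max (- u3 x) 0 = 0"
        by eventually_elim (metis max.absorb2 neg_le_0_iff_le u1_nonneg)
      then show False using n3(2) by simp
    qed
    show "\<not> (AE x in lebesgue. u2 x = u3 x)"
    proof
      assume "AE x in lebesgue. u2 x = u3 x"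
      then have "AE x in lebesgue. max (u3 x) 0 = 0" by eventually_elim (metis max.absorb2 u2(2))
      then show False using n3(1) by simp
    qed
    show "AE x in lebesgue. u1 x \<ge> 0" "AE x in lebesgue. u2 x \<le> 0" using u1_nonneg u2(2) by auto
    show "\<not> (AE x in lebesgue. u1 x = 0)"
    proof
      assume "AE x in lebesgue. u1 x = 0"
      then have "AE x in lebesgue. max (u1 x) 0 = 0" by eventually_elim simp
      then show False using n1 by simp
    qed
    show "\<not> (AE x in lebesgue. u2 x = 0)" by (rule u2(3))
    show "\<not> (AE x in lebesgue. u3 x = 0)"
    proof
      assume "AE x in lebesgue. u3 x = 0"
      then have "AE x in lebesgue. max (u3 x) 0 = 0" by eventually_elim simp
      then show False using n3(1) by simp
    qed
    show "\<not> (AE x in lebesgue. max (u3 x) 0 = 0)" "\<not> (AE x in lebesgue. max (- u3 x) 0 = 0)"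
      by (fact n3)+
  qed
qed

end
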